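(* Let $U$ be a standard Galois order of type $A$, let $\overline v\in\mathbb C^\mu$ be a seed, and let $\Psi=\Psi(\overline v)$, $\Omega=\Psi\cap\overline\Sigma$. If $f_{k,i}^{+}(\overline v+z)\neq0$ and $f_{k,i}^{-}(\overline v+z)\ne0$ for all $z\in\mathsf Z(\overline v)$ and all $(k,i)$ with $1\le k\le r'$, $1\le i\le\mu_k$, then $V(\Omega,T(\overline v))$ is an irreducible $U$-module.
   Context: Setting. Let $\mu=(\mu_1,\dots,\mu_r)\in\mathbb N^r$ (positive integers), $\mathbb C^\mu=\mathbb C^{\mu_1}\times\cdots\times\mathbb C^{\mu_r}$ with standard bilinear form, canonical basis $e_{k,i}$ and dual basis $x_{k,i}$ ($1\le k\le r$, $1\le i\le\mu_k$). $\Lambda=\mathbb C[X_\mu]=\mathbb C[x_{k,i}]$, $L=\mathbb C(X_\mu)$ its fraction field. $S_\mu=S_{\mu_1}\times\cdots\times S_{\mu_r}$ acts on $\mathbb C^\mu$ by permuting coordinates within each block ($\sigma e_{k,i}=e_{k,\sigma[k](i)}$, where $\sigma[k]$ is the component of $\sigma$ in $S_{\mu_k}$) and on functions by $(\sigma f)(x)=f(\sigma^{-1}x)$; it is the reflection group of the root system $\Phi=\{x_{k,i}-x_{k,j}: i\ne j\}$ with base $\Sigma=\{x_{k,i}-x_{k,i+1}\}$. $\Gamma=\mathbb C[X_\mu]^{S_\mu}$, $K=L^{S_\mu}$. For $v\in\mathbb C^\mu$, $t_v$ is the automorphism of $L$ given by $t_v(f)(x)=f(x+v)$; $L\#\mathbb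 C^\mu$ is the smash product, identified with the algebra of operators $\sum_v f_vt_v$ (finite sums, $f_v\in L$) on $L$, and $S_\mu$ acts on it by conjugation. The anti-isomorphism $\dagger$ is $(f t_v)^\dagger=t_{-v}\cdot f=t_{-v}(f)\,t_{-v}$. Fix $r'\le r$; $\mathbb Z^{\overline\mu}$ is the set of $z\in\mathbb Z^\mu$ with $z_{k,i}=0$ for $k>r'$. A Galois order over $\Gamma$ in $(L\#\mathcal M)^{S_\mu}$ (here $\mathcal M=\mathbb Z^{\overline\mu}$ acting by translations) is a finitely generated $\Gamma$-subring $U\subset(L\#\mathcal M)^{S_\mu}$ with $UK=KU=(L\#\mathcal M)^{S_\mu}$ such that for every finite-dimensional right (resp. left) $K$-subspace $E$ of $UK$ (resp. $KU$), $E\cap U$ is a finitely generated right (resp. left) $\Gamma$-module. A standard Galois order of type $A$ is a Galois order $U$ generated by $\Gamma$ and elements $X_k^{\pm}$, $1\le k\le r'$, of the form $$X_k^\pm=\mathrm{sym}_k\Big(t_{\pm e_{k,1}}\frac{f_k^\pm}{\prod_{j=2}^{\mu_k}(x_{k,1}-x_{k,j})}\Big),$$ where $\mathrm{sym}_k=\frac1{\mu_k!}\sum_{\sigma\in S_{\mu_k}}\sigma$ ($S_{\mu_k}$ seen as the $k$-th factor of $S_\mu$) and $f_k^\pm\in\mathbb C[X_\mu]$ is invariant under the stabilizer of $e_{k,1}$ in $S_\mu$. Put $f_{k,1}^\pm=\frac1{\mu_k}f_k^\pm$ and $f_{k,i}^\pm=\sigma\cdot f_{k,1}^\pm$ for any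 $\sigma\in S_\mu$ with $\sigma[k](1)=i$; thus $$(X_k^\pm)^\dagger=\sum_{i=1}^{\mu_k}\frac{f_{k,i}^\pm}{\prod_{j\ne i}(x_{k,i}-x_{k,j})}\,t_{e_{k,i}}^{\mp1}.$$ $U$ acts on $\Gamma^*=\mathrm{Hom}_{\mathbb C}(\Gamma,\mathbb C)$ by $X\cdot\chi=\chi\circ X^\dagger$ (each $X^\dagger$, $X\in U$, maps $\Gamma$ to $\Gamma$). Seeds: $\overline\Phi=\{x_{k,i}-x_{k,j}:1\le k\le r',\ i\neq j\}$, $\overline\Sigma=\Sigma\cap\overline\Phi$. For $v\in\mathbb C^\mu$, $\Psi(v)=\{\alpha\in\overline\Phi:\alpha(v)\in\mathbb Z\}$. $v$ is a seed if $\Psi(v)$ is a standard subsystem of $\overline\Phi$ (the subsystem generated by a subset of $\overline\Sigma$) and $\alpha(v)=0$ for all $\alpha\in\Psi(v)$. For a seed $\overline v$ with $\Psi=\Psi(\overline v)$, $\Omega=\Psi\cap\overline\Sigma$, let $W=W(\Psi)$ (the group generated by the reflections in $\Psi$) and $\mathsf Z(\overline v)=\{z\in\mathbb Z^{\overline\mu}:\alpha(z)\ge0\ \forall\alpha\in\Omega\}$. BGG operators (with respect to $\Psi,\Omega,W$; $\Psi^+$ the positive roots, $\omega_0$ the longest element of $W$): for a simple reflection $s$ with simple root $\alpha_s$, $\nabla_s=\frac1{\alpha_s}(1-s)$; $\partial_\sigma=\nabla_{s_1}\circ\cdots\circ\nabla_{s_\ell}$ for a reduced decomposition $\sigma=s_1\cdots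 s_\ell$; $\mathfrak S_\sigma=\frac1{|W|}\partial_{\sigma^{-1}\omega_0}\big(\prod_{\alpha\in\Psi^+}\alpha\big)$. $I_W\subset\Lambda$ is the ideal generated by positive degree $W$-invariants. $\Theta$ is the algebra morphism from $\Lambda$ to differential operators with $\Theta(x_{k,i})=\partial/\partial x_{k,i}$, $(f,g)_\Theta=\Theta(f)(g)(0)$, and $P_\sigma$ ($\sigma\in W$) is the unique polynomial with $(f,P_\sigma)_\Theta=0$ for all $f\in I_W$ and $(P_\sigma,\mathfrak S_\tau)_\Theta=\delta_{\sigma,\tau}$ for all $\tau\in W$. For $v\in\mathbb C^\mu$, $\mathcal D_\sigma^v\in\Gamma^*$ is $\mathcal D^v_\sigma(\gamma)=\big(\Theta(P_\sigma)(\gamma)\big)(v)$; $\mathcal D(\Omega,v)\subset\Gamma^*$ is the span of $\{\mathcal D_\sigma^v:\sigma\in W\}$; and $V(\Omega,T(\overline v))=\sum_{z\in\mathbb Z^{\overline\mu}}\mathcal D(\Omega,\overline v+z)$, which is a $U$-submodule of $\Gamma^*$. *)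

theory Defs
  imports
    "HOL-Library.Poly_Mapping"
    "HOL-Library.Product_Lexorder"
    "HOL-Library.Function_Algebras"
    "HOL-Combinatorics.Permutations"
    "HOL-Computational_Algebra.Polynomial_Factorial"
    "HOL-Algebra.Generated_Rings"
begin

text \<open>A pair \<open>(k, i)\<close> indexes the coordinate \<open>x\<^sub>k\<^sub>,\<^sub>i\<close>, with \<open>k\<close> and \<open>i\<close> counted from 1.
  The tuple \<open>\<mu>\<close> is a list, \<open>r = length \<mu>\<close>.  Everything attached to \<open>\<mu>\<close> is a subset of a type
  built on all pairs: vectors vanish off \<open>idx \<mu>\<close>, polynomials only involve variables
  in \<open>idx \<mu>\<close>.  The lexicographic order on pairs is only there to make \<open>mpol\<close> an integral domain.\<close>

type_synonym index = "nat \<times> nat"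
type_synonym vec = "index \<Rightarrow> complex"
type_synonym mpol = "(index \<Rightarrow>\<^sub>0 nat) \<Rightarrow>\<^sub>0 complex"
type_synonym ratf = "mpol fract"
type_synonym smash = "vec \<Rightarrow>\<^sub>0 ratf"

definition msize :: "nat list \<Rightarrow> nat \<Rightarrow> nat" where
  "msize \<mu> k = \<mu> ! (k - 1)"

definition idx :: "nat list \<Rightarrow> index set" where
  "idx \<mu> = {(k, i). 1 \<le> k \<and> k \<le> length \<mu> \<and> 1 \<le> i \<and> i \<le> msize \<mu> k}"

definition Cvec :: "nat list \<Rightarrow> vec set" where
  "Cvec \<mu> = {v. \<forall>p. p \<notin> idx \<mu> \<longrightarrow> v p = 0}"

definition unit_vec :: "index \<Rightarrow> vec" where
  "unit_vec p = (\<lambda>q. if q = p then 1 else 0)"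

text \<open>\<open>Zbar \<mu> r'\<close>: integral vectors supported on the first \<open>r'\<close> blocks.\<close>

definition Zbar :: "nat list \<Rightarrow> nat \<Rightarrow> vec set" where
  "Zbar \<mu> r' = {z \<in> Cvec \<mu>. (\<forall>p. z p \<in> \<int>) \<and> (\<forall>k i. k > r' \<longrightarrow> z (k, i) = 0)}"


section \<open>Polynomials and rational functions\<close>

definition cst :: "complex \<Rightarrow> mpol" where
  "cst c = Poly_Mapping.single 0 c"

definition var :: "index \<Rightarrow> mpol" where
  "var p = Poly_Mapping.single (Poly_Mapping.single p 1) 1"

text \<open>The ring homomorphism out of the polynomial ring that is \<open>c\<close> on constants and
  sends \<open>var q\<close> to \<open>s q\<close>.\<close>

definition mpol_hom :: "(complex \<Rightarrow> 'a::comm_ring_1) \<Rightarrow> (index \<Rightarrow> 'a) \<Rightarrow> mpol \<Rightarrow> 'a" where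
  "mpol_hom c s f = (\<Sum>m \<in> Poly_Mapping.keys f. c (Poly_Mapping.lookup f m) *
     (\<Prod>q \<in> Poly_Mapping.keys m. s q ^ Poly_Mapping.lookup m q))"

definition mpol_eval :: "mpol \<Rightarrow> vec \<Rightarrow> complex" where
  "mpol_eval f v = mpol_hom (\<lambda>c. c) v f"

definition Lam :: "nat list \<Rightarrow> mpol set" where
  "Lam \<mu> = {f. \<forall>m \<in> Poly_Mapping.keys f. Poly_Mapping.keys m \<subseteq> idx \<mu>}"

definition Lfield :: "nat list \<Rightarrow> ratf set" where
  "Lfield \<mu> = {Fract a b | a b. a \<in> Lam \<mu> \<and> b \<in> Lam \<mu> \<and> b \<noteq> 0}"

text \<open>Extension of an injective ring endomorphism to the fraction field.\<close>

definition fract_ext :: "(mpol \<Rightarrow> mpol) \<Rightarrow> ratf \<Rightarrow> ratf" where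
  "fract_ext \<phi> x = (THE y. \<exists>a b. b \<noteq> 0 \<and> x = Fract a b \<and> y = Fract (\<phi> a) (\<phi> b))"

text \<open>The translation \<open>(t\<^sub>v f)(x) = f(x + v)\<close>.\<close>

definition transl :: "vec \<Rightarrow> mpol \<Rightarrow> mpol" where
  "transl v = mpol_hom cst (\<lambda>q. var q + cst (v q))"

definition translL :: "vec \<Rightarrow> ratf \<Rightarrow> ratf" where
  "translL v = fract_ext (transl v)"

text \<open>Permutations of indices act by \<open>\<sigma> e\<^sub>p = e\<^bsub>\<sigma> p\<^esub>\<close> on vectors; since
  \<open>(\<sigma> f)(x) = f(\<sigma>\<inverse> x)\<close>, the variable \<open>var p\<close> is sent to \<open>var (\<sigma> p)\<close>.\<close>

definition perm_vec :: "(index \<Rightarrow> index) \<Rightarrow> vec \<Rightarrow> vec" where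
  "perm_vec \<sigma> v = (\<lambda>p. v (inv_into UNIV \<sigma> p))"

definition perm_pol :: "(index \<Rightarrow> index) \<Rightarrow> mpol \<Rightarrow> mpol" where
  "perm_pol \<sigma> = mpol_hom cst (\<lambda>q. var (\<sigma> q))"

definition permL :: "(index \<Rightarrow> index) \<Rightarrow> ratf \<Rightarrow> ratf" where
  "permL \<sigma> = fract_ext (perm_pol \<sigma>)"

definition Smu :: "nat list \<Rightarrow> (index \<Rightarrow> index) set" where
  "Smu \<mu> = {\<sigma>. \<sigma> permutes idx \<mu> \<and> (\<forall>p. fst (\<sigma> p) = fst p)}"

definition Sblock :: "nat list \<Rightarrow> nat \<Rightarrow> (index \<Rightarrow> index) set" where
  "Sblock \<mu> k = {\<sigma> \<in> Smu \<mu>. \<forall>p. fst p \<noteq> k \<longrightarrow> \<sigma> p = p}"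

definition Gam :: "nat list \<Rightarrow> mpol set" where
  "Gam \<mu> = {f \<in> Lam \<mu>. \<forall>\<sigma> \<in> Smu \<mu>. perm_pol \<sigma> f = f}"

definition Kfield :: "nat list \<Rightarrow> ratf set" where
  "Kfield \<mu> = {f \<in> Lfield \<mu>. \<forall>\<sigma> \<in> Smu \<mu>. permL \<sigma> f = f}"


section \<open>The smash product\<close>

text \<open>The finitely supported map \<open>F\<close> stands for \<open>\<Sum>\<^sub>v F(v) t\<^sub>v\<close>.  The product is
  \<open>(f t\<^sub>u)(g t\<^sub>v) = f t\<^sub>u(g) t\<^bsub>u+v\<^esub>\<close>, not the untwisted convolution \<open>*\<close> of the library.\<close>

definition smul :: "smash \<Rightarrow> smash \<Rightarrow> smash" where
  "smul F G = (\<Sum>u \<in> Poly_Mapping.keys F. \<Sum>v \<in> Poly_Mapping.keys G.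
     Poly_Mapping.single (u + v) (Poly_Mapping.lookup F u * translL u (Poly_Mapping.lookup G v)))"

definition emb :: "ratf \<Rightarrow> smash" where
  "emb f = Poly_Mapping.single 0 f"

definition tr :: "vec \<Rightarrow> smash" where
  "tr v = Poly_Mapping.single v 1"

text \<open>Conjugation: \<open>\<sigma> (f t\<^sub>v) \<sigma>\<inverse> = \<sigma>(f) t\<^bsub>\<sigma> v\<^esub>\<close>.\<close>

definition conj_smash :: "(index \<Rightarrow> index) \<Rightarrow> smash \<Rightarrow> smash" where
  "conj_smash \<sigma> F = (\<Sum>v \<in> Poly_Mapping.keys F.
     Poly_Mapping.single (perm_vec \<sigma> v) (permL \<sigma> (Poly_Mapping.lookup F v)))"

definition dagger :: "smash \<Rightarrow> smash" where
  "dagger F = (\<Sum>v \<in> Poly_Mapping.keys F.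
     Poly_Mapping.single (- v) (translL (- v) (Poly_Mapping.lookup F v)))"

text \<open>The operator on rational functions given by an element of the smash product.\<close>

definition smash_app :: "smash \<Rightarrow> ratf \<Rightarrow> ratf" where
  "smash_app F g = (\<Sum>v \<in> Poly_Mapping.keys F. Poly_Mapping.lookup F v * translL v g)"

text \<open>The ring \<open>(L # M)\<^sup>S\<close> for a group \<open>M\<close> of translations and \<open>S\<close> the product of symmetric groups.\<close>

definition smash_inv :: "nat list \<Rightarrow> vec set \<Rightarrow> smash ring" where
  "smash_inv \<mu> M = \<lparr> carrier = {F. Poly_Mapping.keys F \<subseteq> M \<and>
        (\<forall>v. Poly_Mapping.lookup F v \<in> Lfield \<mu>) \<and> (\<forall>\<sigma> \<in> Smu \<mu>. conj_smash \<sigma> F = F)},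
     monoid.mult = smul, one = emb 1, zero = 0, add = (+) \<rparr>"


section \<open>Galois orders\<close>

text \<open>\<open>prod_span mul A B\<close>: all finite sums of products \<open>mul a b\<close> with \<open>a \<in> A\<close>, \<open>b \<in> B\<close>.
  For a finite set \<open>S\<close> and a subring \<open>R\<close>, \<open>prod_span smul S R\<close> is the right \<open>R\<close>-module
  spanned by \<open>S\<close>, and \<open>prod_span smul R S\<close> the left one.\<close>

definition prod_span :: "('a \<Rightarrow> 'a \<Rightarrow> 'a::comm_monoid_add) \<Rightarrow> 'a set \<Rightarrow> 'a set \<Rightarrow> 'a set" where
  "prod_span mul A B = {(\<Sum>i<n. mul (a i) (b i)) | (n::nat) a b. \<forall>i<n. a i \<in> A \<and> b i \<in> B}"

definition galois_order :: "nat list \<Rightarrow> vec set \<Rightarrow> smash set \<Rightarrow> bool" where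
  "galois_order \<mu> M U \<longleftrightarrow>
     (let R = smash_inv \<mu> M; G = emb ` to_fract ` Gam \<mu>; K = emb ` Kfield \<mu> in
       subring U R \<and> G \<subseteq> U \<and>
       (\<exists>S. finite S \<and> S \<subseteq> U \<and> U = generate_ring R (G \<union> S)) \<and>
       prod_span smul U K = carrier R \<and> prod_span smul K U = carrier R \<and>
       (\<forall>B E. finite B \<and> B \<subseteq> prod_span smul U K \<and> E = prod_span smul B K \<longrightarrow>
          (\<exists>S. finite S \<and> S \<subseteq> E \<inter> U \<and> E \<inter> U = prod_span smul S G)) \<and>
       (\<forall>B E. finite B \<and> B \<subseteq> prod_span smul K U \<and> E = prod_span smul K B \<longrightarrow>
          (\<exists>S. finite S \<and> S \<subseteq> E \<inter> U \<and> E \<inter> U = prod_span smul G S)))"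

definition sym_block :: "nat list \<Rightarrow> nat \<Rightarrow> smash \<Rightarrow> smash" where
  "sym_block \<mu> k F =
     smul (emb (1 / of_nat (fact (msize \<mu> k)))) (\<Sum>\<sigma> \<in> Sblock \<mu> k. conj_smash \<sigma> F)"

definition Xgen :: "nat list \<Rightarrow> nat \<Rightarrow> vec \<Rightarrow> mpol \<Rightarrow> smash" where
  "Xgen \<mu> k v f = sym_block \<mu> k (smul (tr v)
     (emb (to_fract f / (\<Prod>j \<in> {2..msize \<mu> k}. to_fract (var (k, 1) - var (k, j))))))"

definition Xplus :: "nat list \<Rightarrow> (nat \<Rightarrow> mpol) \<Rightarrow> nat \<Rightarrow> smash" where
  "Xplus \<mu> fp k = Xgen \<mu> k (unit_vec (k, 1)) (fp k)"

definition Xminus :: "nat list \<Rightarrow> (nat \<Rightarrow> mpol) \<Rightarrow> nat \<Rightarrow> smash" where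
  "Xminus \<mu> fm k = Xgen \<mu> k (- unit_vec (k, 1)) (fm k)"

text \<open>\<open>U\<close> is a standard Galois order of type A, with \<open>fp k\<close> and \<open>fm k\<close> the polynomials
  \<open>f\<^sub>k\<^sup>+\<close> and \<open>f\<^sub>k\<^sup>-\<close> (only their values at \<open>1 \<le> k \<le> r'\<close> matter).\<close>

definition standard_galois_order ::
  "nat list \<Rightarrow> nat \<Rightarrow> (nat \<Rightarrow> mpol) \<Rightarrow> (nat \<Rightarrow> mpol) \<Rightarrow> smash set \<Rightarrow> bool" where
  "standard_galois_order \<mu> r' fp fm U \<longleftrightarrow>
     (\<forall>k \<in> {1..r'}. fp k \<in> Lam \<mu> \<and> fm k \<in> Lam \<mu> \<and>
        (\<forall>\<sigma> \<in> Smu \<mu>. perm_vec \<sigma> (unit_vec (k, 1)) = unit_vec (k, 1) \<longrightarrow>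
           perm_pol \<sigma> (fp k) = fp k \<and> perm_pol \<sigma> (fm k) = fm k)) \<and>
     galois_order \<mu> (Zbar \<mu> r') U \<and>
     U = generate_ring (smash_inv \<mu> (Zbar \<mu> r'))
           (emb ` to_fract ` Gam \<mu> \<union> Xplus \<mu> fp ` {1..r'} \<union> Xminus \<mu> fm ` {1..r'})"

text \<open>\<open>f\<^bsub>k,i\<^esub> = \<sigma> (f\<^sub>k / \<mu>\<^sub>k)\<close>; among the \<open>\<sigma>\<close> sending \<open>(k, 1)\<close> to \<open>(k, i)\<close>, which all give the
  same polynomial, we take a transposition.\<close>

definition fcoef :: "nat list \<Rightarrow> (nat \<Rightarrow> mpol) \<Rightarrow> nat \<Rightarrow> nat \<Rightarrow> mpol" where
  "fcoef \<mu> f k i =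
     perm_pol (Transposition.transpose (k, 1) (k, i)) (cst (1 / of_nat (msize \<mu> k)) * f k)"


section \<open>Roots and seeds\<close>

text \<open>Roots are linear polynomials; the reflection in \<open>var p - var q\<close> is the transposition of
  \<open>p\<close> and \<open>q\<close>.\<close>

definition Sig :: "nat list \<Rightarrow> mpol set" where
  "Sig \<mu> = {var (k, i) - var (k, i + 1) | k i. (k, i) \<in> idx \<mu> \<and> (k, i + 1) \<in> idx \<mu>}"

definition Phibar :: "nat list \<Rightarrow> nat \<Rightarrow> mpol set" where
  "Phibar \<mu> r' = {var (k, i) - var (k, j) | k i j.
     k \<le> r' \<and> (k, i) \<in> idx \<mu> \<and> (k, j) \<in> idx \<mu> \<and> i \<noteq> j}"

definition Sigbar :: "nat list \<Rightarrow> nat \<Rightarrow> mpol set" where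
  "Sigbar \<mu> r' = Sig \<mu> \<inter> Phibar \<mu> r'"

definition Psi :: "nat list \<Rightarrow> nat \<Rightarrow> vec \<Rightarrow> mpol set" where
  "Psi \<mu> r' v = {\<alpha> \<in> Phibar \<mu> r'. mpol_eval \<alpha> v \<in> \<int>}"

definition refl_closed :: "mpol set \<Rightarrow> bool" where
  "refl_closed \<Xi> \<longleftrightarrow> (\<forall>p q. \<forall>\<beta> \<in> \<Xi>. var p - var q \<in> \<Xi> \<longrightarrow>
     perm_pol (Transposition.transpose p q) \<beta> \<in> \<Xi>)"

definition subsystem_gen :: "nat list \<Rightarrow> nat \<Rightarrow> mpol set \<Rightarrow> mpol set" where
  "subsystem_gen \<mu> r' S = \<Inter> {\<Xi>. S \<subseteq> \<Xi> \<and> \<Xi> \<subseteq> Phibar \<mu> r' \<and> refl_closed \<Xi>}"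

definition standard_subsystem :: "nat list \<Rightarrow> nat \<Rightarrow> mpol set \<Rightarrow> bool" where
  "standard_subsystem \<mu> r' \<Xi> \<longleftrightarrow> (\<exists>S \<subseteq> Sigbar \<mu> r'. \<Xi> = subsystem_gen \<mu> r' S)"

definition seed :: "nat list \<Rightarrow> nat \<Rightarrow> vec \<Rightarrow> bool" where
  "seed \<mu> r' v \<longleftrightarrow> v \<in> Cvec \<mu> \<and> standard_subsystem \<mu> r' (Psi \<mu> r' v) \<and>
     (\<forall>\<alpha> \<in> Psi \<mu> r' v. mpol_eval \<alpha> v = 0)"

text \<open>On integral vectors \<open>\<alpha>(z)\<close> is an integer, so \<open>\<alpha>(z) \<ge> 0\<close> says that \<open>\<alpha>(z)\<close> lies in \<open>\<nat>\<close>.\<close>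

definition Zdom :: "nat list \<Rightarrow> nat \<Rightarrow> mpol set \<Rightarrow> vec set" where
  "Zdom \<mu> r' \<Omega> = {z \<in> Zbar \<mu> r'. \<forall>\<alpha> \<in> \<Omega>. mpol_eval \<alpha> z \<in> \<nat>}"


section \<open>BGG operators and dual Schubert polynomials\<close>

text \<open>A word is a list of pairs \<open>(p, q)\<close>, each standing for the transposition of \<open>p\<close> and \<open>q\<close>.\<close>

definition root_words :: "mpol set \<Rightarrow> (index \<times> index) list set" where
  "root_words \<Xi> = {ws. \<forall>(p, q) \<in> set ws. var p - var q \<in> \<Xi>}"

definition word_prod :: "(index \<times> index) list \<Rightarrow> index \<Rightarrow> index" where
  "word_prod ws = foldr (\<lambda>(p, q) \<sigma>. Transposition.transpose p q \<circ> \<sigma>) ws id"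

text \<open>The group generated by the reflections in \<open>\<Psi>\<close>.\<close>

definition weyl :: "mpol set \<Rightarrow> (index \<Rightarrow> index) set" where
  "weyl \<Psi> = word_prod ` root_words \<Psi>"

definition wlen :: "mpol set \<Rightarrow> (index \<Rightarrow> index) \<Rightarrow> nat" where
  "wlen \<Omega> \<sigma> = (LEAST n. \<exists>ws \<in> root_words \<Omega>. length ws = n \<and> word_prod ws = \<sigma>)"

definition reduced :: "mpol set \<Rightarrow> (index \<Rightarrow> index) \<Rightarrow> (index \<times> index) list \<Rightarrow> bool" where
  "reduced \<Omega> \<sigma> ws \<longleftrightarrow> ws \<in> root_words \<Omega> \<and> word_prod ws = \<sigma> \<and> length ws = wlen \<Omega> \<sigma>"

definition longest :: "mpol set \<Rightarrow> mpol set \<Rightarrow> index \<Rightarrow> index" where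
  "longest \<Psi> \<Omega> = (ARG_MAX (wlen \<Omega>) \<sigma>. \<sigma> \<in> weyl \<Psi>)"

definition pos_roots :: "mpol set \<Rightarrow> mpol set \<Rightarrow> mpol set" where
  "pos_roots \<Psi> \<Omega> = {\<alpha> \<in> \<Psi>. \<exists>c :: mpol \<Rightarrow> nat. \<alpha> = (\<Sum>\<beta> \<in> \<Omega>. of_nat (c \<beta>) * \<beta>)}"

definition nabla :: "index \<Rightarrow> index \<Rightarrow> mpol \<Rightarrow> mpol" where
  "nabla p q f =
     (THE g. (var p - var q) * g = f - perm_pol (Transposition.transpose p q) f)"

text \<open>The operator \<open>\<partial>\<^sub>\<sigma>\<close>, independent of the chosen reduced word.\<close>

definition bgg :: "mpol set \<Rightarrow> (index \<Rightarrow> index) \<Rightarrow> mpol \<Rightarrow> mpol" where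
  "bgg \<Omega> \<sigma> f = foldr (\<lambda>(p, q). nabla p q) (SOME ws. reduced \<Omega> \<sigma> ws) f"

definition schubert :: "mpol set \<Rightarrow> mpol set \<Rightarrow> (index \<Rightarrow> index) \<Rightarrow> mpol" where
  "schubert \<Psi> \<Omega> \<sigma> = cst (1 / of_nat (card (weyl \<Psi>))) *
     bgg \<Omega> (inv_into UNIV \<sigma> \<circ> longest \<Psi> \<Omega>) (\<Prod>\<alpha> \<in> pos_roots \<Psi> \<Omega>. \<alpha>)"

text \<open>The ideal of \<open>Lam \<mu>\<close> generated by the invariants without constant term (equivalently, by
  the homogeneous invariants of positive degree).\<close>

definition inv_ideal :: "nat list \<Rightarrow> mpol set \<Rightarrow> mpol set" where
  "inv_ideal \<mu> \<Psi> = prod_span (*) (Lam \<mu>)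
     {g \<in> Lam \<mu>. Poly_Mapping.lookup g 0 = 0 \<and> (\<forall>\<sigma> \<in> weyl \<Psi>. perm_pol \<sigma> g = g)}"

definition pdiff :: "index \<Rightarrow> mpol \<Rightarrow> mpol" where
  "pdiff q g = (\<Sum>m \<in> Poly_Mapping.keys g.
     Poly_Mapping.single (m - Poly_Mapping.single q 1)
       (of_nat (Poly_Mapping.lookup m q) * Poly_Mapping.lookup g m))"

text \<open>\<open>Theta f\<close> is the operator \<open>f(\<partial>)\<close>; partial derivatives commute, so the order in
  which a monomial is applied is immaterial.\<close>

definition Theta :: "mpol \<Rightarrow> mpol \<Rightarrow> mpol" where
  "Theta f g = (\<Sum>m \<in> Poly_Mapping.keys f. cst (Poly_Mapping.lookup f m) *
     foldr (\<lambda>q. pdiff q ^^ Poly_Mapping.lookup m q)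
       (sorted_list_of_set (Poly_Mapping.keys m)) g)"

definition Theta_form :: "mpol \<Rightarrow> mpol \<Rightarrow> complex" where
  "Theta_form f g = mpol_eval (Theta f g) 0"

definition Pdual :: "nat list \<Rightarrow> mpol set \<Rightarrow> mpol set \<Rightarrow> (index \<Rightarrow> index) \<Rightarrow> mpol" where
  "Pdual \<mu> \<Psi> \<Omega> \<sigma> = (THE P. P \<in> Lam \<mu> \<and> (\<forall>f \<in> inv_ideal \<mu> \<Psi>. Theta_form f P = 0) \<and>
     (\<forall>\<tau> \<in> weyl \<Psi>. Theta_form P (schubert \<Psi> \<Omega> \<tau>) = (if \<sigma> = \<tau> then 1 else 0)))"


section \<open>Modules inside the dual of the invariant ring\<close>

text \<open>A linear functional on \<open>Gam \<mu>\<close> is represented by the function on all polynomials which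
  extends it by 0, so that equality of functionals is equality of functions.\<close>

definition cscale :: "complex \<Rightarrow> (mpol \<Rightarrow> complex) \<Rightarrow> mpol \<Rightarrow> complex" where
  "cscale c \<chi> = (\<lambda>f. c * \<chi> f)"

global_interpretation functional: vector_space cscale
  by unfold_locales (auto simp: cscale_def fun_eq_iff algebra_simps)

definition Gdual :: "nat list \<Rightarrow> (mpol \<Rightarrow> complex) set" where
  "Gdual \<mu> = {\<chi>. (\<forall>f \<in> Gam \<mu>. \<forall>g \<in> Gam \<mu>. \<chi> (f + g) = \<chi> f + \<chi> g) \<and>
     (\<forall>c. \<forall>f \<in> Gam \<mu>. \<chi> (cst c * f) = c * \<chi> f) \<and> (\<forall>f. f \<notin> Gam \<mu> \<longrightarrow> \<chi> f = 0)}"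

definition dual_act :: "nat list \<Rightarrow> smash \<Rightarrow> (mpol \<Rightarrow> complex) \<Rightarrow> mpol \<Rightarrow> complex" where
  "dual_act \<mu> X \<chi> = (\<lambda>\<gamma>. if \<gamma> \<in> Gam \<mu>
     then \<chi> (the_inv to_fract (smash_app (dagger X) (to_fract \<gamma>))) else 0)"

definition submodule_dual :: "nat list \<Rightarrow> smash set \<Rightarrow> (mpol \<Rightarrow> complex) set \<Rightarrow> bool" where
  "submodule_dual \<mu> U V \<longleftrightarrow> V \<subseteq> Gdual \<mu> \<and> functional.subspace V \<and>
     (\<forall>X \<in> U. \<forall>\<chi> \<in> V. dual_act \<mu> X \<chi> \<in> V)"

definition irreducible_dual :: "nat list \<Rightarrow> smash set \<Rightarrow> (mpol \<Rightarrow> complex) set \<Rightarrow> bool" where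
  "irreducible_dual \<mu> U V \<longleftrightarrow> submodule_dual \<mu> U V \<and> V \<noteq> {0} \<and>
     (\<forall>N. submodule_dual \<mu> U N \<and> N \<subseteq> V \<longrightarrow> N = {0} \<or> N = V)"

definition Dfun :: "nat list \<Rightarrow> mpol set \<Rightarrow> mpol set \<Rightarrow> (index \<Rightarrow> index) \<Rightarrow> vec \<Rightarrow>
    mpol \<Rightarrow> complex" where
  "Dfun \<mu> \<Psi> \<Omega> \<sigma> v = (\<lambda>\<gamma>. if \<gamma> \<in> Gam \<mu>
     then mpol_eval (Theta (Pdual \<mu> \<Psi> \<Omega> \<sigma>) \<gamma>) v else 0)"

definition Dspace :: "nat list \<Rightarrow> mpol set \<Rightarrow> mpol set \<Rightarrow> vec \<Rightarrow> (mpol \<Rightarrow> complex) set" where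
  "Dspace \<mu> \<Psi> \<Omega> v = functional.span ((\<lambda>\<sigma>. Dfun \<mu> \<Psi> \<Omega> \<sigma> v) ` weyl \<Psi>)"

text \<open>The sum of the subspaces \<open>Dspace \<mu> \<Psi> \<Omega> (v + z)\<close> over \<open>z \<in> Zbar \<mu> r'\<close>.\<close>

definition Vmod :: "nat list \<Rightarrow> nat \<Rightarrow> mpol set \<Rightarrow> mpol set \<Rightarrow> vec \<Rightarrow> (mpol \<Rightarrow> complex) set" where
  "Vmod \<mu> r' \<Psi> \<Omega> v = functional.span (\<Union>z \<in> Zbar \<mu> r'. Dspace \<mu> \<Psi> \<Omega> (v + z))"

end

theory Submission
  imports Defs
begin

text \<open>Near a point \<open>v = vbar + z\<close> the functionals in the module are \<open>\<gamma> \<mapsto> \<phi>(\<gamma>(v + x))\<close>, where \<open>\<phi>\<close> runs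
  through the functionals on polynomials that kill the coinvariant ideal of \<open>W\<close>; this is what the
  dual Schubert polynomials span.  A generator of \<open>U\<close> sends such a functional to a sum, over the level
  sets of \<open>v\<close> in block \<open>k\<close>, of functionals obtained by composing \<open>\<phi>\<close> with iterated divided differences,
  which preserve the ideal.

  Let \<open>N\<close> be a nonzero submodule.  Symmetric polynomials interpolate invariant jets on finitely many
  orbits, so \<open>N\<close> contains a functional supported on one orbit, and multiplying it by a symmetric
  polynomial of maximal order gives an evaluation \<open>\<gamma> \<mapsto> \<gamma>(vbar + z)\<close>; after sorting, \<open>z\<close> is dominant.
  As the coefficients \<open>f\<^sub>k\<^sub>,\<^sub>i\<close> do not vanish at dominant shifts, the generators move evaluations along
  a path of dominant vectors down to \<open>z = 0\<close>.  There \<open>W\<close> fixes \<open>vbar\<close>, so the local space is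
  one-dimensional and lies in \<open>N\<close>.  On the way back along the paths Newton's expansion of a polynomial
  in divided differences shows that the whole local space at \<open>vbar + z\<close> is reached.\<close>

section \<open>Polynomials\<close>

text \<open>The points \<open>vbar + z\<close> lie on walls to a varying degree, and a symmetric
  polynomial has a jet there that is invariant under the stabiliser. So a functional \<phi> on all
  polynomials is not determined by its restriction to symmetric ones, and the local spaces differ in
  dimension, down to 1 at \<open>vbar\<close>. The work is therefore done with \<phi> before
  restriction, where multiplication and divided differences act freely. Two facts make jets
  manageable. The coinvariant ideal contains every polynomial whose order exceeds the number of
  positive roots, so one truncation order serves throughout, and a polynomial with nonzero constant
  term acts as a unit. And shifts of coordinates from different level sets of one point lie in
  different orbits, as sums of squares show, so the summands produced by a generator can be isolated
  by symmetric polynomials. Newton's expansion is taken with elementary symmetric coefficients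
  because these are invariant under the stabiliser of the shifted point. Its constant term shows
  that a step does not kill an evaluation; the full expansion shows that a step reaches the whole
  local space.\<close>

lemma keysum_superset:
  assumes "\<And>v. h v 0 = (0::'b::comm_monoid_add)" "finite A" "Poly_Mapping.keys F \<subseteq> A"
  shows "(\<Sum>v\<in>Poly_Mapping.keys F. h v (Poly_Mapping.lookup F v)) = (\<Sum>v\<in>A. h v (Poly_Mapping.lookup F v))"
  by (rule sum.mono_neutral_left) (use assms in \<open>auto simp: in_keys_iff\<close>)

text \<open>Substitution, derivatives and the smash product are all defined by sums over the support
  of a finitely supported map. A summand that vanishes at coefficient 0 lets the support be enlarged
  to a common one, which gives additivity once and for all.\<close>

lemma keysum_add:
  assumes add: "\<And>v a b. h v (a + b) = h v a + h v b" and h0: "\<And>v. h v 0 = (0::'b::comm_monoid_add)"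
  shows "(\<Sum>v\<in>Poly_Mapping.keys (F + G). h v (Poly_Mapping.lookup (F + G) v)) =
    (\<Sum>v\<in>Poly_Mapping.keys F. h v (Poly_Mapping.lookup F v)) + (\<Sum>v\<in>Poly_Mapping.keys G. h v (Poly_Mapping.lookup G v))"
  by (rule setsum_keys_plus_distrib) (simp_all add: add h0)

lemma keysum_single:
  assumes "\<And>v. h v 0 = (0::'b::comm_monoid_add)"
  shows "(\<Sum>v\<in>Poly_Mapping.keys (Poly_Mapping.single u x). h v (Poly_Mapping.lookup (Poly_Mapping.single u x) v)) = h u x"
  using keysum_superset[of h "{u}" "Poly_Mapping.single u x"] assms by simp

lemma keysum_sum:
  assumes add: "\<And>v a b. h v (a + b) = h v a + h v b" and h0: "\<And>v. h v 0 = (0::'b::comm_monoid_add)"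
  shows "(\<Sum>v\<in>Poly_Mapping.keys (sum F A). h v (Poly_Mapping.lookup (sum F A) v)) =
    (\<Sum>i\<in>A. \<Sum>v\<in>Poly_Mapping.keys (F i). h v (Poly_Mapping.lookup (F i) v))"
  by (induction A rule: infinite_finite_induct) (simp_all add: keysum_add[of h, OF add h0])

lemma sum_single_keys:
  "(\<Sum>v\<in>Poly_Mapping.keys F. Poly_Mapping.single v (Poly_Mapping.lookup F v)) = F"
  by (rule poly_mapping_eqI) (auto simp: lookup_sum lookup_single when_def in_keys_iff)

lemma cst_0 [simp]: "cst 0 = 0" and cst_1 [simp]: "cst 1 = 1"
  and cst_add: "cst (a + b) = cst a + cst b" and cst_mult: "cst (a * b) = cst a * cst b"
  and cst_uminus: "cst (- a) = - cst a" and cst_diff: "cst (a - b) = cst a - cst b"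
  by (simp_all add: cst_def single_add mult_single single_uminus single_diff)

lemma cst_of_nat: "cst (of_nat n) = of_nat n"
  by (induction n) (simp_all add: cst_add)

section \<open>Monomials, degree and induction over polynomials\<close>

definition mpmon :: "(index \<Rightarrow>\<^sub>0 nat) \<Rightarrow> mpol" where
  "mpmon m = Poly_Mapping.single m 1"

lemma single_eq_cst_mpmon: "Poly_Mapping.single m c = cst c * mpmon m"
  by (simp add: cst_def mpmon_def mult_single)

lemma mpmon_add: "mpmon (m + n) = mpmon m * mpmon n"
  by (simp add: mpmon_def mult_single)

lemma mpol_expand: "f = (\<Sum>m\<in>Poly_Mapping.keys f. cst (Poly_Mapping.lookup f m) * mpmon m)" for f :: mpol
  by (simp add: single_eq_cst_mpmon[symmetric] sum_single_keys)

definition edeg :: "(index \<Rightarrow>\<^sub>0 nat) \<Rightarrow> nat" where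
  "edeg m = (\<Sum>q\<in>Poly_Mapping.keys m. Poly_Mapping.lookup m q)"

lemma edeg_add: "edeg (m + n) = edeg m + edeg n"
  unfolding edeg_def by (rule keysum_add) auto

lemma edeg_single [simp]: "edeg (Poly_Mapping.single q n) = n"
  unfolding edeg_def by (rule keysum_single[of "\<lambda>_ n. n"]) auto

lemma edeg_0 [simp]: "edeg 0 = 0" by (simp add: edeg_def)

lemma edeg_eq_0_iff [simp]: "edeg m = 0 \<longleftrightarrow> m = 0"
  unfolding edeg_def by (metis edeg_0 edeg_def finite_keys in_keys_iff keys_eq_empty sum_eq_0_iff all_not_in_conv)

lemma expo_induct [case_names zero add]:
  fixes m :: "index \<Rightarrow>\<^sub>0 nat"
  assumes zero: "P 0" and add: "\<And>q m. P m \<Longrightarrow> P (m + Poly_Mapping.single q 1)"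
  shows "P m"
proof (induction "edeg m" arbitrary: m)
  case 0
  then show ?case using zero by simp
next
  case (Suc d)
  then obtain q where q: "Poly_Mapping.lookup m q > 0"
    by (metis edeg_eq_0_iff nat.distinct(1) neq0_conv poly_mapping_eqI lookup_zero)
  define n where "n = m - Poly_Mapping.single q 1"
  have m: "m = n + Poly_Mapping.single q 1"
    by (rule poly_mapping_eqI) (use q in \<open>auto simp: n_def lookup_add lookup_minus lookup_single when_def\<close>)
  have "d = edeg n" using Suc(2) unfolding m by (simp add: edeg_add)
  then show ?case using Suc(1) add unfolding m by blast
qed

lemma mpmon_0 [simp]: "mpmon 0 = 1"
  by (simp add: mpmon_def)

lemma mpmon_single: "mpmon (Poly_Mapping.single q 1) = var q"
  by (simp add: mpmon_def var_def)

text \<open>Monomials arise from constants by multiplying with one variable at a time, so the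
  multiplicative case only has to treat a single variable. Product rules and homomorphism properties
  then become linear statements.\<close>

lemma mpol_induct [case_names cst add var]:
  fixes f :: mpol
  assumes cst: "\<And>c. P (cst c)" and add: "\<And>f g. P f \<Longrightarrow> P g \<Longrightarrow> P (f + g)"
    and var: "\<And>f q. P f \<Longrightarrow> P (f * var q)"
  shows "P f"
proof -
  have mon: "P (cst c * mpmon m)" for c m
  proof (induction m rule: expo_induct)
    case zero
    show ?case using cst by simp
  next
    case (add q m)
    then show ?case using var[of "cst c * mpmon m" q] by (simp only: mpmon_add mpmon_single mult.assoc)
  qed
  have "P (\<Sum>m\<in>A. cst (Poly_Mapping.lookup f m) * mpmon m)" for A
    by (induction A rule: infinite_finite_induct) (use cst[of 0] mon add in auto)
  then show ?thesis using mpol_expand by metis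
qed

text \<open>The polynomial ring of the definitions is only a subset of its type, so ring homomorphisms
  are treated as a predicate on functions between types.\<close>

definition ring_map :: "('a::comm_ring_1 \<Rightarrow> 'b::comm_ring_1) \<Rightarrow> bool" where
  "ring_map \<phi> \<longleftrightarrow> \<phi> 1 = 1 \<and> (\<forall>x y. \<phi> (x + y) = \<phi> x + \<phi> y) \<and> (\<forall>x y. \<phi> (x * y) = \<phi> x * \<phi> y)"

context
  fixes \<phi> :: "'a::comm_ring_1 \<Rightarrow> 'b::comm_ring_1"
  assumes \<phi>: "ring_map \<phi>"
begin

lemma ring_map_1: "\<phi> 1 = 1" and ring_map_add: "\<phi> (x + y) = \<phi> x + \<phi> y"
  and ring_map_mult: "\<phi> (x * y) = \<phi> x * \<phi> y"
  using \<phi> by (auto simp: ring_map_def)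

lemma ring_map_0: "\<phi> 0 = 0"
  using ring_map_add[of 0 0] by simp

lemma ring_map_uminus: "\<phi> (- x) = - \<phi> x"
  using ring_map_add[of x "- x"] ring_map_0 by (simp add: eq_neg_iff_add_eq_0 add.commute)

lemma ring_map_diff: "\<phi> (x - y) = \<phi> x - \<phi> y"
  using ring_map_add[of x "- y"] ring_map_uminus by simp

lemma ring_map_sum: "\<phi> (sum f A) = (\<Sum>x\<in>A. \<phi> (f x))"
  by (induction A rule: infinite_finite_induct) (simp_all add: ring_map_0 ring_map_add)

lemma ring_map_prod: "\<phi> (prod f A) = (\<Prod>x\<in>A. \<phi> (f x))"
  by (induction A rule: infinite_finite_induct) (simp_all add: ring_map_1 ring_map_mult)

lemma ring_map_power: "\<phi> (x ^ n) = \<phi> x ^ n"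
  by (induction n) (simp_all add: ring_map_1 ring_map_mult)

lemmas ring_map_simps = ring_map_0 ring_map_1 ring_map_add ring_map_mult ring_map_uminus
  ring_map_diff ring_map_sum ring_map_prod ring_map_power

end

lemma ring_map_comp: "ring_map \<phi> \<Longrightarrow> ring_map \<psi> \<Longrightarrow> ring_map (\<lambda>x. \<phi> (\<psi> x))"
  by (simp add: ring_map_def)

lemma ring_map_id: "ring_map (\<lambda>x. x)"
  by (simp add: ring_map_def)

lemma ring_map_cst: "ring_map cst"
  by (simp add: ring_map_def cst_add cst_mult)

lemma ring_map_eqI:
  assumes "ring_map \<phi>" "ring_map \<psi>" "\<And>c. \<phi> (cst c) = \<psi> (cst c)" "\<And>q. \<phi> (var q) = \<psi> (var q)"
  shows "\<phi> f = \<psi> f"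
  by (induction f rule: mpol_induct)
    (simp_all add: assms(3,4) ring_map_add[OF assms(1)] ring_map_add[OF assms(2)]
      ring_map_mult[OF assms(1)] ring_map_mult[OF assms(2)])

context
  fixes c :: "complex \<Rightarrow> 'a::comm_ring_1" and s :: "index \<Rightarrow> 'a"
  assumes c: "ring_map c"
begin

private definition ev :: "(index \<Rightarrow>\<^sub>0 nat) \<Rightarrow> 'a" where
  "ev m = (\<Prod>q\<in>Poly_Mapping.keys m. s q ^ Poly_Mapping.lookup m q)"

private lemma ev_superset: "finite A \<Longrightarrow> Poly_Mapping.keys m \<subseteq> A \<Longrightarrow>
    ev m = (\<Prod>q\<in>A. s q ^ Poly_Mapping.lookup m q)"
  unfolding ev_def by (rule prod.mono_neutral_left) (auto simp: in_keys_iff)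

private lemma ev_add: "ev (m + n) = ev m * ev n"
proof -
  let ?A = "Poly_Mapping.keys m \<union> Poly_Mapping.keys n"
  have "Poly_Mapping.keys (m + n) \<subseteq> ?A" by (rule keys_add)
  then show ?thesis by (simp add: ev_superset[where A = ?A] lookup_add power_add prod.distrib)
qed

private lemma hom_eq: "mpol_hom c s f = (\<Sum>m\<in>Poly_Mapping.keys f. c (Poly_Mapping.lookup f m) * ev m)"
  by (simp add: mpol_hom_def ev_def)

private lemma hom_add: "mpol_hom c s (f + g) = mpol_hom c s f + mpol_hom c s g"
  unfolding hom_eq
  by (rule keysum_add) (simp_all add: ring_map_simps[OF c] algebra_simps)

private lemma hom_single: "mpol_hom c s (Poly_Mapping.single m a) = c a * ev m"
  unfolding hom_eq
  by (rule keysum_single[of "\<lambda>m a. c a * ev m"]) (simp_all add: ring_map_simps[OF c])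

lemma mpol_hom_cst: "mpol_hom c s (cst a) = c a"
  unfolding cst_def hom_single by (simp add: ev_def)

lemma mpol_hom_var: "mpol_hom c s (var q) = s q"
  unfolding var_def hom_single by (simp add: ev_def ring_map_simps[OF c])

private lemma hom_mult_var: "mpol_hom c s (f * var q) = mpol_hom c s f * s q"
proof -
  have "mpol_hom c s ((\<Sum>m\<in>A. Poly_Mapping.single m (Poly_Mapping.lookup f m)) * var q) =
    mpol_hom c s (\<Sum>m\<in>A. Poly_Mapping.single m (Poly_Mapping.lookup f m)) * s q" for A
  proof (induction A rule: infinite_finite_induct)
    case (insert x F)
    have "ev (x + Poly_Mapping.single q 1) = ev x * s q"
      by (simp add: ev_add) (simp add: ev_def)
    with insert show ?case
      by (simp add: hom_add distrib_right hom_single) (simp add: var_def mult_single hom_single)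
  qed (use hom_single[of 0 0] in \<open>auto simp: ring_map_simps[OF c]\<close>)
  then show ?thesis using sum_single_keys by metis
qed

text \<open>Multiplicativity is known against a single variable; induction over one factor and, in
  the constant case, over the other one extends it to all products.\<close>

lemma ring_map_mpol_hom: "ring_map (mpol_hom c s)"
  unfolding ring_map_def
proof safe
  show "mpol_hom c s 1 = 1" using mpol_hom_cst[of 1] by (simp add: ring_map_simps[OF c])
  fix f g
  show "mpol_hom c s (f + g) = mpol_hom c s f + mpol_hom c s g" by (rule hom_add)
  show "mpol_hom c s (f * g) = mpol_hom c s f * mpol_hom c s g"
  proof (induction g rule: mpol_induct)
    case (cst a)
    show ?case
    proof (induction f rule: mpol_induct)
      case (var f q)
      have "f * var q * cst a = f * cst a * var q" by (simp add: mult_ac)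
      with var show ?case by (simp only: hom_mult_var) (simp add: mult_ac)
    qed (simp_all add: hom_add distrib_right flip: cst_mult, simp add: mpol_hom_cst ring_map_simps[OF c])
  qed (simp_all add: hom_add distrib_left hom_mult_var flip: mult.assoc)
qed

end

section \<open>Evaluation, translation and permutation of variables\<close>

lemma ring_map_eval: "ring_map (\<lambda>f. mpol_eval f v)"
  unfolding mpol_eval_def using ring_map_mpol_hom[OF ring_map_id] .
lemma ring_map_transl: "ring_map (transl v)"
  unfolding transl_def using ring_map_mpol_hom[OF ring_map_cst] .
lemma ring_map_perm: "ring_map (perm_pol \<sigma>)"
  unfolding perm_pol_def using ring_map_mpol_hom[OF ring_map_cst] .

lemma eval_cst [simp]: "mpol_eval (cst c) v = c" and eval_var [simp]: "mpol_eval (var q) v = v q"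
  unfolding mpol_eval_def by (simp_all add: mpol_hom_cst mpol_hom_var ring_map_id)
lemma transl_cst [simp]: "transl v (cst c) = cst c" and transl_var [simp]: "transl v (var q) = var q + cst (v q)"
  unfolding transl_def by (simp_all add: mpol_hom_cst mpol_hom_var ring_map_cst)
lemma perm_cst [simp]: "perm_pol \<sigma> (cst c) = cst c" and perm_var [simp]: "perm_pol \<sigma> (var q) = var (\<sigma> q)"
  unfolding perm_pol_def by (simp_all add: mpol_hom_cst mpol_hom_var ring_map_cst)

lemmas eval_simps [simp] = ring_map_simps[OF ring_map_eval]
lemmas transl_simps [simp] = ring_map_simps[OF ring_map_transl]
lemmas perm_simps [simp] = ring_map_simps[OF ring_map_perm]

lemma transl_transl: "transl u (transl v f) = transl (u + v) f"
  by (rule ring_map_eqI[OF ring_map_comp[OF ring_map_transl ring_map_transl] ring_map_transl])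
    (simp_all add: cst_add)

lemma transl_0 [simp]: "transl 0 f = f"
  by (rule ring_map_eqI[OF ring_map_transl ring_map_id]) simp_all

lemma eval_transl: "mpol_eval (transl u f) v = mpol_eval f (u + v)"
proof (induction f rule: mpol_induct)
  case (var f q)
  then show ?case by (simp add: add.commute)
qed simp_all

lemma perm_perm: "perm_pol \<sigma> (perm_pol \<tau> f) = perm_pol (\<sigma> \<circ> \<tau>) f"
  by (rule ring_map_eqI[OF ring_map_comp[OF ring_map_perm ring_map_perm] ring_map_perm]) simp_all

lemma perm_id [simp]: "perm_pol id f = f"
  by (rule ring_map_eqI[OF ring_map_perm ring_map_id]) simp_all

lemma perm_transl: "bij \<sigma> \<Longrightarrow> perm_pol \<sigma> (transl v f) = transl (perm_vec \<sigma> v) (perm_pol \<sigma> f)"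
  by (rule ring_map_eqI[OF ring_map_comp[OF ring_map_perm ring_map_transl]
        ring_map_comp[OF ring_map_transl ring_map_perm]])
    (simp_all add: perm_vec_def bij_is_inj)

lemma eval_perm: "bij \<sigma> \<Longrightarrow> mpol_eval (perm_pol \<sigma> f) (perm_vec \<sigma> v) = mpol_eval f v"
  by (induction f rule: mpol_induct) (simp_all add: perm_vec_def bij_is_inj)

section \<open>Homogeneous components and the order of vanishing at the origin\<close>

definition hcomp :: "nat \<Rightarrow> mpol \<Rightarrow> mpol" where
  "hcomp d f = (\<Sum>m\<in>Poly_Mapping.keys f. if edeg m = d then Poly_Mapping.single m (Poly_Mapping.lookup f m) else 0)"

lemma lookup_hcomp: "Poly_Mapping.lookup (hcomp d f) m = (if edeg m = d then Poly_Mapping.lookup f m else 0)"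
proof -
  have "Poly_Mapping.lookup (hcomp d f) m =
    (\<Sum>n\<in>Poly_Mapping.keys f. if n = m then (if edeg m = d then Poly_Mapping.lookup f m else 0) else 0)"
    unfolding hcomp_def lookup_sum
    by (rule sum.cong) (auto simp: lookup_single when_def)
  then show ?thesis by (auto simp: in_keys_iff)
qed

lemma hcomp_0 [simp]: "hcomp d 0 = 0" and hcomp_add [simp]: "hcomp d (f + g) = hcomp d f + hcomp d g"
  and hcomp_diff [simp]: "hcomp d (f - g) = hcomp d f - hcomp d g"
  by (rule poly_mapping_eqI; simp add: lookup_hcomp lookup_add lookup_minus)+

lemma hcomp_sum [simp]: "hcomp d (sum f A) = (\<Sum>x\<in>A. hcomp d (f x))"
  by (induction A rule: infinite_finite_induct) simp_all

lemma hcomp_hcomp: "hcomp d (hcomp e f) = (if d = e then hcomp d f else 0)"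
  by (rule poly_mapping_eqI) (simp add: lookup_hcomp)

lemma hcomp_single: "hcomp d (Poly_Mapping.single m c) = (if edeg m = d then Poly_Mapping.single m c else 0)"
  by (rule poly_mapping_eqI) (auto simp: lookup_hcomp lookup_single when_def)

lemma hcomp_cst: "hcomp d (cst c) = (if d = 0 then cst c else 0)"
  by (auto simp: cst_def hcomp_single)

lemma hcomp_zero_eq: "hcomp 0 f = cst (Poly_Mapping.lookup f 0)"
  by (rule poly_mapping_eqI) (auto simp: lookup_hcomp cst_def lookup_single when_def)

text \<open>The predicate \<open>ordge d\<close> describes the \<open>d\<close>-th power of the maximal ideal at the origin.\<close>

definition ordge :: "nat \<Rightarrow> mpol \<Rightarrow> bool" where
  "ordge d f \<longleftrightarrow> (\<forall>m\<in>Poly_Mapping.keys f. d \<le> edeg m)"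

lemma ordge_0 [simp]: "ordge d 0" and ordge_zero [simp]: "ordge 0 f"
  by (simp_all add: ordge_def)

lemma ordge_add: "ordge d f \<Longrightarrow> ordge d g \<Longrightarrow> ordge d (f + g)"
  using keys_add[of f g] by (auto simp: ordge_def)

lemma ordge_sum: "(\<And>x. x \<in> A \<Longrightarrow> ordge d (f x)) \<Longrightarrow> ordge d (sum f A)"
  by (induction A rule: infinite_finite_induct) (auto intro: ordge_add)

lemma ordge_uminus: "ordge d f \<Longrightarrow> ordge d (- f)"
  by (simp add: ordge_def)

lemma ordge_mult: "ordge d f \<Longrightarrow> ordge e g \<Longrightarrow> ordge (d + e) (f * g)"
  using keys_mult[of f g] by (force simp: ordge_def edeg_add intro: add_mono)

lemma ordge_mult_left: "ordge d f \<Longrightarrow> ordge d (g * f)" and ordge_mult_right: "ordge d f \<Longrightarrow> ordge d (f * g)"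
  using ordge_mult[of 0 g d f] ordge_mult[of d f 0 g] by simp_all

lemma ordge_power: "ordge d f \<Longrightarrow> ordge (n * d) (f ^ n)"
  by (induction n) (auto intro: ordge_mult)

lemma ordge_mono: "ordge d f \<Longrightarrow> e \<le> d \<Longrightarrow> ordge e f"
  by (auto simp: ordge_def)

lemma ordge_hcomp: "ordge d f \<Longrightarrow> e < d \<Longrightarrow> hcomp e f = 0"
  by (rule poly_mapping_eqI) (auto simp: lookup_hcomp ordge_def in_keys_iff dest: leD)

lemma lookup_zero_eq_eval: "Poly_Mapping.lookup f 0 = mpol_eval f 0"
proof (induction f rule: mpol_induct)
  case (var f q)
  have "ordge 1 (var q)" by (simp add: ordge_def var_def)
  then have "ordge 1 (f * var q)" by (rule ordge_mult_left)
  then have "Poly_Mapping.lookup (f * var q) 0 = 0"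
    unfolding ordge_def using edeg_0 by (metis in_keys_iff not_one_le_zero)
  then show ?case by simp
qed (simp_all add: lookup_add cst_def[symmetric], simp add: cst_def)

lemma ordge_1_iff: "ordge 1 f \<longleftrightarrow> mpol_eval f 0 = 0"
  unfolding ordge_def lookup_zero_eq_eval[symmetric] using edeg_eq_0_iff
  by (metis in_keys_iff less_one linorder_not_le)

definition homogeneous :: "nat \<Rightarrow> mpol \<Rightarrow> bool" where
  "homogeneous d f \<longleftrightarrow> hcomp d f = f"

lemma homogeneous_hcomp: "homogeneous d f \<Longrightarrow> hcomp e f = (if e = d then f else 0)"
  unfolding homogeneous_def by (metis hcomp_hcomp)

lemma hcomp_mult_hom:
  assumes "homogeneous e g"
  shows "hcomp (e + d) (g * f) = g * hcomp d f"
proof -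
  have keyg: "edeg m = e" if "m \<in> Poly_Mapping.keys g" for m
    using assms that by (metis homogeneous_def in_keys_iff lookup_hcomp)
  have *: "hcomp (e + d) (Poly_Mapping.single m a * Poly_Mapping.single n b) =
      Poly_Mapping.single m a * hcomp d (Poly_Mapping.single n b)" if "edeg m = e" for m n a b
    using that by (simp add: mult_single hcomp_single edeg_add)
  let ?G = "\<lambda>m. Poly_Mapping.single m (Poly_Mapping.lookup g m)"
    and ?F = "\<lambda>m. Poly_Mapping.single m (Poly_Mapping.lookup f m)"
  have "hcomp (e + d) (sum ?G (Poly_Mapping.keys g) * sum ?F (Poly_Mapping.keys f)) =
     (sum ?G (Poly_Mapping.keys g) * hcomp d (sum ?F (Poly_Mapping.keys f)))"
    by (simp add: sum_product keyg * )
  then show ?thesis by (simp add: sum_single_keys)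
qed

lemma hcomp_mult_lt:
  assumes "homogeneous e g" "d < e"
  shows "hcomp d (g * f) = 0"
proof -
  have "ordge e g" using assms(1) unfolding homogeneous_def ordge_def
    by (metis in_keys_iff lookup_hcomp order_refl)
  then show ?thesis using assms(2) ordge_mult_right ordge_hcomp by blast
qed

lemma homogeneous_mult: "homogeneous d f \<Longrightarrow> homogeneous e g \<Longrightarrow> homogeneous (d + e) (f * g)"
  by (simp add: homogeneous_def hcomp_mult_hom)

lemma homogeneous_prod:
  "finite A \<Longrightarrow> (\<And>x. x \<in> A \<Longrightarrow> homogeneous 1 (f x)) \<Longrightarrow> homogeneous (card A) (prod f A)"
proof (induction A rule: finite_induct)
  case empty
  then show ?case using hcomp_cst[of 0 1] by (simp add: homogeneous_def)
next
  case (insert x F)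
  then show ?case using homogeneous_mult[of 1 "f x" "card F" "prod f F"] by simp
qed

lemma homogeneous_var: "homogeneous 1 (var q)"
  by (simp add: homogeneous_def var_def hcomp_single)

lemma homogeneous_diff: "homogeneous d f \<Longrightarrow> homogeneous d g \<Longrightarrow> homogeneous d (f - g)"
  by (simp add: homogeneous_def)

text \<open>Substituting variables for variables preserves the degree, and this includes
  substitutions that are not bijective.\<close>

lemma perm_hcomp: "perm_pol \<sigma> (hcomp d f) = hcomp d (perm_pol \<sigma> f)"
proof (induction f arbitrary: d rule: mpol_induct)
  case (var f q)
  show ?case
  proof (cases d)
    case 0
    then show ?thesis
      using hcomp_mult_lt[OF homogeneous_var[of q], of 0 f] hcomp_mult_lt[OF homogeneous_var[of "\<sigma> q"], of 0 "perm_pol \<sigma> f"]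
      by (simp add: mult.commute)
  next
    case (Suc e)
    then show ?thesis
      using hcomp_mult_hom[OF homogeneous_var[of q], of e f]
        hcomp_mult_hom[OF homogeneous_var[of "\<sigma> q"], of e "perm_pol \<sigma> f"] var
      by (simp add: mult.commute)
  qed
qed (simp_all add: hcomp_cst)

definition tdeg :: "mpol \<Rightarrow> nat" where
  "tdeg f = (if f = 0 then 0 else Max (edeg ` Poly_Mapping.keys f))"

lemma edeg_le_tdeg: "m \<in> Poly_Mapping.keys f \<Longrightarrow> edeg m \<le> tdeg f"
  by (auto simp: tdeg_def)

lemma sum_hcomp: "tdeg f \<le> D \<Longrightarrow> (\<Sum>d\<le>D. hcomp d f) = f"
proof (rule poly_mapping_eqI)
  fix m assume D: "tdeg f \<le> D"
  show "Poly_Mapping.lookup (\<Sum>d\<le>D. hcomp d f) m = Poly_Mapping.lookup f m"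
  proof (cases "m \<in> Poly_Mapping.keys f")
    case True
    then have "edeg m \<le> D" using edeg_le_tdeg D le_trans by blast
    then show ?thesis by (simp add: lookup_sum lookup_hcomp)
  next
    case False
    then show ?thesis by (simp add: lookup_sum lookup_hcomp in_keys_iff)
  qed
qed

section \<open>Subrings of polynomials and units\<close>

lemma Lam_cst [simp]: "cst c \<in> Lam \<mu>"
  by (auto simp: Lam_def cst_def)

lemma Lam_0 [simp]: "0 \<in> Lam \<mu>" and Lam_1 [simp]: "1 \<in> Lam \<mu>"
  using Lam_cst[of 0] Lam_cst[of 1] by simp_all

lemma Lam_var: "q \<in> idx \<mu> \<Longrightarrow> var q \<in> Lam \<mu>"
  by (auto simp: Lam_def var_def)

lemma Lam_add: "f \<in> Lam \<mu> \<Longrightarrow> g \<in> Lam \<mu> \<Longrightarrow> f + g \<in> Lam \<mu>"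
  using keys_add[of f g] by (force simp: Lam_def)

lemma Lam_uminus: "f \<in> Lam \<mu> \<Longrightarrow> - f \<in> Lam \<mu>"
  by (auto simp: Lam_def)

lemma Lam_diff: "f \<in> Lam \<mu> \<Longrightarrow> g \<in> Lam \<mu> \<Longrightarrow> f - g \<in> Lam \<mu>"
  using Lam_add[of f \<mu> "- g"] Lam_uminus by simp

lemma Lam_mult: "f \<in> Lam \<mu> \<Longrightarrow> g \<in> Lam \<mu> \<Longrightarrow> f * g \<in> Lam \<mu>"
proof -
  assume fg: "f \<in> Lam \<mu>" "g \<in> Lam \<mu>"
  have "Poly_Mapping.keys m \<subseteq> idx \<mu>" if m: "m \<in> Poly_Mapping.keys (f * g)" for m
  proof -
    from m keys_mult[of f g] obtain a b where
      ab: "m = a + b" "a \<in> Poly_Mapping.keys f" "b \<in> Poly_Mapping.keys g" by blast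
    then show ?thesis using keys_add[of a b] fg unfolding Lam_def by blast
  qed
  then show ?thesis by (simp add: Lam_def)
qed

lemma Lam_sum: "(\<And>x. x \<in> A \<Longrightarrow> f x \<in> Lam \<mu>) \<Longrightarrow> sum f A \<in> Lam \<mu>"
  by (induction A rule: infinite_finite_induct) (auto intro: Lam_add)

lemma Lam_prod: "(\<And>x. x \<in> A \<Longrightarrow> f x \<in> Lam \<mu>) \<Longrightarrow> prod f A \<in> Lam \<mu>"
  by (induction A rule: infinite_finite_induct) (auto intro: Lam_mult)

lemma Lam_power: "f \<in> Lam \<mu> \<Longrightarrow> f ^ n \<in> Lam \<mu>"
  by (induction n) (auto intro: Lam_mult)

lemma mpmon_eq_prod: "mpmon m = (\<Prod>q\<in>Poly_Mapping.keys m. var q ^ Poly_Mapping.lookup m q)"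
proof (induction m rule: expo_induct)
  case (add q m)
  let ?n = "m + Poly_Mapping.single q 1"
  let ?A = "insert q (Poly_Mapping.keys m)"
  have "(\<Prod>p\<in>Poly_Mapping.keys ?n. var p ^ Poly_Mapping.lookup ?n p) = (\<Prod>p\<in>?A. var p ^ Poly_Mapping.lookup ?n p)"
    by (rule prod.mono_neutral_left) (auto simp: in_keys_iff lookup_add lookup_single when_def split: if_splits)
  also have "\<dots> = (\<Prod>p\<in>?A. var p ^ Poly_Mapping.lookup m p) * (\<Prod>p\<in>?A. if p = q then var q else 1)"
    by (simp only: prod.distrib[symmetric], rule prod.cong) (auto simp: lookup_add lookup_single when_def)
  also have "(\<Prod>p\<in>?A. var p ^ Poly_Mapping.lookup m p) = mpmon m"
    unfolding add by (rule prod.mono_neutral_right) (auto simp: in_keys_iff)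
  finally show ?case by (simp add: mpmon_add mpmon_single del: One_nat_def)
qed simp

lemma Lam_mpmon: "Poly_Mapping.keys m \<subseteq> idx \<mu> \<Longrightarrow> mpmon m \<in> Lam \<mu>"
  by (auto simp: Lam_def mpmon_def)

lemma Lam_ring_map:
  assumes \<phi>: "ring_map \<phi>" and c: "\<And>c. \<phi> (cst c) \<in> Lam \<nu>" and v: "\<And>q. q \<in> idx \<mu> \<Longrightarrow> \<phi> (var q) \<in> Lam \<nu>"
    and f: "f \<in> Lam \<mu>"
  shows "\<phi> f \<in> Lam \<nu>"
proof -
  have "\<phi> (mpmon m) \<in> Lam \<nu>" if "Poly_Mapping.keys m \<subseteq> idx \<mu>" for m
    using that v by (auto simp: mpmon_eq_prod ring_map_simps[OF \<phi>] intro!: Lam_prod Lam_power)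
  moreover have "\<forall>m\<in>Poly_Mapping.keys f. Poly_Mapping.keys m \<subseteq> idx \<mu>"
    using f by (simp add: Lam_def)
  ultimately have "(\<Sum>m\<in>Poly_Mapping.keys f. \<phi> (cst (Poly_Mapping.lookup f m)) * \<phi> (mpmon m)) \<in> Lam \<nu>"
    using c by (intro Lam_sum Lam_mult) auto
  then show ?thesis
    using mpol_expand[of f] by (metis (no_types, lifting) ring_map_mult[OF \<phi>] ring_map_sum[OF \<phi>] sum.cong)
qed

lemma Lam_transl: "f \<in> Lam \<mu> \<Longrightarrow> transl v f \<in> Lam \<mu>"
  by (rule Lam_ring_map[OF ring_map_transl]) (auto intro: Lam_add Lam_var)

lemma Lam_perm: "f \<in> Lam \<mu> \<Longrightarrow> (\<And>q. q \<in> idx \<mu> \<Longrightarrow> \<sigma> q \<in> idx \<mu>) \<Longrightarrow> perm_pol \<sigma> f \<in> Lam \<mu>"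
  by (rule Lam_ring_map[OF ring_map_perm]) (auto intro: Lam_var)

lemma finite_idx: "finite (idx \<mu>)"
proof (rule finite_subset)
  show "idx \<mu> \<subseteq> (SIGMA k:{..length \<mu>}. {..msize \<mu> k})"
    by (auto simp: idx_def)
qed auto

text \<open>A polynomial that does not vanish at the origin is invertible modulo every power of the
  maximal ideal: truncate the geometric series.\<close>

lemma truncated_inverse:
  assumes d: "d \<in> Lam \<mu>" and d0: "mpol_eval d 0 \<noteq> 0"
  obtains d' where "d' \<in> Lam \<mu>" "ordge M (d' * d - 1)"
proof -
  define a where "a = mpol_eval d 0"
  define n where "n = 1 - cst (1 / a) * d"
  have n: "n \<in> Lam \<mu>" "ordge 1 n"
    using d d0 unfolding ordge_1_iff by (auto simp: n_def a_def intro!: Lam_diff Lam_mult)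
  define d' where "d' = cst (1 / a) * (\<Sum>k<M. n ^ k)"
  have "d' * d - 1 = (1 - n) * (\<Sum>k<M. n ^ k) - 1"
    by (simp add: d'_def n_def mult_ac)
  also have "\<dots> = - (n ^ M)"
    unfolding one_diff_power_eq[of n M, symmetric] by simp
  finally have eq: "d' * d - 1 = - (n ^ M)" .
  have "ordge M (d' * d - 1)"
    unfolding eq using ordge_power[OF n(2), of M] by (simp add: ordge_uminus)
  moreover have "d' \<in> Lam \<mu>" unfolding d'_def using n by (auto intro!: Lam_mult Lam_sum Lam_power)
  ultimately show ?thesis using that by blast
qed

section \<open>Divided differences\<close>

abbreviation swap :: "index \<Rightarrow> index \<Rightarrow> index \<Rightarrow> index" where
  "swap \<equiv> Transposition.transpose"

lemma var_eq_iff [simp]: "var p = var q \<longleftrightarrow> p = q"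
  unfolding var_def by (metis One_nat_def keys_single singleton_insert_inj_eq' zero_neq_one)

text \<open>Roots are stored as polynomials, so the ordered pair has to be recovered from the
  polynomial. At the unit vector of \<open>p\<close> the left-hand side is 1, while a difference of
  variables takes the value 1 there only if its first index is \<open>p\<close>.\<close>

lemma var_diff_eq_iff:
  assumes "p \<noteq> q"
  shows "var p - var q = var a - var b \<longleftrightarrow> p = a \<and> q = b"
proof
  assume eq: "var p - var q = var a - var b"
  have "p = a"
  proof (rule ccontr)
    assume "p \<noteq> a"
    have "mpol_eval (var p - var q) (unit_vec p) = mpol_eval (var a - var b) (unit_vec p)" using eq by simp
    with \<open>p \<noteq> a\<close> assms show False by (auto simp: unit_vec_def split: if_splits)
  qed
  with eq show "p = a \<and> q = b" by simp
qed auto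

lemma root_nonzero [simp]: "p \<noteq> q \<Longrightarrow> var p - var q \<noteq> 0"
  by simp

text \<open>Two substitutions that agree on the variables modulo \<open>d\<close> agree modulo
  \<open>d\<close> on every polynomial.\<close>

lemma perm_diff_dvd:
  assumes "\<And>r. d dvd var (\<sigma> r) - var (\<tau> r)"
  shows "d dvd perm_pol \<sigma> f - perm_pol \<tau> f"
proof (induction f rule: mpol_induct)
  case (add f g)
  have "perm_pol \<sigma> (f + g) - perm_pol \<tau> (f + g) = (perm_pol \<sigma> f - perm_pol \<tau> f) + (perm_pol \<sigma> g - perm_pol \<tau> g)"
    by simp
  with add show ?case by (metis dvd_add)
next
  case (var f q)
  have "perm_pol \<sigma> (f * var q) - perm_pol \<tau> (f * var q) =
      (perm_pol \<sigma> f - perm_pol \<tau> f) * var (\<sigma> q) + perm_pol \<tau> f * (var (\<sigma> q) - var (\<tau> q))"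
    by (simp add: algebra_simps)
  with var assms show ?case by (metis dvd_add dvd_mult dvd_mult2)
qed simp

lemma swap_diff_dvd: "var p - var q dvd f - perm_pol (swap p q) f"
proof -
  have "var p - var q dvd perm_pol id f - perm_pol (swap p q) f"
  proof (rule perm_diff_dvd)
    fix r show "var p - var q dvd var (id r) - var (swap p q r)"
      using dvd_minus_iff[of "var p - var q" "var p - var q"]
      by (cases "r = p"; cases "r = q") auto
  qed
  then show ?thesis by simp
qed

text \<open>The quotient is unique because the ring is an integral domain. This turns every identity
  for \<open>nabla\<close> into one that is checked after multiplication by the root.\<close>

lemma nabla_unique:
  assumes "p \<noteq> q" "(var p - var q) * g = f - perm_pol (swap p q) f"
  shows "nabla p q f = g"
  unfolding nabla_def
proof (rule the_equality, fact)
  fix h assume "(var p - var q) * h = f - perm_pol (swap p q) f"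
  then have "(var p - var q) * h = (var p - var q) * g" using assms(2) by simp
  with root_nonzero[OF assms(1)] show "h = g" using mult_left_cancel by blast
qed

lemma nabla_mult_root: "p \<noteq> q \<Longrightarrow> (var p - var q) * nabla p q f = f - perm_pol (swap p q) f"
  using swap_diff_dvd[of p q f] nabla_unique[of p q _ f] by (metis dvd_def)

lemma swap_swap [simp]: "perm_pol (swap p q) (perm_pol (swap p q) f) = f"
  by (simp add: perm_perm)

lemma nabla_add: "p \<noteq> q \<Longrightarrow> nabla p q (f + g) = nabla p q f + nabla p q g"
  by (rule nabla_unique) (simp_all add: distrib_left nabla_mult_root)

lemma nabla_leibniz: "p \<noteq> q \<Longrightarrow> nabla p q (f * g) = nabla p q f * g + perm_pol (swap p q) f * nabla p q g"
proof (rule nabla_unique)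
  assume pq: "p \<noteq> q"
  have "(var p - var q) * (nabla p q f * g + perm_pol (swap p q) f * nabla p q g) =
    ((var p - var q) * nabla p q f) * g + perm_pol (swap p q) f * ((var p - var q) * nabla p q g)"
    by (simp add: distrib_left mult_ac)
  also have "\<dots> = f * g - perm_pol (swap p q) (f * g)"
    unfolding nabla_mult_root[OF pq] by (simp add: algebra_simps)
  finally show "(var p - var q) * (nabla p q f * g + perm_pol (swap p q) f * nabla p q g) = \<dots>" .
qed

lemma nabla_invariant: "p \<noteq> q \<Longrightarrow> perm_pol (swap p q) f = f \<Longrightarrow> nabla p q f = 0"
  by (rule nabla_unique) simp_all

lemma nabla_mult_invariant:
  "p \<noteq> q \<Longrightarrow> perm_pol (swap p q) g = g \<Longrightarrow> nabla p q (g * f) = g * nabla p q f"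
  by (simp add: nabla_leibniz nabla_invariant)

lemma nabla_cst_mult: "p \<noteq> q \<Longrightarrow> nabla p q (cst c * f) = cst c * nabla p q f"
  by (rule nabla_mult_invariant) simp_all

lemma nabla_0 [simp]: "p \<noteq> q \<Longrightarrow> nabla p q 0 = 0"
  by (rule nabla_invariant) simp_all

lemma swap_nabla: "p \<noteq> q \<Longrightarrow> perm_pol (swap p q) (nabla p q f) = nabla p q f"
proof -
  assume pq: "p \<noteq> q"
  have "perm_pol (swap p q) ((var p - var q) * nabla p q f) = perm_pol (swap p q) f - f"
    unfolding nabla_mult_root[OF pq] by simp
  then have "- ((var p - var q) * perm_pol (swap p q) (nabla p q f)) = - (f - perm_pol (swap p q) f)"
    by (simp only: perm_simps perm_var transpose_apply_first transpose_apply_second) (simp add: algebra_simps)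
  then have "(var p - var q) * perm_pol (swap p q) (nabla p q f) = f - perm_pol (swap p q) f"
    by (rule neg_equal_iff_equal[THEN iffD1])
  from nabla_unique[OF pq this] show ?thesis by simp
qed

lemma nabla_nabla: "p \<noteq> q \<Longrightarrow> nabla p q (nabla p q f) = 0"
  by (simp add: nabla_invariant swap_nabla)

lemma nabla_flip: "p \<noteq> q \<Longrightarrow> nabla q p f = - nabla p q f"
proof (rule nabla_unique)
  assume pq: "p \<noteq> q"
  show "(var q - var p) * - nabla p q f = f - perm_pol (swap q p) f"
    using nabla_mult_root[OF pq, of f] by (simp add: transpose_commute algebra_simps)
qed auto

lemma perm_nabla:
  assumes "bij \<sigma>" "p \<noteq> q"
  shows "perm_pol \<sigma> (nabla p q f) = nabla (\<sigma> p) (\<sigma> q) (perm_pol \<sigma> f)"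
proof (rule sym, rule nabla_unique)
  show "\<sigma> p \<noteq> \<sigma> q" using assms by (metis bij_is_inj injD)
  have "swap (\<sigma> p) (\<sigma> q) \<circ> \<sigma> = \<sigma> \<circ> swap p q"
    using assms by (auto simp: fun_eq_iff Transposition.transpose_def bij_is_inj inj_eq)
  then have "perm_pol (swap (\<sigma> p) (\<sigma> q)) (perm_pol \<sigma> f) = perm_pol \<sigma> (perm_pol (swap p q) f)"
    by (simp add: perm_perm)
  moreover have "perm_pol \<sigma> ((var p - var q) * nabla p q f) = perm_pol \<sigma> (f - perm_pol (swap p q) f)"
    unfolding nabla_mult_root[OF assms(2)] ..
  ultimately show "(var (\<sigma> p) - var (\<sigma> q)) * perm_pol \<sigma> (nabla p q f) =
      perm_pol \<sigma> f - perm_pol (swap (\<sigma> p) (\<sigma> q)) (perm_pol \<sigma> f)"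
    by simp
qed

lemma nabla_commute:
  assumes "a \<noteq> b" "p \<noteq> q" "a \<notin> {p, q}" "b \<notin> {p, q}"
  shows "nabla a b (nabla p q f) = nabla p q (nabla a b f)"
proof (rule nabla_unique[OF assms(1)])
  have fix_ab: "perm_pol (swap p q) (var a - var b) = var a - var b"
    using assms by (simp add: Transposition.transpose_def)
  have "(var a - var b) * nabla p q (nabla a b f) = nabla p q ((var a - var b) * nabla a b f)"
    using assms fix_ab by (simp add: nabla_mult_invariant)
  also have "\<dots> = nabla p q f - nabla p q (perm_pol (swap a b) f)"
    using assms(2) nabla_add[of p q "f - perm_pol (swap a b) f" "perm_pol (swap a b) f"]
    by (simp add: nabla_mult_root[OF assms(1)])
  also have "nabla p q (perm_pol (swap a b) f) = perm_pol (swap a b) (nabla p q f)"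
    using perm_nabla[of "swap a b" p q f] assms by auto
  finally show "(var a - var b) * nabla p q (nabla a b f) = nabla p q f - perm_pol (swap a b) (nabla p q f)" .
qed

text \<open>Multiplied by the three positive roots of the rank two system, a threefold divided
  difference becomes the alternating sum over the six permutations of \<open>a\<close>,
  \<open>b\<close>, \<open>c\<close>.\<close>

lemma nabla_triple:
  assumes "a \<noteq> b" "b \<noteq> c" "a \<noteq> c"
  defines "s \<equiv> perm_pol (swap a b)" and "t \<equiv> perm_pol (swap b c)"
  shows "(var a - var b) * (var b - var c) * (var a - var c) * nabla a b (nabla b c (nabla a b f)) =
    f - s f - t f + s (t f) + t (s f) - s (t (s f))"
proof -
  define \<alpha> \<beta> \<gamma> where "\<alpha> = var a - var b" and "\<beta> = var b - var c" and "\<gamma> = var a - var c"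
  define g h k where "g = nabla a b f" and "h = nabla b c g" and "k = nabla a b h"
  have g: "\<alpha> * g = f - s f" and h: "\<beta> * h = g - t g" and k: "\<alpha> * k = h - s h"
    using assms by (simp_all add: g_def h_def k_def \<alpha>_def \<beta>_def nabla_mult_root)
  have sg: "s g = g" using assms by (simp add: g_def s_def swap_nabla)
  have roots: "s \<beta> = \<gamma>" "t \<alpha> = \<gamma>" "s \<gamma> = \<beta>"
    using assms by (simp_all add: \<alpha>_def \<beta>_def \<gamma>_def s_def t_def Transposition.transpose_def)
  have hom: "s (x * y) = s x * s y" "s (x - y) = s x - s y" "t (x * y) = t x * t y" "t (x - y) = t x - t y" for x y
    by (simp_all add: s_def t_def)
  have sh: "\<gamma> * s h = g - s (t g)" using arg_cong[OF h, of s] by (simp add: hom roots sg)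
  have tg: "\<gamma> * t g = t f - t (s f)" using arg_cong[OF g, of t] by (simp add: hom roots)
  have stg: "\<beta> * s (t g) = s (t f) - s (t (s f))" using arg_cong[OF tg, of s] by (simp add: hom roots)
  have "\<alpha> * \<beta> * \<gamma> * k = \<beta> * \<gamma> * (\<alpha> * k)" by (simp only: mult_ac)
  also have "\<dots> = \<gamma> * (\<beta> * h) - \<beta> * (\<gamma> * s h)"
    unfolding k by (simp only: right_diff_distrib mult_ac)
  also have "\<dots> = (\<gamma> - \<beta>) * g - \<gamma> * t g + \<beta> * s (t g)"
    unfolding h sh by (simp add: algebra_simps)
  also have "\<gamma> - \<beta> = \<alpha>" by (simp add: \<alpha>_def \<beta>_def \<gamma>_def)
  finally have "\<alpha> * \<beta> * \<gamma> * k = f - s f - t f + s (t f) + t (s f) - s (t (s f))"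
    unfolding g tg stg by (simp add: algebra_simps)
  then show ?thesis by (simp only: \<alpha>_def \<beta>_def \<gamma>_def k_def h_def g_def)
qed

text \<open>Exchanging \<open>a\<close> and \<open>c\<close> in \<open>nabla_triple\<close> reverses
  three roots and three operators, so the two signs cancel. The alternating sum on the right stays
  the same because the transpositions themselves satisfy the braid relation.\<close>

lemma nabla_braid:
  assumes "a \<noteq> b" "b \<noteq> c" "a \<noteq> c"
  shows "nabla a b (nabla b c (nabla a b f)) = nabla b c (nabla a b (nabla b c f))"
proof -
  let ?d = "(var a - var b) * (var b - var c) * (var a - var c)"
  let ?s = "perm_pol (swap a b)" and ?t = "perm_pol (swap b c)"
  have "swap a b \<circ> (swap b c \<circ> swap a b) = swap b c \<circ> (swap a b \<circ> swap b c)"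
    using assms by (auto simp: fun_eq_iff Transposition.transpose_def)
  then have sts: "?s (?t (?s f)) = ?t (?s (?t f))" by (simp add: perm_perm)
  have flip: "nabla c b (nabla b a (nabla c b f)) = - nabla b c (nabla a b (nabla b c f))"
  proof -
    have neg: "nabla p q (- g) = - nabla p q g" if "p \<noteq> q" for p q g
      using nabla_cst_mult[OF that, of "-1" g] by (simp add: cst_uminus)
    show ?thesis using assms by (simp add: nabla_flip[of a b] nabla_flip[of b c] neg)
  qed
  have "(var c - var b) * (var b - var a) * (var c - var a) = - ?d"
    by (simp add: algebra_simps)
  then have "?d * nabla b c (nabla a b (nabla b c f)) = f - ?t f - ?s f + ?t (?s f) + ?s (?t f) - ?t (?s (?t f))"
    using nabla_triple[of c b a f] assms unfolding flip transpose_commute[of c b] transpose_commute[of b a]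
    by (simp only: minus_mult_minus)
  moreover have "?d * nabla a b (nabla b c (nabla a b f)) = f - ?s f - ?t f + ?s (?t f) + ?t (?s f) - ?s (?t (?s f))"
    using nabla_triple[of a b c f] assms by simp
  ultimately have "?d * nabla a b (nabla b c (nabla a b f)) = ?d * nabla b c (nabla a b (nabla b c f))"
    unfolding sts by simp
  then show ?thesis using assms by simp
qed

lemma hcomp_nabla:
  assumes "p \<noteq> q"
  shows "hcomp d (nabla p q f) = nabla p q (hcomp (Suc d) f)"
proof (rule sym, rule nabla_unique[OF assms])
  have "homogeneous 1 (var p - var q)"
    using homogeneous_var homogeneous_diff by blast
  from hcomp_mult_hom[OF this, of d "nabla p q f"]
  show "(var p - var q) * hcomp d (nabla p q f) = hcomp (Suc d) f - perm_pol (swap p q) (hcomp (Suc d) f)"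
    using assms by (simp add: nabla_mult_root perm_hcomp)
qed

text \<open>The retraction onto the subring \<open>Lam \<mu>\<close> that sets all other variables
  to 0. Applied to the equation defining a divided difference it shows, by uniqueness of the
  quotient, that the quotient already lies in the subring.\<close>

definition restrict_vars :: "nat list \<Rightarrow> mpol \<Rightarrow> mpol" where
  "restrict_vars \<mu> = mpol_hom cst (\<lambda>q. if q \<in> idx \<mu> then var q else 0)"

lemma ring_map_restrict: "ring_map (restrict_vars \<mu>)"
  unfolding restrict_vars_def by (rule ring_map_mpol_hom[OF ring_map_cst])

lemma restrict_cst: "restrict_vars \<mu> (cst c) = cst c"
  and restrict_var: "restrict_vars \<mu> (var q) = (if q \<in> idx \<mu> then var q else 0)"
  unfolding restrict_vars_def by (simp_all add: mpol_hom_cst mpol_hom_var ring_map_cst)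

lemma restrict_in_Lam: "restrict_vars \<mu> f \<in> Lam \<mu>"
  by (induction f rule: mpol_induct)
    (auto simp: ring_map_simps[OF ring_map_restrict] restrict_cst restrict_var intro: Lam_add Lam_mult Lam_var)

lemma restrict_Lam: "f \<in> Lam \<mu> \<Longrightarrow> restrict_vars \<mu> f = f"
proof -
  assume f: "f \<in> Lam \<mu>"
  have "restrict_vars \<mu> (mpmon m) = mpmon m" if "m \<in> Poly_Mapping.keys f" for m
  proof -
    have "Poly_Mapping.keys m \<subseteq> idx \<mu>" using f that by (simp add: Lam_def)
    then show ?thesis
      unfolding mpmon_eq_prod ring_map_simps[OF ring_map_restrict] restrict_var
      by (intro prod.cong) auto
  qed
  then have "restrict_vars \<mu> (\<Sum>m\<in>Poly_Mapping.keys f. cst (Poly_Mapping.lookup f m) * mpmon m) =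
      (\<Sum>m\<in>Poly_Mapping.keys f. cst (Poly_Mapping.lookup f m) * mpmon m)"
    by (simp add: ring_map_simps[OF ring_map_restrict] restrict_cst)
  then show ?thesis by (simp flip: mpol_expand)
qed

lemma Lam_nabla:
  assumes pq: "p \<noteq> q" "p \<in> idx \<mu>" "q \<in> idx \<mu>" and f: "f \<in> Lam \<mu>"
  shows "nabla p q f \<in> Lam \<mu>"
proof -
  have "restrict_vars \<mu> ((var p - var q) * nabla p q f) = f - perm_pol (swap p q) f"
    unfolding nabla_mult_root[OF pq(1)]
    by (rule restrict_Lam) (use pq f in \<open>auto intro!: Lam_diff Lam_perm simp: Transposition.transpose_def\<close>)
  then have "(var p - var q) * restrict_vars \<mu> (nabla p q f) = f - perm_pol (swap p q) f"
    using pq by (simp add: ring_map_simps[OF ring_map_restrict] restrict_var)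
  then have "nabla p q f = restrict_vars \<mu> (nabla p q f)" by (rule nabla_unique[OF pq(1)])
  then show ?thesis using restrict_in_Lam by metis
qed

text \<open>Being divisible by \<open>var p - var q\<close> means vanishing after the substitution of
  \<open>var p\<close> for \<open>var q\<close>; in particular these linear forms are prime.\<close>

lemma root_dvd_iff:
  "var p - var q dvd f \<longleftrightarrow> perm_pol (\<lambda>r. if r = q then p else r) f = 0"
proof
  assume "var p - var q dvd f"
  then show "perm_pol (\<lambda>r. if r = q then p else r) f = 0" by (auto simp: dvd_def)
next
  assume 0: "perm_pol (\<lambda>r. if r = q then p else r) f = 0"
  have "var p - var q dvd perm_pol (\<lambda>r. if r = q then p else r) f - perm_pol id f"
    by (rule perm_diff_dvd) auto
  with 0 show "var p - var q dvd f" by simp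
qed

text \<open>Distinct roots with ordered indices are pairwise coprime primes: the substitution that
  kills the new root keeps the product of the old ones nonzero, so the new root must divide the
  cofactor.\<close>

lemma prod_roots_dvd:
  assumes "finite R" "\<And>p q. (p, q) \<in> R \<Longrightarrow> p < q \<and> var p - var q dvd f"
  shows "(\<Prod>(p, q)\<in>R. var p - var q) dvd f"
  using assms
proof (induction R rule: finite_induct)
  case (insert x R)
  obtain p q where x: "x = (p, q)" by (cases x)
  have pq: "p < q" "var p - var q dvd f" using insert.prems x by auto
  from insert obtain g where g: "f = (\<Prod>(p, q)\<in>R. var p - var q) * g" by (auto simp: dvd_def)
  let ?\<rho> = "perm_pol (\<lambda>r. if r = q then p else r)"
  have "?\<rho> (\<Prod>(p, q)\<in>R. var p - var q) \<noteq> 0"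
  proof -
    \<comment> \<open>The requirement \<open>a < b\<close> excludes the pair \<open>(q, p)\<close>,
      whose root is also killed by the substitution.\<close>
    have "(if a = q then p else a) \<noteq> (if b = q then p else b)" if "(a, b) \<in> R" for a b
      using insert.prems[of a b] insert.hyps(2) that x pq by auto
    then show ?thesis using insert.hyps(1) by (auto simp: split_beta)
  qed
  moreover have "?\<rho> f = 0" using pq root_dvd_iff by blast
  ultimately have "?\<rho> g = 0" unfolding g by simp
  then have "var p - var q dvd g" using root_dvd_iff by blast
  then show ?case unfolding g x using insert.hyps x by (simp add: mult_dvd_mono mult.commute)
qed simp

text \<open>The plain notation for inverses is taken by the group theory of HOL-Algebra.\<close>

abbreviation invf :: "(index \<Rightarrow> index) \<Rightarrow> index \<Rightarrow> index" where
  "invf \<equiv> inv_into UNIV"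

declare split_paired_All [simp del] split_paired_Ex [simp del]

section \<open>Words in adjacent transpositions\<close>

definition nabla_word :: "(index \<times> index) list \<Rightarrow> mpol \<Rightarrow> mpol" where
  "nabla_word ws f = foldr (\<lambda>(p, q). nabla p q) ws f"

lemma nabla_word_Nil [simp]: "nabla_word [] f = f"
  and nabla_word_Cons [simp]: "nabla_word ((p, q) # ws) f = nabla p q (nabla_word ws f)"
  and nabla_word_append: "nabla_word (us @ ws) f = nabla_word us (nabla_word ws f)"
  by (simp_all add: nabla_word_def)

lemma word_prod_Nil [simp]: "word_prod [] = id"
  and word_prod_Cons [simp]: "word_prod ((p, q) # ws) = swap p q \<circ> word_prod ws"
  by (simp_all add: word_prod_def)

lemma word_prod_append: "word_prod (us @ ws) = word_prod us \<circ> word_prod ws"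
  by (induction us) (auto simp: o_assoc)

text \<open>\<open>rel\<close> is the partition of the indices into the orbits of a standard parabolic subgroup of
  a product of symmetric groups: every class is an interval of consecutive indices of one block.\<close>

locale young =
  fixes rel :: "index \<Rightarrow> index \<Rightarrow> bool"
  assumes rel_refl: "rel p p" and rel_sym: "rel p q \<Longrightarrow> rel q p"
    and rel_trans: "rel p q \<Longrightarrow> rel q r \<Longrightarrow> rel p r"
    and rel_fst: "rel p q \<Longrightarrow> fst p = fst q"
    and rel_convex: "rel (k, i) (k, j) \<Longrightarrow> i \<le> l \<Longrightarrow> l \<le> j \<Longrightarrow> rel (k, i) (k, l)"
    and rel_finite: "finite {p. \<exists>q. q \<noteq> p \<and> rel p q}"
begin

definition roots :: "mpol set" where
  "roots = {var p - var q | p q. p \<noteq> q \<and> rel p q}"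

definition simple_roots :: "mpol set" where
  "simple_roots = {var (k, i) - var (k, Suc i) | k i. rel (k, i) (k, Suc i)}"

lemma root_memI: "p \<noteq> q \<Longrightarrow> rel p q \<Longrightarrow> var p - var q \<in> roots"
  unfolding roots_def by blast

lemma rootE:
  assumes "\<alpha> \<in> roots"
  obtains p q where "\<alpha> = var p - var q" "p \<noteq> q" "rel p q"
  using assms unfolding roots_def by blast

lemma simple_rootE:
  assumes "\<alpha> \<in> simple_roots"
  obtains k i where "\<alpha> = var (k, i) - var (k, Suc i)" "rel (k, i) (k, Suc i)"
  using assms unfolding simple_roots_def by blast

lemma zero_notin: "0 \<notin> roots" "0 \<notin> simple_roots"
proof -
  show "0 \<notin> roots"
  proof
    assume "0 \<in> roots"
    then show False by (rule rootE) (metis root_nonzero)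
  qed
  show "0 \<notin> simple_roots"
  proof
    assume "0 \<in> simple_roots"
    then show False by (rule simple_rootE) (metis root_nonzero Pair_inject n_not_Suc_n)
  qed
qed

lemma root_neq: "var p - var q \<in> roots \<Longrightarrow> p \<noteq> q" "var p - var q \<in> simple_roots \<Longrightarrow> p \<noteq> q"
  using zero_notin by auto

lemma root_iff: "var p - var q \<in> roots \<longleftrightarrow> p \<noteq> q \<and> rel p q"
proof
  assume a: "var p - var q \<in> roots"
  then obtain p' q' where pq': "var p - var q = var p' - var q'" "p' \<noteq> q'" "rel p' q'" by (rule rootE)
  note pq = root_neq(1)[OF a]
  have "p = p' \<and> q = q'" using pq'(1) unfolding var_diff_eq_iff[OF pq] .
  with pq pq' show "p \<noteq> q \<and> rel p q" by simp
next
  assume "p \<noteq> q \<and> rel p q"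
  then show "var p - var q \<in> roots" using root_memI by simp
qed

definition adj :: "index \<Rightarrow> index \<Rightarrow> bool" where
  "adj p q \<longleftrightarrow> rel p q \<and> q = (fst p, Suc (snd p))"

lemma adj_neq: "adj p q \<Longrightarrow> p \<noteq> q" by (cases p) (auto simp: adj_def)

lemma simple_root_iff: "var p - var q \<in> simple_roots \<longleftrightarrow> adj p q"
proof
  assume a: "var p - var q \<in> simple_roots"
  then obtain k i where ki: "var p - var q = var (k, i) - var (k, Suc i)" "rel (k, i) (k, Suc i)"
    by (rule simple_rootE)
  have "p = (k, i) \<and> q = (k, Suc i)"
    using ki(1) unfolding var_diff_eq_iff[OF root_neq(2)[OF a]] .
  with ki(2) show "adj p q" by (simp add: adj_def)
next
  assume "adj p q"
  then show "var p - var q \<in> simple_roots"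
    by (cases p) (auto simp: adj_def simple_roots_def)
qed

lemma adj_rel: "adj p q \<Longrightarrow> rel p q" unfolding adj_def by blast
lemma adj_less: "adj p q \<Longrightarrow> p < q" by (cases p) (simp add: adj_def)

lemma simple_subset: "simple_roots \<subseteq> roots"
  unfolding simple_roots_def using root_iff by auto

definition words :: "(index \<times> index) list set" where
  "words = root_words simple_roots"

lemma words_iff: "ws \<in> words \<longleftrightarrow> (\<forall>(p, q)\<in>set ws. adj p q)"
  by (auto simp: words_def root_words_def simple_root_iff)

lemma words_Nil [simp]: "[] \<in> words"
  and words_Cons [simp]: "(p, q) # ws \<in> words \<longleftrightarrow> adj p q \<and> ws \<in> words"
  and words_append [simp]: "us @ ws \<in> words \<longleftrightarrow> us \<in> words \<and> ws \<in> words"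
  and words_rev [simp]: "rev ws \<in> words \<longleftrightarrow> ws \<in> words"
  by (auto simp: words_iff)

text \<open>The group is described as all bijections that preserve the classes, which makes closure
  under composition and finiteness immediate. That it is the reflection group is
  \<open>weyl_eq\<close>.\<close>

definition W :: "(index \<Rightarrow> index) set" where
  "W = {\<sigma>. bij \<sigma> \<and> (\<forall>p. rel p (\<sigma> p))}"

lemma W_id [simp]: "id \<in> W" by (simp add: W_def rel_refl)

lemma W_comp: "\<sigma> \<in> W \<Longrightarrow> \<tau> \<in> W \<Longrightarrow> \<sigma> \<circ> \<tau> \<in> W"
  unfolding W_def using rel_trans by (simp add: bij_comp) blast

lemma W_inv: "\<sigma> \<in> W \<Longrightarrow> invf \<sigma> \<in> W"
proof -
  assume \<sigma>: "\<sigma> \<in> W"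
  then have b: "bij \<sigma>" by (simp add: W_def)
  have "rel p (invf \<sigma> p)" for p
  proof -
    have "rel (invf \<sigma> p) (\<sigma> (invf \<sigma> p))" using \<sigma> by (simp add: W_def)
    then show ?thesis using b rel_sym by (simp add: bij_is_surj surj_f_inv_f)
  qed
  with b show ?thesis by (simp add: W_def bij_imp_bij_inv)
qed

lemma W_swap: "rel p q \<Longrightarrow> swap p q \<in> W"
  unfolding W_def by (auto simp: Transposition.transpose_def rel_refl rel_sym)

lemma W_rel: "\<sigma> \<in> W \<Longrightarrow> rel p (\<sigma> p)" and W_bij: "\<sigma> \<in> W \<Longrightarrow> bij \<sigma>"
  by (auto simp: W_def)

lemma W_rel_iff: "\<sigma> \<in> W \<Longrightarrow> rel (\<sigma> p) (\<sigma> q) \<longleftrightarrow> rel p q"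
  using W_rel rel_sym rel_trans by blast

lemma W_eq_iff [simp]: "\<sigma> \<in> W \<Longrightarrow> \<sigma> p = \<sigma> q \<longleftrightarrow> p = q"
  using W_bij by (metis bij_is_inj inj_eq)

lemma W_inv_simps [simp]: "\<sigma> \<in> W \<Longrightarrow> invf \<sigma> (\<sigma> p) = p" "\<sigma> \<in> W \<Longrightarrow> \<sigma> (invf \<sigma> p) = p"
  using W_bij by (auto simp: bij_is_inj bij_is_surj surj_f_inv_f)

lemma W_comp_inv [simp]: "\<sigma> \<in> W \<Longrightarrow> \<sigma> \<circ> invf \<sigma> = id" "\<sigma> \<in> W \<Longrightarrow> invf \<sigma> \<circ> \<sigma> = id"
  by (auto simp: fun_eq_iff)

lemma W_permutes: "\<sigma> \<in> W \<Longrightarrow> \<sigma> permutes {p. \<exists>q. q \<noteq> p \<and> rel p q}"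
  unfolding permutes_def W_def bij_iff by auto

lemma finite_W: "finite W"
  by (rule finite_subset[OF _ finite_permutations[OF rel_finite]]) (use W_permutes in auto)

lemma word_in_W: "ws \<in> words \<Longrightarrow> word_prod ws \<in> W"
proof (induction ws)
  case (Cons w ws)
  obtain p q where w: "w = (p, q)" by (cases w)
  with Cons.prems have "rel p q" "ws \<in> words" using adj_rel by auto
  then show ?case unfolding w word_prod_Cons using Cons.IH W_comp W_swap by blast
qed simp

section \<open>Inversions and length\<close>

definition Inv :: "(index \<Rightarrow> index) \<Rightarrow> (index \<times> index) set" where
  "Inv \<sigma> = {(p, q). p < q \<and> rel p q \<and> \<sigma> q < \<sigma> p}"

definition pairs :: "(index \<times> index) set" where
  "pairs = {(p, q). p < q \<and> rel p q}"

lemma finite_pairs: "finite pairs"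
proof (rule finite_subset)
  let ?S = "{p. \<exists>q. q \<noteq> p \<and> rel p q}"
  show "pairs \<subseteq> ?S \<times> ?S" 
  proof
    fix x assume "x \<in> pairs"
    then obtain p q where x: "x = (p, q)" "p \<noteq> q" "rel p q" by (auto simp: pairs_def)
    with rel_sym[of p q] have "\<exists>r. r \<noteq> p \<and> rel p r" "\<exists>r. r \<noteq> q \<and> rel q r" by metis+
    with x show "x \<in> ?S \<times> ?S" by blast
  qed
  show "finite (?S \<times> ?S)" using rel_finite by simp
qed

lemma Inv_subset: "Inv \<sigma> \<subseteq> pairs" by (auto simp: Inv_def pairs_def)

lemma finite_Inv: "finite (Inv \<sigma>)"
  using Inv_subset finite_pairs finite_subset by blast

text \<open>Only pairs inside one class count, and there the lexicographic order compares second
  coordinates. By \<open>wlen_eq\<close> this is the word length with respect to the simple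
  reflections.\<close>

definition len :: "(index \<Rightarrow> index) \<Rightarrow> nat" where
  "len \<sigma> = card (Inv \<sigma>)"

lemma len_id [simp]: "len id = 0"
  by (auto simp: len_def Inv_def intro!: card_eq_0_iff[THEN iffD2])

lemma adj_between: "adj a b \<Longrightarrow> a < x \<Longrightarrow> b \<le> x"
  by (cases a; cases x) (auto simp: adj_def)

lemma adj_between2: "adj a b \<Longrightarrow> x < b \<Longrightarrow> x \<le> a"
  by (cases a; cases x) (auto simp: adj_def)

text \<open>No index lies strictly between adjacent ones, so exchanging them disturbs the order of
  no other pair.\<close>

lemma swap_adj_less:
  assumes "adj a b" "x < y" "(x, y) \<noteq> (a, b)"
  shows "swap a b x < swap a b y"
  using assms adj_less[OF assms(1)] adj_between[OF assms(1), of x] adj_between[OF assms(1), of y]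
    adj_between2[OF assms(1), of x] adj_between2[OF assms(1), of y]
  unfolding Transposition.transpose_def by (auto split: if_splits)

text \<open>Composing with an adjacent transposition on the left adds exactly one inversion, formed
  by the preimages of \<open>a\<close> and \<open>b\<close>.\<close>

lemma len_ascent:
  assumes \<sigma>: "\<sigma> \<in> W" and ab: "adj a b" and asc: "invf \<sigma> a < invf \<sigma> b"
  shows "len (swap a b \<circ> \<sigma>) = Suc (len \<sigma>)"
proof -
  define i j where "i = invf \<sigma> a" and "j = invf \<sigma> b"
  have ij: "\<sigma> i = a" "\<sigma> j = b" "i < j" using \<sigma> asc by (simp_all add: i_def j_def)
  have "rel i j" using W_rel_iff[OF \<sigma>] adj_rel[OF ab] ij by metis
  have "Inv (swap a b \<circ> \<sigma>) = insert (i, j) (Inv \<sigma>)"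
  proof (intro equalityI subsetI)
    fix x assume x: "x \<in> Inv (swap a b \<circ> \<sigma>)"
    obtain p q where pq: "x = (p, q)" "p < q" "rel p q" "swap a b (\<sigma> q) < swap a b (\<sigma> p)"
      using x by (auto simp: Inv_def)
    show "x \<in> insert (i, j) (Inv \<sigma>)"
    proof (cases "\<sigma> q < \<sigma> p")
      case True
      with pq show ?thesis by (auto simp: Inv_def)
    next
      case False
      with pq(2) \<sigma> have "\<sigma> p < \<sigma> q" by (metis W_eq_iff linorder_neqE less_irrefl)
      with pq(4) swap_adj_less[OF ab this] have "(\<sigma> p, \<sigma> q) = (a, b)" by fastforce
      then have "p = i" "q = j" using ij \<sigma> W_eq_iff by auto
      with pq show ?thesis by simp
    qed
  next
    fix x assume "x \<in> insert (i, j) (Inv \<sigma>)"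
    then consider "x = (i, j)" | "x \<in> Inv \<sigma>" by blast
    then show "x \<in> Inv (swap a b \<circ> \<sigma>)"
    proof cases
      case 1
      then show ?thesis using ij \<open>rel i j\<close> adj_less[OF ab] by (simp add: Inv_def)
    next
      case 2
      then obtain p q where pq: "x = (p, q)" "p < q" "rel p q" "\<sigma> q < \<sigma> p" by (auto simp: Inv_def)
      have "(\<sigma> q, \<sigma> p) \<noteq> (a, b)" using pq(2) ij \<sigma> W_eq_iff by (metis less_asym prod.inject)
      with swap_adj_less[OF ab pq(4)] pq show ?thesis by (simp add: Inv_def)
    qed
  qed
  moreover have "(i, j) \<notin> Inv \<sigma>" using ij adj_less[OF ab] by (auto simp: Inv_def)
  ultimately show ?thesis by (simp add: len_def finite_Inv)
qed

lemma inv_swap_comp: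
  assumes "\<sigma> \<in> W" "rel a b"
  shows "invf (swap a b \<circ> \<sigma>) x = invf \<sigma> (swap a b x)"
proof -
  have "invf (swap a b \<circ> \<sigma>) = invf \<sigma> \<circ> invf (swap a b)"
    using assms by (intro o_inv_distrib) (auto simp: W_bij)
  then show ?thesis by simp
qed

lemma len_descent:
  assumes \<sigma>: "\<sigma> \<in> W" and ab: "adj a b" and desc: "invf \<sigma> b < invf \<sigma> a"
  shows "len \<sigma> = Suc (len (swap a b \<circ> \<sigma>))"
proof -
  have \<tau>: "swap a b \<circ> \<sigma> \<in> W" using \<sigma> ab by (intro W_comp W_swap adj_rel)
  have "swap a b \<circ> (swap a b \<circ> \<sigma>) = \<sigma>" by (simp add: o_assoc)
  with len_ascent[OF \<tau> ab] show ?thesis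
    using desc by (simp add: inv_swap_comp[OF \<sigma> adj_rel[OF ab]])
qed

lemma descent_iff:
  assumes \<sigma>: "\<sigma> \<in> W" and ab: "adj a b"
  shows "invf \<sigma> b < invf \<sigma> a \<longleftrightarrow> len (swap a b \<circ> \<sigma>) < len \<sigma>"
    and "invf \<sigma> a < invf \<sigma> b \<longleftrightarrow> len \<sigma> < len (swap a b \<circ> \<sigma>)"
proof -
  have neq: "invf \<sigma> a \<noteq> invf \<sigma> b" using W_inv[OF \<sigma>] adj_neq[OF ab] by simp
  have "(invf \<sigma> b < invf \<sigma> a \<longleftrightarrow> len (swap a b \<circ> \<sigma>) < len \<sigma>) \<and>
    (invf \<sigma> a < invf \<sigma> b \<longleftrightarrow> len \<sigma> < len (swap a b \<circ> \<sigma>))"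
  proof (cases "invf \<sigma> a < invf \<sigma> b")
    case True
    then have "\<not> invf \<sigma> b < invf \<sigma> a" by (rule less_not_sym)
    with True len_ascent[OF assms True] show ?thesis by simp
  next
    case False
    then have "invf \<sigma> b < invf \<sigma> a" using neq by (meson linorder_neqE)
    with False len_descent[OF assms this] show ?thesis by simp
  qed
  then show "invf \<sigma> b < invf \<sigma> a \<longleftrightarrow> len (swap a b \<circ> \<sigma>) < len \<sigma>"
    and "invf \<sigma> a < invf \<sigma> b \<longleftrightarrow> len \<sigma> < len (swap a b \<circ> \<sigma>)" by blast+
qed

text \<open>Classes are intervals, so two related indices are joined by a chain of adjacent ones
  within their class, and a transitive relation needs checking on adjacent pairs only.\<close>

lemma rel_chain:
  assumes R: "\<And>a b. adj a b \<Longrightarrow> R a b" and trans: "\<And>a b c. R a b \<Longrightarrow> R b c \<Longrightarrow> R a c"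
    and pq: "p < q" "rel p q"
  shows "R p q"
proof -
  obtain k i where p: "p = (k, i)" by (cases p)
  with rel_fst[OF pq(2)] obtain j where q: "q = (k, j)" by (cases q) auto
  have "i < j" using pq(1) p q by auto
  then obtain d where d: "j = Suc (i + d)" using less_iff_Suc_add by blast
  have "rel (k, i) (k, Suc (i + d)) \<Longrightarrow> R (k, i) (k, Suc (i + d))" for d
  proof (induction d)
    case 0
    then have "adj (k, i) (k, Suc (i + 0))" by (simp add: adj_def)
    then show ?case by (rule R)
  next
    case (Suc d)
    have r: "rel (k, i) (k, Suc (i + d))"
      by (rule rel_convex[OF Suc.prems]) simp_all
    have "rel (k, Suc (i + d)) (k, Suc (i + Suc d))"
      by (rule rel_trans[OF rel_sym[OF r] Suc.prems])
    then have "adj (k, Suc (i + d)) (k, Suc (i + Suc d))" unfolding adj_def by simp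
    from trans[OF Suc.IH[OF r] R[OF this]] show ?case .
  qed
  then show ?thesis using pq p q d by simp
qed

text \<open>The least index that is moved goes up, while its preimage lies above it; together they
  form an inversion.\<close>

lemma W_id_if_no_Inv:
  assumes \<sigma>: "\<sigma> \<in> W" and e: "Inv \<sigma> = {}"
  shows "\<sigma> = id"
proof (rule ccontr)
  assume "\<sigma> \<noteq> id"
  then obtain p0 where "\<sigma> p0 \<noteq> p0" by (auto simp: fun_eq_iff)
  then obtain p where p: "\<sigma> p \<noteq> p" and min: "\<And>q. q < p \<Longrightarrow> \<sigma> q = q"
    using exists_least_iff[of "\<lambda>p. \<sigma> p \<noteq> p"] by blast
  have "p < \<sigma> p"
    using p min[of "\<sigma> p"] \<sigma> by (metis W_eq_iff linorder_neqE)
  define q where "q = invf \<sigma> p"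
  have q: "\<sigma> q = p" using \<sigma> by (simp add: q_def)
  have "p < q" using min[of q] q p by (metis linorder_neqE)
  moreover have "rel p q" using W_rel[OF \<sigma>, of q] q rel_sym by simp
  ultimately have "(p, q) \<in> Inv \<sigma>" using q \<open>p < \<sigma> p\<close> by (simp add: Inv_def)
  with e show False by simp
qed

text \<open>Without a descent the inverse is increasing along each class, by chaining adjacent
  pairs, and then there are no inversions.\<close>

lemma exists_descent:
  assumes \<sigma>: "\<sigma> \<in> W" "\<sigma> \<noteq> id"
  obtains a b where "adj a b" "invf \<sigma> b < invf \<sigma> a"
proof (rule ccontr)
  assume "\<not> thesis"
  with that have "\<not> invf \<sigma> b < invf \<sigma> a" if "adj a b" for a b using that by blast
  then have asc: "invf \<sigma> a < invf \<sigma> b" if "adj a b" for a b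
    using that adj_neq[OF that] W_inv[OF \<sigma>(1)] by (metis W_eq_iff linorder_neqE)
  have mono: "invf \<sigma> p < invf \<sigma> q" if "p < q" "rel p q" for p q
    by (rule rel_chain[where R = "\<lambda>x y. invf \<sigma> x < invf \<sigma> y", OF _ _ that])
      (erule asc, erule (1) less_trans)
  have "Inv \<sigma> = {}"
  proof (rule ccontr)
    assume "Inv \<sigma> \<noteq> {}"
    then obtain p q where pq: "p < q" "rel p q" "\<sigma> q < \<sigma> p" unfolding Inv_def by blast
    with mono[of "\<sigma> q" "\<sigma> p"] \<sigma> show False
      by (simp add: W_rel_iff rel_sym)
  qed
  with W_id_if_no_Inv \<sigma> show False by blast
qed

lemma exists_word:
  assumes "\<sigma> \<in> W"
  shows "\<exists>ws\<in>words. word_prod ws = \<sigma> \<and> length ws = len \<sigma>"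
  using assms
proof (induction "len \<sigma>" arbitrary: \<sigma> rule: less_induct)
  case less
  show ?case
  proof (cases "\<sigma> = id")
    case True
    then show ?thesis by (intro bexI[of _ "[]"]) auto
  next
    case False
    then obtain a b where ab: "adj a b" "invf \<sigma> b < invf \<sigma> a" using exists_descent less.prems by blast
    have \<tau>: "swap a b \<circ> \<sigma> \<in> W" using less.prems ab by (intro W_comp W_swap adj_rel)
    note l = len_descent[OF less.prems ab]
    obtain ws where ws: "ws \<in> words" "word_prod ws = swap a b \<circ> \<sigma>" "length ws = len (swap a b \<circ> \<sigma>)"
      using less.hyps[OF _ \<tau>] l by auto
    show ?thesis
      by (rule bexI[of _ "(a, b) # ws"]) (use ws ab l in \<open>auto simp: o_assoc\<close>)
  qed
qed

lemma len_swap_le: "\<sigma> \<in> W \<Longrightarrow> adj a b \<Longrightarrow> len (swap a b \<circ> \<sigma>) \<le> Suc (len \<sigma>)"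
  using len_ascent len_descent W_inv adj_neq by (metis W_eq_iff linorder_neqE le_Suc_eq less_imp_le lessI)

lemma len_le_length: "ws \<in> words \<Longrightarrow> len (word_prod ws) \<le> length ws"
proof (induction ws)
  case (Cons w ws)
  obtain a b where w: "w = (a, b)" by (cases w)
  with Cons.prems have ab: "adj a b" "ws \<in> words" by simp_all
  from len_swap_le[OF word_in_W[OF ab(2)] ab(1)] Cons.IH[OF ab(2)]
  have "len (swap a b \<circ> word_prod ws) \<le> length (w # ws)" by simp
  then show ?case by (simp only: w word_prod_Cons)
qed simp

lemma wlen_eq: "\<sigma> \<in> W \<Longrightarrow> wlen simple_roots \<sigma> = len \<sigma>"
  unfolding wlen_def words_def[symmetric]
  by (rule Least_equality) (use exists_word len_le_length in auto)

lemma weyl_eq: "weyl roots = W"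
proof
  have "word_prod ws \<in> W" if "ws \<in> root_words roots" for ws
    using that
  proof (induction ws)
    case (Cons w ws)
    obtain p q where w: "w = (p, q)" by (cases w)
    with Cons.prems have "rel p q" "ws \<in> root_words roots" by (auto simp: root_words_def root_iff)
    then show ?case unfolding w word_prod_Cons using Cons.IH W_comp W_swap by blast
  qed simp
  then show "weyl roots \<subseteq> W" by (auto simp: weyl_def)
  have "words \<subseteq> root_words roots"
    using simple_subset by (auto simp: words_def root_words_def)
  then show "W \<subseteq> weyl roots" unfolding weyl_def using exists_word by blast
qed

section \<open>Reduced words and independence of the chosen word\<close>

definition red :: "(index \<times> index) list \<Rightarrow> bool" where
  "red ws \<longleftrightarrow> ws \<in> words \<and> len (word_prod ws) = length ws"

lemma reduced_iff: "\<sigma> \<in> W \<Longrightarrow> reduced simple_roots \<sigma> ws \<longleftrightarrow> red ws \<and> word_prod ws = \<sigma>"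
  by (auto simp: reduced_def red_def wlen_eq simp flip: words_def)

lemma red_Cons: "red ((a, b) # ws) \<longleftrightarrow> adj a b \<and> red ws \<and> invf (word_prod ws) a < invf (word_prod ws) b"
proof (cases "adj a b \<and> ws \<in> words")
  case True
  then have ab: "adj a b" and W: "word_prod ws \<in> W" by (auto intro: word_in_W)
  have le: "len (word_prod ws) \<le> length ws" using True len_le_length by blast
  let ?\<tau> = "swap a b \<circ> word_prod ws"
  have iff: "red ((a, b) # ws) \<longleftrightarrow> len ?\<tau> = Suc (length ws)"
    using True unfolding red_def word_prod_Cons by simp
  show ?thesis
  proof
    assume "red ((a, b) # ws)"
    then have l: "len ?\<tau> = Suc (length ws)" using iff by blast
    then have lt: "len (word_prod ws) < len ?\<tau>" and eq: "len (word_prod ws) = length ws"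
      using le len_swap_le[OF W ab] by linarith+
    from lt have "invf (word_prod ws) a < invf (word_prod ws) b"
      unfolding descent_iff(2)[OF W ab] .
    moreover have "red ws" using True eq unfolding red_def by blast
    ultimately show "adj a b \<and> red ws \<and> invf (word_prod ws) a < invf (word_prod ws) b"
      using ab by blast
  next
    assume r: "adj a b \<and> red ws \<and> invf (word_prod ws) a < invf (word_prod ws) b"
    then have "len ?\<tau> = Suc (len (word_prod ws))" using len_ascent[OF W ab] by blast
    moreover have "len (word_prod ws) = length ws" using r unfolding red_def by blast
    ultimately show "red ((a, b) # ws)" unfolding iff by (simp only:)
  qed
qed (auto simp: red_def)

lemma red_tail: "red (w # ws) \<Longrightarrow> red ws" by (cases w) (simp add: red_Cons)

lemma exists_red: "\<sigma> \<in> W \<Longrightarrow> \<exists>ws. red ws \<and> word_prod ws = \<sigma>"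
  using exists_word by (fastforce simp: red_def)

lemma red_Cons_descent:
  assumes "\<sigma> \<in> W" "adj a b" "invf \<sigma> b < invf \<sigma> a" "red ws" "word_prod ws = swap a b \<circ> \<sigma>"
  shows "red ((a, b) # ws)" "word_prod ((a, b) # ws) = \<sigma>"
  using assms by (auto simp: red_Cons inv_swap_comp[OF _ adj_rel] o_assoc)

lemma red_Cons_inv:
  assumes "red ((a, b) # ws)"
  shows "invf (word_prod ((a, b) # ws)) b < invf (word_prod ((a, b) # ws)) a"
proof -
  have r: "adj a b" "red ws" "invf (word_prod ws) a < invf (word_prod ws) b"
    using assms unfolding red_Cons by blast+
  have "word_prod ws \<in> W" using r(2) word_in_W unfolding red_def by blast
  from inv_swap_comp[OF this adj_rel[OF r(1)]] r(3) show ?thesis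
    unfolding word_prod_Cons by simp
qed

text \<open>This is the argument of Matsumoto's theorem, carried out for the operators. If the first
  letters differ, both are descents of the same permutation. It then has reduced words that begin
  with the two sides of the braid or commutation relation of these letters, and the shorter tails
  are compared by induction.\<close>

lemma nabla_word_reduced_unique:
  assumes "red us" "red ws" "word_prod us = word_prod ws"
  shows "nabla_word us f = nabla_word ws f"
  using assms
proof (induction "length us" arbitrary: us ws f rule: less_induct)
  case less
  have lens: "length us = length ws" using less.prems by (simp add: red_def)
  show ?case
  proof (cases us)
    case Nil
    then show ?thesis using lens by simp
  next
    case (Cons u us')
    then obtain w ws' where ws: "ws = w # ws'" using lens by (cases ws) auto
    obtain a b c d where uw: "u = (a, b)" "w = (c, d)" by (cases u; cases w)
    note us = Cons
    define \<sigma> where "\<sigma> = word_prod us"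
    have \<sigma>: "\<sigma> \<in> W" "\<sigma> = word_prod ws"
      using less.prems by (auto simp: \<sigma>_def red_def word_in_W)
    have ab: "adj a b" and cd: "adj c d" using less.prems us ws uw by (auto simp: red_Cons)
    have dab: "invf \<sigma> b < invf \<sigma> a" using red_Cons_inv less.prems(1) us uw by (simp add: \<sigma>_def)
    have dcd: "invf \<sigma> d < invf \<sigma> c" using red_Cons_inv less.prems(2) ws uw by (simp add: \<sigma>(2))
    have pus: "word_prod us' = swap a b \<circ> \<sigma>" using us uw by (simp add: \<sigma>_def o_assoc)
    have pws: "word_prod ws' = swap c d \<circ> \<sigma>" using ws uw by (simp add: \<sigma>(2) o_assoc)
    have rus: "red us'" and rws: "red ws'" using less.prems us ws red_tail by blast+
    have IH: "nabla_word xs f = nabla_word ys f"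
      if "red xs" "red ys" "word_prod xs = word_prod ys" "length xs < length us" for xs ys
      using less.hyps[OF that(4,1-3)] .
    have lus: "length us' < length us" "length ws' < length us" using us ws lens by auto
    have subW: "swap a b \<circ> \<sigma> \<in> W" "swap c d \<circ> \<sigma> \<in> W"
      using \<sigma> ab cd by (auto intro!: W_comp W_swap adj_rel)
    have invab: "invf (swap a b \<circ> \<sigma>) x = invf \<sigma> (swap a b x)" for x
      by (rule inv_swap_comp[OF \<sigma>(1) adj_rel[OF ab]])
    have invcd: "invf (swap c d \<circ> \<sigma>) x = invf \<sigma> (swap c d x)" for x
      by (rule inv_swap_comp[OF \<sigma>(1) adj_rel[OF cd]])
    \<comment> \<open>Stated with its own variables, since it is applied in both directions: the two
      letters may share an index in either order.\<close>
    have braid: "nabla_word us f = nabla_word ws f"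
      if ab: "adj a b" and bd: "adj b d" and d1: "invf \<sigma> b < invf \<sigma> a" and d2: "invf \<sigma> d < invf \<sigma> b"
        and us: "us = (a, b) # us'" and ws: "ws = (b, d) # ws'" and rus: "red us'" and rws: "red ws'"
        and pus: "word_prod us' = swap a b \<circ> \<sigma>" and pws: "word_prod ws' = swap b d \<circ> \<sigma>"
        and IH: "\<And>xs ys. red xs \<Longrightarrow> red ys \<Longrightarrow> word_prod xs = word_prod ys \<Longrightarrow> length xs < length us \<Longrightarrow>
           nabla_word xs f = nabla_word ys f"
        and lus: "length us' < length us" "length ws' < length us"
      for a b d us ws us' ws'
    proof -
      have neq: "a \<noteq> b" "b \<noteq> d" "a \<noteq> d"
        using adj_less[OF ab] adj_less[OF bd] by (auto dest: less_trans)
      have invs: "\<And>x \<tau>. \<tau> \<in> W \<Longrightarrow> invf (swap a b \<circ> \<tau>) x = invf \<tau> (swap a b x)"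
        "\<And>x \<tau>. \<tau> \<in> W \<Longrightarrow> invf (swap b d \<circ> \<tau>) x = invf \<tau> (swap b d x)"
        using inv_swap_comp adj_rel[OF ab] adj_rel[OF bd] by auto
      have Ws: "\<And>\<tau>. \<tau> \<in> W \<Longrightarrow> swap a b \<circ> \<tau> \<in> W" "\<And>\<tau>. \<tau> \<in> W \<Longrightarrow> swap b d \<circ> \<tau> \<in> W"
        using ab bd by (auto intro!: W_comp W_swap adj_rel)
      have da: "invf \<sigma> d < invf \<sigma> a" using d1 d2 by (rule less_trans[rotated])
      \<comment> \<open>What remains of \<sigma> after all three letters of the braid have been
        removed; either side of the braid followed by a reduced word of \<tau> is a reduced word of
        \<sigma>.\<close>
      define \<tau> where "\<tau> = swap a b \<circ> (swap b d \<circ> (swap a b \<circ> \<sigma>))"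
      have "swap a b (swap b d (swap a b x)) = swap b d (swap a b (swap b d x))" for x
        using neq unfolding Transposition.transpose_def by simp
      then have \<tau>2: "\<tau> = swap b d \<circ> (swap a b \<circ> (swap b d \<circ> \<sigma>))"
        unfolding \<tau>_def by (intro ext) simp
      let ?s = "swap a b" and ?t = "swap b d"
      have swaps: "?t b = d" "?t d = b" "?t a = a" "?s a = b" "?s b = a" "?s d = d"
        using neq by simp_all
      have W1: "?s \<circ> \<sigma> \<in> W" "?t \<circ> \<sigma> \<in> W" using Ws \<sigma>(1) by blast+
      have W2: "?t \<circ> (?s \<circ> \<sigma>) \<in> W" "?s \<circ> (?t \<circ> \<sigma>) \<in> W" using Ws W1 by blast+
      have "\<tau> \<in> W" unfolding \<tau>_def using Ws W2(1) by blast
      then obtain cs where cs: "red cs" "word_prod cs = \<tau>" using exists_red by blast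
      have "invf (?t \<circ> (?s \<circ> \<sigma>)) b < invf (?t \<circ> (?s \<circ> \<sigma>)) a"
        unfolding invs(2)[OF W1(1)] invs(1)[OF \<sigma>(1)] swaps by (rule d2)
      note A1 = red_Cons_descent[OF W2(1) ab this cs(1) cs(2)[unfolded \<tau>_def]]
      have "invf (?s \<circ> \<sigma>) d < invf (?s \<circ> \<sigma>) b"
        unfolding invs(1)[OF \<sigma>(1)] swaps by (rule da)
      note A2 = red_Cons_descent[OF W1(1) bd this A1]
      have "invf (?s \<circ> (?t \<circ> \<sigma>)) d < invf (?s \<circ> (?t \<circ> \<sigma>)) b"
        unfolding invs(1)[OF W1(2)] invs(2)[OF \<sigma>(1)] swaps by (rule d1)
      note B1 = red_Cons_descent[OF W2(2) bd this cs(1) cs(2)[unfolded \<tau>2]]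
      have "invf (?t \<circ> \<sigma>) b < invf (?t \<circ> \<sigma>) a"
        unfolding invs(2)[OF \<sigma>(1)] swaps by (rule da)
      note B2 = red_Cons_descent[OF W1(2) ab this B1]
      have "nabla_word us' f = nabla_word ((b, d) # (a, b) # cs) f"
        by (rule IH[OF rus A2(1) _ lus(1)]) (simp only: A2(2) pus)
      moreover have "nabla_word ws' f = nabla_word ((a, b) # (b, d) # cs) f"
        by (rule IH[OF rws B2(1) _ lus(2)]) (simp only: B2(2) pws)
      ultimately show ?thesis using nabla_braid[OF neq(1,2,3)] by (simp add: us ws)
    qed
    consider "a = c" | "b = c" | "d = a" | "a \<noteq> c" "b \<noteq> c" "d \<noteq> a" by blast
    then show ?thesis
    proof cases
      case 1
      then have "b = d" using ab cd unfolding adj_def by simp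
      then have "nabla_word us' f = nabla_word ws' f"
        using IH[OF rus rws _ lus(1)] 1 pus pws by (simp only:)
      then show ?thesis using 1 \<open>b = d\<close> us ws uw by simp
    next
      case 2
      have us': "us = (a, b) # us'" and ws': "ws = (b, d) # ws'" using us ws uw 2 by simp_all
      show ?thesis
        by (rule braid[OF ab cd[folded 2] dab dcd[folded 2] us' ws' rus rws pus pws[folded 2] IH lus])
    next
      case 3
      have us': "us = (d, b) # us'" and ws': "ws = (c, d) # ws'" using us ws uw 3 by simp_all
      have "nabla_word ws f = nabla_word us f"
        by (rule braid[OF cd ab[folded 3] dcd dab[folded 3] ws' us' rws rus pws pus[folded 3] IH[unfolded lens] lus(2,1)[unfolded lens]])
      then show ?thesis by simp
    next
      case 4
      have bd: "b \<noteq> d" using 4 ab cd unfolding adj_def by (auto simp: prod_eq_iff)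
      let ?s = "swap a b" and ?t = "swap c d"
      have swaps: "?s c = c" "?s d = d" "?t a = a" "?t b = b" using 4 bd by simp_all
      \<comment> \<open>The two letters commute, and both can be stripped off in either
        order.\<close>
      define \<tau> where "\<tau> = ?t \<circ> (?s \<circ> \<sigma>)"
      have "?t (?s x) = ?s (?t x)" for x
        using 4 bd adj_neq[OF ab] adj_neq[OF cd] unfolding Transposition.transpose_def by simp
      then have \<tau>2: "\<tau> = ?s \<circ> (?t \<circ> \<sigma>)" unfolding \<tau>_def by (intro ext) simp
      have "\<tau> \<in> W" unfolding \<tau>_def by (rule W_comp[OF W_swap[OF adj_rel[OF cd]] subW(1)])
      then obtain cs where cs: "red cs" "word_prod cs = \<tau>" using exists_red by blast
      have "invf (?s \<circ> \<sigma>) d < invf (?s \<circ> \<sigma>) c" unfolding invab swaps by (rule dcd)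
      note A = red_Cons_descent[OF subW(1) cd this cs(1) cs(2)[unfolded \<tau>_def]]
      have "invf (?t \<circ> \<sigma>) b < invf (?t \<circ> \<sigma>) a" unfolding invcd swaps by (rule dab)
      note B = red_Cons_descent[OF subW(2) ab this cs(1) cs(2)[unfolded \<tau>2]]
      have "nabla_word us' f = nabla_word ((c, d) # cs) f"
        by (rule IH[OF rus A(1) _ lus(1)]) (simp only: A(2) pus)
      moreover have "nabla_word ws' f = nabla_word ((a, b) # cs) f"
        by (rule IH[OF rws B(1) _ lus(2)]) (simp only: B(2) pws)
      ultimately show ?thesis
        using us ws uw nabla_commute[OF adj_neq[OF ab] adj_neq[OF cd]] 4 bd by simp
    qed
  qed
qed

text \<open>Where a word first fails to be reduced, read from the right, the new letter is a descent
  of the reduced tail. By uniqueness the tail may be rewritten to begin with the same letter, and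
  the square of a divided difference is 0.\<close>

lemma nabla_word_not_reduced:
  assumes "ws \<in> words" "\<not> red ws"
  shows "nabla_word ws f = 0"
  using assms
proof (induction ws)
  case Nil
  then show ?case by (simp add: red_def)
next
  case (Cons w ws)
  obtain a b where w: "w = (a, b)" by (cases w)
  have ab: "adj a b" "ws \<in> words" using Cons.prems w by auto
  show ?case
  proof (cases "red ws")
    case False
    then show ?thesis using Cons.IH ab w adj_neq by simp
  next
    case True
    let ?\<sigma> = "word_prod ws"
    have \<sigma>: "?\<sigma> \<in> W" using ab word_in_W by blast
    have desc: "invf ?\<sigma> b < invf ?\<sigma> a"
      using Cons.prems(2) True ab w W_inv[OF \<sigma>] adj_neq[OF ab(1)] by (metis W_eq_iff linorder_neqE red_Cons)
    obtain cs where cs: "red cs" "word_prod cs = swap a b \<circ> ?\<sigma>"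
      using exists_red W_comp[OF W_swap[OF adj_rel[OF ab(1)]] \<sigma>] by blast
    have "nabla_word ws f = nabla_word ((a, b) # cs) f"
      by (rule nabla_word_reduced_unique[OF True red_Cons_descent(1)[OF \<sigma> ab(1) desc cs]])
        (use red_Cons_descent(2)[OF \<sigma> ab(1) desc cs] in simp)
    then show ?thesis using w adj_neq[OF ab(1)] by (simp add: nabla_nabla)
  qed
qed

end

section \<open>The coinvariant ideal and Schubert polynomials\<close>

definition const_coeff :: "mpol \<Rightarrow> complex" where
  "const_coeff f = mpol_eval f 0"

lemma ring_map_const_coeff: "ring_map const_coeff"
  using ring_map_eval[of 0] by (simp add: ring_map_def const_coeff_def)

lemmas const_coeff_simps [simp] = ring_map_simps[OF ring_map_const_coeff]

lemma const_coeff_cst [simp]: "const_coeff (cst c) = c" and const_coeff_var [simp]: "const_coeff (var q) = 0"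
  by (simp_all add: const_coeff_def)

lemma const_coeff_perm: "bij \<sigma> \<Longrightarrow> const_coeff (perm_pol \<sigma> f) = const_coeff f"
  using eval_perm[of \<sigma> f 0] by (simp add: const_coeff_def perm_vec_def zero_fun_def)

lemma lookup_zero_eq: "Poly_Mapping.lookup f 0 = const_coeff f"
  by (simp add: lookup_zero_eq_eval const_coeff_def)

lemma prod_spanI: "a \<in> A \<Longrightarrow> b \<in> B \<Longrightarrow> mul a b \<in> prod_span mul A B"
  unfolding prod_span_def by (rule CollectI, rule exI[of _ "1::nat"]) auto

lemma prod_span_0: "0 \<in> prod_span mul A B"
  unfolding prod_span_def by (rule CollectI, rule exI[of _ "0::nat"]) auto

lemma prod_span_add:
  assumes "x \<in> prod_span mul A B" "y \<in> prod_span mul A B"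
  shows "x + y \<in> prod_span mul A B"
proof -
  obtain n :: nat and a b where x: "x = (\<Sum>i<n. mul (a i) (b i))" "\<forall>i<n. a i \<in> A \<and> b i \<in> B"
    using assms(1) unfolding prod_span_def by blast
  obtain m :: nat and c d where y: "y = (\<Sum>i<m. mul (c i) (d i))" "\<forall>i<m. c i \<in> A \<and> d i \<in> B"
    using assms(2) unfolding prod_span_def by blast
  let ?a = "\<lambda>i. if i < n then a i else c (i - n)" and ?b = "\<lambda>i. if i < n then b i else d (i - n)"
  have split: "(\<Sum>i<n + m. F i) = (\<Sum>i<n. F i) + (\<Sum>i<m. F (n + i))" for F :: "nat \<Rightarrow> 'a"
    by (induction m) (simp_all add: add.assoc)
  have "(\<Sum>i<n + m. mul (?a i) (?b i)) = (\<Sum>i<n. mul (?a i) (?b i)) + (\<Sum>i<m. mul (?a (n + i)) (?b (n + i)))"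
    by (rule split)
  also have "\<dots> = x + y" using x(1) y(1) by simp
  finally have "x + y = (\<Sum>i<n + m. mul (?a i) (?b i))" ..
  moreover have "\<forall>i<n + m. ?a i \<in> A \<and> ?b i \<in> B" using x(2) y(2) by auto
  ultimately show ?thesis unfolding prod_span_def
    by (intro CollectI exI[of _ "n + m"] exI[of _ ?a] exI[of _ ?b] conjI)
qed

lemma prod_span_induct:
  assumes "x \<in> prod_span mul A B" "P 0" "\<And>x y. P x \<Longrightarrow> P y \<Longrightarrow> P (x + y)"
    "\<And>a b. a \<in> A \<Longrightarrow> b \<in> B \<Longrightarrow> P (mul a b)"
  shows "P x"
proof -
  obtain n :: nat and a b where x: "x = (\<Sum>i<n. mul (a i) (b i))" "\<forall>i<n. a i \<in> A \<and> b i \<in> B"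
    using assms(1) unfolding prod_span_def by blast
  have "P (\<Sum>i<m. mul (a i) (b i))" if "m \<le> n" for m
    using that by (induction m) (use assms(2-4) x(2) in auto)
  then show ?thesis using x(1) by simp
qed

locale young_idx = young rel for rel +
  fixes \<mu> :: "nat list"
  assumes rel_idx: "rel p q \<Longrightarrow> p \<noteq> q \<Longrightarrow> p \<in> idx \<mu>"
begin

lemma rel_idx2: "rel p q \<Longrightarrow> p \<noteq> q \<Longrightarrow> q \<in> idx \<mu>"
  using rel_idx rel_sym by metis

lemma W_idx: "\<sigma> \<in> W \<Longrightarrow> p \<in> idx \<mu> \<Longrightarrow> \<sigma> p \<in> idx \<mu>"
  using rel_idx2[of p "\<sigma> p"] W_rel by metis

lemma Lam_perm_W: "\<sigma> \<in> W \<Longrightarrow> f \<in> Lam \<mu> \<Longrightarrow> perm_pol \<sigma> f \<in> Lam \<mu>"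
  by (rule Lam_perm) (auto intro: W_idx)

lemma Lam_nabla_rel: "rel p q \<Longrightarrow> p \<noteq> q \<Longrightarrow> f \<in> Lam \<mu> \<Longrightarrow> nabla p q f \<in> Lam \<mu>"
  by (rule Lam_nabla) (auto intro: rel_idx rel_idx2)

lemma Lam_nabla_word: "ws \<in> words \<Longrightarrow> f \<in> Lam \<mu> \<Longrightarrow> nabla_word ws f \<in> Lam \<mu>"
proof (induction ws)
  case (Cons w ws)
  obtain a b where w: "w = (a, b)" by (cases w)
  then show ?case using Cons Lam_nabla_rel[OF adj_rel adj_neq] by simp
qed simp

lemma nabla_word_add: "ws \<in> words \<Longrightarrow> nabla_word ws (f + g) = nabla_word ws f + nabla_word ws g"
proof (induction ws)
  case (Cons w ws)
  obtain a b where w: "w = (a, b)" by (cases w)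
  then show ?case using Cons nabla_add[OF adj_neq] by simp
qed simp

lemma nabla_word_mult_invariant:
  assumes "\<forall>\<sigma>\<in>W. perm_pol \<sigma> g = g"
  shows "ws \<in> words \<Longrightarrow> nabla_word ws (g * f) = g * nabla_word ws f"
proof (induction ws)
  case (Cons w ws)
  obtain a b where w: "w = (a, b)" by (cases w)
  with Cons.prems have ab: "adj a b" "ws \<in> words" by simp_all
  have "perm_pol (swap a b) g = g" using assms W_swap[OF adj_rel[OF ab(1)]] by blast
  then show ?case using Cons.IH ab w nabla_mult_invariant[OF adj_neq[OF ab(1)]] by simp
qed simp

lemma nabla_word_cst_mult: "ws \<in> words \<Longrightarrow> nabla_word ws (cst c * f) = cst c * nabla_word ws f"
  by (rule nabla_word_mult_invariant) simp_all

lemma hcomp_nabla_word: "ws \<in> words \<Longrightarrow> hcomp d (nabla_word ws f) = nabla_word ws (hcomp (d + length ws) f)"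
proof (induction ws arbitrary: d)
  case (Cons w ws)
  obtain a b where w: "w = (a, b)" by (cases w)
  with Cons.prems have ab: "adj a b" "ws \<in> words" by simp_all
  show ?case using Cons.IH[OF ab(2), of "Suc d"] by (simp add: w hcomp_nabla[OF adj_neq[OF ab(1)]])
qed simp

lemma eval_0_hcomp: "const_coeff f = const_coeff (hcomp 0 f)"
  by (simp add: hcomp_zero_eq lookup_zero_eq)

lemma eval_nabla_word: "ws \<in> words \<Longrightarrow> const_coeff (nabla_word ws f) = const_coeff (nabla_word ws (hcomp (length ws) f))"
  using hcomp_nabla_word[of ws 0 f] eval_0_hcomp[of "nabla_word ws f"] by simp

abbreviation I :: "mpol set" where "I \<equiv> inv_ideal \<mu> roots"

definition invs :: "mpol set" where
  "invs = {g \<in> Lam \<mu>. const_coeff g = 0 \<and> (\<forall>\<sigma>\<in>W. perm_pol \<sigma> g = g)}"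

lemma I_eq: "I = prod_span (*) (Lam \<mu>) invs"
  by (simp add: inv_ideal_def invs_def weyl_eq lookup_zero_eq)

lemma I_0: "0 \<in> I" and I_add: "x \<in> I \<Longrightarrow> y \<in> I \<Longrightarrow> x + y \<in> I"
  and I_gen: "a \<in> Lam \<mu> \<Longrightarrow> g \<in> invs \<Longrightarrow> a * g \<in> I"
  unfolding I_eq by (blast intro: prod_span_0 prod_span_add prod_spanI)+

lemma I_induct [consumes 1, case_names zero add gen]:
  assumes "x \<in> I" "P 0" "\<And>x y. P x \<Longrightarrow> P y \<Longrightarrow> P (x + y)" "\<And>a g. a \<in> Lam \<mu> \<Longrightarrow> g \<in> invs \<Longrightarrow> P (a * g)"
  shows "P x"
  using assms unfolding I_eq by (rule prod_span_induct)

lemma invs_I: "g \<in> invs \<Longrightarrow> g \<in> I"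
  using I_gen[of 1 g] by simp

lemma I_mult: "x \<in> I \<Longrightarrow> b \<in> Lam \<mu> \<Longrightarrow> b * x \<in> I"
proof (induction rule: I_induct)
  case (gen a g)
  then have "(b * a) * g \<in> I" by (intro I_gen Lam_mult)
  then show ?case by (simp add: mult.assoc)
qed (simp_all add: I_0 I_add distrib_left)

lemma I_uminus: "x \<in> I \<Longrightarrow> - x \<in> I"
  using I_mult[of x "- 1"] Lam_uminus[of 1 \<mu>] by simp

lemma I_diff: "x \<in> I \<Longrightarrow> y \<in> I \<Longrightarrow> x - y \<in> I"
  using I_add[of x "- y"] I_uminus by simp

lemma I_sum: "(\<And>x. x \<in> A \<Longrightarrow> f x \<in> I) \<Longrightarrow> sum f A \<in> I"
  by (induction A rule: infinite_finite_induct) (simp_all add: I_0 I_add)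

lemma I_Lam: "x \<in> I \<Longrightarrow> x \<in> Lam \<mu>"
  by (induction rule: I_induct) (auto intro: Lam_add Lam_mult simp: invs_def)

lemma I_eval: "x \<in> I \<Longrightarrow> const_coeff x = 0"
  by (induction rule: I_induct) (auto simp: invs_def)

lemma I_nabla:
  assumes "rel p q" "p \<noteq> q" "x \<in> I"
  shows "nabla p q x \<in> I"
  using assms(3)
proof (induction rule: I_induct)
  case (gen a g)
  have "perm_pol (swap p q) g = g" using gen(2) W_swap[OF assms(1)] by (simp add: invs_def)
  then have "nabla p q (a * g) = nabla p q a * g"
    using nabla_mult_invariant[OF assms(2), of g a] by (simp add: mult.commute)
  then show ?case using I_gen[OF Lam_nabla_rel gen(2)] assms gen(1) by simp
qed (simp_all add: I_0 I_add nabla_add assms)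

lemma I_nabla_word: "ws \<in> words \<Longrightarrow> x \<in> I \<Longrightarrow> nabla_word ws x \<in> I"
proof (induction ws)
  case (Cons w ws)
  obtain a b where w: "w = (a, b)" by (cases w)
  then show ?case using Cons I_nabla[OF adj_rel adj_neq] by simp
qed simp

text \<open>In characteristic 0 the average over \<open>W\<close> is available, and this makes membership in the
  ideal an easy induction on the degree.\<close>

lemma I_if_nabla_words_vanish:
  assumes "f \<in> Lam \<mu>" "\<And>ws. ws \<in> words \<Longrightarrow> const_coeff (nabla_word ws f) = 0"
  shows "f \<in> I"
proof -
  have "f \<in> I" if "f \<in> Lam \<mu>" "\<And>ws. ws \<in> words \<Longrightarrow> const_coeff (nabla_word ws f) = 0"
    "\<And>d. d \<ge> D \<Longrightarrow> hcomp d f = 0" for D f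
    using that
  proof (induction D arbitrary: f)
    case 0
    then have "f = 0" using sum_hcomp[of f "tdeg f"] by simp
    then show ?case by (simp add: I_0)
  next
    case (Suc D)
    \<comment> \<open>The polynomial \<open>nabla a b f\<close> has smaller degree and inherits the
      hypothesis, because a word may be prolonged on the right by the letter
      \<open>(a, b)\<close>.\<close>
    have step: "f - perm_pol (swap a b) f \<in> I" if ab: "adj a b" for a b
    proof -
      have "nabla a b f \<in> I"
      proof (rule Suc.IH)
        show "nabla a b f \<in> Lam \<mu>" using Lam_nabla_rel[OF adj_rel adj_neq] ab Suc.prems(1) by blast
        show "const_coeff (nabla_word ws (nabla a b f)) = 0" if "ws \<in> words" for ws
          using Suc.prems(2)[of "ws @ [(a, b)]"] that ab by (simp add: nabla_word_append)
        show "hcomp d (nabla a b f) = 0" if "d \<ge> D" for d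
          using Suc.prems(3)[of "Suc d"] that adj_neq[OF ab] by (simp add: hcomp_nabla)
      qed
      moreover have "var a - var b \<in> Lam \<mu>"
        using rel_idx[OF adj_rel[OF ab] adj_neq[OF ab]] rel_idx2[OF adj_rel[OF ab] adj_neq[OF ab]]
        by (intro Lam_diff Lam_var)
      ultimately have "(var a - var b) * nabla a b f \<in> I" by (rule I_mult)
      then show ?thesis unfolding nabla_mult_root[OF adj_neq[OF ab]] .
    qed
    have I_swap: "perm_pol (swap a b) x \<in> I" if "adj a b" "x \<in> I" for a b x
    proof -
      have "perm_pol (swap a b) x = x - (var a - var b) * nabla a b x"
        using nabla_mult_root[OF adj_neq[OF that(1)], of x] by simp
      moreover have "var a - var b \<in> Lam \<mu>"
        using rel_idx[OF adj_rel adj_neq] rel_idx2[OF adj_rel adj_neq] that(1)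
        by (intro Lam_diff Lam_var) blast+
      ultimately show ?thesis
        using I_nabla[OF adj_rel adj_neq] that by (simp add: I_diff I_mult)
    qed
    have words: "f - perm_pol (word_prod ws) f \<in> I" if "ws \<in> words" for ws
      using that
    proof (induction ws)
      case Nil
      have "f - perm_pol id f \<in> I" by (simp add: I_0)
      then show ?case by (simp only: word_prod_Nil)
    next
      case (Cons w ws)
      obtain a b where w: "w = (a, b)" by (cases w)
      with Cons.prems have ab: "adj a b" "ws \<in> words" by simp_all
      have "f - perm_pol (word_prod (w # ws)) f =
          (f - perm_pol (swap a b) f) + perm_pol (swap a b) (f - perm_pol (word_prod ws) f)"
        by (simp add: w perm_perm)
      then show ?case using I_add[OF step[OF ab(1)] I_swap[OF ab(1) Cons.IH[OF ab(2)]]] by simp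
    qed
    have f0: "const_coeff f = 0" using Suc.prems(2)[of "[]"] by simp
    \<comment> \<open>Modulo the ideal each translate of \<open>f\<close> equals \<open>f\<close>,
      so \<open>card W\<close> times \<open>f\<close> is congruent to the orbit sum. The orbit sum
      is invariant without constant term, hence a generator of the ideal.\<close>
    define avg where "avg = (\<Sum>\<sigma>\<in>W. perm_pol \<sigma> f)"
    have diffs: "(\<Sum>\<sigma>\<in>W. f - perm_pol \<sigma> f) \<in> I"
      by (rule I_sum) (use exists_red words in \<open>force simp: red_def\<close>)
    have "avg \<in> invs"
    proof -
      have "perm_pol \<tau> avg = avg" if \<tau>: "\<tau> \<in> W" for \<tau>
      proof -
        have "perm_pol \<tau> avg = (\<Sum>\<sigma>\<in>W. perm_pol (\<tau> \<circ> \<sigma>) f)" by (simp add: avg_def perm_perm)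
        also have "\<dots> = avg" unfolding avg_def
          by (rule sum.reindex_bij_witness[of _ "\<lambda>\<sigma>. invf \<tau> \<circ> \<sigma>" "\<lambda>\<sigma>. \<tau> \<circ> \<sigma>"])
            (use \<tau> W_comp W_inv in \<open>auto simp: o_assoc\<close>)
        finally show ?thesis .
      qed
      moreover have "const_coeff (perm_pol \<sigma> f) = 0" if "\<sigma> \<in> W" for \<sigma>
        using f0 by (simp add: const_coeff_perm W_bij that)
      ultimately show ?thesis
        using Suc.prems(1) by (auto simp: invs_def avg_def intro!: Lam_sum Lam_perm_W)
    qed
    then have "(\<Sum>\<sigma>\<in>W. f - perm_pol \<sigma> f) + avg \<in> I" using diffs I_add invs_I by blast
    then have "of_nat (card W) * f \<in> I" by (simp add: avg_def sum_subtractf)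
    then have "cst (1 / of_nat (card W)) * (of_nat (card W) * f) \<in> I" by (rule I_mult) simp
    moreover have "card W \<noteq> 0" using finite_W W_id by (metis card_eq_0_iff empty_iff)
    then have "cst (1 / of_nat (card W)) * (of_nat (card W) * f) = f"
      by (simp add: cst_of_nat[symmetric] mult.assoc[symmetric] cst_mult[symmetric])
    ultimately show ?case by simp
  qed
  moreover have "hcomp d f = 0" if "d \<ge> Suc (tdeg f)" for d
    by (rule poly_mapping_eqI) (use edeg_le_tdeg[of _ f] that in \<open>force simp: lookup_hcomp in_keys_iff\<close>)
  ultimately show ?thesis using assms by blast
qed

section \<open>The product of the positive roots and antisymmetrisation\<close>

definition delta :: mpol where
  "delta = (\<Prod>(p, q)\<in>pairs. var p - var q)"

lemma Lam_delta: "delta \<in> Lam \<mu>"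
  unfolding delta_def
proof (rule Lam_prod)
  fix x assume x: "x \<in> pairs"
  obtain p q where pq: "x = (p, q)" by (cases x)
  with x have "rel p q" "p \<noteq> q" by (auto simp: pairs_def)
  then show "(case x of (p, q) \<Rightarrow> var p - var q) \<in> Lam \<mu>"
    using rel_idx rel_idx2 by (simp add: pq Lam_diff Lam_var)
qed

lemma homogeneous_delta: "homogeneous (card pairs) delta"
  unfolding delta_def
  by (rule homogeneous_prod[OF finite_pairs]) (auto simp: split_beta intro!: homogeneous_diff homogeneous_var simp del: One_nat_def)

text \<open>An adjacent transposition permutes the positive roots other than its own and changes the
  sign of that one.\<close>

lemma swap_delta:
  assumes ab: "adj a b"
  shows "perm_pol (swap a b) delta = - delta"
proof -
  let ?s = "swap a b" and ?P = "pairs - {(a, b)}"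
  have mem: "(a, b) \<in> pairs" using ab adj_less adj_rel by (simp add: pairs_def)
  have delta: "delta = (var a - var b) * (\<Prod>(p, q)\<in>?P. var p - var q)"
    unfolding delta_def using prod.remove[OF finite_pairs mem, of "\<lambda>(p, q). var p - var q"] by simp
  have maps: "(?s p, ?s q) \<in> ?P" if pq: "(p, q) \<in> ?P" for p q
  proof -
    have "p < q" "rel p q" "(p, q) \<noteq> (a, b)" using pq by (auto simp: pairs_def)
    then have lt: "?s p < ?s q" and rel: "rel (?s p) (?s q)"
      using swap_adj_less[OF ab] W_rel_iff[OF W_swap[OF adj_rel[OF ab]]] by blast+
    have "(?s p, ?s q) \<noteq> (a, b)"
    proof
      assume "(?s p, ?s q) = (a, b)"
      then have "?s p = a" "?s q = b" by simp_all
      then have "p = swap a b a" "q = swap a b b" by (metis transpose_involutory)+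
      then have "p = b" "q = a" by simp_all
      with \<open>p < q\<close> adj_less[OF ab] show False by (metis less_asym)
    qed
    with lt rel show ?thesis by (simp add: pairs_def)
  qed
  have maps': "(?s (fst x), ?s (snd x)) \<in> ?P" if "x \<in> ?P" for x
    using maps[of "fst x" "snd x"] that by (simp del: Diff_iff)
  have "perm_pol ?s (\<Prod>(p, q)\<in>?P. var p - var q) = (\<Prod>(p, q)\<in>?P. var (?s p) - var (?s q))"
    by (simp add: split_beta)
  also have "\<dots> = (\<Prod>(p, q)\<in>?P. var p - var q)"
    by (rule prod.reindex_bij_witness[of _ "\<lambda>x. (?s (fst x), ?s (snd x))" "\<lambda>x. (?s (fst x), ?s (snd x))"])
      (simp_all add: split_beta maps' del: Diff_iff)
  finally have "perm_pol ?s delta = (var b - var a) * (\<Prod>(p, q)\<in>?P. var p - var q)"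
    unfolding delta by simp
  then show ?thesis unfolding delta by (simp add: algebra_simps)
qed

lemma W_permutation: "\<sigma> \<in> W \<Longrightarrow> permutation \<sigma>"
  using W_permutes rel_finite permutation_permutes by blast

lemma perm_delta: "\<sigma> \<in> W \<Longrightarrow> perm_pol \<sigma> delta = of_int (sign \<sigma>) * delta"
proof -
  have "ws \<in> words \<Longrightarrow> perm_pol (word_prod ws) delta = of_int (sign (word_prod ws)) * delta" for ws
  proof (induction ws)
    case Nil
    have "perm_pol id delta = of_int (sign id) * delta" by simp
    then show ?case by (simp only: word_prod_Nil)
  next
    case (Cons w ws)
    obtain a b where w: "w = (a, b)" by (cases w)
    with Cons.prems have ab: "adj a b" "ws \<in> words" by simp_all
    have sgn: "sign (swap a b \<circ> word_prod ws) = - sign (word_prod ws)"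
      using sign_compose[OF permutation_swap_id[of a b] W_permutation[OF word_in_W[OF ab(2)]]] adj_neq[OF ab(1)]
      by (simp add: sign_swap_id)
    have "perm_pol (swap a b) (of_int n * delta) = - (of_int n * delta)" for n
      using swap_delta[OF ab(1)] by (cases n rule: int_cases2) (simp_all add: cst_of_nat[symmetric])
    then have "perm_pol (swap a b \<circ> word_prod ws) delta = - (of_int (sign (word_prod ws)) * delta)"
      using Cons.IH[OF ab(2)] by (simp only: perm_perm[symmetric])
    then show ?case by (simp only: w word_prod_Cons sgn) simp
  qed
  then show "\<sigma> \<in> W \<Longrightarrow> perm_pol \<sigma> delta = of_int (sign \<sigma>) * delta"
    using exists_word by blast
qed

definition antisym :: "mpol \<Rightarrow> mpol" where
  "antisym f = (\<Sum>\<sigma>\<in>W. of_int (sign \<sigma>) * perm_pol \<sigma> f)"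

lemma antisym_add: "antisym (f + g) = antisym f + antisym g"
  by (simp add: antisym_def distrib_left sum.distrib)

lemma antisym_mult_invariant: "\<forall>\<sigma>\<in>W. perm_pol \<sigma> g = g \<Longrightarrow> antisym (f * g) = antisym f * g"
  by (simp add: antisym_def sum_distrib_right mult.assoc)

lemma antisym_delta: "antisym delta = of_nat (card W) * delta"
proof -
  have "antisym delta = (\<Sum>\<sigma>\<in>W. delta)"
    unfolding antisym_def by (rule sum.cong) (simp_all add: perm_delta sign_def)
  then show ?thesis by simp
qed

lemma delta_dvd_antisym: "delta dvd antisym f"
  unfolding delta_def
proof (rule prod_roots_dvd[OF finite_pairs])
  fix p q assume "(p, q) \<in> pairs"
  then have pq: "p < q" "rel p q" by (auto simp: pairs_def)
  then have neq: "p \<noteq> q" by blast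
  let ?s = "swap p q"
  have s: "?s \<in> W" by (rule W_swap[OF pq(2)])
  have of_int: "perm_pol ?s (of_int n) = of_int n" for n
    by (cases n rule: int_cases2) (simp_all add: cst_of_nat[symmetric])
  have "perm_pol ?s (antisym f) = (\<Sum>\<sigma>\<in>W. of_int (sign \<sigma>) * perm_pol (?s \<circ> \<sigma>) f)"
    by (simp add: antisym_def perm_perm of_int)
  also have "\<dots> = (\<Sum>\<sigma>\<in>W. - (of_int (sign \<sigma>) * perm_pol \<sigma> f))"
  proof (rule sum.reindex_bij_witness[of _ "\<lambda>\<sigma>. ?s \<circ> \<sigma>" "\<lambda>\<sigma>. ?s \<circ> \<sigma>"])
    fix \<sigma> assume \<sigma>: "\<sigma> \<in> W"
    show "?s \<circ> (?s \<circ> \<sigma>) = \<sigma>" "?s \<circ> (?s \<circ> \<sigma>) = \<sigma>" by (simp_all add: o_assoc)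
    show "?s \<circ> \<sigma> \<in> W" "?s \<circ> \<sigma> \<in> W" using s \<sigma> W_comp by blast+
    have "sign (?s \<circ> \<sigma>) = - sign \<sigma>"
      using sign_compose[OF permutation_swap_id[of p q] W_permutation[OF \<sigma>]] neq by (simp add: sign_swap_id)
    then show "- (of_int (sign (?s \<circ> \<sigma>)) * perm_pol (?s \<circ> \<sigma>) f) = of_int (sign \<sigma>) * perm_pol (?s \<circ> \<sigma>) f"
      by simp
  qed
  finally have "perm_pol ?s (antisym f) = - antisym f" by (simp add: antisym_def sum_negf)
  \<comment> \<open>An alternating polynomial minus its reflection is twice itself, and 2 is
    invertible among the constants.\<close>
  then have "var p - var q dvd 2 * antisym f"
    using swap_diff_dvd[of p q "antisym f"] by simp
  then have "var p - var q dvd cst (1 / 2) * (2 * antisym f)" by (rule dvd_mult)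
  moreover have "cst (1 / 2) * 2 = (1 :: mpol)"
    using cst_mult[of "1/2" 2] cst_of_nat[of 2] by simp
  then have "cst (1 / 2) * (2 * antisym f) = antisym f" by (simp only: mult.assoc[symmetric]) simp
  ultimately show "p < q \<and> var p - var q dvd antisym f" using pq by simp
qed

lemma delta_nonzero: "delta \<noteq> 0"
  unfolding delta_def using finite_pairs by (auto simp: split_beta pairs_def)

text \<open>Antisymmetrisation is linear over the invariants and lands in the multiples of
  \<open>delta\<close>; a generator without constant term therefore leaves a cofactor without
  constant term. For \<open>delta\<close> itself the cofactor is the order of the group, which is
  why it is not in the ideal.\<close>

lemma antisym_I: "x \<in> I \<Longrightarrow> \<exists>h. antisym x = delta * h \<and> const_coeff h = 0"
proof (induction rule: I_induct)
    case zero
    show ?case by (rule exI[of _ 0]) (simp add: antisym_def)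
  next
    case (add x y)
    then obtain h k where "antisym x = delta * h" "const_coeff h = 0" "antisym y = delta * k" "const_coeff k = 0"
      by blast
    then show ?case by (intro exI[of _ "h + k"]) (simp add: antisym_add distrib_left)
  next
    case (gen a g)
    obtain b where b: "antisym a = delta * b" using delta_dvd_antisym unfolding dvd_def by blast
    have "antisym (a * g) = delta * (b * g)"
      using gen(2) antisym_mult_invariant[of g a] b by (simp add: invs_def mult.assoc)
    then show ?case using gen(2) by (intro exI[of _ "b * g"]) (simp add: invs_def)
qed

lemma delta_notin_I: "delta \<notin> I"
proof
  assume "delta \<in> I"
  then obtain h where h: "antisym delta = delta * h" "const_coeff h = 0" using antisym_I by blast
  then have "h = of_nat (card W)"
    using delta_nonzero unfolding antisym_delta by simp
  with h(2) have "card W = 0" by (simp add: cst_of_nat[symmetric])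
  then show False using finite_W W_id by (metis card_eq_0_iff empty_iff)
qed

end

lemma card_eq_by_involution:
  assumes "\<And>x. x \<in> A \<Longrightarrow> g (f x) = x \<and> f x \<in> B" "\<And>x. x \<in> B \<Longrightarrow> f (g x) = x \<and> g x \<in> A"
  shows "card A = card B"
proof -
  have "bij_betw f A B" by (rule bij_betw_byWitness[where f' = g]) (use assms in blast)+
  then show ?thesis by (rule bij_betw_same_card)
qed

context young_idx
begin

lemma bgg_eq: 
  assumes "red ws"
  shows "bgg simple_roots (word_prod ws) f = nabla_word ws f"
proof -
  have W: "word_prod ws \<in> W" using assms word_in_W by (simp add: red_def)
  let ?us = "SOME us. reduced simple_roots (word_prod ws) us"
  have "reduced simple_roots (word_prod ws) ws" using assms by (simp add: reduced_iff[OF W])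
  then have "reduced simple_roots (word_prod ws) ?us" by (rule someI)
  then have "red ?us" "word_prod ?us = word_prod ws" by (simp_all add: reduced_iff[OF W])
  from nabla_word_reduced_unique[OF this(1) assms this(2)] show ?thesis
    by (simp add: bgg_def nabla_word_def)
qed

section \<open>The longest element\<close>

definition w0 :: "index \<Rightarrow> index" where
  "w0 = longest roots simple_roots"

lemma w0_W: "w0 \<in> W" and w0_max: "\<sigma> \<in> W \<Longrightarrow> len \<sigma> \<le> len w0"
proof -
  have bound: "wlen simple_roots \<sigma> < Suc (card pairs)" if "\<sigma> \<in> W" for \<sigma>
    using wlen_eq[OF that] card_mono[OF finite_pairs Inv_subset[of \<sigma>]] by (simp add: len_def)
  have w: "w0 = arg_max (wlen simple_roots) (\<lambda>\<sigma>. \<sigma> \<in> W)"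
    unfolding w0_def longest_def weyl_eq ..
  have "w0 \<in> W \<and> (\<forall>\<sigma>. \<sigma> \<in> W \<longrightarrow> wlen simple_roots \<sigma> \<le> wlen simple_roots w0)"
    unfolding w by (rule arg_max_nat_lemma[of "\<lambda>\<sigma>. \<sigma> \<in> W", OF W_id]) (use bound in blast)
  then show "w0 \<in> W" "\<sigma> \<in> W \<Longrightarrow> len \<sigma> \<le> len w0" by (auto simp: wlen_eq)
qed

text \<open>If the inverse of \<open>w0\<close> kept the order of some adjacent pair, multiplying by
  that transposition would lengthen \<open>w0\<close>. Chaining adjacent pairs gives the reversal
  for the inverse, hence for \<open>w0\<close>.\<close>

lemma w0_reverses: "p < q \<Longrightarrow> rel p q \<Longrightarrow> w0 q < w0 p"
proof -
  have adj: "invf w0 b < invf w0 a" if ab: "adj a b" for a b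
  proof (rule ccontr)
    assume "\<not> invf w0 b < invf w0 a"
    moreover have "invf w0 a \<noteq> invf w0 b" using W_inv[OF w0_W] adj_neq[OF ab] by simp
    ultimately have "invf w0 a < invf w0 b" by (meson linorder_neqE)
    from len_ascent[OF w0_W ab this] w0_max[OF W_comp[OF W_swap[OF adj_rel[OF ab]] w0_W]]
    show False by simp
  qed
  have inv: "invf w0 q < invf w0 p" if "p < q" "rel p q" for p q
    by (rule rel_chain[where R = "\<lambda>x y. invf w0 y < invf w0 x", OF _ _ that]) (erule adj, erule (1) less_trans[rotated])
  assume pq: "p < q" "rel p q"
  show "w0 q < w0 p"
  proof (rule ccontr)
    assume "\<not> w0 q < w0 p"
    moreover have "w0 p \<noteq> w0 q" using w0_W pq(1) by simp
    ultimately have "w0 p < w0 q" by (meson linorder_neqE)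
    from inv[OF this] pq w0_W show False by (simp add: W_rel_iff less_not_sym)
  qed
qed

lemma Inv_w0: "Inv w0 = pairs"
  unfolding Inv_def pairs_def using w0_reverses by blast

lemma len_w0: "len w0 = card pairs"
  by (simp add: len_def Inv_w0)

lemma len_le_pairs: "len \<sigma> \<le> card pairs"
  unfolding len_def by (rule card_mono[OF finite_pairs Inv_subset])

text \<open>A permutation with all pairs inverted reverses each class, so composed with the inverse
  of \<open>w0\<close> it is increasing on the classes and thus the identity.\<close>

lemma w0_unique:
  assumes \<sigma>: "\<sigma> \<in> W" and len: "len \<sigma> = card pairs"
  shows "\<sigma> = w0"
proof -
  have "Inv \<sigma> = pairs"
    using len card_subset_eq[OF finite_pairs Inv_subset] by (simp add: len_def)
  then have rev: "\<sigma> q < \<sigma> p" if "p < q" "rel p q" for p q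
    using that unfolding Inv_def pairs_def by blast
  let ?u = "\<sigma> \<circ> invf w0"
  have u: "?u \<in> W" using \<sigma> w0_W W_comp W_inv by blast
  have iW: "invf w0 \<in> W" using W_inv[OF w0_W] .
  have "Inv ?u = {}"
  proof (rule ccontr)
    assume "Inv ?u \<noteq> {}"
    then obtain p q where pq: "p < q" "rel p q" "?u q < ?u p" unfolding Inv_def by blast
    let ?a = "invf w0 p" and ?b = "invf w0 q"
    have rel: "rel ?a ?b" using pq(2) W_rel_iff[OF iW] by blast
    have "?a \<noteq> ?b" using iW pq(1) by simp
    then consider "?a < ?b" | "?b < ?a" by (meson linorder_neqE)
    then show False
    proof cases
      case 1
      from w0_reverses[OF this rel] pq(1) w0_W show False by (simp add: less_not_sym)
    next
      case 2
      from rev[OF this rel_sym[OF rel]] pq(3) show False by (simp add: less_not_sym)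
    qed
  qed
  then have "?u = id" using W_id_if_no_Inv[OF u] by blast
  then have "?u \<circ> w0 = w0" by simp
  then show ?thesis using w0_W by (simp add: o_assoc[symmetric])
qed

lemma Inv_iff: "x \<in> Inv \<sigma> \<longleftrightarrow> fst x < snd x \<and> rel (fst x) (snd x) \<and> \<sigma> (snd x) < \<sigma> (fst x)"
  by (cases x) (simp add: Inv_def)

lemma pairs_iff: "x \<in> pairs \<longleftrightarrow> fst x < snd x \<and> rel (fst x) (snd x)"
  by (cases x) (simp add: pairs_def)

lemma W_rel_sym: "\<sigma> \<in> W \<Longrightarrow> rel p q \<Longrightarrow> rel (\<sigma> q) (\<sigma> p)"
  using W_rel_iff rel_sym by blast

lemma len_inv: "\<sigma> \<in> W \<Longrightarrow> len (invf \<sigma>) = len \<sigma>"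
proof -
  assume \<sigma>: "\<sigma> \<in> W"
  note i\<sigma> = W_inv[OF \<sigma>]
  have "card (Inv \<sigma>) = card (Inv (invf \<sigma>))"
  proof (rule card_eq_by_involution[where f = "\<lambda>x. (\<sigma> (snd x), \<sigma> (fst x))"
        and g = "\<lambda>x. (invf \<sigma> (snd x), invf \<sigma> (fst x))"], goal_cases)
    case (1 x)
    then show ?case using \<sigma> W_rel_sym[OF \<sigma>] by (simp add: Inv_iff)
  next
    case (2 x)
    then show ?case using \<sigma> W_rel_sym[OF i\<sigma>] by (simp add: Inv_iff)
  qed
  then show ?thesis unfolding len_def ..
qed

lemma w0_inv_reverses: "p < q \<Longrightarrow> rel p q \<Longrightarrow> invf w0 q < invf w0 p"
proof (rule ccontr)
  note iW = W_inv[OF w0_W]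
  assume pq: "p < q" "rel p q" and "\<not> invf w0 q < invf w0 p"
  moreover have "invf w0 p \<noteq> invf w0 q" using iW pq(1) by simp
  ultimately have "invf w0 p < invf w0 q" by (meson linorder_neqE)
  from w0_reverses[OF this] pq W_rel_iff[OF iW] w0_W show False by (simp add: less_not_sym)
qed

text \<open>As \<open>w0\<close> reverses every pair, the inversions of \<sigma> after
  \<open>w0\<close> correspond to the pairs that \<sigma> does not invert.\<close>

lemma len_comp_w0: "\<sigma> \<in> W \<Longrightarrow> len \<sigma> + len (\<sigma> \<circ> w0) = card pairs"
proof -
  assume \<sigma>: "\<sigma> \<in> W"
  note iW = W_inv[OF w0_W]
  have "card (Inv (\<sigma> \<circ> w0)) = card (pairs - Inv \<sigma>)"
  proof (rule card_eq_by_involution[where f = "\<lambda>x. (w0 (snd x), w0 (fst x))"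
        and g = "\<lambda>x. (invf w0 (snd x), invf w0 (fst x))"], goal_cases)
    case (1 x)
    then have x: "fst x < snd x" "rel (fst x) (snd x)" "\<sigma> (w0 (snd x)) < \<sigma> (w0 (fst x))"
      by (simp_all add: Inv_iff)
    then have "\<not> \<sigma> (w0 (fst x)) < \<sigma> (w0 (snd x))" using less_not_sym by blast
    then show ?case
      using w0_reverses[OF x(1,2)] W_rel_sym[OF w0_W x(2)] w0_W by (simp add: Inv_iff pairs_iff)
  next
    case (2 x)
    then have x: "fst x < snd x" "rel (fst x) (snd x)" "\<not> \<sigma> (snd x) < \<sigma> (fst x)"
      by (auto simp: Inv_iff pairs_iff)
    moreover have "\<sigma> (fst x) \<noteq> \<sigma> (snd x)" using \<sigma> x(1) by simp
    ultimately have "\<sigma> (fst x) < \<sigma> (snd x)" by (meson linorder_neqE)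
    then show ?case
      using w0_inv_reverses[OF x(1,2)] W_rel_sym[OF iW x(2)] w0_W by (simp add: Inv_iff)
  qed
  then show ?thesis
    using card_Diff_subset[OF finite_Inv Inv_subset] card_mono[OF finite_pairs Inv_subset[of \<sigma>]]
    by (simp add: len_def)
qed

section \<open>The functionals dual to the Schubert polynomials\<close>

definition E :: "(index \<Rightarrow> index) \<Rightarrow> mpol \<Rightarrow> complex" where
  "E \<sigma> f = const_coeff (bgg simple_roots \<sigma> f)"

lemma E_word: "red ws \<Longrightarrow> E (word_prod ws) f = const_coeff (nabla_word ws f)"
  by (simp add: E_def bgg_eq)

lemma word_functional:
  assumes "ws \<in> words"
  shows "const_coeff (nabla_word ws f) = (if red ws then E (word_prod ws) f else 0)"
  using assms by (simp add: E_word nabla_word_not_reduced)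

lemma E_add: "\<sigma> \<in> W \<Longrightarrow> E \<sigma> (f + g) = E \<sigma> f + E \<sigma> g"
  and E_cst_mult: "\<sigma> \<in> W \<Longrightarrow> E \<sigma> (cst c * f) = c * E \<sigma> f"
  and E_I: "\<sigma> \<in> W \<Longrightarrow> x \<in> I \<Longrightarrow> E \<sigma> x = 0"
  and E_degree: "\<sigma> \<in> W \<Longrightarrow> E \<sigma> f = E \<sigma> (hcomp (len \<sigma>) f)"
proof -
  assume "\<sigma> \<in> W"
  then obtain ws where ws: "red ws" "word_prod ws = \<sigma>" using exists_red by blast
  then have w: "ws \<in> words" and l: "length ws = len \<sigma>" by (auto simp: red_def)
  note E = E_word[OF ws(1), unfolded ws(2)]
  show "E \<sigma> (f + g) = E \<sigma> f + E \<sigma> g" "E \<sigma> (cst c * f) = c * E \<sigma> f"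
    by (simp_all add: E nabla_word_add nabla_word_cst_mult w)
  show "E \<sigma> x = 0" if "x \<in> I" using I_eval[OF I_nabla_word[OF w that]] by (simp add: E)
  show "E \<sigma> f = E \<sigma> (hcomp (len \<sigma>) f)" using eval_nabla_word[OF w, of f] by (simp add: E l)
qed

lemma E_0: "\<sigma> \<in> W \<Longrightarrow> E \<sigma> 0 = 0"
  using E_I I_0 by blast

lemma E_uminus: "\<sigma> \<in> W \<Longrightarrow> E \<sigma> (- f) = - E \<sigma> f"
  using E_cst_mult[of \<sigma> "-1" f] by (simp add: cst_uminus)

lemma E_diff: "\<sigma> \<in> W \<Longrightarrow> E \<sigma> (f - g) = E \<sigma> f - E \<sigma> g"
  using E_add[of \<sigma> f "- g"] by (simp add: E_uminus)

lemma E_sum: "\<sigma> \<in> W \<Longrightarrow> E \<sigma> (sum f A) = (\<Sum>x\<in>A. E \<sigma> (f x))"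
  by (induction A rule: infinite_finite_induct) (simp_all add: E_0 E_add)

text \<open>Every word in divided differences gives either one of the functionals
  \<open>E \<sigma>\<close> or 0, so the criterion by words reduces to finitely many functionals:
  they cut out the coinvariant ideal.\<close>

lemma I_iff_E: "f \<in> Lam \<mu> \<Longrightarrow> f \<in> I \<longleftrightarrow> (\<forall>\<sigma>\<in>W. E \<sigma> f = 0)"
proof
  assume "f \<in> Lam \<mu>" "\<forall>\<sigma>\<in>W. E \<sigma> f = 0"
  then show "f \<in> I"
    by (intro I_if_nabla_words_vanish) (auto simp: word_functional red_def word_in_W)
qed (simp add: E_I)

text \<open>The functional \<open>E \<sigma>\<close> sees only the component of degree
  \<open>len \<sigma>\<close>, and lengths are bounded by the number of positive roots. This bound
  is the origin of the truncation order \<open>depth\<close>.\<close>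

lemma ordge_I:
  assumes "f \<in> Lam \<mu>" "ordge (Suc (card pairs)) f"
  shows "f \<in> I"
proof -
  have "E \<sigma> f = 0" if "\<sigma> \<in> W" for \<sigma>
  proof (rule trans[OF E_degree[OF that]])
    have "hcomp (len \<sigma>) f = 0"
      using ordge_hcomp[OF assms(2)] len_le_pairs[of \<sigma>] by (simp add: le_imp_less_Suc)
    then show "E \<sigma> (hcomp (len \<sigma>) f) = 0" by (simp add: E_0[OF that])
  qed
  then show ?thesis using I_iff_E assms(1) by blast
qed

lemma E_delta: "\<sigma> \<in> W \<Longrightarrow> \<sigma> \<noteq> w0 \<Longrightarrow> E \<sigma> delta = 0"
  by (rule trans[OF E_degree])
    (use homogeneous_hcomp[OF homogeneous_delta, of "len \<sigma>"] w0_unique[of \<sigma>] in \<open>auto simp: E_0\<close>)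

text \<open>Since \<open>delta\<close> is outside the ideal, some functional detects it, and by
  degree this can only be the one of the longest element.\<close>

lemma E_w0_delta: "E w0 delta \<noteq> 0"
  using delta_notin_I I_iff_E[OF Lam_delta] E_delta by blast

lemma pos_roots_eq: "pos_roots roots simple_roots = (\<lambda>(p, q). var p - var q) ` pairs"
proof (intro equalityI subsetI)
  have fin: "finite simple_roots"
  proof (rule finite_subset)
    show "simple_roots \<subseteq> (\<lambda>(p, q). var p - var q) ` pairs"
    proof
      fix \<alpha> assume "\<alpha> \<in> simple_roots"
      then obtain k i where ki: "\<alpha> = var (k, i) - var (k, Suc i)" "rel (k, i) (k, Suc i)" by (rule simple_rootE)
      then have "((k, i), (k, Suc i)) \<in> pairs" by (simp add: pairs_def)
      then show "\<alpha> \<in> (\<lambda>(p, q). var p - var q) ` pairs" unfolding ki(1) by (rule rev_image_eqI) simp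
    qed
  qed (simp add: finite_pairs)
  {
    fix \<alpha> assume "\<alpha> \<in> pos_roots roots simple_roots"
    then obtain c :: "mpol \<Rightarrow> nat" where \<alpha>: "\<alpha> \<in> roots" "\<alpha> = (\<Sum>\<beta>\<in>simple_roots. of_nat (c \<beta>) * \<beta>)"
      by (auto simp: pos_roots_def)
    obtain p q where pq: "\<alpha> = var p - var q" "p \<noteq> q" "rel p q" using \<alpha>(1) by (rule rootE)
    \<comment> \<open>A point at which every simple root has the value 1. Evaluation there gives the
      sum of the coefficients, and this must be the nonnegative difference of the second
      coordinates.\<close>
    let ?v = "\<lambda>p :: index. - of_nat (snd p) :: complex"
    have ev1: "mpol_eval \<beta> ?v = 1" if "\<beta> \<in> simple_roots" for \<beta>
      using that by (rule simple_rootE) simp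
    have "mpol_eval (of_nat n) ?v = of_nat n" for n
      by (simp add: cst_of_nat[symmetric])
    then have "mpol_eval \<alpha> ?v = of_nat (\<Sum>\<beta>\<in>simple_roots. c \<beta>)"
      unfolding \<alpha>(2) by (simp add: ev1)
    then have "of_nat (snd q) - of_nat (snd p) = (of_nat (\<Sum>\<beta>\<in>simple_roots. c \<beta>) :: complex)"
      by (simp add: pq(1))
    then have "of_nat (snd q) = (of_nat (snd p + (\<Sum>\<beta>\<in>simple_roots. c \<beta>)) :: complex)"
      by (simp add: algebra_simps)
    then have "snd q = snd p + (\<Sum>\<beta>\<in>simple_roots. c \<beta>)" by (simp only: of_nat_eq_iff)
    moreover have "snd p \<noteq> snd q" using pq rel_fst[OF pq(3)] by (metis prod_eq_iff)
    ultimately have "p < q" using rel_fst[OF pq(3)] by (simp add: less_prod_def')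
    with pq(3) have "(p, q) \<in> pairs" by (simp add: pairs_iff)
    then show "\<alpha> \<in> (\<lambda>(p, q). var p - var q) ` pairs" unfolding pq(1) by (rule rev_image_eqI) simp
  }
  {
    fix \<alpha> assume "\<alpha> \<in> (\<lambda>(p, q). var p - var q) ` pairs"
    then obtain x where "x \<in> pairs" "\<alpha> = (case x of (p, q) \<Rightarrow> var p - var q)" by blast
    then obtain p q where pq: "\<alpha> = var p - var q" "p < q" "rel p q"
      using pairs_iff[of x] by (cases x) simp
    have "\<exists>c :: mpol \<Rightarrow> nat. var p - var q = (\<Sum>\<beta>\<in>simple_roots. of_nat (c \<beta>) * \<beta>)"
    proof (rule rel_chain[OF _ _ pq(2,3)])
      fix a b assume "adj a b"
      then have "var a - var b \<in> simple_roots" by (simp add: simple_root_iff)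
      then show "\<exists>c :: mpol \<Rightarrow> nat. var a - var b = (\<Sum>\<beta>\<in>simple_roots. of_nat (c \<beta>) * \<beta>)"
        using fin by (intro exI[of _ "\<lambda>\<beta>. if \<beta> = var a - var b then 1 else 0"])
          (simp add: if_distrib[of of_nat] if_distrib[of "\<lambda>x. x * _"] cong: if_cong)
    next
      fix a b e
      assume "\<exists>c :: mpol \<Rightarrow> nat. var a - var b = (\<Sum>\<beta>\<in>simple_roots. of_nat (c \<beta>) * \<beta>)"
        and "\<exists>c :: mpol \<Rightarrow> nat. var b - var e = (\<Sum>\<beta>\<in>simple_roots. of_nat (c \<beta>) * \<beta>)"
      then obtain c d :: "mpol \<Rightarrow> nat" where
        cd: "var a - var b = (\<Sum>\<beta>\<in>simple_roots. of_nat (c \<beta>) * \<beta>)"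
        "var b - var e = (\<Sum>\<beta>\<in>simple_roots. of_nat (d \<beta>) * \<beta>)" by blast
      have "var a - var e = (var a - var b) + (var b - var e)" by simp
      also have "\<dots> = (\<Sum>\<beta>\<in>simple_roots. of_nat (c \<beta> + d \<beta>) * \<beta>)"
        unfolding cd by (simp add: sum.distrib distrib_right)
      finally show "\<exists>c :: mpol \<Rightarrow> nat. var a - var e = (\<Sum>\<beta>\<in>simple_roots. of_nat (c \<beta>) * \<beta>)"
        by (intro exI[of _ "\<lambda>\<beta>. c \<beta> + d \<beta>"])
    qed
    moreover have "\<alpha> \<in> roots" unfolding pq(1) using pq(2,3) by (intro root_memI) auto
    ultimately show "\<alpha> \<in> pos_roots roots simple_roots" unfolding pos_roots_def pq(1) by blast
  }
qed

lemma prod_pos_roots: "(\<Prod>\<alpha>\<in>pos_roots roots simple_roots. \<alpha>) = delta"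
proof -
  have "inj_on (\<lambda>(p, q). var p - var q) pairs"
  proof (rule inj_onI)
    fix x y assume xy: "x \<in> pairs" "y \<in> pairs" "(case x of (p, q) \<Rightarrow> var p - var q) = (case y of (p, q) \<Rightarrow> var p - var q)"
    obtain p q a b where [simp]: "x = (p, q)" "y = (a, b)" by (cases x; cases y)
    have "p \<noteq> q" using xy(1) by (auto simp: pairs_def)
    from var_diff_eq_iff[OF this, of a b] xy(3) show "x = y" by simp
  qed
  then show ?thesis unfolding pos_roots_eq delta_def by (subst prod.reindex) auto
qed

definition schub_const :: complex where
  "schub_const = E w0 delta / of_nat (card W)"

lemma schub_const_nonzero: "schub_const \<noteq> 0"
proof -
  have "card W \<noteq> 0" using finite_W W_id by (metis card_eq_0_iff empty_iff)
  then show ?thesis using E_w0_delta by (simp add: schub_const_def)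
qed

abbreviation schub :: "(index \<Rightarrow> index) \<Rightarrow> mpol" where
  "schub \<equiv> schubert roots simple_roots"

lemma schub_eq: "schub \<tau> = cst (1 / of_nat (card W)) * bgg simple_roots (invf \<tau> \<circ> w0) delta"
  unfolding schubert_def weyl_eq w0_def prod_pos_roots ..

lemma Lam_schub: "\<tau> \<in> W \<Longrightarrow> schub \<tau> \<in> Lam \<mu>"
proof -
  assume "\<tau> \<in> W"
  then have "invf \<tau> \<circ> w0 \<in> W" using w0_W W_comp W_inv by blast
  then obtain ws where "red ws" "word_prod ws = invf \<tau> \<circ> w0" using exists_red by blast
  then show ?thesis
    using bgg_eq[of ws delta] Lam_nabla_word[OF _ Lam_delta, of ws] unfolding schub_eq
    by (simp add: Lam_mult red_def)
qed

lemma E_schub: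
  assumes \<sigma>: "\<sigma> \<in> W" and \<tau>: "\<tau> \<in> W"
  shows "E \<sigma> (schub \<tau>) = (if \<sigma> = \<tau> then schub_const else 0)"
proof -
  have u: "invf \<tau> \<circ> w0 \<in> W" using \<tau> w0_W W_comp W_inv by blast
  obtain ws where ws: "red ws" "word_prod ws = \<sigma>" using exists_red \<sigma> by blast
  obtain us where us: "red us" "word_prod us = invf \<tau> \<circ> w0" using exists_red u by blast
  have words: "ws @ us \<in> words" using ws us by (simp add: red_def)
  have prod: "word_prod (ws @ us) = \<sigma> \<circ> (invf \<tau> \<circ> w0)" by (simp only: word_prod_append ws us)
  have "E \<sigma> (bgg simple_roots (invf \<tau> \<circ> w0) delta) = const_coeff (nabla_word (ws @ us) delta)"
    using E_word[OF ws(1), of "nabla_word us delta"] bgg_eq[OF us(1), of delta]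
    by (simp only: ws us nabla_word_append)
  also have "\<dots> = (if red (ws @ us) then E (\<sigma> \<circ> (invf \<tau> \<circ> w0)) delta else 0)"
    unfolding word_functional[OF words] prod ..
  also have "\<dots> = (if \<sigma> = \<tau> then E w0 delta else 0)"
  proof (cases "\<sigma> = \<tau>")
    case True
    have prod': "\<sigma> \<circ> (invf \<tau> \<circ> w0) = w0" using True \<tau> by (simp add: o_assoc)
    have "length (ws @ us) = len \<sigma> + len (invf \<tau> \<circ> w0)" using ws us by (simp add: red_def)
    also have "\<dots> = card pairs"
      using len_comp_w0[OF W_inv[OF \<tau>]] len_inv[OF \<tau>] True by simp
    finally have "red (ws @ us)"
      using words len_w0 unfolding red_def prod prod' by simp
    with True show ?thesis unfolding prod' by simp
  next
    case False
    have "\<sigma> \<circ> (invf \<tau> \<circ> w0) \<noteq> w0"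
    proof
      assume eq: "\<sigma> \<circ> (invf \<tau> \<circ> w0) = w0"
      have "\<sigma> (invf \<tau> x) = x" for x
        using fun_cong[OF eq, of "invf w0 x"] w0_W by simp
      from this[of "\<tau> _"] have "\<sigma> = \<tau>" using \<tau> by (intro ext) simp
      with False show False by simp
    qed
    then show ?thesis using False E_delta[OF W_comp[OF \<sigma> u]] by simp
  qed
  finally show ?thesis unfolding schub_eq E_cst_mult[OF \<sigma>] by (simp add: schub_const_def)
qed

lemma schubert_expansion:
  assumes "f \<in> Lam \<mu>"
  shows "f - (\<Sum>\<tau>\<in>W. cst (E \<tau> f / schub_const) * schub \<tau>) \<in> I"
proof -
  have "f - (\<Sum>\<tau>\<in>W. cst (E \<tau> f / schub_const) * schub \<tau>) \<in> Lam \<mu>"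
    using assms by (intro Lam_diff Lam_sum Lam_mult Lam_schub Lam_cst)
  moreover have "E \<sigma> (f - (\<Sum>\<tau>\<in>W. cst (E \<tau> f / schub_const) * schub \<tau>)) = 0" if \<sigma>: "\<sigma> \<in> W" for \<sigma>
  proof -
    have "E \<sigma> (\<Sum>\<tau>\<in>W. cst (E \<tau> f / schub_const) * schub \<tau>) =
        (\<Sum>\<tau>\<in>W. E \<tau> f / schub_const * (if \<sigma> = \<tau> then schub_const else 0))"
      unfolding E_sum[OF \<sigma>] by (rule sum.cong) (simp_all add: E_cst_mult[OF \<sigma>] E_schub[OF \<sigma>])
    also have "\<dots> = (\<Sum>\<tau>\<in>W. if \<tau> = \<sigma> then E \<sigma> f else 0)"
      by (rule sum.cong) (auto simp: schub_const_nonzero)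
    also have "\<dots> = E \<sigma> f" using \<sigma> finite_W by simp
    finally show ?thesis using E_diff[OF \<sigma>] by simp
  qed
  ultimately show ?thesis using I_iff_E by blast
qed

end

lemma Gam_Lam: "f \<in> Gam \<mu> \<Longrightarrow> f \<in> Lam \<mu>"
  by (simp add: Gam_def)

section \<open>The differential pairing and dual Schubert polynomials\<close>

lemma pdiff_additive:
  "pdiff q (f + g) = pdiff q f + pdiff q g"
  unfolding pdiff_def
  by (rule keysum_add) (simp_all add: single_add[symmetric] algebra_simps)

lemma pdiff_single:
  "pdiff q (Poly_Mapping.single m c) = Poly_Mapping.single (m - Poly_Mapping.single q 1) (of_nat (Poly_Mapping.lookup m q) * c)"
  unfolding pdiff_def
  by (rule keysum_single[of "\<lambda>m c. Poly_Mapping.single (m - Poly_Mapping.single q 1) (of_nat (Poly_Mapping.lookup m q) * c)"]) simp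

lemma pdiff_cst [simp]: "pdiff q (cst c) = 0"
  by (simp add: cst_def pdiff_single)

lemma expo_cancel:
  fixes m :: "index \<Rightarrow>\<^sub>0 nat"
  shows "m + Poly_Mapping.single q 1 - Poly_Mapping.single q 1 = m"
    and "Poly_Mapping.lookup m q \<noteq> 0 \<Longrightarrow> m - Poly_Mapping.single q 1 + Poly_Mapping.single q 1 = m"
    and "p \<noteq> q \<Longrightarrow> m + Poly_Mapping.single p 1 - Poly_Mapping.single q 1 = m - Poly_Mapping.single q 1 + Poly_Mapping.single p 1"
  by (rule poly_mapping_eqI; auto simp: lookup_add lookup_minus lookup_single when_def)+

lemma pdiff_mult_var: "pdiff q (f * var p) = pdiff q f * var p + (if p = q then f else 0)"
proof -
  have single: "pdiff q (Poly_Mapping.single m c * var p) =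
      pdiff q (Poly_Mapping.single m c) * var p + (if p = q then Poly_Mapping.single m c else 0)" for m c
  proof (cases "p = q")
    case True
    then show ?thesis
      using expo_cancel(2)[of m q]
      by (cases "Poly_Mapping.lookup m q = 0")
        (simp_all add: var_def mult_single pdiff_single expo_cancel(1) lookup_add distrib_right single_add
          del: One_nat_def)
  next
    case False
    then show ?thesis
      by (simp add: var_def mult_single pdiff_single expo_cancel(3) lookup_add lookup_single del: One_nat_def)
  qed
  have "pdiff q ((\<Sum>m\<in>A. Poly_Mapping.single m (Poly_Mapping.lookup f m)) * var p) =
      pdiff q (\<Sum>m\<in>A. Poly_Mapping.single m (Poly_Mapping.lookup f m)) * var p +
      (if p = q then \<Sum>m\<in>A. Poly_Mapping.single m (Poly_Mapping.lookup f m) else 0)" for A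
  proof (induction A rule: infinite_finite_induct)
    case (insert x F)
    then show ?case by (simp add: distrib_right pdiff_additive single)
  qed (use pdiff_cst[of q 0] in simp_all)
  from this[of "Poly_Mapping.keys f"] show ?thesis by (simp only: sum_single_keys)
qed

lemma pdiff_transl: "pdiff q (transl v f) = transl v (pdiff q f)"
proof (induction f rule: mpol_induct)
  case (var f p)
  have "pdiff q (g * cst c) = pdiff q g * cst c" for g c
  proof (induction g rule: mpol_induct)
    case (cst a)
    then show ?case by (simp flip: cst_mult)
  next
    case (var g r)
    have "pdiff q (g * var r * cst c) = pdiff q (g * cst c * var r)" by (simp only: mult_ac)
    also have "\<dots> = pdiff q g * cst c * var r + (if r = q then g * cst c else 0)"
      unfolding pdiff_mult_var var ..
    also have "\<dots> = pdiff q (g * var r) * cst c"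
      unfolding pdiff_mult_var by (simp add: algebra_simps)
    finally show ?case .
  qed (simp_all add: pdiff_additive distrib_right)
  then show ?case using var by (simp add: pdiff_additive pdiff_mult_var distrib_left)
qed (simp_all add: pdiff_additive)

lemma lookup_pdiff:
  "Poly_Mapping.lookup (pdiff q g) m =
    of_nat (Suc (Poly_Mapping.lookup m q)) * Poly_Mapping.lookup g (m + Poly_Mapping.single q 1)"
proof -
  have single: "Poly_Mapping.lookup (pdiff q (Poly_Mapping.single n c)) m =
    of_nat (Suc (Poly_Mapping.lookup m q)) * Poly_Mapping.lookup (Poly_Mapping.single n c) (m + Poly_Mapping.single q 1)" for n c
  proof (cases "n = m + Poly_Mapping.single q 1")
    case True
    then show ?thesis by (simp add: pdiff_single expo_cancel(1) lookup_add lookup_single del: One_nat_def)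
  next
    case False
    then have "n - Poly_Mapping.single q 1 \<noteq> m \<or> Poly_Mapping.lookup n q = 0"
      using expo_cancel(2)[of n q] by metis
    with False show ?thesis by (auto simp: pdiff_single lookup_single simp del: One_nat_def)
  qed
  have "Poly_Mapping.lookup (pdiff q (\<Sum>n\<in>A. Poly_Mapping.single n (Poly_Mapping.lookup g n))) m =
    of_nat (Suc (Poly_Mapping.lookup m q)) *
      Poly_Mapping.lookup (\<Sum>n\<in>A. Poly_Mapping.single n (Poly_Mapping.lookup g n)) (m + Poly_Mapping.single q 1)" for A
  proof (induction A rule: infinite_finite_induct)
    case (insert x F)
    show ?case
      unfolding sum.insert[OF insert.hyps] pdiff_additive lookup_add insert.IH single by (simp only: distrib_left)
  qed (use pdiff_cst[of q 0] in simp_all)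
  from this[of "Poly_Mapping.keys g"] show ?thesis by (simp only: sum_single_keys)
qed

lemma lookup_pdiff_power:
  "Poly_Mapping.lookup ((pdiff q ^^ k) g) m =
    of_nat (fact (Poly_Mapping.lookup m q + k)) / of_nat (fact (Poly_Mapping.lookup m q)) *
      Poly_Mapping.lookup g (m + Poly_Mapping.single q k)"
proof (induction k arbitrary: m)
  case (Suc k)
  let ?a = "Poly_Mapping.lookup m q"
  have n: "m + Poly_Mapping.single q 1 + Poly_Mapping.single q k = m + Poly_Mapping.single q (Suc k)"
    unfolding add.assoc single_add[symmetric] by simp
  have f: "of_nat (Suc a) * (of_nat (fact (a + 1 + k)) / of_nat (fact (a + 1))) =
      (of_nat (fact (a + Suc k)) / of_nat (fact a) :: complex)" for a
  proof -
    have "a + 1 + k = a + Suc k" by simp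
    then show ?thesis
      by (simp only: Suc_eq_plus1[symmetric] fact_Suc of_nat_mult of_nat_id times_divide_eq_right
          nonzero_mult_divide_mult_cancel_left[OF of_nat_neq_0])
  qed
  have l: "Poly_Mapping.lookup (m + Poly_Mapping.single q 1) q = ?a + 1" by (simp add: lookup_add)
  have "Poly_Mapping.lookup ((pdiff q ^^ Suc k) g) m =
      of_nat (Suc ?a) * (of_nat (fact (?a + 1 + k)) / of_nat (fact (?a + 1))) *
        Poly_Mapping.lookup g (m + Poly_Mapping.single q (Suc k))"
    unfolding funpow.simps comp_def lookup_pdiff Suc l n by (simp only: mult.assoc)
  then show ?case unfolding f .
qed simp

definition mdiff :: "(index \<Rightarrow>\<^sub>0 nat) \<Rightarrow> mpol \<Rightarrow> mpol" where
  "mdiff m g = foldr (\<lambda>q. pdiff q ^^ Poly_Mapping.lookup m q) (sorted_list_of_set (Poly_Mapping.keys m)) g"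

definition mfact :: "(index \<Rightarrow>\<^sub>0 nat) \<Rightarrow> complex" where
  "mfact m = (\<Prod>q\<in>Poly_Mapping.keys m. of_nat (fact (Poly_Mapping.lookup m q)))"

lemma mfact_nonzero [simp]: "mfact m \<noteq> 0"
  by (simp add: mfact_def)

lemma const_coeff_mdiff: "const_coeff (mdiff m g) = mfact m * Poly_Mapping.lookup g m"
proof -
  have fold: "distinct qs \<Longrightarrow> (\<And>q. q \<in> set qs \<Longrightarrow> Poly_Mapping.lookup n q = 0) \<Longrightarrow>
    Poly_Mapping.lookup (foldr (\<lambda>q. pdiff q ^^ Poly_Mapping.lookup m q) qs g) n =
    (\<Prod>q\<in>set qs. of_nat (fact (Poly_Mapping.lookup m q))) *
      Poly_Mapping.lookup g (n + (\<Sum>q\<in>set qs. Poly_Mapping.single q (Poly_Mapping.lookup m q)))" for qs n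
  proof (induction qs arbitrary: n)
    case (Cons q qs)
    have "Poly_Mapping.lookup (n + Poly_Mapping.single q (Poly_Mapping.lookup m q)) r = 0" if "r \<in> set qs" for r
      using Cons.prems that by (auto simp: lookup_add lookup_single when_def)
    from Cons.IH[OF _ this] Cons.prems show ?case
      by (simp add: lookup_pdiff_power add.assoc)
  qed simp
  have "const_coeff (mdiff m g) = mfact m *
      Poly_Mapping.lookup g (\<Sum>q\<in>Poly_Mapping.keys m. Poly_Mapping.single q (Poly_Mapping.lookup m q))"
    unfolding mdiff_def lookup_zero_eq[symmetric] mfact_def using fold[of "sorted_list_of_set (Poly_Mapping.keys m)" 0]
    by simp
  then show ?thesis by (simp only: sum_single_keys)
qed

lemma mdiff_transl: "mdiff m (transl v g) = transl v (mdiff m g)"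
proof -
  have "(pdiff q ^^ k) (transl v g) = transl v ((pdiff q ^^ k) g)" for q k g
    by (induction k) (simp_all add: pdiff_transl)
  then have "foldr (\<lambda>q. pdiff q ^^ Poly_Mapping.lookup m q) qs (transl v g) =
    transl v (foldr (\<lambda>q. pdiff q ^^ Poly_Mapping.lookup m q) qs g)" for qs
    by (induction qs) simp_all
  then show ?thesis by (simp add: mdiff_def)
qed

text \<open>The pairing is diagonal in the monomials, with the products of factorials of the
  exponents on the diagonal. Its symmetry and nondegeneracy are read off from this form.\<close>

lemma Theta_form_eq:
  "Theta_form f g = (\<Sum>m\<in>Poly_Mapping.keys f. Poly_Mapping.lookup f m * mfact m * Poly_Mapping.lookup g m)"
  unfolding Theta_form_def Theta_def mdiff_def[symmetric] const_coeff_def[symmetric]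
  by (simp add: const_coeff_mdiff mult.assoc)

lemma Theta_form_sym: "Theta_form f g = Theta_form g f"
proof -
  let ?A = "Poly_Mapping.keys f \<union> Poly_Mapping.keys g"
  have "Theta_form f g = (\<Sum>m\<in>?A. Poly_Mapping.lookup f m * mfact m * Poly_Mapping.lookup g m)"
    unfolding Theta_form_eq by (rule sum.mono_neutral_left) (auto simp: in_keys_iff)
  also have "\<dots> = (\<Sum>m\<in>?A. Poly_Mapping.lookup g m * mfact m * Poly_Mapping.lookup f m)"
    by (simp add: mult_ac)
  also have "\<dots> = Theta_form g f"
    unfolding Theta_form_eq by (rule sum.mono_neutral_right) (auto simp: in_keys_iff)
  finally show ?thesis .
qed

text \<open>Differential operators with constant coefficients commute with translations, so
  evaluating a derivative at \<open>v\<close> is the same as pairing with the Taylor expansion at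
  \<open>v\<close>.\<close>

lemma eval_Theta: "mpol_eval (Theta f g) v = Theta_form f (transl v g)"
proof -
  have "Theta f (transl v g) = transl v (Theta f g)"
    unfolding Theta_def mdiff_def[symmetric] by (simp add: mdiff_transl)
  then show ?thesis unfolding Theta_form_def by (simp add: eval_transl)
qed

lemma lookup_cst_mult: "Poly_Mapping.lookup (cst c * g) m = c * Poly_Mapping.lookup g m"
proof -
  have "Poly_Mapping.lookup (cst c * (\<Sum>n\<in>A. Poly_Mapping.single n (Poly_Mapping.lookup g n))) m =
    c * Poly_Mapping.lookup (\<Sum>n\<in>A. Poly_Mapping.single n (Poly_Mapping.lookup g n)) m" for A
    by (induction A rule: infinite_finite_induct)
      (simp_all add: distrib_left lookup_add cst_def mult_single lookup_single when_def)
  from this[of "Poly_Mapping.keys g"] show ?thesis by (simp only: sum_single_keys)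
qed

lemma Theta_form_add: "Theta_form f (g + h) = Theta_form f g + Theta_form f h"
  and Theta_form_diff: "Theta_form f (g - h) = Theta_form f g - Theta_form f h"
  and Theta_form_cst_mult: "Theta_form f (cst c * g) = c * Theta_form f g"
proof -
  show "Theta_form f (g + h) = Theta_form f g + Theta_form f h" "Theta_form f (g - h) = Theta_form f g - Theta_form f h"
    by (simp_all add: Theta_form_eq lookup_add lookup_minus algebra_simps sum.distrib sum_subtractf)
  show "Theta_form f (cst c * g) = c * Theta_form f g"
    unfolding Theta_form_eq lookup_cst_mult sum_distrib_left by (rule sum.cong) (simp_all add: mult_ac)
qed

context young_idx
begin

lemma finite_monomials: "finite {m. Poly_Mapping.keys m \<subseteq> idx \<mu> \<and> edeg m = d}"
proof (rule finite_imageD)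
  let ?M = "{m. Poly_Mapping.keys m \<subseteq> idx \<mu> \<and> edeg m = d}"
  have le: "Poly_Mapping.lookup m q \<le> edeg m" for m q
  proof (cases "q \<in> Poly_Mapping.keys m")
    case True
    then show ?thesis unfolding edeg_def by (rule member_le_sum) auto
  qed (simp add: in_keys_iff)
  have sub: "Poly_Mapping.lookup ` ?M \<subseteq>
      {f. \<forall>x. (x \<in> idx \<mu> \<longrightarrow> f x \<in> {..d}) \<and> (x \<notin> idx \<mu> \<longrightarrow> f x = 0)}"
  proof (rule image_subsetI, rule CollectI, intro allI conjI impI)
    fix m x assume "m \<in> ?M"
    then have ks: "Poly_Mapping.keys m \<subseteq> idx \<mu>" and ed: "edeg m = d" by (simp_all only: mem_Collect_eq)
    from le[of m x] show "Poly_Mapping.lookup m x \<in> {..d}" unfolding ed atMost_iff .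
    assume "x \<notin> idx \<mu>"
    then have "x \<notin> Poly_Mapping.keys m" by (rule contra_subsetD[OF ks])
    then show "Poly_Mapping.lookup m x = 0" unfolding in_keys_iff by (rule notnotD)
  qed
  show "finite (Poly_Mapping.lookup ` ?M)"
    by (rule finite_subset[OF sub finite_set_of_finite_funs[OF finite_idx finite_atMost]])
  show "inj_on Poly_Mapping.lookup ?M" by (rule inj_onI) (simp only: poly_mapping.lookup_inject)
qed

text \<open>The polynomial that represents the functional \<open>E \<sigma>\<close>, divided by
  \<open>schub_const\<close>, through the diagonal pairing; it is homogeneous of degree
  \<open>len \<sigma>\<close>. It turns out to be the dual Schubert polynomial.\<close>

definition dual_poly :: "(index \<Rightarrow> index) \<Rightarrow> mpol" where
  "dual_poly \<sigma> = (\<Sum>m | Poly_Mapping.keys m \<subseteq> idx \<mu> \<and> edeg m = len \<sigma>.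
     Poly_Mapping.single m (E \<sigma> (mpmon m) / (mfact m * schub_const)))"

lemma lookup_dual_poly:
  "Poly_Mapping.lookup (dual_poly \<sigma>) m =
     (if Poly_Mapping.keys m \<subseteq> idx \<mu> \<and> edeg m = len \<sigma> then E \<sigma> (mpmon m) / (mfact m * schub_const) else 0)"
proof -
  let ?M = "{m. Poly_Mapping.keys m \<subseteq> idx \<mu> \<and> edeg m = len \<sigma>}"
  have "Poly_Mapping.lookup (dual_poly \<sigma>) m =
      (\<Sum>n\<in>?M. if n = m then E \<sigma> (mpmon m) / (mfact m * schub_const) else 0)"
    unfolding dual_poly_def lookup_sum by (rule sum.cong) (auto simp: lookup_single when_def)
  then show ?thesis using finite_monomials[of "len \<sigma>"] by simp
qed

lemma Lam_keys: "f \<in> Lam \<mu> \<Longrightarrow> m \<in> Poly_Mapping.keys f \<Longrightarrow> Poly_Mapping.keys m \<subseteq> idx \<mu>"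
  unfolding Lam_def mem_Collect_eq by (erule bspec)

lemma Lam_dual_poly: "dual_poly \<sigma> \<in> Lam \<mu>"
  unfolding Lam_def mem_Collect_eq
proof
  fix m assume "m \<in> Poly_Mapping.keys (dual_poly \<sigma>)"
  then show "Poly_Mapping.keys m \<subseteq> idx \<mu>"
    using lookup_dual_poly[of \<sigma> m] unfolding in_keys_iff by (metis (full_types))
qed

lemma Theta_form_dual_poly:
  assumes \<sigma>: "\<sigma> \<in> W" and f: "f \<in> Lam \<mu>"
  shows "Theta_form (dual_poly \<sigma>) f = E \<sigma> f / schub_const"
proof -
  have summand: "Poly_Mapping.lookup f m * mfact m * Poly_Mapping.lookup (dual_poly \<sigma>) m =
      Poly_Mapping.lookup f m * E \<sigma> (mpmon m) / schub_const" if "m \<in> Poly_Mapping.keys f" for m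
  proof (cases "edeg m = len \<sigma>")
    case True
    have "Poly_Mapping.keys m \<subseteq> idx \<mu>" by (rule Lam_keys[OF f that])
    with True have eq: "Poly_Mapping.lookup (dual_poly \<sigma>) m = E \<sigma> (mpmon m) / (mfact m * schub_const)"
      unfolding lookup_dual_poly by (simp only: simp_thms if_True)
    have "a * c * (e / (c * s)) = a * e / s" if "c \<noteq> 0" for a c e s :: complex
      using that by (cases "s = 0") (simp_all add: field_simps)
    from this[OF mfact_nonzero] show ?thesis unfolding eq .
  next
    case False
    then have h0: "hcomp (len \<sigma>) (mpmon m) = 0"
      unfolding mpmon_def hcomp_single by (simp only: if_False)
    from E_degree[OF \<sigma>, of "mpmon m"] have "E \<sigma> (mpmon m) = 0"
      unfolding h0 E_0[OF \<sigma>] .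
    moreover have "Poly_Mapping.lookup (dual_poly \<sigma>) m = 0"
      unfolding lookup_dual_poly using False by (simp only: simp_thms if_False)
    ultimately show ?thesis by (simp only: mult_zero_right div_0)
  qed
  have "Theta_form (dual_poly \<sigma>) f = (\<Sum>m\<in>Poly_Mapping.keys f. Poly_Mapping.lookup f m * E \<sigma> (mpmon m) / schub_const)"
    unfolding Theta_form_sym[of "dual_poly \<sigma>" f] unfolding Theta_form_eq by (rule sum.cong) (simp_all add: summand)
  also have "\<dots> = E \<sigma> (\<Sum>m\<in>Poly_Mapping.keys f. cst (Poly_Mapping.lookup f m) * mpmon m) / schub_const"
    by (simp add: E_sum[OF \<sigma>] E_cst_mult[OF \<sigma>] sum_divide_distrib)
  finally show ?thesis by (simp flip: mpol_expand)
qed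

lemma Theta_form_nondegenerate: "P \<in> Lam \<mu> \<Longrightarrow> (\<And>f. f \<in> Lam \<mu> \<Longrightarrow> Theta_form P f = 0) \<Longrightarrow> P = 0"
proof (rule poly_mapping_eqI)
  fix m assume P: "P \<in> Lam \<mu>" and 0: "\<And>f. f \<in> Lam \<mu> \<Longrightarrow> Theta_form P f = 0"
  show "Poly_Mapping.lookup P m = Poly_Mapping.lookup 0 m"
  proof (cases "m \<in> Poly_Mapping.keys P")
    case True
    then have "mpmon m \<in> Lam \<mu>" using P by (intro Lam_mpmon Lam_keys)
    from 0[OF this] have "Theta_form (mpmon m) P = 0" unfolding Theta_form_sym[of "mpmon m"] .
    then show ?thesis by (simp add: Theta_form_eq mpmon_def)
  qed (simp add: in_keys_iff)
qed

text \<open>The representing polynomial satisfies the conditions by \<open>E_I\<close> and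
  \<open>E_schub\<close>. They determine it: modulo the ideal every polynomial is a combination of
  Schubert polynomials, so the pairing with all of \<open>Lam \<mu>\<close> is prescribed, and the
  pairing is nondegenerate.\<close>

lemma Pdual_eq:
  assumes \<sigma>: "\<sigma> \<in> W"
  shows "Pdual \<mu> roots simple_roots \<sigma> = dual_poly \<sigma>"
  unfolding Pdual_def weyl_eq
proof (rule the_equality)
  show "dual_poly \<sigma> \<in> Lam \<mu> \<and> (\<forall>f\<in>I. Theta_form f (dual_poly \<sigma>) = 0) \<and>
      (\<forall>\<tau>\<in>W. Theta_form (dual_poly \<sigma>) (schub \<tau>) = (if \<sigma> = \<tau> then 1 else 0))"
  proof (intro conjI ballI)
    show "dual_poly \<sigma> \<in> Lam \<mu>" by (rule Lam_dual_poly)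
    show "Theta_form f (dual_poly \<sigma>) = 0" if "f \<in> I" for f
      unfolding Theta_form_sym[of f] Theta_form_dual_poly[OF \<sigma> I_Lam[OF that]] E_I[OF \<sigma> that] by simp
    show "Theta_form (dual_poly \<sigma>) (schub \<tau>) = (if \<sigma> = \<tau> then 1 else 0)" if "\<tau> \<in> W" for \<tau>
      unfolding Theta_form_dual_poly[OF \<sigma> Lam_schub[OF that]] E_schub[OF \<sigma> that]
      using schub_const_nonzero by simp
  qed
next
  fix P
  assume P: "P \<in> Lam \<mu> \<and> (\<forall>f\<in>I. Theta_form f P = 0) \<and>
      (\<forall>\<tau>\<in>W. Theta_form P (schub \<tau>) = (if \<sigma> = \<tau> then 1 else 0))"
  have "Theta_form P f = Theta_form (dual_poly \<sigma>) f" if f: "f \<in> Lam \<mu>" for f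
  proof -
    let ?g = "\<Sum>\<tau>\<in>W. cst (E \<tau> f / schub_const) * schub \<tau>"
    have "Theta_form P (f - ?g) = 0"
      unfolding Theta_form_sym[of P] using P schubert_expansion[OF f] by blast
    then have "Theta_form P f = Theta_form P ?g" by (simp add: Theta_form_diff)
    also have "\<dots> = (\<Sum>\<tau>\<in>W. E \<tau> f / schub_const * Theta_form P (schub \<tau>))"
    proof -
      have "Theta_form P 0 = 0" using Theta_form_diff[of P 0 0] by simp
      then have "Theta_form P (\<Sum>\<tau>\<in>A. cst (E \<tau> f / schub_const) * schub \<tau>) =
          (\<Sum>\<tau>\<in>A. E \<tau> f / schub_const * Theta_form P (schub \<tau>))" for A
        by (induction A rule: infinite_finite_induct) (simp_all add: Theta_form_add Theta_form_cst_mult)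
      then show ?thesis .
    qed
    also have "\<dots> = (\<Sum>\<tau>\<in>W. if \<tau> = \<sigma> then E \<sigma> f / schub_const else 0)"
    proof (rule sum.cong)
      fix \<tau> assume "\<tau> \<in> W"
      then have "Theta_form P (schub \<tau>) = (if \<sigma> = \<tau> then 1 else 0)" using P by blast
      then show "E \<tau> f / schub_const * Theta_form P (schub \<tau>) = (if \<tau> = \<sigma> then E \<sigma> f / schub_const else 0)"
        by simp
    qed simp
    also have "\<dots> = Theta_form (dual_poly \<sigma>) f"
      using \<sigma> finite_W by (simp add: Theta_form_dual_poly[OF \<sigma> f])
    finally show ?thesis .
  qed
  then have "Theta_form (P - dual_poly \<sigma>) f = 0" if "f \<in> Lam \<mu>" for f
    unfolding Theta_form_sym[of _ f] Theta_form_diff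
    unfolding Theta_form_sym[of f] using that by simp
  then show "P = dual_poly \<sigma>"
    using Theta_form_nondegenerate[of "P - dual_poly \<sigma>"] P Lam_dual_poly by (simp add: Lam_diff)
qed

text \<open>The functionals on all polynomials that kill the coinvariant ideal; after translation to a
  point they cut out the spaces spanned by the dual Schubert functionals.\<close>

definition Ann :: "(mpol \<Rightarrow> complex) set" where
  "Ann = {\<phi>. (\<forall>f g. \<phi> (f + g) = \<phi> f + \<phi> g) \<and> (\<forall>c f. \<phi> (cst c * f) = c * \<phi> f) \<and> (\<forall>f\<in>I. \<phi> f = 0)}"

text \<open>Different \<phi> may give the same functional here, since the Taylor expansion of a
  symmetric polynomial at \<open>v\<close> is constrained by the stabiliser of
  \<open>v\<close>.\<close>

definition chi :: "(mpol \<Rightarrow> complex) \<Rightarrow> vec \<Rightarrow> mpol \<Rightarrow> complex" where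
  "chi \<phi> v = (\<lambda>\<gamma>. if \<gamma> \<in> Gam \<mu> then \<phi> (transl v \<gamma>) else 0)"

lemma Ann_add: "\<phi> \<in> Ann \<Longrightarrow> \<phi> (f + g) = \<phi> f + \<phi> g" and Ann_cst: "\<phi> \<in> Ann \<Longrightarrow> \<phi> (cst c * f) = c * \<phi> f"
  and Ann_I: "\<phi> \<in> Ann \<Longrightarrow> f \<in> I \<Longrightarrow> \<phi> f = 0"
  by (auto simp: Ann_def)

lemma Ann_0: "\<phi> \<in> Ann \<Longrightarrow> \<phi> 0 = 0"
  using Ann_I I_0 by blast

lemma Ann_diff: "\<phi> \<in> Ann \<Longrightarrow> \<phi> (f - g) = \<phi> f - \<phi> g"
  using Ann_add[of \<phi> "f - g" g] by simp

lemma Ann_sum: "\<phi> \<in> Ann \<Longrightarrow> \<phi> (sum f A) = (\<Sum>x\<in>A. \<phi> (f x))"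
  by (induction A rule: infinite_finite_induct) (simp_all add: Ann_0 Ann_add)

lemma Ann_cong: "\<phi> \<in> Ann \<Longrightarrow> f - g \<in> I \<Longrightarrow> \<phi> f = \<phi> g"
  using Ann_I[of \<phi> "f - g"] by (simp add: Ann_diff)

lemma sum_fun_apply: "(\<Sum>x\<in>A. f x) y = (\<Sum>x\<in>A. f x y)"
  for f :: "'i \<Rightarrow> mpol \<Rightarrow> complex"
  by (induction A rule: infinite_finite_induct) simp_all

lemma Dfun_eq:
  assumes "\<sigma> \<in> W"
  shows "Dfun \<mu> roots simple_roots \<sigma> v = chi (\<lambda>f. E \<sigma> f / schub_const) v"
  by (rule ext) (simp add: Dfun_def chi_def Pdual_eq[OF assms] eval_Theta Theta_form_dual_poly[OF assms] Lam_transl Gam_Lam)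

lemma Dspace_eq: "Dspace \<mu> roots simple_roots v = (\<lambda>\<phi>. chi \<phi> v) ` Ann"
proof
  have "functional.subspace ((\<lambda>\<phi>. chi \<phi> v) ` Ann)"
    unfolding functional.subspace_def
  proof (intro conjI ballI allI)
    have "(\<lambda>f. 0) \<in> Ann" by (simp add: Ann_def)
    then show "0 \<in> (\<lambda>\<phi>. chi \<phi> v) ` Ann"
      by (rule rev_image_eqI) (simp add: chi_def fun_eq_iff)
  next
    fix x y assume "x \<in> (\<lambda>\<phi>. chi \<phi> v) ` Ann" "y \<in> (\<lambda>\<phi>. chi \<phi> v) ` Ann"
    then obtain \<phi> \<psi> where *: "\<phi> \<in> Ann" "\<psi> \<in> Ann" "x = chi \<phi> v" "y = chi \<psi> v" by blast
    then have "(\<lambda>f. \<phi> f + \<psi> f) \<in> Ann" by (simp add: Ann_def algebra_simps)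
    then show "x + y \<in> (\<lambda>\<phi>. chi \<phi> v) ` Ann"
      by (rule rev_image_eqI) (simp add: chi_def fun_eq_iff *)
  next
    fix c x assume "x \<in> (\<lambda>\<phi>. chi \<phi> v) ` Ann"
    then obtain \<phi> where *: "\<phi> \<in> Ann" "x = chi \<phi> v" by blast
    then have "(\<lambda>f. c * \<phi> f) \<in> Ann" by (simp add: Ann_def algebra_simps)
    then show "cscale c x \<in> (\<lambda>\<phi>. chi \<phi> v) ` Ann"
      by (rule rev_image_eqI) (simp add: chi_def fun_eq_iff * cscale_def)
  qed
  moreover have "(\<lambda>\<sigma>. Dfun \<mu> roots simple_roots \<sigma> v) ` weyl roots \<subseteq> (\<lambda>\<phi>. chi \<phi> v) ` Ann"
    unfolding weyl_eq
  proof
    fix x assume "x \<in> (\<lambda>\<sigma>. Dfun \<mu> roots simple_roots \<sigma> v) ` W"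
    then obtain \<sigma> where \<sigma>: "\<sigma> \<in> W" "x = Dfun \<mu> roots simple_roots \<sigma> v" by blast
    then have "(\<lambda>f. E \<sigma> f / schub_const) \<in> Ann" by (simp add: Ann_def E_add E_cst_mult E_I add_divide_distrib)
    then show "x \<in> (\<lambda>\<phi>. chi \<phi> v) ` Ann" by (rule rev_image_eqI) (simp add: \<sigma> Dfun_eq)
  qed
  ultimately show "Dspace \<mu> roots simple_roots v \<subseteq> (\<lambda>\<phi>. chi \<phi> v) ` Ann"
    unfolding Dspace_def by (intro functional.span_minimal)
next
  show "(\<lambda>\<phi>. chi \<phi> v) ` Ann \<subseteq> Dspace \<mu> roots simple_roots v"
  proof
    fix x assume "x \<in> (\<lambda>\<phi>. chi \<phi> v) ` Ann"
    then obtain \<phi> where \<phi>: "\<phi> \<in> Ann" "x = chi \<phi> v" by blast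
    \<comment> \<open>The Schubert polynomials are a basis modulo the ideal, so the coefficients of
      \<phi> in the dual basis are its values on them.\<close>
    have "x = (\<Sum>\<sigma>\<in>W. cscale (\<phi> (schub \<sigma>)) (Dfun \<mu> roots simple_roots \<sigma> v))"
    proof (rule ext)
      fix \<gamma>
      show "x \<gamma> = (\<Sum>\<sigma>\<in>W. cscale (\<phi> (schub \<sigma>)) (Dfun \<mu> roots simple_roots \<sigma> v)) \<gamma>"
      proof (cases "\<gamma> \<in> Gam \<mu>")
        case True
        let ?f = "transl v \<gamma>"
        have "\<phi> ?f = \<phi> (\<Sum>\<tau>\<in>W. cst (E \<tau> ?f / schub_const) * schub \<tau>)"
          using Ann_cong[OF \<phi>(1)] schubert_expansion Lam_transl Gam_Lam True by blast
        also have "\<dots> = (\<Sum>\<tau>\<in>W. E \<tau> ?f / schub_const * \<phi> (schub \<tau>))"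
          by (simp only: Ann_sum[OF \<phi>(1)] Ann_cst[OF \<phi>(1)])
        finally show ?thesis
          using True by (simp add: \<phi>(2) sum_fun_apply cscale_def Dfun_eq chi_def mult.commute)
      qed (simp add: \<phi>(2) sum_fun_apply cscale_def Dfun_eq chi_def)
    qed
    also have "\<dots> \<in> Dspace \<mu> roots simple_roots v"
      unfolding Dspace_def weyl_eq by (intro functional.span_sum functional.span_scale functional.span_base) blast
    finally show "x \<in> Dspace \<mu> roots simple_roots v" .
  qed
qed

lemma Ann_ordge: "\<phi> \<in> Ann \<Longrightarrow> f \<in> Lam \<mu> \<Longrightarrow> ordge (Suc (card pairs)) f \<Longrightarrow> \<phi> f = 0"
  using ordge_I Ann_I by blast

lemma Ann_comp_mult: "\<phi> \<in> Ann \<Longrightarrow> a \<in> Lam \<mu> \<Longrightarrow> (\<lambda>f. \<phi> (a * f)) \<in> Ann"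
proof -
  assume \<phi>: "\<phi> \<in> Ann" and a: "a \<in> Lam \<mu>"
  show ?thesis unfolding Ann_def
  proof (rule CollectI, intro conjI allI ballI)
    show "\<phi> (a * (f + g)) = \<phi> (a * f) + \<phi> (a * g)" for f g
      unfolding distrib_left by (rule Ann_add[OF \<phi>])
    show "\<phi> (a * (cst c * f)) = c * \<phi> (a * f)" for c f
      unfolding mult.left_commute[of a "cst c"] by (rule Ann_cst[OF \<phi>])
    show "\<phi> (a * f) = 0" if "f \<in> I" for f
      by (rule Ann_I[OF \<phi> I_mult[OF that a]])
  qed
qed

lemma Ann_comp_nabla: "\<phi> \<in> Ann \<Longrightarrow> rel p q \<Longrightarrow> p \<noteq> q \<Longrightarrow> (\<lambda>f. \<phi> (nabla p q f)) \<in> Ann"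
  by (simp add: Ann_def nabla_add nabla_cst_mult I_nabla)

lemma Ann_const_coeff: "const_coeff \<in> Ann"
  by (simp add: Ann_def I_eval)

end

section \<open>Rational functions and the smash product\<close>

lemma to_fract_sum: "to_fract (sum f A) = (\<Sum>x\<in>A. to_fract (f x))"
  by (induction A rule: infinite_finite_induct) simp_all

lemma to_fract_prod: "to_fract (prod f A) = (\<Prod>x\<in>A. to_fract (f x))"
  by (induction A rule: infinite_finite_induct) simp_all

lemma fract_cases:
  fixes x :: ratf
  obtains a b where "b \<noteq> 0" "x = to_fract a / to_fract b"
proof -
  obtain a b where "x = Fract a b" "b \<noteq> 0" by (cases x) auto
  then show ?thesis using that[of b a] by (simp add: Fract_conv_to_fract)
qed

context
  fixes \<phi> :: "mpol \<Rightarrow> mpol"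
  assumes \<phi>: "ring_map \<phi>" and inj: "\<And>f. \<phi> f = 0 \<Longrightarrow> f = 0"
begin

private lemma nz: "b \<noteq> 0 \<Longrightarrow> \<phi> b \<noteq> 0" using inj by blast

lemma fract_ext_Fract: "b \<noteq> 0 \<Longrightarrow> fract_ext \<phi> (Fract a b) = Fract (\<phi> a) (\<phi> b)"
  unfolding fract_ext_def
proof (rule the_equality)
  assume b: "b \<noteq> 0"
  then show "\<exists>c d. d \<noteq> 0 \<and> Fract a b = Fract c d \<and> Fract (\<phi> a) (\<phi> b) = Fract (\<phi> c) (\<phi> d)" by blast
  fix y assume "\<exists>c d. d \<noteq> 0 \<and> Fract a b = Fract c d \<and> y = Fract (\<phi> c) (\<phi> d)"
  then obtain c d where cd: "d \<noteq> 0" "Fract a b = Fract c d" "y = Fract (\<phi> c) (\<phi> d)" by blast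
  then have "a * d = c * b" using b by (simp add: eq_fract)
  then have "\<phi> a * \<phi> d = \<phi> c * \<phi> b" using ring_map_mult[OF \<phi>] by metis
  then show "y = Fract (\<phi> a) (\<phi> b)" using cd b nz by (simp add: eq_fract)
qed

lemma fract_ext_quot: "b \<noteq> 0 \<Longrightarrow> fract_ext \<phi> (to_fract a / to_fract b) = to_fract (\<phi> a) / to_fract (\<phi> b)"
  using fract_ext_Fract[of b a] by (simp add: Fract_conv_to_fract)

lemma fract_ext_to_fract: "fract_ext \<phi> (to_fract a) = to_fract (\<phi> a)"
  using fract_ext_quot[of 1 a] by (simp add: ring_map_1[OF \<phi>])

lemma ring_map_fract_ext: "ring_map (fract_ext \<phi>)"
  unfolding ring_map_def
proof (intro conjI allI)
  show "fract_ext \<phi> 1 = 1" using fract_ext_to_fract[of 1] by (simp add: ring_map_1[OF \<phi>])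
  fix x y :: ratf
  obtain a b where x: "b \<noteq> 0" "x = to_fract a / to_fract b" by (rule fract_cases)
  obtain c d where y: "d \<noteq> 0" "y = to_fract c / to_fract d" by (rule fract_cases)
  have "x + y = to_fract (a * d + c * b) / to_fract (b * d)"
    using x y by (simp add: add_frac_eq)
  moreover have bd: "b * d \<noteq> 0" using x y by simp
  ultimately have "fract_ext \<phi> (x + y) = to_fract (\<phi> (a * d + c * b)) / to_fract (\<phi> (b * d))"
    by (simp only: fract_ext_quot[OF bd])
  also have "\<dots> = fract_ext \<phi> x + fract_ext \<phi> y"
    using x y nz by (simp add: fract_ext_quot ring_map_add[OF \<phi>] ring_map_mult[OF \<phi>] add_frac_eq)
  finally show "fract_ext \<phi> (x + y) = fract_ext \<phi> x + fract_ext \<phi> y" .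
  have "x * y = to_fract (a * c) / to_fract (b * d)"
    using x y by simp
  then have "fract_ext \<phi> (x * y) = to_fract (\<phi> (a * c)) / to_fract (\<phi> (b * d))"
    by (simp only: fract_ext_quot[OF bd])
  also have "\<dots> = fract_ext \<phi> x * fract_ext \<phi> y"
    using x y by (simp add: fract_ext_quot ring_map_mult[OF \<phi>])
  finally show "fract_ext \<phi> (x * y) = fract_ext \<phi> x * fract_ext \<phi> y" .
qed

end

section \<open>Translations and permutations of rational functions\<close>

lemma ring_map_divide:
  fixes \<phi> :: "'a::field \<Rightarrow> 'b::field"
  assumes \<phi>: "ring_map \<phi>"
  shows "\<phi> (x / y) = \<phi> x / \<phi> y"
proof (cases "y = 0")
  case True
  then show ?thesis by (simp add: ring_map_0[OF \<phi>])
next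
  case False
  have "\<phi> (x / y) * \<phi> y = \<phi> x" using ring_map_mult[OF \<phi>, of "x / y" y] False by simp
  moreover have "\<phi> y \<noteq> 0"
    using ring_map_mult[OF \<phi>, of y "inverse y"] False ring_map_1[OF \<phi>] by auto
  ultimately show ?thesis by (simp add: field_simps)
qed

lemma transl_eq_0: "transl v f = 0 \<Longrightarrow> f = 0"
  using transl_transl[of "- v" v f] by simp

lemma perm_eq_0: "bij \<sigma> \<Longrightarrow> perm_pol \<sigma> f = 0 \<Longrightarrow> f = 0"
proof -
  assume b: "bij \<sigma>" and 0: "perm_pol \<sigma> f = 0"
  have "perm_pol (invf \<sigma>) (perm_pol \<sigma> f) = f"
    unfolding perm_perm inv_o_cancel[OF bij_is_inj[OF b]] by (rule perm_id)
  with 0 show "f = 0" by simp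
qed

lemma ring_map_translL: "ring_map (translL v)"
  unfolding translL_def using ring_map_fract_ext[OF ring_map_transl transl_eq_0] .

lemma translL_to_fract [simp]: "translL v (to_fract f) = to_fract (transl v f)"
  unfolding translL_def using fract_ext_to_fract[OF ring_map_transl transl_eq_0] .

lemma translL_quot: "translL v (to_fract f / to_fract g) = to_fract (transl v f) / to_fract (transl v g)"
  by (simp add: ring_map_divide[OF ring_map_translL])

lemmas translL_simps [simp] = ring_map_simps[OF ring_map_translL] ring_map_divide[OF ring_map_translL]

lemma translL_translL: "translL u (translL v x) = translL (u + v) x"
proof -
  obtain a b where "x = to_fract a / to_fract b" by (rule fract_cases)
  then show ?thesis by (simp only: translL_quot transl_transl)
qed

lemma translL_0 [simp]: "translL 0 x = x"
proof -
  obtain a b where "x = to_fract a / to_fract b" by (rule fract_cases)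
  then show ?thesis by (simp only: translL_quot transl_0)
qed

context
  fixes \<sigma> :: "index \<Rightarrow> index"
  assumes \<sigma>: "bij \<sigma>"
begin

lemma ring_map_permL: "ring_map (permL \<sigma>)"
  unfolding permL_def using ring_map_fract_ext[OF ring_map_perm perm_eq_0[OF \<sigma>]] .

lemma permL_to_fract: "permL \<sigma> (to_fract f) = to_fract (perm_pol \<sigma> f)"
  unfolding permL_def using fract_ext_to_fract[OF ring_map_perm perm_eq_0[OF \<sigma>]] .

lemma permL_quot: "permL \<sigma> (to_fract f / to_fract g) = to_fract (perm_pol \<sigma> f) / to_fract (perm_pol \<sigma> g)"
  by (simp add: ring_map_divide[OF ring_map_permL] permL_to_fract)

lemma permL_translL: "permL \<sigma> (translL v x) = translL (perm_vec \<sigma> v) (permL \<sigma> x)"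
proof -
  obtain a b where "x = to_fract a / to_fract b" by (rule fract_cases)
  then show ?thesis by (simp only: translL_quot permL_quot perm_transl[OF \<sigma>])
qed

end

text \<open>The operator of \<open>dagger F\<close> on rational functions: \<open>(f t\<^sub>v)\<^sup>\<dagger>\<close> sends \<open>g\<close> to \<open>t\<^bsub>-v\<^esub>(f g)\<close>.\<close>

definition dop :: "smash \<Rightarrow> ratf \<Rightarrow> ratf" where
  "dop F g = (\<Sum>v\<in>Poly_Mapping.keys F. translL (- v) (Poly_Mapping.lookup F v * g))"

lemma dop_single: "dop (Poly_Mapping.single v f) g = translL (- v) (f * g)"
  unfolding dop_def by (rule keysum_single[of "\<lambda>v f. translL (- v) (f * g)"]) simp

lemma dop_add: "dop (F + G) g = dop F g + dop G g"
  unfolding dop_def by (rule keysum_add) (simp_all add: distrib_right)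

lemma dop_sum: "dop (sum F A) g = (\<Sum>x\<in>A. dop (F x) g)"
  unfolding dop_def by (rule keysum_sum) (simp_all add: distrib_right)

lemma dop_zero [simp]: "dop 0 g = 0"
  by (simp add: dop_def)

lemma dop_uminus: "dop (- F) g = - dop F g"
  using dop_add[of F "- F" g] by (simp add: eq_neg_iff_add_eq_0 add.commute)

lemma dop_add_right: "dop F (g + h) = dop F g + dop F h"
  by (simp add: dop_def distrib_left sum.distrib)

lemma dop_sum_right: "dop F (sum g A) = (\<Sum>x\<in>A. dop F (g x))"
  by (induction A rule: infinite_finite_induct) (simp_all add: dop_add_right, simp_all add: dop_def)

lemma smash_app_dagger: "smash_app (dagger F) g = dop F g"
proof -
  have "smash_app (\<Sum>v\<in>A. Poly_Mapping.single (- v) (translL (- v) (Poly_Mapping.lookup F v))) g =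
      (\<Sum>v\<in>A. translL (- v) (Poly_Mapping.lookup F v) * translL (- v) g)" for A
    unfolding smash_app_def
    by (subst keysum_sum) (auto simp: distrib_right keysum_single[of "\<lambda>v f. f * translL v g"] simp del: mult_1_left intro!: sum.cong)
  then show ?thesis by (simp add: dagger_def dop_def)
qed

text \<open>The dagger reverses products: translating back by \<open>u\<close> turns the twisted
  factor into an untwisted one. Composing functionals with these operators therefore gives a left
  action.\<close>

lemma dop_smul: "dop (smul F G) g = dop G (dop F g)"
proof -
  have "dop (smul F G) g =
    (\<Sum>u\<in>Poly_Mapping.keys F. \<Sum>v\<in>Poly_Mapping.keys G.
      translL (- (u + v)) (Poly_Mapping.lookup F u * translL u (Poly_Mapping.lookup G v) * g))"
    by (simp add: smul_def dop_sum dop_single)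
  also have "\<dots> = (\<Sum>u\<in>Poly_Mapping.keys F. \<Sum>v\<in>Poly_Mapping.keys G.
      translL (- v) (Poly_Mapping.lookup G v * translL (- u) (Poly_Mapping.lookup F u * g)))"
  proof (intro sum.cong refl)
    fix u v
    have "translL (- (u + v)) (Poly_Mapping.lookup F u * translL u (Poly_Mapping.lookup G v) * g) =
      translL (- v) (translL (- u) (Poly_Mapping.lookup F u * translL u (Poly_Mapping.lookup G v) * g))"
      by (simp only: translL_translL minus_add_distrib add.commute)
    also have "translL (- u) (Poly_Mapping.lookup F u * translL u (Poly_Mapping.lookup G v) * g) =
        Poly_Mapping.lookup G v * translL (- u) (Poly_Mapping.lookup F u * g)"
      by (simp only: translL_simps translL_translL left_minus translL_0) (simp only: mult_ac)
    finally show "translL (- (u + v)) (Poly_Mapping.lookup F u * translL u (Poly_Mapping.lookup G v) * g) =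
      translL (- v) (Poly_Mapping.lookup G v * translL (- u) (Poly_Mapping.lookup F u * g))" .
  qed
  also have "\<dots> = (\<Sum>u\<in>Poly_Mapping.keys F. dop G (translL (- u) (Poly_Mapping.lookup F u * g)))"
    by (simp add: dop_def)
  also have "\<dots> = dop G (dop F g)"
    by (simp only: dop_sum_right[symmetric] dop_def[of F])
  finally show ?thesis .
qed

lemma dop_emb: "dop (emb f) g = f * g"
  by (simp add: emb_def dop_single)

lemma Smu_bij: "\<sigma> \<in> Smu \<mu> \<Longrightarrow> bij \<sigma>"
  by (auto simp: Smu_def permutes_bij)

lemma Sblock_Smu: "\<sigma> \<in> Sblock \<mu> k \<Longrightarrow> \<sigma> \<in> Smu \<mu>"
  by (simp add: Sblock_def)

lemma dop_conj_single:
  assumes "bij \<sigma>"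
  shows "dop (conj_smash \<sigma> (Poly_Mapping.single v f)) g = translL (- perm_vec \<sigma> v) (permL \<sigma> f * g)"
proof -
  have "conj_smash \<sigma> (Poly_Mapping.single v f) = Poly_Mapping.single (perm_vec \<sigma> v) (permL \<sigma> f)"
    unfolding conj_smash_def
    by (rule keysum_single[of "\<lambda>v f. Poly_Mapping.single (perm_vec \<sigma> v) (permL \<sigma> f)"])
      (simp add: ring_map_simps[OF ring_map_permL[OF assms]])
  then show ?thesis by (simp add: dop_single)
qed

lemma dop_Xgen:
  "dop (Xgen \<mu> k v f) g = (\<Sum>\<sigma>\<in>Sblock \<mu> k. to_fract (cst (1 / of_nat (fact (msize \<mu> k)))) *
     permL \<sigma> (to_fract f / (\<Prod>j\<in>{2..msize \<mu> k}. to_fract (var (k, 1) - var (k, j)))) * translL (- perm_vec \<sigma> v) g)"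
proof -
  define h where "h = to_fract f / (\<Prod>j\<in>{2..msize \<mu> k}. to_fract (var (k, 1) - var (k, j)))"
  define c where "c = to_fract (cst (1 / of_nat (fact (msize \<mu> k))))"
  have c: "1 / of_nat (fact (msize \<mu> k)) = c"
  proof -
    have "cst (1 / of_nat (fact (msize \<mu> k))) * of_nat (fact (msize \<mu> k)) = 1"
      by (simp add: cst_of_nat[symmetric] cst_mult[symmetric] del: of_nat_fact)
    then have "c * to_fract (of_nat (fact (msize \<mu> k))) = 1"
      unfolding c_def by (metis to_fract_1 to_fract_mult)
    moreover have "to_fract (of_nat n :: mpol) = of_nat n" for n by (induction n) simp_all
    ultimately have "c * of_nat (fact (msize \<mu> k)) = 1" by (simp only:)
    then show ?thesis by (metis divide_eq_eq mult_zero_right zero_neq_one)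
  qed
  have "smul (tr v) (emb h) = Poly_Mapping.single v (translL v h)"
    unfolding smul_def tr_def emb_def by (cases "h = 0") simp_all
  then have "dop (Xgen \<mu> k v f) g =
      (\<Sum>\<sigma>\<in>Sblock \<mu> k. translL (- perm_vec \<sigma> v) (permL \<sigma> (translL v h) * (c * g)))"
    unfolding Xgen_def sym_block_def h_def[symmetric] c dop_smul dop_emb dop_sum
    by (intro sum.cong refl) (simp only: dop_conj_single[OF Smu_bij[OF Sblock_Smu]])
  also have "\<dots> = (\<Sum>\<sigma>\<in>Sblock \<mu> k. c * permL \<sigma> h * translL (- perm_vec \<sigma> v) g)"
  proof (intro sum.cong refl)
    fix \<sigma> assume "\<sigma> \<in> Sblock \<mu> k"
    then have b: "bij \<sigma>" using Smu_bij Sblock_Smu by blast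
    have "translL u c = c" for u unfolding c_def by simp
    then show "translL (- perm_vec \<sigma> v) (permL \<sigma> (translL v h) * (c * g)) = c * permL \<sigma> h * translL (- perm_vec \<sigma> v) g"
      by (simp only: permL_translL[OF b] translL_simps translL_translL left_minus translL_0) (simp only: mult_ac)
  qed
  finally show ?thesis unfolding h_def c_def .
qed

subsection \<open>The block symmetric groups\<close>

definition block :: "nat list \<Rightarrow> nat \<Rightarrow> index set" where
  "block \<mu> k = {p \<in> idx \<mu>. fst p = k}"

lemma finite_block: "finite (block \<mu> k)"
  using finite_idx by (simp add: block_def)

lemma block_idx: "p \<in> block \<mu> k \<Longrightarrow> p \<in> idx \<mu>" and block_fst: "p \<in> block \<mu> k \<Longrightarrow> fst p = k"
  by (simp_all add: block_def)

lemma Smu_permutes: "\<sigma> \<in> Smu \<mu> \<Longrightarrow> \<sigma> permutes idx \<mu>" and Smu_fst: "\<sigma> \<in> Smu \<mu> \<Longrightarrow> fst (\<sigma> p) = fst p"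
  by (simp_all add: Smu_def)

lemma Smu_idx: "\<sigma> \<in> Smu \<mu> \<Longrightarrow> p \<in> idx \<mu> \<Longrightarrow> \<sigma> p \<in> idx \<mu>"
  using permutes_in_image[OF Smu_permutes] by blast

lemma Smu_block: "\<sigma> \<in> Smu \<mu> \<Longrightarrow> p \<in> block \<mu> k \<Longrightarrow> \<sigma> p \<in> block \<mu> k"
  by (simp add: block_def Smu_idx Smu_fst)

lemma Smu_id: "id \<in> Smu \<mu>"
  by (simp add: Smu_def)

lemma Smu_comp: "\<sigma> \<in> Smu \<mu> \<Longrightarrow> \<tau> \<in> Smu \<mu> \<Longrightarrow> \<sigma> \<circ> \<tau> \<in> Smu \<mu>"
  by (simp add: Smu_def permutes_compose)

lemma Smu_inv_simps: "\<sigma> \<in> Smu \<mu> \<Longrightarrow> \<sigma> (invf \<sigma> p) = p" "\<sigma> \<in> Smu \<mu> \<Longrightarrow> invf \<sigma> (\<sigma> p) = p"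
  using permutes_inverses[OF Smu_permutes] by blast+

lemma Smu_inv: "\<sigma> \<in> Smu \<mu> \<Longrightarrow> invf \<sigma> \<in> Smu \<mu>"
proof -
  assume \<sigma>: "\<sigma> \<in> Smu \<mu>"
  have "fst (invf \<sigma> p) = fst p" for p
    using Smu_fst[OF \<sigma>, of "invf \<sigma> p"] Smu_inv_simps(1)[OF \<sigma>] by simp
  then show ?thesis using permutes_inv[OF Smu_permutes[OF \<sigma>]] by (simp add: Smu_def)
qed

lemma Smu_comp_inv: "\<sigma> \<in> Smu \<mu> \<Longrightarrow> \<sigma> \<circ> invf \<sigma> = id" "\<sigma> \<in> Smu \<mu> \<Longrightarrow> invf \<sigma> \<circ> \<sigma> = id"
  by (rule ext, simp add: Smu_inv_simps)+

lemma finite_Smu: "finite (Smu \<mu>)"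
  by (rule finite_subset[OF _ finite_permutations[OF finite_idx]]) (auto simp: Smu_def)

lemma Smu_swap: "p \<in> block \<mu> k \<Longrightarrow> q \<in> block \<mu> k \<Longrightarrow> swap p q \<in> Smu \<mu>"
proof -
  assume p: "p \<in> block \<mu> k" and q: "q \<in> block \<mu> k"
  have "swap p q permutes idx \<mu>" by (rule permutes_swap_id[OF block_idx[OF p] block_idx[OF q]])
  moreover have "fst (swap p q r) = fst r" for r
    using block_fst[OF p] block_fst[OF q] by (simp add: Transposition.transpose_def)
  ultimately show ?thesis by (simp add: Smu_def)
qed

lemma perm_vec_apply: "perm_vec \<sigma> v p = v (invf \<sigma> p)"
  by (simp add: perm_vec_def)

lemma perm_vec_comp: "\<sigma> \<in> Smu \<mu> \<Longrightarrow> \<tau> \<in> Smu \<mu> \<Longrightarrow> perm_vec \<sigma> (perm_vec \<tau> v) = perm_vec (\<sigma> \<circ> \<tau>) v"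
  unfolding perm_vec_def by (subst o_inv_distrib) (auto simp: Smu_bij)

lemma perm_vec_id [simp]: "perm_vec id v = v"
  by (simp add: perm_vec_def)

lemma perm_vec_inv: "\<sigma> \<in> Smu \<mu> \<Longrightarrow> perm_vec (invf \<sigma>) (perm_vec \<sigma> v) = v"
  "\<sigma> \<in> Smu \<mu> \<Longrightarrow> perm_vec \<sigma> (perm_vec (invf \<sigma>) v) = v"
  by (simp_all add: perm_vec_comp[of _ \<mu>] Smu_inv Smu_comp_inv)

lemma Cvec_perm: "\<sigma> \<in> Smu \<mu> \<Longrightarrow> v \<in> Cvec \<mu> \<Longrightarrow> perm_vec \<sigma> v \<in> Cvec \<mu>"
proof -
  assume \<sigma>: "\<sigma> \<in> Smu \<mu>" and v: "v \<in> Cvec \<mu>"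
  have "invf \<sigma> p \<notin> idx \<mu>" if "p \<notin> idx \<mu>" for p
    using that Smu_idx[OF \<sigma>, of "invf \<sigma> p"] Smu_inv_simps(1)[OF \<sigma>] by metis
  with v show ?thesis by (simp add: Cvec_def perm_vec_def)
qed

definition svec :: "complex \<Rightarrow> index \<Rightarrow> vec" where
  "svec e p = (\<lambda>q. if q = p then e else 0)"

lemma svec_1: "svec 1 p = unit_vec p" and svec_m1: "svec (- 1) p = - unit_vec p"
  by (simp_all add: svec_def unit_vec_def fun_eq_iff)

lemma svec_uminus: "- svec e p = svec (- e) p"
  by (simp add: svec_def fun_eq_iff)

lemma perm_svec: "bij \<sigma> \<Longrightarrow> perm_vec \<sigma> (svec e p) = svec e (\<sigma> p)"
  unfolding perm_vec_def svec_def by (rule ext) (metis bij_inv_eq_iff)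

text \<open>The symmetrising sum is grouped by the image \<open>p\<close> of \<open>(k, 1)\<close>.
  The groups are cosets of the stabiliser of \<open>(k, 1)\<close>, and \<open>f\<close> is
  invariant under the stabiliser, so all terms of a group agree. The constant is the order of the
  stabiliser in the block group divided by the factorial of the block size.\<close>

lemma dop_Xgen_sum:
  assumes k: "(k, 1) \<in> idx \<mu>"
    and inv: "\<And>\<sigma>. \<sigma> \<in> Smu \<mu> \<Longrightarrow> perm_vec \<sigma> (unit_vec (k, 1)) = unit_vec (k, 1) \<Longrightarrow> perm_pol \<sigma> f = f"
  obtains c where "c \<noteq> 0" "\<And>e g. dop (Xgen \<mu> k (svec e (k, 1)) f) g =
    (\<Sum>p\<in>block \<mu> k. to_fract (cst c * perm_pol (swap (k, 1) p) f) /
       (\<Prod>q\<in>block \<mu> k - {p}. to_fract (var p - var q)) * translL (svec (- e) p) g)"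
proof -
  define p0 where "p0 = (k, 1::nat)"
  let ?B = "block \<mu> k" and ?S = "Sblock \<mu> k"
  have p0: "p0 \<in> ?B" using k by (simp add: block_def p0_def)
  have prod0: "(\<Prod>j\<in>{2..msize \<mu> k}. to_fract (var (k, 1) - var (k, j))) = (\<Prod>q\<in>?B - {p0}. to_fract (var p0 - var q))"
  proof (rule prod.reindex_bij_witness[of _ snd "\<lambda>j. (k, j)"], goal_cases)
    case (2 j)
    then show ?case using k by (auto simp: block_def idx_def p0_def)
  next
    case (3 q)
    then show ?case by (simp add: block_def prod_eq_iff)
  next
    case (4 q)
    then show ?case by (cases q) (auto simp: block_def idx_def p0_def)
  qed (simp_all add: p0_def)
  have fix0: "perm_vec \<sigma> (unit_vec p0) = unit_vec p0" if "\<sigma> \<in> Smu \<mu>" "\<sigma> p0 = p0" for \<sigma>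
    using perm_svec[OF Smu_bij[OF that(1)], of 1 p0] that(2) by (simp add: svec_1)
  have swapS: "swap p0 p \<in> ?S" if "p \<in> ?B" for p
    using Smu_swap[OF p0 that] block_fst[OF that] block_fst[OF p0]
    by (auto simp: Sblock_def Transposition.transpose_def)
  have Scomp: "\<sigma> \<circ> \<tau> \<in> ?S" if "\<sigma> \<in> ?S" "\<tau> \<in> ?S" for \<sigma> \<tau>
    using that Smu_comp by (auto simp: Sblock_def)
  have finS: "finite ?S" by (rule finite_subset[OF _ finite_Smu[of \<mu>]]) (auto simp: Sblock_def)
  define h where "h = to_fract f / (\<Prod>j\<in>{2..msize \<mu> k}. to_fract (var (k, 1) - var (k, j)))"
  define H where "H p = to_fract (perm_pol (swap p0 p) f) / (\<Prod>q\<in>?B - {p}. to_fract (var p - var q))" for p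
  have perm_h: "permL \<sigma> h = H (\<sigma> p0)" if \<sigma>: "\<sigma> \<in> ?S" for \<sigma>
  proof -
    have \<sigma>': "\<sigma> \<in> Smu \<mu>" and b: "bij \<sigma>" using Sblock_Smu[OF \<sigma>] Smu_bij by auto
    let ?p = "\<sigma> p0"
    have pB: "?p \<in> ?B" by (rule Smu_block[OF \<sigma>' p0])
    have "perm_pol (swap p0 ?p \<circ> \<sigma>) f = f"
    proof (rule inv)
      show "swap p0 ?p \<circ> \<sigma> \<in> Smu \<mu>" by (rule Smu_comp[OF Smu_swap[OF p0 pB] \<sigma>'])
      from fix0[OF this] show "perm_vec (swap p0 ?p \<circ> \<sigma>) (unit_vec (k, 1)) = unit_vec (k, 1)"
        unfolding p0_def by simp
    qed
    then have "perm_pol (swap p0 ?p) (perm_pol (swap p0 ?p) (perm_pol \<sigma> f)) = perm_pol (swap p0 ?p) f"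
      by (simp only: perm_perm)
    then have pf: "perm_pol \<sigma> f = perm_pol (swap p0 ?p) f" by simp
    have "permL \<sigma> h = to_fract (perm_pol \<sigma> f) / (\<Prod>q\<in>?B - {p0}. to_fract (var ?p - var (\<sigma> q)))"
      unfolding h_def prod0 unfolding to_fract_prod[symmetric] permL_quot[OF b] by (simp add: to_fract_prod)
    also have "(\<Prod>q\<in>?B - {p0}. to_fract (var ?p - var (\<sigma> q))) = (\<Prod>q\<in>?B - {?p}. to_fract (var ?p - var q))"
    proof (rule prod.reindex_bij_witness[of _ "invf \<sigma>" \<sigma>], goal_cases)
      case (1 q)
      then show ?case using Smu_inv_simps[OF \<sigma>'] by simp
    next
      case (2 q)
      then show ?case using Smu_block[OF \<sigma>'] bij_is_inj[OF b] by (auto dest: injD)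
    next
      case (3 q)
      then show ?case using Smu_inv_simps[OF \<sigma>'] by simp
    next
      case (4 q)
      then show ?case using Smu_block[OF Smu_inv[OF \<sigma>']] Smu_inv_simps[OF \<sigma>'] by (metis Diff_iff empty_iff insert_iff)
    next
      case (5 q)
      then show ?case by simp
    qed
    finally show ?thesis unfolding H_def pf .
  qed
  define N where "N = card {\<sigma> \<in> ?S. \<sigma> p0 = p0}"
  have fibre: "card {\<sigma> \<in> ?S. \<sigma> p0 = p} = N" if "p \<in> ?B" for p
    unfolding N_def
  proof (rule card_eq_by_involution[where f = "\<lambda>\<sigma>. swap p0 p \<circ> \<sigma>" and g = "\<lambda>\<sigma>. swap p0 p \<circ> \<sigma>"])
    have "swap p0 p \<circ> (swap p0 p \<circ> \<sigma>) = \<sigma>" for \<sigma> :: "index \<Rightarrow> index" by (simp add: o_assoc)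
    then show "swap p0 p \<circ> (swap p0 p \<circ> \<sigma>) = \<sigma> \<and> swap p0 p \<circ> \<sigma> \<in> {\<sigma> \<in> ?S. \<sigma> p0 = p0}"
      if "\<sigma> \<in> {\<sigma> \<in> ?S. \<sigma> p0 = p}" for \<sigma>
      using that Scomp[OF swapS[OF \<open>p \<in> ?B\<close>]] by simp
    show "swap p0 p \<circ> (swap p0 p \<circ> \<sigma>) = \<sigma> \<and> swap p0 p \<circ> \<sigma> \<in> {\<sigma> \<in> ?S. \<sigma> p0 = p}"
      if "\<sigma> \<in> {\<sigma> \<in> ?S. \<sigma> p0 = p0}" for \<sigma>
      using that Scomp[OF swapS[OF \<open>p \<in> ?B\<close>]] by (simp add: o_assoc)
  qed
  have "id \<in> ?S" unfolding Sblock_def using Smu_id by simp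
  then have id: "id \<in> {\<sigma> \<in> ?S. \<sigma> p0 = p0}" by simp
  have "{\<sigma> \<in> ?S. \<sigma> p0 = p0} \<subseteq> ?S" by (rule Collect_restrict)
  then have fin: "finite {\<sigma> \<in> ?S. \<sigma> p0 = p0}" using finS by (rule finite_subset)
  have N: "N \<noteq> 0"
  proof
    assume "N = 0"
    then have "{\<sigma> \<in> ?S. \<sigma> p0 = p0} = {}" using fin unfolding N_def by (simp only: card_0_eq)
    with id show False by (simp only: empty_iff)
  qed
  define c :: complex where "c = of_nat N / of_nat (fact (msize \<mu> k))"
  show ?thesis
  proof (rule that)
    show "c \<noteq> 0" using N by (simp add: c_def)
    fix e g
    let ?c = "to_fract (cst (1 / of_nat (fact (msize \<mu> k))))"
    let ?G = "\<lambda>p. ?c * H p * translL (svec (- e) p) g"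
    have "dop (Xgen \<mu> k (svec e (k, 1)) f) g = (\<Sum>\<sigma>\<in>?S. ?G (\<sigma> p0))"
      unfolding dop_Xgen h_def[symmetric]
      by (rule sum.cong) (simp_all add: perm_h perm_svec[OF Smu_bij[OF Sblock_Smu]] svec_uminus p0_def[symmetric, simplified])
    also have "\<dots> = (\<Sum>p\<in>?B. \<Sum>\<sigma>\<in>{\<sigma> \<in> ?S. \<sigma> p0 = p}. ?G (\<sigma> p0))"
      by (rule sum.group[symmetric, OF finS finite_block]) (use Smu_block[OF Sblock_Smu p0] in blast)
    also have "\<dots> = (\<Sum>p\<in>?B. of_nat N * ?G p)"
      by (rule sum.cong) (simp_all add: fibre)
    also have "\<dots> = (\<Sum>p\<in>?B. to_fract (cst c * perm_pol (swap p0 p) f) /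
       (\<Prod>q\<in>?B - {p}. to_fract (var p - var q)) * translL (svec (- e) p) g)"
    proof (rule sum.cong[OF refl])
      fix p
      have "cst c = of_nat N * cst (1 / of_nat (fact (msize \<mu> k)))"
        unfolding c_def cst_of_nat[symmetric] cst_mult[symmetric] by simp
      moreover have "to_fract (of_nat n :: mpol) = of_nat n" for n by (induction n) simp_all
      ultimately have "to_fract (cst c) = of_nat N * ?c" by (simp only: to_fract_mult)
      then show "of_nat N * ?G p = to_fract (cst c * perm_pol (swap p0 p) f) /
         (\<Prod>q\<in>?B - {p}. to_fract (var p - var q)) * translL (svec (- e) p) g"
        by (simp only: H_def to_fract_mult) (simp add: mult_ac)
    qed
    finally show "dop (Xgen \<mu> k (svec e (k, 1)) f) g = (\<Sum>p\<in>?B. to_fract (cst c * perm_pol (swap (k, 1) p) f) /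
       (\<Prod>q\<in>?B - {p}. to_fract (var p - var q)) * translL (svec (- e) p) g)"
      unfolding p0_def .
  qed
qed

subsection \<open>Iterated divided differences over a set of indices\<close>

definition ddiff :: "index \<Rightarrow> index list \<Rightarrow> mpol \<Rightarrow> mpol" where
  "ddiff q bs f = foldr (\<lambda>b. nabla q b) bs f"

lemma ddiff_Nil [simp]: "ddiff q [] f = f" and ddiff_Cons [simp]: "ddiff q (b # bs) f = nabla q b (ddiff q bs f)"
  by (simp_all add: ddiff_def)

lemma ddiff_add: "q \<notin> set bs \<Longrightarrow> ddiff q bs (f + g) = ddiff q bs f + ddiff q bs g"
proof (induction bs)
  case (Cons b bs)
  then have "q \<noteq> b" by auto
  with Cons show ?case by (simp add: nabla_add)
qed simp

lemma ddiff_mult_invariant: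
  "q \<notin> set bs \<Longrightarrow> (\<And>b. b \<in> set bs \<Longrightarrow> perm_pol (swap q b) g = g) \<Longrightarrow> ddiff q bs (g * f) = g * ddiff q bs f"
proof (induction bs)
  case (Cons b bs)
  then have "q \<noteq> b" by auto
  with Cons show ?case by (simp add: nabla_mult_invariant)
qed simp

lemma ddiff_0: "q \<notin> set bs \<Longrightarrow> ddiff q bs 0 = 0"
  using ddiff_mult_invariant[of q bs 0 0] by simp

lemma ddiff_sum: "q \<notin> set bs \<Longrightarrow> ddiff q bs (sum f A) = (\<Sum>x\<in>A. ddiff q bs (f x))"
  by (induction A rule: infinite_finite_induct) (simp_all add: ddiff_0 ddiff_add)

lemma Lam_ddiff: "q \<notin> set bs \<Longrightarrow> q \<in> idx \<mu> \<Longrightarrow> set bs \<subseteq> idx \<mu> \<Longrightarrow> f \<in> Lam \<mu> \<Longrightarrow> ddiff q bs f \<in> Lam \<mu>"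
proof (induction bs)
  case (Cons b bs)
  then have "q \<noteq> b" "b \<in> idx \<mu>" by auto
  with Cons show ?case by (auto intro: Lam_nabla)
qed simp

lemma to_fract_nabla:
  "p \<noteq> q \<Longrightarrow> to_fract (nabla p q f) = (to_fract f - to_fract (perm_pol (swap p q) f)) / to_fract (var p - var q)"
proof -
  assume pq: "p \<noteq> q"
  have "to_fract (var p - var q) * to_fract (nabla p q f) = to_fract f - to_fract (perm_pol (swap p q) f)"
    unfolding to_fract_mult[symmetric] nabla_mult_root[OF pq] by simp
  moreover have "to_fract (var p - var q) \<noteq> 0" using root_nonzero[OF pq] by (simp only: to_fract_eq_0_iff not_False_eq_True)
  ultimately show ?thesis by (simp add: nonzero_eq_divide_eq mult.commute)
qed

lemma partial_fractions:
  fixes u v w y z :: "'a::field"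
  assumes "w - u \<noteq> 0" "w - v \<noteq> 0" "u - v \<noteq> 0"
  shows "(y / ((w - u) * z) - y / ((w - v) * z)) / (u - v) = y / ((w - u) * ((w - v) * z))"
proof (cases "z = 0")
  case False
  then show ?thesis using assms by (simp add: divide_simps) (simp add: algebra_simps)
qed simp

text \<open>Newton's formula for divided differences, with the poles of the right-hand side cancelling.\<close>

lemma to_fract_ddiff:
  assumes "distinct (q # bs)" "\<And>a b. a \<in> set bs \<Longrightarrow> b \<in> set bs \<Longrightarrow> perm_pol (swap a b) f = f"
  shows "to_fract (ddiff q bs f) = (\<Sum>i\<in>set (q # bs). to_fract (perm_pol (swap q i) f) /
    (\<Prod>j\<in>set (q # bs) - {i}. to_fract (var i - var j)))"
  using assms
proof (induction bs)
  case Nil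
  show ?case by (simp add: perm_id[unfolded id_def])
next
  case (Cons b bs)
  let ?T = "set bs" and ?x = "\<lambda>i. to_fract (var i)" and ?F = "\<lambda>i. to_fract (perm_pol (swap q i) f)"
  have d: "q \<noteq> b" "q \<notin> ?T" "b \<notin> ?T" using Cons.prems(1) by auto
  have IH: "to_fract (ddiff q bs f) = (\<Sum>i\<in>insert q ?T. ?F i / (\<Prod>j\<in>insert q ?T - {i}. ?x i - ?x j))"
    using Cons.IH Cons.prems by simp
  have bij: "bij (swap q b)" by simp
  have G: "to_fract (ddiff q bs f) = ?F q / (\<Prod>j\<in>?T. ?x q - ?x j) +
      (\<Sum>i\<in>?T. ?F i / ((?x i - ?x q) * (\<Prod>j\<in>?T - {i}. ?x i - ?x j)))"
  proof -
    have "(\<Prod>j\<in>insert q ?T - {i}. ?x i - ?x j) = (?x i - ?x q) * (\<Prod>j\<in>?T - {i}. ?x i - ?x j)" if "i \<in> ?T" for i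
    proof -
      have "insert q ?T - {i} = insert q (?T - {i})" using that d by blast
      then show ?thesis using d by simp
    qed
    moreover have "insert q ?T - {q} = ?T" using d by blast
    ultimately show ?thesis unfolding IH using d by simp
  qed
  \<comment> \<open>Moving the outer transposition inwards turns it into the transposition of
    \<open>i\<close> and \<open>b\<close>, in which \<open>f\<close> is symmetric.\<close>
  have sw: "perm_pol (swap q b) (perm_pol (swap q i) f) = perm_pol (swap q i) f" if "i \<in> ?T" for i
  proof -
    have "swap q b \<circ> swap q i = swap q i \<circ> swap i b"
      using that d by (intro ext) (auto simp: Transposition.transpose_def)
    then have "perm_pol (swap q b) (perm_pol (swap q i) f) = perm_pol (swap q i) (perm_pol (swap i b) f)"
      by (simp only: perm_perm)
    then show ?thesis using Cons.prems(2)[of i b] that by simp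
  qed
  have px: "permL (swap q b) (?x i - ?x j) = ?x (swap q b i) - ?x (swap q b j)" for i j
    by (simp add: ring_map_simps[OF ring_map_permL[OF bij]] permL_to_fract[OF bij])
  have \<tau>G: "to_fract (perm_pol (swap q b) (ddiff q bs f)) = ?F b / (\<Prod>j\<in>?T. ?x b - ?x j) +
      (\<Sum>i\<in>?T. ?F i / ((?x i - ?x b) * (\<Prod>j\<in>?T - {i}. ?x i - ?x j)))"
  proof -
    have swT: "swap q b j = j" if "j \<in> ?T" for j using that d by (auto intro: transpose_apply_other)
    have prT: "(\<Prod>j\<in>?T. ?x b - ?x (swap q b j)) = (\<Prod>j\<in>?T. ?x b - ?x j)"
      by (rule prod.cong) (simp_all add: swT)
    have pr: "(\<Prod>j\<in>?T - {i}. ?x i - ?x (swap q b j)) = (\<Prod>j\<in>?T - {i}. ?x i - ?x j)" for i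
      by (rule prod.cong) (simp_all add: swT)
    have "to_fract (perm_pol (swap q b) (ddiff q bs f)) = permL (swap q b) (to_fract (ddiff q bs f))"
      by (simp add: permL_to_fract[OF bij])
    also have "\<dots> = to_fract (perm_pol (swap q b) (perm_pol (swap q q) f)) / (\<Prod>j\<in>?T. ?x b - ?x j) +
      (\<Sum>i\<in>?T. ?F i / ((?x i - ?x b) * (\<Prod>j\<in>?T - {i}. ?x i - ?x j)))"
      unfolding G
      by (simp add: ring_map_simps[OF ring_map_permL[OF bij]] ring_map_divide[OF ring_map_permL[OF bij]]
          permL_to_fract[OF bij] swT sw pr prT cong: sum.cong)
    finally show ?thesis by simp
  qed
  have nz: "?x i - ?x j \<noteq> 0" if "i \<noteq> j" for i j
    using root_nonzero[OF that] by (metis to_fract_diff to_fract_eq_0_iff)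
  have "to_fract (ddiff q (b # bs) f) = (to_fract (ddiff q bs f) - to_fract (perm_pol (swap q b) (ddiff q bs f))) / (?x q - ?x b)"
    using to_fract_nabla[OF d(1)] by simp
  also have "\<dots> = ?F q / (\<Prod>j\<in>?T. ?x q - ?x j) / (?x q - ?x b) - ?F b / (\<Prod>j\<in>?T. ?x b - ?x j) / (?x q - ?x b) +
     (\<Sum>i\<in>?T. (?F i / ((?x i - ?x q) * (\<Prod>j\<in>?T - {i}. ?x i - ?x j)) -
       ?F i / ((?x i - ?x b) * (\<Prod>j\<in>?T - {i}. ?x i - ?x j))) / (?x q - ?x b))"
    unfolding G \<tau>G by (simp add: sum_subtractf sum_divide_distrib add_divide_distrib diff_divide_distrib)
  also have "(\<Sum>i\<in>?T. (?F i / ((?x i - ?x q) * (\<Prod>j\<in>?T - {i}. ?x i - ?x j)) -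
       ?F i / ((?x i - ?x b) * (\<Prod>j\<in>?T - {i}. ?x i - ?x j))) / (?x q - ?x b)) =
      (\<Sum>i\<in>?T. ?F i / ((?x i - ?x q) * ((?x i - ?x b) * (\<Prod>j\<in>?T - {i}. ?x i - ?x j))))"
    by (rule sum.cong[OF refl], rule partial_fractions; rule nz; use d in auto)
  also have "\<dots> = (\<Sum>i\<in>?T. ?F i / (\<Prod>j\<in>insert q (insert b ?T) - {i}. ?x i - ?x j))"
  proof (rule sum.cong[OF refl])
    fix i assume i: "i \<in> ?T"
    then have "insert q (insert b ?T) - {i} = insert q (insert b (?T - {i}))" using d by blast
    then show "?F i / ((?x i - ?x q) * ((?x i - ?x b) * (\<Prod>j\<in>?T - {i}. ?x i - ?x j))) =
        ?F i / (\<Prod>j\<in>insert q (insert b ?T) - {i}. ?x i - ?x j)"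
      using d by simp
  qed
  also have "?F q / (\<Prod>j\<in>?T. ?x q - ?x j) / (?x q - ?x b) = ?F q / (\<Prod>j\<in>insert q (insert b ?T) - {q}. ?x q - ?x j)"
  proof -
    have "insert q (insert b ?T) - {q} = insert b ?T" using d by blast
    then show ?thesis using d by (simp add: mult.commute)
  qed
  also have "?F b / (\<Prod>j\<in>?T. ?x b - ?x j) / (?x q - ?x b) = - (?F b / (\<Prod>j\<in>insert q (insert b ?T) - {b}. ?x b - ?x j))"
  proof -
    have "insert q (insert b ?T) - {b} = insert q ?T" using d by blast
    moreover have "y / z / (u - v) = - (y / ((v - u) * z))" for y z u v :: ratf
      by (metis divide_divide_eq_left minus_diff_eq minus_divide_right mult.commute)
    ultimately show ?thesis using d by simp
  qed
  finally show ?case using d by (simp add: add_ac perm_id[unfolded id_def])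
qed

text \<open>One step is the identity \<open>Y = x\<^sub>q \<nabla>(Y) - \<nabla>(x\<^sub>b Y)\<close> for \<open>\<nabla> = \<nabla>\<^sub>q\<^sub>b\<close>.\<close>

lemma ddiff_expansion:
  assumes "distinct (q # bs)"
  shows "f = (\<Sum>S\<in>Pow (set bs). var q ^ card (set bs - S) * ddiff q bs ((\<Prod>j\<in>S. - var j) * f))"
  using assms
proof (induction bs)
  case Nil
  show ?case by simp
next
  case (Cons b bs)
  let ?T = "set bs"
  have d: "q \<noteq> b" "q \<notin> ?T" "b \<notin> ?T" "distinct (q # bs)" using Cons.prems by auto
  let ?Y = "\<lambda>S. ddiff q bs ((\<Prod>j\<in>S. - var j) * f)"
  have step: "Y = var q * nabla q b Y + nabla q b (- var b * Y)" for Y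
  proof -
    have "nabla q b (- var b) = 1"
      by (rule nabla_unique[OF d(1)]) (use d(1) in simp)
    then show ?thesis using nabla_leibniz[OF d(1), of "- var b" Y] d(1) by simp
  qed
  have bY: "- var b * ?Y S = ddiff q bs ((\<Prod>j\<in>insert b S. - var j) * f)" if "S \<subseteq> ?T" for S
  proof -
    have "finite S" "b \<notin> S" using that d finite_subset by auto
    then have "(\<Prod>j\<in>insert b S. - var j) * f = - var b * ((\<Prod>j\<in>S. - var j) * f)" by (simp add: mult.assoc)
    moreover have "ddiff q bs (- var b * ((\<Prod>j\<in>S. - var j) * f)) = - var b * ?Y S"
    proof (rule ddiff_mult_invariant[OF d(2)])
      fix c assume "c \<in> ?T"
      then have "b \<noteq> c" using d by blast
      then show "perm_pol (swap q c) (- var b) = - var b" using d(1) by simp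
    qed
    ultimately show ?thesis by simp
  qed
  have cards: "card (insert b ?T - S) = Suc (card (?T - S))" "card (insert b ?T - insert b S) = card (?T - S)"
    if "S \<subseteq> ?T" for S
  proof -
    have "insert b ?T - S = insert b (?T - S)" "insert b ?T - insert b S = ?T - S" using that d by blast+
    then show "card (insert b ?T - S) = Suc (card (?T - S))" "card (insert b ?T - insert b S) = card (?T - S)"
      using d by simp_all
  qed
  let ?Z = "\<lambda>S. var q ^ card (insert b ?T - S) * ddiff q (b # bs) ((\<Prod>j\<in>S. - var j) * f)"
  have "f = (\<Sum>S\<in>Pow ?T. var q ^ card (?T - S) * ?Y S)" by (rule Cons.IH[OF d(4)])
  also have "\<dots> = (\<Sum>S\<in>Pow ?T. ?Z S + ?Z (insert b S))"
  proof (rule sum.cong[OF refl])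
    fix S assume "S \<in> Pow ?T"
    then have S: "S \<subseteq> ?T" by simp
    have "var q ^ card (?T - S) * ?Y S =
        var q ^ card (?T - S) * (var q * nabla q b (?Y S) + nabla q b (- var b * ?Y S))"
      using step[of "?Y S"] by simp
    then show "var q ^ card (?T - S) * ?Y S = ?Z S + ?Z (insert b S)"
      unfolding bY[OF S] cards[OF S] by (simp add: distrib_left mult_ac)
  qed
  also have "\<dots> = (\<Sum>S\<in>Pow (insert b ?T). ?Z S)"
  proof -
    have "inj_on (insert b) (Pow ?T)" using d(3) by (auto simp: inj_on_def)
    moreover have "Pow ?T \<inter> insert b ` Pow ?T = {}" using d(3) by auto
    ultimately show ?thesis
      unfolding Pow_insert by (subst sum.union_disjoint) (auto simp: sum.reindex sum.distrib)
  qed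
  finally show ?case by simp
qed

text \<open>The elementary symmetric polynomial of degree \<open>m\<close> in the negated variables
  indexed by \<open>T\<close>.\<close>

definition esym :: "index set \<Rightarrow> nat \<Rightarrow> mpol" where
  "esym T m = (\<Sum>S\<in>{S \<in> Pow T. card S = m}. \<Prod>j\<in>S. - var j)"

text \<open>Subsets of equal size are collected because the single products are not symmetric in the
  list, whereas their sums are. Only a symmetric factor can be supplied by multiplication with a
  symmetric polynomial at the shifted point.\<close>

lemma ddiff_esym_expansion:
  assumes "distinct (q # bs)"
  shows "f = (\<Sum>m\<le>length bs. var q ^ (length bs - m) * ddiff q bs (esym (set bs) m * f))"
proof -
  let ?T = "set bs"
  have q: "q \<notin> ?T" and l: "card ?T = length bs" using assms distinct_card by auto
  let ?Z = "\<lambda>S. var q ^ card (?T - S) * ddiff q bs ((\<Prod>j\<in>S. - var j) * f)"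
  have "f = (\<Sum>S\<in>Pow ?T. ?Z S)" by (rule ddiff_expansion[OF assms])
  also have "\<dots> = (\<Sum>m\<in>{..length bs}. \<Sum>S\<in>{S \<in> Pow ?T. card S = m}. ?Z S)"
    by (rule sum.group[symmetric]) (auto simp: l[symmetric] card_mono)
  also have "\<dots> = (\<Sum>m\<in>{..length bs}. var q ^ (length bs - m) * ddiff q bs (esym ?T m * f))"
  proof (rule sum.cong[OF refl])
    fix m
    have "(\<Sum>S\<in>{S \<in> Pow ?T. card S = m}. ?Z S) =
        (\<Sum>S\<in>{S \<in> Pow ?T. card S = m}. var q ^ (length bs - m) * ddiff q bs ((\<Prod>j\<in>S. - var j) * f))"
      by (rule sum.cong[OF refl]) (auto simp: card_Diff_subset finite_subset l)
    then show "(\<Sum>S\<in>{S \<in> Pow ?T. card S = m}. ?Z S) = var q ^ (length bs - m) * ddiff q bs (esym ?T m * f)"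
      by (simp add: esym_def sum_distrib_right ddiff_sum[OF q] sum_distrib_left)
  qed
  finally show ?thesis .
qed

lemma Lam_esym: "T \<subseteq> idx \<mu> \<Longrightarrow> esym T m \<in> Lam \<mu>"
  unfolding esym_def by (intro Lam_sum Lam_prod Lam_uminus Lam_var) auto

lemma perm_esym:
  assumes "inj \<sigma>" "\<sigma> ` T = T"
  shows "perm_pol \<sigma> (esym T m) = esym T m"
proof -
  have inj: "inj_on \<sigma> S" for S using assms(1) by (rule inj_on_subset) simp
  have bij: "bij_betw (image \<sigma>) {S \<in> Pow T. card S = m} {S \<in> Pow T. card S = m}"
  proof (rule bij_betw_imageI)
    show "inj_on (image \<sigma>) {S \<in> Pow T. card S = m}"
      using assms(1) by (auto simp: inj_on_def inj_image_eq_iff)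
    show "image \<sigma> ` {S \<in> Pow T. card S = m} = {S \<in> Pow T. card S = m}"
    proof (intro equalityI subsetI)
      fix S assume "S \<in> {S \<in> Pow T. card S = m}"
      then have S: "S \<subseteq> T" "card S = m" by auto
      then obtain S' where S': "S' \<subseteq> T" "S = \<sigma> ` S'" using assms(2) by (metis subset_imageE)
      then have "card S' = m" using S(2) card_image[OF inj] by metis
      with S' show "S \<in> image \<sigma> ` {S \<in> Pow T. card S = m}" by blast
    next
      fix S assume "S \<in> image \<sigma> ` {S \<in> Pow T. card S = m}"
      then obtain S' where S': "S' \<subseteq> T" "card S' = m" "S = \<sigma> ` S'" by auto
      then have "S \<subseteq> T" "card S = m" using assms(2) card_image[OF inj] by blast+
      then show "S \<in> {S \<in> Pow T. card S = m}" by simp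
    qed
  qed
  have "perm_pol \<sigma> (esym T m) = (\<Sum>S\<in>{S \<in> Pow T. card S = m}. \<Prod>j\<in>\<sigma> ` S. - var j)"
    by (simp add: esym_def prod.reindex[OF inj])
  also have "\<dots> = esym T m"
    unfolding esym_def using sum.reindex_bij_betw[OF bij, of "\<lambda>S. \<Prod>j\<in>S. - var j"] .
  finally show ?thesis .
qed

section \<open>Symmetric polynomials near a point\<close>

lemma ordge_iff_hcomp: "ordge M f \<longleftrightarrow> (\<forall>d<M. hcomp d f = 0)"
proof
  assume *: "\<forall>d<M. hcomp d f = 0"
  show "ordge M f" unfolding ordge_def
  proof (rule ballI, rule ccontr)
    fix m assume m: "m \<in> Poly_Mapping.keys f" "\<not> M \<le> edeg m"
    then have "hcomp (edeg m) f = 0" using * by simp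
    then have "Poly_Mapping.lookup f m = 0" using lookup_hcomp[of "edeg m" f m] by simp
    with m(1) show False unfolding in_keys_iff by simp
  qed
qed (simp add: ordge_hcomp)

lemma ordge_perm: "ordge M f \<Longrightarrow> ordge M (perm_pol \<sigma> f)"
  unfolding ordge_iff_hcomp perm_hcomp[symmetric] by simp

lemma ordge_var: "ordge 1 (var q)"
  unfolding ordge_1_iff by simp

lemma Gam_perm: "\<gamma> \<in> Gam \<mu> \<Longrightarrow> \<sigma> \<in> Smu \<mu> \<Longrightarrow> perm_pol \<sigma> \<gamma> = \<gamma>"
  by (simp add: Gam_def)

lemma GamI: "f \<in> Lam \<mu> \<Longrightarrow> (\<And>\<sigma>. \<sigma> \<in> Smu \<mu> \<Longrightarrow> perm_pol \<sigma> f = f) \<Longrightarrow> f \<in> Gam \<mu>"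
  by (simp add: Gam_def)

lemma Gam_cst: "cst c \<in> Gam \<mu>" by (rule GamI) simp_all

lemma Gam_1: "1 \<in> Gam \<mu>" using Gam_cst[of 1] by simp

lemma Gam_mult: "f \<in> Gam \<mu> \<Longrightarrow> g \<in> Gam \<mu> \<Longrightarrow> f * g \<in> Gam \<mu>"
  by (rule GamI) (simp_all add: Lam_mult Gam_Lam Gam_perm)

lemma Gam_add: "f \<in> Gam \<mu> \<Longrightarrow> g \<in> Gam \<mu> \<Longrightarrow> f + g \<in> Gam \<mu>"
  by (rule GamI) (simp_all add: Lam_add Gam_Lam Gam_perm)

lemma Gam_diff: "f \<in> Gam \<mu> \<Longrightarrow> g \<in> Gam \<mu> \<Longrightarrow> f - g \<in> Gam \<mu>"
  by (rule GamI) (simp_all add: Lam_diff Gam_Lam Gam_perm)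

lemma Gam_average:
  assumes "g \<in> Lam \<mu>"
  shows "(\<Sum>\<sigma>\<in>Smu \<mu>. perm_pol \<sigma> g) \<in> Gam \<mu>"
proof (rule GamI)
  show "(\<Sum>\<sigma>\<in>Smu \<mu>. perm_pol \<sigma> g) \<in> Lam \<mu>"
    by (rule Lam_sum, rule Lam_perm[OF assms], erule (1) Smu_idx)
  fix \<tau> assume \<tau>: "\<tau> \<in> Smu \<mu>"
  have "perm_pol \<tau> (\<Sum>\<sigma>\<in>Smu \<mu>. perm_pol \<sigma> g) = (\<Sum>\<sigma>\<in>Smu \<mu>. perm_pol (\<tau> \<circ> \<sigma>) g)"
    by (simp add: perm_perm)
  also have "\<dots> = (\<Sum>\<sigma>\<in>Smu \<mu>. perm_pol \<sigma> g)"
    by (rule sum.reindex_bij_witness[of _ "\<lambda>\<sigma>. invf \<tau> \<circ> \<sigma>" "\<lambda>\<sigma>. \<tau> \<circ> \<sigma>"])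
      (use \<tau> in \<open>simp_all add: o_assoc Smu_comp_inv Smu_comp Smu_inv\<close>)
  finally show "perm_pol \<tau> (\<Sum>\<sigma>\<in>Smu \<mu>. perm_pol \<sigma> g) = (\<Sum>\<sigma>\<in>Smu \<mu>. perm_pol \<sigma> g)" .
qed

lemma perm_transl_inv:
  "\<sigma> \<in> Smu \<mu> \<Longrightarrow> transl w (perm_pol \<sigma> g) = perm_pol \<sigma> (transl (perm_vec (invf \<sigma>) w) g)"
  by (simp add: perm_transl[OF Smu_bij] perm_vec_inv)

lemma const_coeff_transl: "const_coeff (transl v f) = mpol_eval f v"
  unfolding const_coeff_def eval_transl by simp

text \<open>Symmetric polynomials realise every jet at \<open>v\<close> that is invariant under the stabiliser of \<open>v\<close>,
  together with vanishing jets at finitely many other orbits: correct the jet at the rest of the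
  orbit by a product of linear forms, then average.\<close>

lemma local_interpolation:
  assumes v: "v \<in> Cvec \<mu>" and F: "finite F" "F \<subseteq> Cvec \<mu>" and h: "h \<in> Lam \<mu>"
    and stab: "\<And>\<sigma>. \<sigma> \<in> Smu \<mu> \<Longrightarrow> perm_vec \<sigma> v = v \<Longrightarrow> perm_pol \<sigma> h = h"
    and orb: "\<And>w \<sigma>. w \<in> F \<Longrightarrow> \<sigma> \<in> Smu \<mu> \<Longrightarrow> perm_vec \<sigma> w \<noteq> v"
  obtains \<gamma> where "\<gamma> \<in> Gam \<mu>" "ordge M (transl v \<gamma> - h)" "\<And>w. w \<in> F \<Longrightarrow> ordge M (transl w \<gamma>)"
proof -
  \<comment> \<open>All points where the correction has to vanish: the rest of the orbit of
    \<open>v\<close> and the orbits of the points of \<open>F\<close>.\<close>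
  define A where "A = ((\<lambda>\<sigma>. perm_vec \<sigma> v) ` Smu \<mu> - {v}) \<union> (\<Union>\<sigma>\<in>Smu \<mu>. perm_vec \<sigma> ` F)"
  have finA: "finite A" unfolding A_def using finite_Smu F(1) by simp
  have A: "w \<in> Cvec \<mu>" "w \<noteq> v" if "w \<in> A" for w
    using that v F(2) orb Cvec_perm unfolding A_def by blast+
  have "\<exists>p. p \<in> idx \<mu> \<and> v p \<noteq> w p" if w: "w \<in> A" for w
  proof (rule ccontr)
    assume "\<not> (\<exists>p. p \<in> idx \<mu> \<and> v p \<noteq> w p)"
    then have "v p = w p" for p using v A(1)[OF w] by (cases "p \<in> idx \<mu>") (simp_all add: Cvec_def)
    then have "v = w" by (rule ext)
    with A(2)[OF w] show False by simp
  qed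
  then obtain P where P: "\<And>w. w \<in> A \<Longrightarrow> P w \<in> idx \<mu> \<and> v (P w) \<noteq> w (P w)" by metis
  define L where "L = (\<Prod>w\<in>A. (var (P w) - cst (w (P w))) ^ M)"
  have L: "L \<in> Lam \<mu>" unfolding L_def
    by (intro Lam_prod Lam_power Lam_diff Lam_var Lam_cst) (simp add: P)
  have "const_coeff (transl v L) = (\<Prod>w\<in>A. (v (P w) - w (P w)) ^ M)" by (simp add: L_def)
  then have "const_coeff (transl v L) \<noteq> 0" using finA P by simp
  then obtain a where a: "a \<in> Lam \<mu>" "ordge M (a * transl v L - 1)"
    using truncated_inverse[OF Lam_transl[OF L]] unfolding const_coeff_def by blast
  \<comment> \<open>The factor \<open>a\<close> inverts the jet of \<open>L\<close> at
    \<open>v\<close>, so \<open>g\<close> has the jet \<open>h\<close> at \<open>v\<close>, while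
    \<open>L\<close> makes its jets on \<open>A\<close> vanish to order \<open>M\<close>.\<close>
  define g where "g = transl (- v) (h * a) * L"
  have g: "g \<in> Lam \<mu>" unfolding g_def by (intro Lam_mult Lam_transl h a L)
  have "transl v g = h * a * transl v L"
    by (simp add: g_def transl_transl)
  then have "transl v g - h = h * (a * transl v L - 1)" by (simp add: algebra_simps)
  then have gv: "ordge M (transl v g - h)" using a(2) by (simp add: ordge_mult_left)
  have gw: "ordge M (transl w g)" if w: "w \<in> A" for w
  proof -
    have "ordge M (var (P w) ^ M)" using ordge_power[OF ordge_var, of M "P w"] by simp
    moreover have "transl w L = var (P w) ^ M * transl w (\<Prod>u\<in>A - {w}. (var (P u) - cst (u (P u))) ^ M)"
      unfolding L_def prod.remove[OF finA w] transl_simps transl_var transl_cst by simp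
    ultimately have "ordge M (transl w L)" by (simp only: ordge_mult_right)
    then show ?thesis unfolding g_def transl_simps by (rule ordge_mult_left)
  qed
  let ?St = "{\<sigma> \<in> Smu \<mu>. perm_vec \<sigma> v = v}"
  have finSt: "finite ?St" by (rule finite_subset[OF Collect_restrict finite_Smu])
  have "id \<in> ?St" using Smu_id by simp
  then have c: "card ?St \<noteq> 0" unfolding card_0_eq[OF finSt] by blast
  \<comment> \<open>In the sum over the group only the stabiliser of \<open>v\<close> contributes at
    \<open>v\<close>, each element once the jet \<open>h\<close>; hence the normalisation by its
    order.\<close>
  define \<gamma> where "\<gamma> = cst (1 / of_nat (card ?St)) * (\<Sum>\<sigma>\<in>Smu \<mu>. perm_pol \<sigma> g)"
  show thesis
  proof (rule that)
    show "\<gamma> \<in> Gam \<mu>" unfolding \<gamma>_def by (rule Gam_mult[OF Gam_cst Gam_average[OF g]])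
    have T: "ordge M (transl v (perm_pol \<sigma> g) - (if \<sigma> \<in> ?St then h else 0))" if \<sigma>: "\<sigma> \<in> Smu \<mu>" for \<sigma>
    proof (cases "perm_vec \<sigma> v = v")
      case True
      then have "perm_vec (invf \<sigma>) v = v" using perm_vec_inv(1)[OF \<sigma>, of v] by simp
      then have "transl v (perm_pol \<sigma> g) - h = perm_pol \<sigma> (transl v g - h)"
        using perm_transl_inv[OF \<sigma>, of v g] stab[OF \<sigma> True] by simp
      then show ?thesis using ordge_perm[OF gv] True \<sigma> by simp
    next
      case False
      have "perm_vec (invf \<sigma>) v \<noteq> v" using perm_vec_inv(2)[OF \<sigma>, of v] False by metis
      then have "perm_vec (invf \<sigma>) v \<in> A" unfolding A_def using Smu_inv[OF \<sigma>] by blast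
      from ordge_perm[OF gw[OF this]] show ?thesis
        unfolding perm_transl_inv[OF \<sigma>, of v g] using False by simp
    qed
    have "transl v \<gamma> - h =
        cst (1 / of_nat (card ?St)) * (\<Sum>\<sigma>\<in>Smu \<mu>. transl v (perm_pol \<sigma> g) - (if \<sigma> \<in> ?St then h else 0))"
    proof -
      have "(\<Sum>\<sigma>\<in>Smu \<mu>. if \<sigma> \<in> ?St then h else 0) = (\<Sum>\<sigma>\<in>?St. h)"
        by (rule sum.mono_neutral_cong_right) (auto simp: finite_Smu)
      also have "\<dots> = cst (of_nat (card ?St)) * h" by (simp add: cst_of_nat)
      finally have "cst (1 / of_nat (card ?St)) * (\<Sum>\<sigma>\<in>Smu \<mu>. if \<sigma> \<in> ?St then h else 0) = h"
        using c by (simp add: mult.assoc[symmetric] cst_mult[symmetric])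
      then show ?thesis by (simp only: \<gamma>_def sum_subtractf right_diff_distrib transl_simps transl_cst)
    qed
    then show "ordge M (transl v \<gamma> - h)"
      using ordge_mult_left[OF ordge_sum[OF T]] by (simp only:)
    fix w assume w: "w \<in> F"
    have "ordge M (transl w (perm_pol \<sigma> g))" if \<sigma>: "\<sigma> \<in> Smu \<mu>" for \<sigma>
    proof -
      have "perm_vec (invf \<sigma>) w \<in> A" unfolding A_def using Smu_inv[OF \<sigma>] w by blast
      from ordge_perm[OF gw[OF this]] show ?thesis unfolding perm_transl_inv[OF \<sigma>, of w g] .
    qed
    then show "ordge M (transl w \<gamma>)"
      unfolding \<gamma>_def transl_simps by (intro ordge_mult_left ordge_sum)
  qed
qed

section \<open>Local form of the generators\<close>

text \<open>The shape shared by both kinds of generators: equivariant numerators \<open>F p\<close>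
  over the differences within the block. The number \<open>e\<close> is the shift of the dagger
  operator, so its sign is opposite to that of the generator.\<close>

definition gen_op :: "nat list \<Rightarrow> smash \<Rightarrow> nat \<Rightarrow> complex \<Rightarrow> (index \<Rightarrow> mpol) \<Rightarrow> bool" where
  "gen_op \<mu> X k e F \<longleftrightarrow> (\<forall>p\<in>block \<mu> k. F p \<in> Lam \<mu>) \<and>
    (\<forall>\<sigma>\<in>Smu \<mu>. \<forall>p\<in>block \<mu> k. perm_pol \<sigma> (F p) = F (\<sigma> p)) \<and>
    (\<forall>g. dop X g = (\<Sum>p\<in>block \<mu> k. to_fract (F p) / (\<Prod>q\<in>block \<mu> k - {p}. to_fract (var p - var q)) *
       translL (svec e p) g))"

lemma gen_op_Lam: "gen_op \<mu> X k e F \<Longrightarrow> p \<in> block \<mu> k \<Longrightarrow> F p \<in> Lam \<mu>"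
  and gen_op_perm: "gen_op \<mu> X k e F \<Longrightarrow> \<sigma> \<in> Smu \<mu> \<Longrightarrow> p \<in> block \<mu> k \<Longrightarrow> perm_pol \<sigma> (F p) = F (\<sigma> p)"
  and gen_op_dop: "gen_op \<mu> X k e F \<Longrightarrow> dop X g =
    (\<Sum>p\<in>block \<mu> k. to_fract (F p) / (\<Prod>q\<in>block \<mu> k - {p}. to_fract (var p - var q)) * translL (svec e p) g)"
  by (simp_all add: gen_op_def)

lemma gen_op_Xgen:
  assumes k: "(k, 1) \<in> idx \<mu>" and f: "f \<in> Lam \<mu>"
    and inv: "\<And>\<sigma>. \<sigma> \<in> Smu \<mu> \<Longrightarrow> perm_vec \<sigma> (unit_vec (k, 1)) = unit_vec (k, 1) \<Longrightarrow> perm_pol \<sigma> f = f"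
  obtains c where "c \<noteq> 0" "\<And>e. gen_op \<mu> (Xgen \<mu> k (svec e (k, 1)) f) k (- e) (\<lambda>p. cst c * perm_pol (swap (k, 1) p) f)"
proof -
  let ?p0 = "(k, 1::nat)" and ?B = "block \<mu> k"
  have p0: "?p0 \<in> ?B" using k by (simp add: block_def)
  obtain c where c: "c \<noteq> 0" "\<And>e g. dop (Xgen \<mu> k (svec e (k, 1)) f) g =
    (\<Sum>p\<in>?B. to_fract (cst c * perm_pol (swap ?p0 p) f) /
       (\<Prod>q\<in>?B - {p}. to_fract (var p - var q)) * translL (svec (- e) p) g)"
    using dop_Xgen_sum[OF k inv] by blast
  have perm: "perm_pol \<sigma> (perm_pol (swap ?p0 p) f) = perm_pol (swap ?p0 (\<sigma> p)) f"
    if \<sigma>: "\<sigma> \<in> Smu \<mu>" and p: "p \<in> ?B" for \<sigma> p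
  proof -
    have \<sigma>p: "\<sigma> p \<in> ?B" by (rule Smu_block[OF \<sigma> p])
    let ?\<tau> = "swap ?p0 (\<sigma> p) \<circ> (\<sigma> \<circ> swap ?p0 p)"
    have \<tau>: "?\<tau> \<in> Smu \<mu>" by (intro Smu_comp \<sigma> Smu_swap[OF p0 \<sigma>p] Smu_swap[OF p0 p])
    have "?\<tau> ?p0 = ?p0" by simp
    then have "perm_vec ?\<tau> (unit_vec ?p0) = unit_vec ?p0"
      using perm_svec[OF Smu_bij[OF \<tau>], of 1 ?p0] by (simp only: svec_1)
    from inv[OF \<tau> this] have "perm_pol (swap ?p0 (\<sigma> p)) (perm_pol (swap ?p0 (\<sigma> p)) (perm_pol \<sigma> (perm_pol (swap ?p0 p) f))) =
        perm_pol (swap ?p0 (\<sigma> p)) f"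
      by (simp only: perm_perm)
    then show ?thesis by (simp only: swap_swap)
  qed
  have Lam: "cst c * perm_pol (swap ?p0 p) f \<in> Lam \<mu>" if "p \<in> ?B" for p
    by (rule Lam_mult[OF Lam_cst Lam_perm[OF f Smu_idx[OF Smu_swap[OF p0 that]]]])
  have "gen_op \<mu> (Xgen \<mu> k (svec e (k, 1)) f) k (- e) (\<lambda>p. cst c * perm_pol (swap (k, 1) p) f)" for e
    unfolding gen_op_def
  proof (intro conjI ballI allI)
    show "cst c * perm_pol (swap (k, 1) p) f \<in> Lam \<mu>" if "p \<in> ?B" for p by (rule Lam[OF that])
    show "perm_pol \<sigma> (cst c * perm_pol (swap (k, 1) p) f) = cst c * perm_pol (swap (k, 1) (\<sigma> p)) f"
      if "\<sigma> \<in> Smu \<mu>" "p \<in> ?B" for \<sigma> p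
      by (simp only: perm_simps perm_cst perm[OF that])
  qed (rule c(2))
  with c(1) show thesis by (rule that)
qed

lemma to_fract_linear_transl: "translL v (to_fract (var p - var q)) = to_fract (var p - var q + cst (v p - v q))"
  by (simp add: cst_diff algebra_simps)

text \<open>By \<open>to_fract_ddiff\<close> the sum is an iterated divided difference over the
  whole block, hence a polynomial. Symmetry follows by reindexing the sum.\<close>

lemma symmetrization:
  assumes B: "p0 \<in> block \<mu> k" and H: "\<And>p. p \<in> block \<mu> k \<Longrightarrow> H p \<in> Lam \<mu>"
    and perm: "\<And>\<sigma> p. \<sigma> \<in> Smu \<mu> \<Longrightarrow> p \<in> block \<mu> k \<Longrightarrow> perm_pol \<sigma> (H p) = H (\<sigma> p)"
  shows "\<exists>G\<in>Gam \<mu>. to_fract G = (\<Sum>p\<in>block \<mu> k. to_fract (H p) / (\<Prod>q\<in>block \<mu> k - {p}. to_fract (var p - var q)))"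
proof -
  let ?B = "block \<mu> k"
  obtain bs where bs: "set bs = ?B - {p0}" "distinct bs"
    using finite_distinct_list[of "?B - {p0}"] finite_block by blast
  have dist: "distinct (p0 # bs)" using bs by simp
  have set: "set (p0 # bs) = ?B" unfolding list.set(2) bs(1) by (rule insert_Diff[OF B])
  define G where "G = ddiff p0 bs (H p0)"
  have "to_fract G = (\<Sum>i\<in>set (p0 # bs). to_fract (perm_pol (swap p0 i) (H p0)) /
      (\<Prod>j\<in>set (p0 # bs) - {i}. to_fract (var i - var j)))"
    unfolding G_def
  proof (rule to_fract_ddiff[OF dist])
    fix a b assume ab: "a \<in> set bs" "b \<in> set bs"
    then have ab': "a \<in> ?B - {p0}" "b \<in> ?B - {p0}" unfolding bs(1) by blast+
    then have "p0 \<noteq> a" "p0 \<noteq> b" by blast+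
    with ab' have "a \<in> ?B" "b \<in> ?B" and s: "swap a b p0 = p0" by simp_all
    from perm[OF Smu_swap[OF this(1,2)] B] show "perm_pol (swap a b) (H p0) = H p0" unfolding s .
  qed
  also have "\<dots> = (\<Sum>p\<in>?B. to_fract (H p) / (\<Prod>q\<in>?B - {p}. to_fract (var p - var q)))"
    unfolding set by (rule sum.cong[OF refl]) (simp only: perm[OF Smu_swap[OF B] B] transpose_apply_first)
  finally have G: "to_fract G = (\<Sum>p\<in>?B. to_fract (H p) / (\<Prod>q\<in>?B - {p}. to_fract (var p - var q)))" .
  have "G \<in> Gam \<mu>"
  proof (rule GamI)
    have "set bs \<subseteq> idx \<mu>" "p0 \<notin> set bs" using bs(1) block_idx by auto
    then show "G \<in> Lam \<mu>" unfolding G_def using Lam_ddiff[OF _ block_idx[OF B] _ H[OF B]] by blast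
    fix \<sigma> assume \<sigma>: "\<sigma> \<in> Smu \<mu>"
    have b: "bij \<sigma>" by (rule Smu_bij[OF \<sigma>])
    note hom = ring_map_simps[OF ring_map_permL[OF b]] ring_map_divide[OF ring_map_permL[OF b]] permL_to_fract[OF b]
    have "to_fract (perm_pol \<sigma> G) = (\<Sum>p\<in>?B. to_fract (perm_pol \<sigma> (H p)) / (\<Prod>q\<in>?B - {p}. to_fract (var (\<sigma> p) - var (\<sigma> q))))"
      unfolding permL_to_fract[OF b, symmetric] G by (simp add: hom)
    also have "\<dots> = (\<Sum>p\<in>?B. to_fract (H (\<sigma> p)) / (\<Prod>q\<in>?B - {\<sigma> p}. to_fract (var (\<sigma> p) - var q)))"
    proof (rule sum.cong[OF refl])
      fix p assume p: "p \<in> ?B"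
      have "(\<Prod>q\<in>?B - {p}. to_fract (var (\<sigma> p) - var (\<sigma> q))) = (\<Prod>q\<in>?B - {\<sigma> p}. to_fract (var (\<sigma> p) - var q))"
      proof (rule prod.reindex_bij_witness[of _ "invf \<sigma>" \<sigma>], goal_cases)
        case (2 q)
        then show ?case using Smu_block[OF \<sigma>] bij_is_inj[OF b] by (auto dest: injD)
      next
        case (4 q)
        then show ?case using Smu_block[OF Smu_inv[OF \<sigma>]] Smu_inv_simps[OF \<sigma>] by (metis Diff_iff empty_iff insert_iff)
      qed (simp_all add: Smu_inv_simps[OF \<sigma>])
      then show "to_fract (perm_pol \<sigma> (H p)) / (\<Prod>q\<in>?B - {p}. to_fract (var (\<sigma> p) - var (\<sigma> q))) =
          to_fract (H (\<sigma> p)) / (\<Prod>q\<in>?B - {\<sigma> p}. to_fract (var (\<sigma> p) - var q))"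
        by (simp only: perm[OF \<sigma> p])
    qed
    also have "\<dots> = (\<Sum>p\<in>?B. to_fract (H p) / (\<Prod>q\<in>?B - {p}. to_fract (var p - var q)))"
      by (rule sum.reindex_bij_witness[of _ "invf \<sigma>" \<sigma>])
        (simp_all add: Smu_inv_simps[OF \<sigma>] Smu_block[OF \<sigma>] Smu_block[OF Smu_inv[OF \<sigma>]])
    also have "\<dots> = to_fract G" by (rule G[symmetric])
    finally show "perm_pol \<sigma> G = G" by (simp only: to_fract_eq_iff)
  qed
  with G show ?thesis by blast
qed

lemma gen_op_Gam:
  assumes X: "gen_op \<mu> X k e F" and k: "p0 \<in> block \<mu> k" and \<gamma>: "\<gamma> \<in> Gam \<mu>"
  shows "\<exists>G\<in>Gam \<mu>. dop X (to_fract \<gamma>) = to_fract G"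
proof -
  have "\<exists>G\<in>Gam \<mu>. to_fract G = (\<Sum>p\<in>block \<mu> k. to_fract (F p * transl (svec e p) \<gamma>) /
      (\<Prod>q\<in>block \<mu> k - {p}. to_fract (var p - var q)))"
  proof (rule symmetrization[OF k])
    show "F p * transl (svec e p) \<gamma> \<in> Lam \<mu>" if "p \<in> block \<mu> k" for p
      by (intro Lam_mult Lam_transl Gam_Lam \<gamma> gen_op_Lam[OF X that])
    show "perm_pol \<sigma> (F p * transl (svec e p) \<gamma>) = F (\<sigma> p) * transl (svec e (\<sigma> p)) \<gamma>"
      if "\<sigma> \<in> Smu \<mu>" "p \<in> block \<mu> k" for \<sigma> p
      using that by (simp add: gen_op_perm[OF X] perm_transl[OF Smu_bij] perm_svec[OF Smu_bij] Gam_perm[OF \<gamma>])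
  qed
  moreover have "dop X (to_fract \<gamma>) = (\<Sum>p\<in>block \<mu> k. to_fract (F p * transl (svec e p) \<gamma>) /
      (\<Prod>q\<in>block \<mu> k - {p}. to_fract (var p - var q)))"
    unfolding gen_op_dop[OF X] by (rule sum.cong) simp_all
  ultimately show ?thesis by metis
qed

section \<open>Clearing the denominators at a point\<close>

definition vpairs :: "nat list \<Rightarrow> nat \<Rightarrow> vec \<Rightarrow> (index \<times> index) set" where
  "vpairs \<mu> k v = {x \<in> block \<mu> k \<times> block \<mu> k. v (fst x) \<noteq> v (snd x)}"

definition vlin :: "vec \<Rightarrow> index \<times> index \<Rightarrow> mpol" where
  "vlin v x = var (fst x) - var (snd x) + cst (v (fst x) - v (snd x))"

text \<open>The translates to \<open>v\<close> of all differences in the block that do not vanish at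
  \<open>v\<close>. The product over all ordered pairs is a common multiple of the unit parts of all
  denominators, and its cofactors \<open>vden_at\<close> are permuted by the stabiliser of
  \<open>v\<close>.\<close>

definition vden :: "nat list \<Rightarrow> nat \<Rightarrow> vec \<Rightarrow> mpol" where
  "vden \<mu> k v = (\<Prod>x\<in>vpairs \<mu> k v. vlin v x)"

definition vden_at :: "nat list \<Rightarrow> nat \<Rightarrow> vec \<Rightarrow> index \<Rightarrow> mpol" where
  "vden_at \<mu> k v p = (\<Prod>x\<in>{x \<in> vpairs \<mu> k v. fst x \<noteq> p}. vlin v x)"

lemma finite_vpairs: "finite (vpairs \<mu> k v)"
  unfolding vpairs_def by (rule finite_subset[OF Collect_restrict]) (simp add: finite_block)

lemma Lam_vlin: "x \<in> vpairs \<mu> k v \<Longrightarrow> vlin v x \<in> Lam \<mu>"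
  unfolding vlin_def vpairs_def by (intro Lam_add Lam_diff Lam_var Lam_cst) (auto dest: block_idx)

lemma Lam_vden: "vden \<mu> k v \<in> Lam \<mu>"
  unfolding vden_def by (rule Lam_prod) (rule Lam_vlin)

lemma Lam_vden_at: "vden_at \<mu> k v p \<in> Lam \<mu>"
  unfolding vden_at_def by (rule Lam_prod, erule CollectE, erule conjE, rule Lam_vlin)

lemma const_coeff_vlin: "x \<in> vpairs \<mu> k v \<Longrightarrow> const_coeff (vlin v x) \<noteq> 0"
  by (simp add: vlin_def vpairs_def)

lemma const_coeff_vden: "const_coeff (vden \<mu> k v) \<noteq> 0" and const_coeff_vden_at: "const_coeff (vden_at \<mu> k v p) \<noteq> 0"
  unfolding vden_def vden_at_def using finite_vpairs const_coeff_vlin by simp_all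

lemma vden_split:
  assumes "p \<in> block \<mu> k"
  shows "vden \<mu> k v = vden_at \<mu> k v p * (\<Prod>q\<in>{q \<in> block \<mu> k. v q \<noteq> v p}. vlin v (p, q))"
proof -
  let ?V = "vpairs \<mu> k v"
  have "vden \<mu> k v = (\<Prod>x\<in>{x \<in> ?V. fst x \<noteq> p}. vlin v x) * (\<Prod>x\<in>{x \<in> ?V. fst x = p}. vlin v x)"
    unfolding vden_def using finite_vpairs
    by (subst prod.union_disjoint[symmetric]) (auto intro!: prod.cong)
  also have "(\<Prod>x\<in>{x \<in> ?V. fst x = p}. vlin v x) = (\<Prod>q\<in>{q \<in> block \<mu> k. v q \<noteq> v p}. vlin v (p, q))"
    by (rule prod.reindex_bij_witness[of _ "\<lambda>q. (p, q)" snd]) (use assms in \<open>auto simp: vpairs_def\<close>)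
  finally show ?thesis unfolding vden_at_def .
qed

lemma perm_vden_at:
  assumes \<sigma>: "\<sigma> \<in> Smu \<mu>" and v: "perm_vec \<sigma> v = v"
  shows "perm_pol \<sigma> (vden_at \<mu> k v p) = vden_at \<mu> k v (\<sigma> p)"
proof -
  have v\<sigma>: "v (\<sigma> q) = v q" for q
    using fun_cong[OF v, of "\<sigma> q"] Smu_inv_simps(2)[OF \<sigma>] by (simp add: perm_vec_def)
  have v\<sigma>': "v (invf \<sigma> q) = v q" for q using v\<sigma>[of "invf \<sigma> q"] Smu_inv_simps(1)[OF \<sigma>] by simp
  have "perm_pol \<sigma> (vden_at \<mu> k v p) = (\<Prod>x\<in>{x \<in> vpairs \<mu> k v. fst x \<noteq> p}. vlin v (\<sigma> (fst x), \<sigma> (snd x)))"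
    by (simp add: vden_at_def vlin_def v\<sigma>)
  also have "\<dots> = vden_at \<mu> k v (\<sigma> p)"
    unfolding vden_at_def
  proof (rule prod.reindex_bij_witness[of _ "\<lambda>x. (invf \<sigma> (fst x), invf \<sigma> (snd x))" "\<lambda>x. (\<sigma> (fst x), \<sigma> (snd x))"], goal_cases)
    case (2 x)
    then have "\<sigma> (fst x) \<noteq> \<sigma> p" using bij_is_inj[OF Smu_bij[OF \<sigma>]] by (auto dest: injD)
    with 2 show ?case using Smu_block[OF \<sigma>] v\<sigma> by (simp add: vpairs_def mem_Times_iff)
  next
    case (4 x)
    have "invf \<sigma> (fst x) \<noteq> p"
    proof
      assume "invf \<sigma> (fst x) = p"
      then have "\<sigma> p = fst x" using Smu_inv_simps(1)[OF \<sigma>, of "fst x"] by (simp only:)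
      with 4 show False by simp
    qed
    with 4 show ?case using Smu_block[OF Smu_inv[OF \<sigma>]] v\<sigma>' by (simp add: vpairs_def mem_Times_iff)
  qed (simp_all add: Smu_inv_simps[OF \<sigma>])
  finally show ?thesis .
qed

lemma swap_fixes: "v a = v b \<Longrightarrow> perm_vec (swap a b) v = v"
  by (rule ext) (simp add: perm_vec_def Transposition.transpose_def)

text \<open>After multiplication by the unit \<open>vden\<close>, the image of \<open>\<gamma>\<close> under a generator is, near \<open>v\<close>,
  a sum over the level sets of \<open>v\<close> of divided differences of shifts of \<open>\<gamma>\<close>.\<close>

lemma gen_op_local:
  assumes X: "gen_op \<mu> X k e F" and \<gamma>: "\<gamma> \<in> Gam \<mu>" and G: "dop X (to_fract \<gamma>) = to_fract G"
    and rep: "\<And>u. u \<in> v ` block \<mu> k \<Longrightarrow> rep u \<in> block \<mu> k \<and> v (rep u) = u"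
    and lst: "\<And>u. u \<in> v ` block \<mu> k \<Longrightarrow> distinct (lst u) \<and> set (lst u) = {p \<in> block \<mu> k. v p = u} - {rep u}"
  shows "vden \<mu> k v * transl v G = (\<Sum>u\<in>v ` block \<mu> k. ddiff (rep u) (lst u)
    (vden_at \<mu> k v (rep u) * transl v (F (rep u)) * transl (v + svec e (rep u)) \<gamma>))"
proof -
  let ?B = "block \<mu> k"
  define K where "K p = vden_at \<mu> k v p * transl v (F p) * transl (v + svec e p) \<gamma>" for p
  let ?Q = "\<lambda>u. {p \<in> ?B. v p = u}"
  have nz: "to_fract (vlin v (p, q)) \<noteq> 0" if "v p \<noteq> v q" for p q
  proof -
    have "const_coeff (vlin v (p, q)) \<noteq> 0" using that by (simp add: vlin_def)
    then have "vlin v (p, q) \<noteq> 0" by (metis const_coeff_simps(1))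
    then show ?thesis by simp
  qed
  have "to_fract (transl v G) = (\<Sum>p\<in>?B. to_fract (transl v (F p) * transl (v + svec e p) \<gamma>) /
      (\<Prod>q\<in>?B - {p}. to_fract (vlin v (p, q))))"
    unfolding translL_to_fract[symmetric] G[symmetric] gen_op_dop[OF X]
    unfolding translL_simps translL_translL to_fract_linear_transl
    by (simp add: vlin_def)
  then have "to_fract (vden \<mu> k v * transl v G) = (\<Sum>p\<in>?B. to_fract (vden \<mu> k v) *
      (to_fract (transl v (F p) * transl (v + svec e p) \<gamma>) / (\<Prod>q\<in>?B - {p}. to_fract (vlin v (p, q)))))"
    by (simp only: to_fract_mult sum_distrib_left)
  \<comment> \<open>The factors that separate levels cancel against \<open>vden\<close>. The
    remaining differences lie inside one level set, where translation to \<open>v\<close> does not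
    change them.\<close>
  also have "\<dots> = (\<Sum>p\<in>?B. to_fract (K p) / (\<Prod>q\<in>?Q (v p) - {p}. to_fract (var p - var q)))"
  proof (rule sum.cong[OF refl])
    fix p assume p: "p \<in> ?B"
    let ?y = "transl v (F p) * transl (v + svec e p) \<gamma>" and ?R = "{q \<in> ?B. v q \<noteq> v p}"
    have "(\<Prod>q\<in>?B - {p}. to_fract (vlin v (p, q))) =
        (\<Prod>q\<in>?R. to_fract (vlin v (p, q))) * (\<Prod>q\<in>?Q (v p) - {p}. to_fract (vlin v (p, q)))"
      by (subst prod.union_disjoint[symmetric]) (auto simp: finite_block intro!: prod.cong)
    also have "(\<Prod>q\<in>?Q (v p) - {p}. to_fract (vlin v (p, q))) = (\<Prod>q\<in>?Q (v p) - {p}. to_fract (var p - var q))"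
      by (rule prod.cong) (auto simp: vlin_def)
    finally have P: "(\<Prod>q\<in>?B - {p}. to_fract (vlin v (p, q))) =
        (\<Prod>q\<in>?R. to_fract (vlin v (p, q))) * (\<Prod>q\<in>?Q (v p) - {p}. to_fract (var p - var q))" .
    have R0: "(\<Prod>q\<in>?R. to_fract (vlin v (p, q))) \<noteq> 0"
    proof
      assume "(\<Prod>q\<in>?R. to_fract (vlin v (p, q))) = 0"
      then obtain q where q: "q \<in> ?R" "to_fract (vlin v (p, q)) = 0"
        unfolding prod_zero_iff[OF finite_subset[OF Collect_restrict finite_block]] by blast
      from q(1) have "v q \<noteq> v p" by simp
      from nz[OF not_sym[OF this]] q(2) show False by (rule notE)
    qed
    have "to_fract (vden \<mu> k v) = to_fract (vden_at \<mu> k v p) * (\<Prod>q\<in>?R. to_fract (vlin v (p, q)))"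
      unfolding vden_split[OF p] by (simp add: to_fract_prod)
    moreover have "(a * r) * (y / (r * s)) = (a * y) / s" if "r \<noteq> 0" for a r y s :: ratf
      using that by simp
    ultimately show "to_fract (vden \<mu> k v) * (to_fract ?y / (\<Prod>q\<in>?B - {p}. to_fract (vlin v (p, q)))) =
        to_fract (K p) / (\<Prod>q\<in>?Q (v p) - {p}. to_fract (var p - var q))"
      unfolding P using R0 by (simp only: K_def to_fract_mult mult.assoc)
  qed
  also have "\<dots> = (\<Sum>u\<in>v ` ?B. \<Sum>p\<in>?Q u. to_fract (K p) / (\<Prod>q\<in>?Q (v p) - {p}. to_fract (var p - var q)))"
    by (rule sum.group[symmetric]) (simp_all add: finite_block)
  also have "\<dots> = (\<Sum>u\<in>v ` ?B. to_fract (ddiff (rep u) (lst u) (K (rep u))))"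
  proof (rule sum.cong[OF refl])
    fix u assume u: "u \<in> v ` ?B"
    note r = rep[OF u] and l = lst[OF u]
    have inQ: "rep u \<in> ?Q u" using r by simp
    have set: "set (rep u # lst u) = ?Q u"
      unfolding list.set(2) conjunct2[OF l] by (rule insert_Diff[OF inQ])
    have dist: "distinct (rep u # lst u)" using l by simp
    \<comment> \<open>A transposition inside a level set fixes \<open>v\<close>, so it permutes the
      numerators of that level set; this is the symmetry that turns the sum over the level set into
      a divided difference.\<close>
    have permK: "perm_pol (swap a b) (K p) = K (swap a b p)" if "a \<in> ?Q u" "b \<in> ?Q u" "p \<in> ?Q u" for a b p
    proof -
      have S: "swap a b \<in> Smu \<mu>" using Smu_swap that by blast
      have fv: "perm_vec (swap a b) v = v" using that by (intro swap_fixes) simp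
      have shift: "perm_vec (swap a b) (v + svec e p) = v + svec e (swap a b p)"
      proof -
        have "perm_vec (swap a b) (v + svec e p) = perm_vec (swap a b) v + perm_vec (swap a b) (svec e p)"
          by (simp add: perm_vec_def fun_eq_iff)
        then show ?thesis by (simp only: fv perm_svec[OF Smu_bij[OF S]])
      qed
      have pB: "p \<in> ?B" using that by simp
      show ?thesis
        unfolding K_def perm_simps perm_transl[OF Smu_bij[OF S]] fv shift perm_vden_at[OF S fv]
          gen_op_perm[OF X S pB] Gam_perm[OF \<gamma> S] ..
    qed
    have "to_fract (ddiff (rep u) (lst u) (K (rep u))) = (\<Sum>i\<in>set (rep u # lst u). to_fract (perm_pol (swap (rep u) i) (K (rep u))) /
      (\<Prod>j\<in>set (rep u # lst u) - {i}. to_fract (var i - var j)))"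
    proof (rule to_fract_ddiff[OF dist])
      fix a b assume ab: "a \<in> set (lst u)" "b \<in> set (lst u)"
      then have ab': "a \<in> ?Q u - {rep u}" "b \<in> ?Q u - {rep u}" unfolding conjunct2[OF l, symmetric] by blast+
      then have "rep u \<noteq> a" "rep u \<noteq> b" by blast+
      then have s: "swap a b (rep u) = rep u" by simp
      have "a \<in> ?Q u" "b \<in> ?Q u" using ab' by blast+
      from permK[OF this inQ] show "perm_pol (swap a b) (K (rep u)) = K (rep u)" unfolding s .
    qed
    also have "\<dots> = (\<Sum>i\<in>?Q u. to_fract (K i) / (\<Prod>j\<in>?Q u - {i}. to_fract (var i - var j)))"
      unfolding set by (rule sum.cong[OF refl]) (simp only: permK[OF inQ _ inQ] transpose_apply_first)
    also have "\<dots> = (\<Sum>i\<in>?Q u. to_fract (K i) / (\<Prod>j\<in>?Q (v i) - {i}. to_fract (var i - var j)))"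
      by (rule sum.cong[OF refl]) simp
    finally show "(\<Sum>i\<in>?Q u. to_fract (K i) / (\<Prod>j\<in>?Q (v i) - {i}. to_fract (var i - var j))) =
        to_fract (ddiff (rep u) (lst u) (K (rep u)))" ..
  qed
  also have "\<dots> = to_fract (\<Sum>u\<in>v ` ?B. ddiff (rep u) (lst u) (K (rep u)))"
    by (simp only: to_fract_sum)
  finally show ?thesis unfolding K_def by (simp only: to_fract_eq_iff)
qed

section \<open>Seeds\<close>

lemma Phibar_iff:
  "var p - var q \<in> Phibar \<mu> r' \<longleftrightarrow> p \<noteq> q \<and> p \<in> idx \<mu> \<and> q \<in> idx \<mu> \<and> fst p = fst q \<and> fst p \<le> r'"
proof
  assume "var p - var q \<in> Phibar \<mu> r'"
  then obtain k i j where *: "var p - var q = var (k, i) - var (k, j)" "k \<le> r'" "(k, i) \<in> idx \<mu>" "(k, j) \<in> idx \<mu>" "i \<noteq> j"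
    unfolding Phibar_def by blast
  then have "(k, i) \<noteq> (k, j)" by simp
  from var_diff_eq_iff[OF this, of p q] *(1) have "p = (k, i) \<and> q = (k, j)" by metis
  with * show "p \<noteq> q \<and> p \<in> idx \<mu> \<and> q \<in> idx \<mu> \<and> fst p = fst q \<and> fst p \<le> r'" by simp
next
  assume a: "p \<noteq> q \<and> p \<in> idx \<mu> \<and> q \<in> idx \<mu> \<and> fst p = fst q \<and> fst p \<le> r'"
  obtain k i where p: "p = (k, i)" by (cases p)
  obtain l j where q: "q = (l, j)" by (cases q)
  have l: "l = k" using a by (simp add: p q)
  have "i \<noteq> j" "k \<le> r'" "(k, i) \<in> idx \<mu>" "(k, j) \<in> idx \<mu>" using a unfolding p q l by simp_all
  then show "var p - var q \<in> Phibar \<mu> r'" unfolding Phibar_def p q l by blast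
qed

lemma PhibarE:
  assumes "\<alpha> \<in> Phibar \<mu> r'"
  obtains p q where "\<alpha> = var p - var q"
  using assms unfolding Phibar_def by blast

lemma Psi_iff: "var p - var q \<in> Psi \<mu> r' v \<longleftrightarrow>
    p \<noteq> q \<and> p \<in> idx \<mu> \<and> q \<in> idx \<mu> \<and> fst p = fst q \<and> fst p \<le> r' \<and> v p - v q \<in> \<int>"
  unfolding Psi_def mem_Collect_eq Phibar_iff by simp

lemma Sigbar_iff: "var p - var q \<in> Sigbar \<mu> r' \<longleftrightarrow>
    p \<in> idx \<mu> \<and> q \<in> idx \<mu> \<and> q = (fst p, Suc (snd p)) \<and> fst p \<le> r'"
proof
  assume a: "var p - var q \<in> Sigbar \<mu> r'"
  then have P: "p \<noteq> q \<and> p \<in> idx \<mu> \<and> q \<in> idx \<mu> \<and> fst p = fst q \<and> fst p \<le> r'"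
    unfolding Sigbar_def using Phibar_iff by blast
  from a obtain k i where *: "var p - var q = var (k, i) - var (k, i + 1)" unfolding Sigbar_def Sig_def by blast
  have "p = (k, i) \<and> q = (k, i + 1)" using *[unfolded var_diff_eq_iff[OF conjunct1[OF P]]] .
  with P show "p \<in> idx \<mu> \<and> q \<in> idx \<mu> \<and> q = (fst p, Suc (snd p)) \<and> fst p \<le> r'" by simp
next
  assume a: "p \<in> idx \<mu> \<and> q \<in> idx \<mu> \<and> q = (fst p, Suc (snd p)) \<and> fst p \<le> r'"
  obtain k i where p: "p = (k, i)" by (cases p)
  have q: "q = (k, i + 1)" using a p by simp
  have "(k, i) \<in> idx \<mu>" "(k, i + 1) \<in> idx \<mu>" using a p q by simp_all
  then have "var p - var q \<in> Sig \<mu>" unfolding Sig_def p q by blast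
  moreover have "var p - var q \<in> Phibar \<mu> r'" unfolding Phibar_iff using a p q by simp
  ultimately show "var p - var q \<in> Sigbar \<mu> r'" unfolding Sigbar_def by simp
qed

text \<open>A root of a standard subsystem is a sum of consecutive simple roots of that subsystem:
  the roots with this property form a reflection-closed set.\<close>

lemma subsystem_gen_interval:
  assumes S: "S \<subseteq> Sigbar \<mu> r'" and root: "var (k, i) - var (k, j) \<in> subsystem_gen \<mu> r' S"
    and l: "i \<le> l" "l < j"
  shows "var (k, l) - var (k, Suc l) \<in> S"
proof -
  define R where "R p q \<longleftrightarrow> p \<in> idx \<mu> \<and> q \<in> idx \<mu> \<and> fst p = fst q \<and> fst p \<le> r' \<and>
    (\<forall>l. min (snd p) (snd q) \<le> l \<and> l < max (snd p) (snd q) \<longrightarrow> var (fst p, l) - var (fst p, Suc l) \<in> S)" for p q :: index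
  define \<Xi> where "\<Xi> = {var p - var q | p q. p \<noteq> q \<and> R p q}"
  have R_sym: "R q p" if "R p q" for p q
    using that unfolding R_def by (metis min.commute max.commute)
  have R_refl: "R p p" if "R p q" for p q
  proof -
    have "\<not> (min (snd p) (snd p) \<le> l \<and> l < max (snd p) (snd p))" for l by linarith
    then show ?thesis using that unfolding R_def by blast
  qed
  have R_trans: "R p t" if "R p q" "R q t" for p q t
  proof -
    have "var (fst p, l) - var (fst p, Suc l) \<in> S" if l: "min (snd p) (snd t) \<le> l \<and> l < max (snd p) (snd t)" for l
    proof -
      have "(min (snd p) (snd q) \<le> l \<and> l < max (snd p) (snd q)) \<or> (min (snd q) (snd t) \<le> l \<and> l < max (snd q) (snd t))"
        using l by linarith
      then show ?thesis using \<open>R p q\<close> \<open>R q t\<close> unfolding R_def by metis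
    qed
    then show ?thesis using that unfolding R_def by simp
  qed
  have mem: "var p - var q \<in> \<Xi> \<longleftrightarrow> p \<noteq> q \<and> R p q" for p q
  proof
    assume "var p - var q \<in> \<Xi>"
    then obtain a b where ab: "var p - var q = var a - var b" "a \<noteq> b" "R a b" unfolding \<Xi>_def by blast
    from var_diff_eq_iff[OF ab(2), of p q] ab(1) have "p = a \<and> q = b" by metis
    with ab show "p \<noteq> q \<and> R p q" by simp
  next
    assume "p \<noteq> q \<and> R p q"
    then show "var p - var q \<in> \<Xi>" unfolding \<Xi>_def by blast
  qed
  have "\<Xi> \<subseteq> Phibar \<mu> r'"
  proof
    fix \<alpha> assume "\<alpha> \<in> \<Xi>"
    then obtain p q where pq: "\<alpha> = var p - var q" "p \<noteq> q" "R p q" unfolding \<Xi>_def by blast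
    then show "\<alpha> \<in> Phibar \<mu> r'" unfolding pq(1) Phibar_iff R_def by simp
  qed
  moreover have "S \<subseteq> \<Xi>"
  proof
    fix \<alpha> assume \<alpha>: "\<alpha> \<in> S"
    then have "\<alpha> \<in> Sigbar \<mu> r'" using S by blast
    then have "\<alpha> \<in> Phibar \<mu> r'" unfolding Sigbar_def by blast
    then obtain p q where pq: "\<alpha> = var p - var q" by (rule PhibarE)
    have P: "p \<in> idx \<mu> \<and> q \<in> idx \<mu> \<and> q = (fst p, Suc (snd p)) \<and> fst p \<le> r'"
      using \<open>\<alpha> \<in> Sigbar \<mu> r'\<close> unfolding pq Sigbar_iff .
    then have q: "fst q = fst p" "snd q = Suc (snd p)" by simp_all
    have S': "var (fst p, l) - var (fst p, Suc l) \<in> S" if l: "min (snd p) (snd q) \<le> l \<and> l < max (snd p) (snd q)" for l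
    proof -
      have "l = snd p" using l q by simp
      then have "(fst p, l) = p" "(fst p, Suc l) = q" using P by simp_all
      then show ?thesis using \<alpha> pq by simp
    qed
    have "p \<noteq> q" using q by auto
    moreover have "R p q"
    proof -
      have "p \<in> idx \<mu>" "q \<in> idx \<mu>" "fst p \<le> r'" "fst p = fst q" using P q(1)[symmetric] by blast+
      then show ?thesis unfolding R_def using S' by blast
    qed
    ultimately show "\<alpha> \<in> \<Xi>" unfolding pq mem by simp
  qed
  moreover have "refl_closed \<Xi>"
    unfolding refl_closed_def
  proof (intro allI ballI impI)
    fix p q \<beta> assume \<beta>: "\<beta> \<in> \<Xi>" and "var p - var q \<in> \<Xi>"
    then have pq: "p \<noteq> q" "R p q" unfolding mem by simp_all
    obtain a b where ab: "\<beta> = var a - var b" "a \<noteq> b" "R a b" using \<beta> unfolding \<Xi>_def by blast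
    have step: "R c (swap p q c)" if "R c c" for c
      using that pq R_sym[OF pq(2)] by (simp add: Transposition.transpose_def)
    have "R (swap p q a) (swap p q b)"
      by (rule R_trans[OF R_sym[OF step[OF R_refl[OF ab(3)]]] R_trans[OF ab(3) step[OF R_refl[OF R_sym[OF ab(3)]]]]])
    moreover have "swap p q a \<noteq> swap p q b" using ab(2) by (metis transpose_involutory)
    ultimately show "perm_pol (swap p q) \<beta> \<in> \<Xi>" unfolding ab(1) perm_simps perm_var mem by simp
  qed
  ultimately have "subsystem_gen \<mu> r' S \<subseteq> \<Xi>" unfolding subsystem_gen_def by blast
  with root have "R (k, i) (k, j)" using mem by blast
  then show ?thesis using l unfolding R_def by simp
qed

locale seed_setup =
  fixes \<mu> :: "nat list" and r' :: nat and vbar :: vec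
  assumes seed: "seed \<mu> r' vbar"
begin

definition rel :: "index \<Rightarrow> index \<Rightarrow> bool" where
  "rel p q \<longleftrightarrow> p = q \<or> (p \<in> idx \<mu> \<and> q \<in> idx \<mu> \<and> fst p = fst q \<and> fst p \<le> r' \<and> vbar p - vbar q \<in> \<int>)"

lemma rel_Psi: "p \<noteq> q \<Longrightarrow> rel p q \<longleftrightarrow> var p - var q \<in> Psi \<mu> r' vbar"
  unfolding rel_def Psi_iff by blast

lemma rel_trans': "rel p q \<Longrightarrow> rel q t \<Longrightarrow> rel p t"
proof -
  assume a: "rel p q" "rel q t"
  show "rel p t"
  proof (cases "p = q \<or> q = t")
    case True
    then show ?thesis using a by auto
  next
    case False
    then have "vbar p - vbar q \<in> \<int>" "vbar q - vbar t \<in> \<int>" using a unfolding rel_def by blast+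
    then have "(vbar p - vbar q) + (vbar q - vbar t) \<in> \<int>" by (rule Ints_add)
    then have "vbar p - vbar t \<in> \<int>" by simp
    then show ?thesis using a False unfolding rel_def by simp
  qed
qed

lemma rel_sym': "rel p q \<Longrightarrow> rel q p"
proof -
  assume a: "rel p q"
  have "vbar q - vbar p \<in> \<int>" if "vbar p - vbar q \<in> \<int>" using Ints_minus[OF that] by simp
  with a show ?thesis unfolding rel_def by auto
qed

text \<open>Standardness of the subsystem enters here: a root of \<Psi> is a sum of consecutive
  simple roots that belong to \<Psi> themselves.\<close>

lemma rel_convex': "rel (k, i) (k, j) \<Longrightarrow> i \<le> l \<Longrightarrow> l \<le> j \<Longrightarrow> rel (k, i) (k, l)"
proof -
  assume r: "rel (k, i) (k, j)" and l: "i \<le> l" "l \<le> j"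
  obtain S where S: "S \<subseteq> Sigbar \<mu> r'" "Psi \<mu> r' vbar = subsystem_gen \<mu> r' S"
    using seed unfolding seed_def standard_subsystem_def by blast
  have sub: "S \<subseteq> Psi \<mu> r' vbar" unfolding S(2) subsystem_gen_def by blast
  have adj: "rel (k, m) (k, Suc m)" if m: "i \<le> m" "m < j" for m
  proof -
    have ne: "(k, i) \<noteq> (k, j)" "(k, m) \<noteq> (k, Suc m)" using m by simp_all
    have "var (k, i) - var (k, j) \<in> subsystem_gen \<mu> r' S" using r unfolding rel_Psi[OF ne(1)] S(2) .
    from subsystem_gen_interval[OF S(1) this m] have "var (k, m) - var (k, Suc m) \<in> Psi \<mu> r' vbar" using sub by blast
    then show ?thesis unfolding rel_Psi[OF ne(2)] .
  qed
  have "rel (k, i) (k, i + d)" if "i + d \<le> j" for d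
    using that
  proof (induction d)
    case 0
    show ?case by (simp add: rel_def)
  next
    case (Suc d)
    then have "rel (k, i) (k, i + d)" by simp
    moreover have "rel (k, i + d) (k, i + Suc d)" using adj[of "i + d"] Suc.prems by simp
    ultimately show ?case by (rule rel_trans')
  qed
  from this[of "l - i"] l show ?thesis by simp
qed

sublocale young_idx rel \<mu>
proof unfold_locales
  show "rel p p" for p by (simp add: rel_def)
  show "rel p q \<Longrightarrow> rel q p" for p q by (rule rel_sym')
  show "rel p q \<Longrightarrow> rel q r \<Longrightarrow> rel p r" for p q r by (rule rel_trans')
  show "rel p q \<Longrightarrow> fst p = fst q" for p q unfolding rel_def by auto
  show "rel (k, i) (k, j) \<Longrightarrow> i \<le> l \<Longrightarrow> l \<le> j \<Longrightarrow> rel (k, i) (k, l)" for k i j l by (rule rel_convex')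
  show "rel p q \<Longrightarrow> p \<noteq> q \<Longrightarrow> p \<in> idx \<mu>" for p q unfolding rel_def by blast
  show "finite {p. \<exists>q. q \<noteq> p \<and> rel p q}"
  proof (rule finite_subset[OF _ finite_idx[of \<mu>]], rule subsetI)
    fix p assume "p \<in> {p. \<exists>q. q \<noteq> p \<and> rel p q}"
    then obtain q where "q \<noteq> p" "rel p q" by blast
    then show "p \<in> idx \<mu>" unfolding rel_def by blast
  qed
qed

lemma rel_vbar: "rel p q \<Longrightarrow> vbar p = vbar q"
proof (cases "p = q")
  case False
  assume "rel p q"
  then have "var p - var q \<in> Psi \<mu> r' vbar" unfolding rel_Psi[OF False] .
  then have "mpol_eval (var p - var q) vbar = 0" using seed unfolding seed_def by blast
  then show ?thesis by simp
qed simp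

lemma roots_eq: "roots = Psi \<mu> r' vbar"
proof (intro equalityI subsetI)
  fix \<alpha> assume "\<alpha> \<in> roots"
  then obtain p q where "\<alpha> = var p - var q" "p \<noteq> q" "rel p q" by (rule rootE)
  then show "\<alpha> \<in> Psi \<mu> r' vbar" using rel_Psi by blast
next
  fix \<alpha> assume a: "\<alpha> \<in> Psi \<mu> r' vbar"
  then have "\<alpha> \<in> Phibar \<mu> r'" unfolding Psi_def by blast
  then obtain p q where \<alpha>: "\<alpha> = var p - var q" by (rule PhibarE)
  have "p \<noteq> q" using a unfolding \<alpha> Psi_iff by blast
  with a show "\<alpha> \<in> roots" unfolding \<alpha> root_iff using rel_Psi by blast
qed

lemma simple_roots_eq: "simple_roots = Psi \<mu> r' vbar \<inter> Sigbar \<mu> r'"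
proof (intro equalityI subsetI)
  fix \<alpha> assume "\<alpha> \<in> simple_roots"
  then obtain k i where ki: "\<alpha> = var (k, i) - var (k, Suc i)" "rel (k, i) (k, Suc i)" by (rule simple_rootE)
  have "(k, i) \<noteq> (k, Suc i)" by simp
  then have P: "\<alpha> \<in> Psi \<mu> r' vbar" using ki rel_Psi by blast
  then have "\<alpha> \<in> Sigbar \<mu> r'" unfolding ki(1) Sigbar_iff Psi_iff by simp
  with P show "\<alpha> \<in> Psi \<mu> r' vbar \<inter> Sigbar \<mu> r'" by blast
next
  fix \<alpha> assume a: "\<alpha> \<in> Psi \<mu> r' vbar \<inter> Sigbar \<mu> r'"
  then have "\<alpha> \<in> Phibar \<mu> r'" unfolding Psi_def by blast
  then obtain p q where \<alpha>: "\<alpha> = var p - var q" by (rule PhibarE)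
  have P: "var p - var q \<in> Psi \<mu> r' vbar" and "var p - var q \<in> Sigbar \<mu> r'" using a unfolding \<alpha> by blast+
  then have q: "q = (fst p, Suc (snd p))" unfolding Sigbar_iff by blast
  have "p \<noteq> q" using P unfolding Psi_iff by blast
  then have "rel p q" using P rel_Psi by blast
  then show "\<alpha> \<in> simple_roots" unfolding \<alpha> simple_root_iff adj_def using q by blast
qed

section \<open>Integral translates of the seed and local functionals\<close>

abbreviation Z :: "vec set" where "Z \<equiv> Zbar \<mu> r'"

lemma Z_Ints: "z \<in> Z \<Longrightarrow> z p \<in> \<int>" and Z_idx: "z \<in> Z \<Longrightarrow> p \<notin> idx \<mu> \<Longrightarrow> z p = 0"
  and Z_block: "z \<in> Z \<Longrightarrow> fst p > r' \<Longrightarrow> z p = 0"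
  by (simp_all add: Zbar_def Cvec_def) (metis prod.collapse)

lemma ZI: "(\<And>p. z p \<in> \<int>) \<Longrightarrow> (\<And>p. p \<notin> idx \<mu> \<or> fst p > r' \<Longrightarrow> z p = 0) \<Longrightarrow> z \<in> Z"
  by (simp add: Zbar_def Cvec_def)

lemma vbar_Cvec: "vbar \<in> Cvec \<mu>" using seed by (simp add: seed_def)

lemma vbar_add_Cvec: "z \<in> Z \<Longrightarrow> vbar + z \<in> Cvec \<mu>"
  using vbar_Cvec Z_idx by (simp add: Cvec_def)

lemma Z_add_svec:
  assumes "z \<in> Z" "e \<in> \<int>" "p \<in> idx \<mu>" "fst p \<le> r'"
  shows "z + svec e p \<in> Z"
proof (rule ZI)
  show "(z + svec e p) q \<in> \<int>" for q using Z_Ints[OF assms(1), of q] assms(2) by (simp add: svec_def)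
  show "(z + svec e p) q = 0" if "q \<notin> idx \<mu> \<or> fst q > r'" for q
    using that Z_idx[OF assms(1), of q] Z_block[OF assms(1), of q] assms(3,4) by (auto simp: svec_def)
qed

text \<open>Coordinates that coincide at an integral translate of \<open>vbar\<close> differ by an
  integer at \<open>vbar\<close>. So the divided differences over a level set use roots of \<Psi>
  only, and these preserve the coinvariant ideal.\<close>

lemma level_rel:
  assumes z: "z \<in> Z" and k: "k \<le> r'" and p: "p \<in> block \<mu> k" and q: "q \<in> block \<mu> k"
    and eq: "(vbar + z) p = (vbar + z) q"
  shows "rel p q"
proof -
  have "vbar p - vbar q = z q - z p" using eq by (simp add: algebra_simps)
  then have "vbar p - vbar q \<in> \<int>" using Z_Ints[OF z] Ints_diff by metis
  then show ?thesis unfolding rel_def using p q k by (simp add: block_def)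
qed

lemma Ann_comp_ddiff:
  assumes "\<phi> \<in> Ann" "\<And>b. b \<in> set bs \<Longrightarrow> rel q b" "q \<notin> set bs"
  shows "(\<lambda>f. \<phi> (ddiff q bs f)) \<in> Ann"
  using assms
proof (induction bs arbitrary: \<phi>)
  case Nil
  then show ?case by simp
next
  case (Cons b bs)
  have "rel q b" "q \<noteq> b" using Cons.prems by auto
  then have "(\<lambda>f. \<phi> (nabla q b f)) \<in> Ann" by (rule Ann_comp_nabla[OF Cons.prems(1)])
  from Cons.IH[OF this] show ?case using Cons.prems by simp
qed

lemma chi_Gam: "\<gamma> \<in> Gam \<mu> \<Longrightarrow> chi \<phi> v \<gamma> = \<phi> (transl v \<gamma>)" and chi_not_Gam: "\<gamma> \<notin> Gam \<mu> \<Longrightarrow> chi \<phi> v \<gamma> = 0"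
  by (simp_all add: chi_def)

lemma chi_Gdual: "\<phi> \<in> Ann \<Longrightarrow> chi \<phi> v \<in> Gdual \<mu>"
  unfolding Gdual_def
  by (simp add: chi_def Gam_add Gam_mult[OF Gam_cst] Ann_add Ann_cst)

definition depth :: nat where "depth = Suc (card pairs)"

lemma Ann_depth: "\<phi> \<in> Ann \<Longrightarrow> f \<in> Lam \<mu> \<Longrightarrow> ordge depth f \<Longrightarrow> \<phi> f = 0"
  unfolding depth_def by (rule Ann_ordge)

lemma Ann_depth_cong: "\<phi> \<in> Ann \<Longrightarrow> f \<in> Lam \<mu> \<Longrightarrow> g \<in> Lam \<mu> \<Longrightarrow> ordge depth (f - g) \<Longrightarrow> \<phi> f = \<phi> g"
  using Ann_depth[of \<phi> "f - g"] Ann_diff[of \<phi> f g] Lam_diff[of f \<mu> g] by simp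

lemma Ann_unit:
  assumes "\<phi> \<in> Ann" "f \<in> Lam \<mu>" "a \<in> Lam \<mu>" "b \<in> Lam \<mu>" "ordge depth (a * b - 1)"
  shows "\<phi> (a * (b * f)) = \<phi> f"
proof (rule Ann_depth_cong[OF assms(1)])
  show "a * (b * f) \<in> Lam \<mu>" "f \<in> Lam \<mu>" using assms by (simp_all add: Lam_mult)
  have "a * (b * f) - f = (a * b - 1) * f" by (simp add: algebra_simps)
  then show "ordge depth (a * (b * f) - f)" using ordge_mult_right[OF assms(5)] by simp
qed

lemma unit_inverse:
  assumes "d \<in> Lam \<mu>" "const_coeff d \<noteq> 0"
  obtains d' where "d' \<in> Lam \<mu>" "ordge depth (d' * d - 1)" "const_coeff d' \<noteq> 0"
proof -
  obtain d' where d': "d' \<in> Lam \<mu>" "ordge depth (d' * d - 1)"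
    using truncated_inverse[OF assms(1)] assms(2) unfolding const_coeff_def by blast
  have "ordge 1 (d' * d - 1)" by (rule ordge_mono[OF d'(2)]) (simp add: depth_def)
  then have "const_coeff d' * const_coeff d = 1" unfolding ordge_1_iff const_coeff_def[symmetric] by simp
  then have "const_coeff d' \<noteq> 0" by auto
  with d' show thesis by (rule that)
qed

lemma dual_act_dop:
  assumes "\<gamma> \<in> Gam \<mu>" "dop X (to_fract \<gamma>) = to_fract G"
  shows "dual_act \<mu> X \<chi> \<gamma> = \<chi> G"
proof -
  have "inj (to_fract :: mpol \<Rightarrow> ratf)" by (rule injI) (simp only: to_fract_eq_iff)
  then have "the_inv to_fract (to_fract G) = G" by (rule the_inv_f_f)
  then show ?thesis unfolding dual_act_def smash_app_dagger using assms by simp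
qed

lemma dual_act_notin: "\<gamma> \<notin> Gam \<mu> \<Longrightarrow> dual_act \<mu> X \<chi> \<gamma> = 0"
  by (simp add: dual_act_def)

text \<open>Multiplication by \<open>d'\<close>, an inverse of \<open>vden\<close> modulo the order
  seen by \<phi>, brings in the polynomial form of the generator. Each level set of \<open>v\<close>
  contributes one functional, based at the shift of its representative.\<close>

lemma dual_act_chi:
  assumes X: "gen_op \<mu> X k e F" and k: "k \<le> r'" and z: "z \<in> Z" and v: "v = vbar + z"
    and p0: "p0 \<in> block \<mu> k" and \<phi>: "\<phi> \<in> Ann"
    and reps: "\<forall>u\<in>v ` block \<mu> k. rep u \<in> block \<mu> k \<and> v (rep u) = u"
    and lists: "\<forall>u. distinct (lst u) \<and> set (lst u) = {p \<in> block \<mu> k. v p = u} - {rep u}"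
    and d': "d' \<in> Lam \<mu>" "ordge depth (d' * vden \<mu> k v - 1)"
  defines "\<Phi> u \<equiv> \<lambda>f. \<phi> (d' * ddiff (rep u) (lst u) (vden_at \<mu> k v (rep u) * transl v (F (rep u)) * f))"
  shows "dual_act \<mu> X (chi \<phi> v) = (\<Sum>u\<in>v ` block \<mu> k. chi (\<Phi> u) (v + svec e (rep u)))"
    and "u \<in> v ` block \<mu> k \<Longrightarrow> \<Phi> u \<in> Ann"
proof -
  let ?B = "block \<mu> k"
  have lst: "distinct (lst u) \<and> set (lst u) = {p \<in> ?B. v p = u} - {rep u}" if "u \<in> v ` ?B" for u
    using lists by (rule spec)
  show "dual_act \<mu> X (chi \<phi> v) = (\<Sum>u\<in>v ` ?B. chi (\<Phi> u) (v + svec e (rep u)))"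
  proof (rule ext)
    fix \<gamma>
    show "dual_act \<mu> X (chi \<phi> v) \<gamma> = (\<Sum>u\<in>v ` ?B. chi (\<Phi> u) (v + svec e (rep u))) \<gamma>"
    proof (cases "\<gamma> \<in> Gam \<mu>")
      case True
      obtain G where G: "G \<in> Gam \<mu>" "dop X (to_fract \<gamma>) = to_fract G"
        using gen_op_Gam[OF X p0 True] by blast
      have "dual_act \<mu> X (chi \<phi> v) \<gamma> = \<phi> (transl v G)"
        unfolding dual_act_dop[OF True G(2)] by (rule chi_Gam[OF G(1)])
      also have "\<dots> = \<phi> (d' * (vden \<mu> k v * transl v G))"
        by (rule Ann_unit[OF \<phi> Lam_transl[OF Gam_Lam[OF G(1)]] d'(1) Lam_vden d'(2), symmetric])
      also have "vden \<mu> k v * transl v G = (\<Sum>u\<in>v ` ?B. ddiff (rep u) (lst u)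
          (vden_at \<mu> k v (rep u) * transl v (F (rep u)) * transl (v + svec e (rep u)) \<gamma>))"
        by (rule gen_op_local[OF X True G(2) bspec[OF reps] lst])
      also have "\<phi> (d' * (\<Sum>u\<in>v ` ?B. ddiff (rep u) (lst u)
          (vden_at \<mu> k v (rep u) * transl v (F (rep u)) * transl (v + svec e (rep u)) \<gamma>))) =
          (\<Sum>u\<in>v ` ?B. \<Phi> u (transl (v + svec e (rep u)) \<gamma>))"
        unfolding sum_distrib_left Ann_sum[OF \<phi>] \<Phi>_def by (rule refl)
      also have "\<dots> = (\<Sum>u\<in>v ` ?B. chi (\<Phi> u) (v + svec e (rep u))) \<gamma>"
        unfolding sum_fun_apply by (rule sum.cong[OF refl]) (simp only: chi_Gam[OF True])
      finally show ?thesis .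
    next
      case False
      then show ?thesis by (simp add: dual_act_notin sum_fun_apply chi_not_Gam)
    qed
  qed
next
  let ?B = "block \<mu> k"
  assume u: "u \<in> v ` ?B"
  note r = bspec[OF reps u] and l = conjunct2[OF spec[OF lists]]
  have "rel (rep u) b" if "b \<in> set (lst u)" for b
  proof -
    have "b \<in> ?B" "v b = v (rep u)" using that r unfolding l by auto
    then show ?thesis using level_rel[OF z k conjunct1[OF r], of b] unfolding v by simp
  qed
  moreover have "rep u \<notin> set (lst u)" unfolding l by blast
  ultimately have "(\<lambda>f. \<phi> (d' * ddiff (rep u) (lst u) f)) \<in> Ann"
    using Ann_comp_ddiff[OF Ann_comp_mult[OF \<phi> d'(1)]] by blast
  then show "\<Phi> u \<in> Ann" unfolding \<Phi>_def
    by (rule Ann_comp_mult) (intro Lam_mult Lam_vden_at Lam_transl gen_op_Lam[OF X conjunct1[OF r]])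
qed

end

text \<open>The representative of one level set can be prescribed, because a step of a generator has
  to arrive at a given shifted point.\<close>

lemma level_representatives:
  fixes v :: vec
  assumes B: "finite B" and q: "q \<in> B"
  obtains rep lst where "\<forall>u\<in>v ` B. rep u \<in> B \<and> v (rep u) = u" "rep (v q) = q"
    "\<forall>u. distinct (lst u) \<and> set (lst u) = {p \<in> B. v p = u} - {rep u}"
proof -
  define rep where "rep u = (if u = v q then q else SOME r. r \<in> B \<and> v r = u)" for u
  define lst where "lst u = (SOME l. set l = {p \<in> B. v p = u} - {rep u} \<and> distinct l)" for u
  show thesis
  proof (rule that, rule ballI)
    show "rep u \<in> B \<and> v (rep u) = u" if "u \<in> v ` B" for u
    proof (cases "u = v q")
      case True
      then show ?thesis unfolding rep_def using q by simp
    next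
      case False
      have "\<exists>r. r \<in> B \<and> v r = u" using that by blast
      from someI_ex[OF this] show ?thesis unfolding rep_def if_not_P[OF False] .
    qed
    show "rep (v q) = q" by (simp add: rep_def)
    show "\<forall>u. distinct (lst u) \<and> set (lst u) = {p \<in> B. v p = u} - {rep u}"
    proof
      fix u
      have "finite ({p \<in> B. v p = u} - {rep u})" using B by simp
      then have "\<exists>l. set l = {p \<in> B. v p = u} - {rep u} \<and> distinct l" by (rule finite_distinct_list)
      from someI_ex[OF this] show "distinct (lst u) \<and> set (lst u) = {p \<in> B. v p = u} - {rep u}"
        unfolding lst_def[symmetric] by (rule conj_commute[THEN iffD1])
    qed
  qed
qed

context seed_setup
begin

section \<open>The module\<close>

abbreviation V :: "(mpol \<Rightarrow> complex) set" where
  "V \<equiv> Vmod \<mu> r' roots simple_roots vbar"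

lemma V_eq: "V = functional.span (\<Union>z\<in>Z. (\<lambda>\<phi>. chi \<phi> (vbar + z)) ` Ann)"
  unfolding Vmod_def Dspace_eq ..

lemma chi_V: "\<phi> \<in> Ann \<Longrightarrow> z \<in> Z \<Longrightarrow> chi \<phi> (vbar + z) \<in> V"
  unfolding V_eq by (rule functional.span_base) blast

lemma subspace_V: "functional.subspace V"
  unfolding V_eq by (rule functional.subspace_span)

lemma subspace_Gdual: "functional.subspace (Gdual \<mu>)"
proof -
  have "x + y \<in> Gdual \<mu>" if "x \<in> Gdual \<mu>" "y \<in> Gdual \<mu>" for x y
    using that unfolding Gdual_def by (simp add: algebra_simps)
  moreover have "cscale c x \<in> Gdual \<mu>" if "x \<in> Gdual \<mu>" for c x
    using that unfolding Gdual_def by (simp add: cscale_def algebra_simps)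
  moreover have "0 \<in> Gdual \<mu>" unfolding Gdual_def by simp
  ultimately show ?thesis unfolding functional.subspace_def by blast
qed

lemma V_Gdual: "V \<subseteq> Gdual \<mu>"
  unfolding V_eq by (rule functional.span_minimal[OF _ subspace_Gdual]) (use chi_Gdual in blast)

lemma Gdual_add: "\<chi> \<in> Gdual \<mu> \<Longrightarrow> f \<in> Gam \<mu> \<Longrightarrow> g \<in> Gam \<mu> \<Longrightarrow> \<chi> (f + g) = \<chi> f + \<chi> g"
  and Gdual_cst: "\<chi> \<in> Gdual \<mu> \<Longrightarrow> f \<in> Gam \<mu> \<Longrightarrow> \<chi> (cst c * f) = c * \<chi> f"
  and Gdual_notin: "\<chi> \<in> Gdual \<mu> \<Longrightarrow> f \<notin> Gam \<mu> \<Longrightarrow> \<chi> f = 0"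
  by (simp_all add: Gdual_def)

text \<open>The condition on symmetric polynomials is carried along because the action on
  functionals reads an operator's value back as a polynomial, and for a product the first factor
  must return a symmetric one.\<close>

definition preserving :: "smash \<Rightarrow> bool" where
  "preserving X \<longleftrightarrow> (\<forall>\<gamma>\<in>Gam \<mu>. \<exists>G\<in>Gam \<mu>. dop X (to_fract \<gamma>) = to_fract G) \<and> (\<forall>\<chi>\<in>V. dual_act \<mu> X \<chi> \<in> V)"

lemma preserving_Gam: "preserving X \<Longrightarrow> \<gamma> \<in> Gam \<mu> \<Longrightarrow> \<exists>G. G \<in> Gam \<mu> \<and> dop X (to_fract \<gamma>) = to_fract G"
  unfolding preserving_def by blast

lemma preserving_add:
  assumes X: "preserving X" and Y: "preserving Y"
  shows "preserving (X + Y)"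
proof -
  have sum: "\<exists>G\<in>Gam \<mu>. dop (X + Y) (to_fract \<gamma>) = to_fract G \<and>
      (\<forall>\<chi>\<in>V. dual_act \<mu> (X + Y) \<chi> \<gamma> = dual_act \<mu> X \<chi> \<gamma> + dual_act \<mu> Y \<chi> \<gamma>)" if \<gamma>: "\<gamma> \<in> Gam \<mu>" for \<gamma>
  proof -
    obtain G where G: "G \<in> Gam \<mu>" "dop X (to_fract \<gamma>) = to_fract G" using preserving_Gam[OF X \<gamma>] by blast
    obtain H where H: "H \<in> Gam \<mu>" "dop Y (to_fract \<gamma>) = to_fract H" using preserving_Gam[OF Y \<gamma>] by blast
    have GH: "dop (X + Y) (to_fract \<gamma>) = to_fract (G + H)" unfolding dop_add G(2) H(2) by simp
    have "dual_act \<mu> (X + Y) \<chi> \<gamma> = dual_act \<mu> X \<chi> \<gamma> + dual_act \<mu> Y \<chi> \<gamma>" if "\<chi> \<in> V" for \<chi>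
      unfolding dual_act_dop[OF \<gamma> GH] dual_act_dop[OF \<gamma> G(2)] dual_act_dop[OF \<gamma> H(2)]
      using V_Gdual that Gdual_add[OF _ G(1) H(1)] by blast
    then show ?thesis using GH Gam_add[OF G(1) H(1)] by blast
  qed
  have "dual_act \<mu> (X + Y) \<chi> \<in> V" if \<chi>: "\<chi> \<in> V" for \<chi>
  proof -
    have "dual_act \<mu> (X + Y) \<chi> = dual_act \<mu> X \<chi> + dual_act \<mu> Y \<chi>"
    proof (rule ext)
      fix \<gamma>
      show "dual_act \<mu> (X + Y) \<chi> \<gamma> = (dual_act \<mu> X \<chi> + dual_act \<mu> Y \<chi>) \<gamma>"
        by (cases "\<gamma> \<in> Gam \<mu>") (use sum[of \<gamma>] \<chi> in \<open>auto simp: dual_act_notin\<close>)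
    qed
    moreover have "dual_act \<mu> X \<chi> \<in> V" "dual_act \<mu> Y \<chi> \<in> V" using X Y \<chi> unfolding preserving_def by blast+
    ultimately show ?thesis using functional.subspace_add[OF subspace_V] by metis
  qed
  with sum show ?thesis unfolding preserving_def by blast
qed

lemma preserving_uminus:
  assumes X: "preserving X"
  shows "preserving (- X)"
proof -
  have sum: "\<exists>G\<in>Gam \<mu>. dop (- X) (to_fract \<gamma>) = to_fract G \<and>
      (\<forall>\<chi>\<in>V. dual_act \<mu> (- X) \<chi> \<gamma> = - 1 * dual_act \<mu> X \<chi> \<gamma>)" if \<gamma>: "\<gamma> \<in> Gam \<mu>" for \<gamma>
  proof -
    obtain G where G: "G \<in> Gam \<mu>" "dop X (to_fract \<gamma>) = to_fract G" using preserving_Gam[OF X \<gamma>] by blast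
    have GH: "dop (- X) (to_fract \<gamma>) = to_fract (cst (- 1) * G)" unfolding dop_uminus G(2) by (simp add: cst_uminus)
    have "dual_act \<mu> (- X) \<chi> \<gamma> = - 1 * dual_act \<mu> X \<chi> \<gamma>" if "\<chi> \<in> V" for \<chi>
      unfolding dual_act_dop[OF \<gamma> GH] dual_act_dop[OF \<gamma> G(2)]
      using V_Gdual that Gdual_cst[OF _ G(1)] by blast
    then show ?thesis using GH Gam_mult[OF Gam_cst G(1)] by blast
  qed
  have "dual_act \<mu> (- X) \<chi> \<in> V" if \<chi>: "\<chi> \<in> V" for \<chi>
  proof -
    have "dual_act \<mu> (- X) \<chi> = cscale (- 1) (dual_act \<mu> X \<chi>)"
    proof (rule ext)
      fix \<gamma>
      show "dual_act \<mu> (- X) \<chi> \<gamma> = cscale (- 1) (dual_act \<mu> X \<chi>) \<gamma>"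
        unfolding cscale_def by (cases "\<gamma> \<in> Gam \<mu>") (use sum[of \<gamma>] \<chi> in \<open>auto simp: dual_act_notin\<close>)
    qed
    moreover have "dual_act \<mu> X \<chi> \<in> V" using X \<chi> unfolding preserving_def by blast
    ultimately show ?thesis using functional.subspace_scale[OF subspace_V] by metis
  qed
  with sum show ?thesis unfolding preserving_def by blast
qed

lemma preserving_smul:
  assumes X: "preserving X" and Y: "preserving Y"
  shows "preserving (smul X Y)"
proof -
  have sum: "\<exists>G\<in>Gam \<mu>. dop (smul X Y) (to_fract \<gamma>) = to_fract G \<and>
      (\<forall>\<chi>. dual_act \<mu> (smul X Y) \<chi> \<gamma> = dual_act \<mu> X (dual_act \<mu> Y \<chi>) \<gamma>)" if \<gamma>: "\<gamma> \<in> Gam \<mu>" for \<gamma>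
  proof -
    obtain G where G: "G \<in> Gam \<mu>" "dop X (to_fract \<gamma>) = to_fract G" using preserving_Gam[OF X \<gamma>] by blast
    obtain H where H: "H \<in> Gam \<mu>" "dop Y (to_fract G) = to_fract H" using preserving_Gam[OF Y G(1)] by blast
    have GH: "dop (smul X Y) (to_fract \<gamma>) = to_fract H" unfolding dop_smul G(2) H(2) ..
    have "dual_act \<mu> (smul X Y) \<chi> \<gamma> = dual_act \<mu> X (dual_act \<mu> Y \<chi>) \<gamma>" for \<chi>
      unfolding dual_act_dop[OF \<gamma> GH] dual_act_dop[OF \<gamma> G(2)] dual_act_dop[OF G(1) H(2)] ..
    then show ?thesis using GH H(1) by blast
  qed
  have "dual_act \<mu> (smul X Y) \<chi> \<in> V" if \<chi>: "\<chi> \<in> V" for \<chi>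
  proof -
    have "dual_act \<mu> (smul X Y) \<chi> = dual_act \<mu> X (dual_act \<mu> Y \<chi>)"
    proof (rule ext)
      fix \<gamma>
      show "dual_act \<mu> (smul X Y) \<chi> \<gamma> = dual_act \<mu> X (dual_act \<mu> Y \<chi>) \<gamma>"
        by (cases "\<gamma> \<in> Gam \<mu>") (use sum[of \<gamma>] in \<open>auto simp: dual_act_notin\<close>)
    qed
    then show ?thesis using X Y \<chi> unfolding preserving_def by simp
  qed
  with sum show ?thesis unfolding preserving_def by blast
qed

lemma preservingI:
  assumes dop: "\<And>\<gamma>. \<gamma> \<in> Gam \<mu> \<Longrightarrow> \<exists>G\<in>Gam \<mu>. dop X (to_fract \<gamma>) = to_fract G"
    and chi: "\<And>\<phi> z. \<phi> \<in> Ann \<Longrightarrow> z \<in> Z \<Longrightarrow> dual_act \<mu> X (chi \<phi> (vbar + z)) \<in> V"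
  shows "preserving X"
  unfolding preserving_def
proof (intro conjI ballI)
  fix \<chi> assume "\<chi> \<in> V"
  then show "dual_act \<mu> X \<chi> \<in> V"
    unfolding V_eq
  proof (induction rule: functional.span_induct)
    case base
    have "dual_act \<mu> X 0 = 0" by (rule ext) (simp add: dual_act_def)
    moreover have "dual_act \<mu> X (x + y) = dual_act \<mu> X x + dual_act \<mu> X y" for x y
      by (rule ext) (simp add: dual_act_def)
    moreover have "dual_act \<mu> X (cscale c x) = cscale c (dual_act \<mu> X x)" for c x
      by (rule ext) (simp add: dual_act_def cscale_def)
    ultimately show ?case
      unfolding V_eq[symmetric] functional.subspace_def mem_Collect_eq
      using functional.subspace_0[OF subspace_V] functional.subspace_add[OF subspace_V]
        functional.subspace_scale[OF subspace_V] by simp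
  next
    case (step x)
    then show ?case unfolding V_eq[symmetric] using chi by blast
  qed
qed (rule dop)

lemma dop_emb_Gam: "dop (emb (to_fract g)) (to_fract \<gamma>) = to_fract (g * \<gamma>)"
  by (simp add: dop_emb)

lemma dual_act_emb:
  assumes g: "g \<in> Gam \<mu>"
  shows "dual_act \<mu> (emb (to_fract g)) (chi \<phi> v) = chi (\<lambda>f. \<phi> (transl v g * f)) v"
proof (rule ext)
  fix \<gamma>
  show "dual_act \<mu> (emb (to_fract g)) (chi \<phi> v) \<gamma> = chi (\<lambda>f. \<phi> (transl v g * f)) v \<gamma>"
  proof (cases "\<gamma> \<in> Gam \<mu>")
    case True
    show ?thesis
      unfolding dual_act_dop[OF True dop_emb_Gam] chi_Gam[OF Gam_mult[OF g True]] chi_Gam[OF True] transl_simps ..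
  qed (simp add: dual_act_notin chi_not_Gam)
qed

lemma preserving_emb: "g \<in> Gam \<mu> \<Longrightarrow> preserving (emb (to_fract g))"
proof (rule preservingI)
  fix \<gamma> assume "g \<in> Gam \<mu>" "\<gamma> \<in> Gam \<mu>"
  then show "\<exists>G\<in>Gam \<mu>. dop (emb (to_fract g)) (to_fract \<gamma>) = to_fract G"
    using dop_emb_Gam Gam_mult by blast
next
  fix \<phi> z assume "g \<in> Gam \<mu>" "\<phi> \<in> Ann" "z \<in> Z"
  then show "dual_act \<mu> (emb (to_fract g)) (chi \<phi> (vbar + z)) \<in> V"
    unfolding dual_act_emb[OF \<open>g \<in> Gam \<mu>\<close>]
    by (intro chi_V Ann_comp_mult Lam_transl Gam_Lam)
qed

lemma preserving_gen_op:
  assumes X: "gen_op \<mu> X k e F" and k: "k \<le> r'" and p0: "p0 \<in> block \<mu> k" and e: "e \<in> \<int>"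
  shows "preserving X"
proof (rule preservingI)
  show "\<exists>G\<in>Gam \<mu>. dop X (to_fract \<gamma>) = to_fract G" if "\<gamma> \<in> Gam \<mu>" for \<gamma>
    by (rule gen_op_Gam[OF X p0 that])
  fix \<phi> z assume \<phi>: "\<phi> \<in> Ann" and z: "z \<in> Z"
  let ?v = "vbar + z" and ?B = "block \<mu> k"
  obtain rep lst where rl: "\<forall>u\<in>?v ` ?B. rep u \<in> ?B \<and> ?v (rep u) = u" "rep (?v p0) = p0"
    "\<forall>u. distinct (lst u) \<and> set (lst u) = {p \<in> ?B. ?v p = u} - {rep u}"
    by (rule level_representatives[OF finite_block p0, where v = ?v])
  note rep = bspec[OF rl(1)] and lst = spec[OF rl(3)]
  obtain d' where d': "d' \<in> Lam \<mu>" "ordge depth (d' * vden \<mu> k ?v - 1)"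
    using unit_inverse[OF Lam_vden const_coeff_vden] by blast
  note act = dual_act_chi[OF X k z refl p0 \<phi> rl(1) rl(3) d']
  have "chi \<psi> (?v + svec e (rep u)) \<in> V" if "\<psi> \<in> Ann" "u \<in> ?v ` ?B" for \<psi> u
  proof -
    have "rep u \<in> ?B" using rep[OF that(2)] by (rule conjunct1)
    then have "z + svec e (rep u) \<in> Z" using z e k by (intro Z_add_svec) (simp_all add: block_def)
    from chi_V[OF that(1) this] show ?thesis by (simp only: add.assoc)
  qed
  note chiV = this
  show "dual_act \<mu> X (chi \<phi> ?v) \<in> V"
    unfolding act(1) by (rule functional.subspace_sum[OF subspace_V], rule chiV[OF act(2)])
qed

lemma Lfield_uminus: "x \<in> Lfield \<mu> \<Longrightarrow> - x \<in> Lfield \<mu>"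
proof -
  assume "x \<in> Lfield \<mu>"
  then obtain a b where "x = Fract a b" "a \<in> Lam \<mu>" "b \<in> Lam \<mu>" "b \<noteq> 0" unfolding Lfield_def by blast
  then have "- x = Fract (- a) b \<and> - a \<in> Lam \<mu>" by (simp add: Lam_uminus)
  then show ?thesis unfolding Lfield_def using \<open>b \<in> Lam \<mu>\<close> \<open>b \<noteq> 0\<close> by blast
qed

lemma carrier_uminus: "h \<in> carrier (smash_inv \<mu> M) \<Longrightarrow> - h \<in> carrier (smash_inv \<mu> M)"
proof -
  assume h: "h \<in> carrier (smash_inv \<mu> M)"
  have "conj_smash \<sigma> (- h) = - h" if \<sigma>: "\<sigma> \<in> Smu \<mu>" for \<sigma>
  proof -
    have "conj_smash \<sigma> (- h) = - conj_smash \<sigma> h"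
      unfolding conj_smash_def keys_minus
      by (simp add: ring_map_uminus[OF ring_map_permL[OF Smu_bij[OF \<sigma>]]] single_uminus sum_negf)
    then show ?thesis using h \<sigma> by (simp add: smash_inv_def)
  qed
  with h show ?thesis unfolding smash_inv_def by (simp add: Lfield_uminus)
qed

lemma a_inv_smash: "h \<in> carrier (smash_inv \<mu> M) \<Longrightarrow> a_inv (smash_inv \<mu> M) h = - h"
proof -
  assume h: "h \<in> carrier (smash_inv \<mu> M)"
  have "a_inv (smash_inv \<mu> M) h = (THE y. y \<in> carrier (smash_inv \<mu> M) \<and> h + y = 0 \<and> y + h = 0)"
    by (simp add: a_inv_def m_inv_def smash_inv_def)
  also have "\<dots> = - h"
    by (rule the_equality) (use carrier_uminus[OF h] in \<open>auto simp: eq_neg_iff_add_eq_0\<close>)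
  finally show ?thesis .
qed

section \<open>Submodules\<close>

context
  fixes N :: "(mpol \<Rightarrow> complex) set"
  assumes subN: "functional.subspace N"
    and embN: "\<And>g \<chi>. g \<in> Gam \<mu> \<Longrightarrow> \<chi> \<in> N \<Longrightarrow> dual_act \<mu> (emb (to_fract g)) \<chi> \<in> N"
begin

lemma dual_act_sum: "dual_act \<mu> X (\<Sum>i\<in>J. c i) = (\<Sum>i\<in>J. dual_act \<mu> X (c i))"
  by (rule ext) (simp add: dual_act_def sum_fun_apply)

lemma chi_cong: "(\<And>f. f \<in> Lam \<mu> \<Longrightarrow> \<phi> f = \<psi> f) \<Longrightarrow> chi \<phi> v = chi \<psi> v"
  by (rule ext) (simp add: chi_def Lam_transl Gam_Lam)

text \<open>Act by a symmetric polynomial whose jet at the chosen point is \<open>h\<close> and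
  whose jets at the other points vanish beyond the order seen by the functionals. The freedom in
  \<open>h\<close> is used in the steps along the paths.\<close>

lemma separate:
  assumes J: "finite J" "i0 \<in> J" and \<phi>: "\<And>i. i \<in> J \<Longrightarrow> \<phi> i \<in> Ann" and v: "\<And>i. i \<in> J \<Longrightarrow> v i \<in> Cvec \<mu>"
    and N: "(\<Sum>i\<in>J. chi (\<phi> i) (v i)) \<in> N"
    and h: "h \<in> Lam \<mu>" "\<And>\<sigma>. \<sigma> \<in> Smu \<mu> \<Longrightarrow> perm_vec \<sigma> (v i0) = v i0 \<Longrightarrow> perm_pol \<sigma> h = h"
    and orb: "\<And>i \<sigma>. i \<in> J \<Longrightarrow> i \<noteq> i0 \<Longrightarrow> \<sigma> \<in> Smu \<mu> \<Longrightarrow> perm_vec \<sigma> (v i) \<noteq> v i0"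
  shows "chi (\<lambda>f. \<phi> i0 (h * f)) (v i0) \<in> N"
proof -
  have F: "finite (v ` (J - {i0}))" "v ` (J - {i0}) \<subseteq> Cvec \<mu>" using J v by auto
  have orb': "perm_vec \<sigma> w \<noteq> v i0" if "w \<in> v ` (J - {i0})" "\<sigma> \<in> Smu \<mu>" for w \<sigma>
    using that orb by blast
  obtain \<gamma> where \<gamma>: "\<gamma> \<in> Gam \<mu>" "ordge depth (transl (v i0) \<gamma> - h)"
      "\<And>w. w \<in> v ` (J - {i0}) \<Longrightarrow> ordge depth (transl w \<gamma>)"
    using local_interpolation[OF v[OF J(2)] F h orb', of depth] by blast
  have t\<gamma>: "transl w \<gamma> \<in> Lam \<mu>" for w by (rule Lam_transl[OF Gam_Lam[OF \<gamma>(1)]])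
  have others: "chi (\<lambda>f. \<phi> i (transl (v i) \<gamma> * f)) (v i) = 0" if i: "i \<in> J - {i0}" for i
  proof -
    have "chi (\<lambda>f. \<phi> i (transl (v i) \<gamma> * f)) (v i) = chi (\<lambda>f. 0) (v i)"
    proof (rule chi_cong)
      fix f assume "f \<in> Lam \<mu>"
      then show "\<phi> i (transl (v i) \<gamma> * f) = 0"
        using i by (intro Ann_depth[OF \<phi>] Lam_mult t\<gamma> ordge_mult_right \<gamma>(3)) auto
    qed
    also have "\<dots> = 0" by (rule ext) (simp add: chi_def)
    finally show ?thesis .
  qed
  have "dual_act \<mu> (emb (to_fract \<gamma>)) (\<Sum>i\<in>J. chi (\<phi> i) (v i)) \<in> N" by (rule embN[OF \<gamma>(1) N])
  also have "dual_act \<mu> (emb (to_fract \<gamma>)) (\<Sum>i\<in>J. chi (\<phi> i) (v i)) = (\<Sum>i\<in>J. chi (\<lambda>f. \<phi> i (transl (v i) \<gamma> * f)) (v i))"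
    unfolding dual_act_sum dual_act_emb[OF \<gamma>(1)] ..
  also have "\<dots> = chi (\<lambda>f. \<phi> i0 (transl (v i0) \<gamma> * f)) (v i0)"
    unfolding sum.remove[OF J] using others by simp
  also have "\<dots> = chi (\<lambda>f. \<phi> i0 (h * f)) (v i0)"
  proof (rule chi_cong)
    fix f assume f: "f \<in> Lam \<mu>"
    have "transl (v i0) \<gamma> * f - h * f = (transl (v i0) \<gamma> - h) * f" by (simp add: algebra_simps)
    then show "\<phi> i0 (transl (v i0) \<gamma> * f) = \<phi> i0 (h * f)"
      using ordge_mult_right[OF \<gamma>(2), of f] by (intro Ann_depth_cong[OF \<phi>[OF J(2)]] Lam_mult t\<gamma> f h(1)) simp
  qed
  finally show ?thesis .
qed

text \<open>Among the symmetric polynomials not killed by the functional take one of maximal order at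
  \<open>v\<close>; it carries the functional to a nonzero multiple of evaluation at \<open>v\<close>.\<close>

lemma socle:
  assumes \<phi>: "\<phi> \<in> Ann" and N: "chi \<phi> v \<in> N" and nz: "chi \<phi> v \<noteq> 0"
  shows "chi const_coeff v \<in> N"
proof -
  define P where "P j \<longleftrightarrow> (\<exists>\<gamma>\<in>Gam \<mu>. ordge j (transl v \<gamma>) \<and> \<phi> (transl v \<gamma>) \<noteq> 0)" for j
  have P0: "P 0"
  proof (rule ccontr)
    assume "\<not> P 0"
    then have "chi \<phi> v \<gamma> = 0 \<gamma>" for \<gamma> unfolding P_def by (simp add: chi_def)
    then have "chi \<phi> v = 0" by (intro ext)
    with nz show False by simp
  qed
  have Pd: "\<not> P depth" unfolding P_def using Ann_depth[OF \<phi> Lam_transl[OF Gam_Lam]] by blast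
  have "\<exists>j. P j \<and> \<not> P (Suc j)"
  proof (rule ccontr)
    assume "\<nexists>j. P j \<and> \<not> P (Suc j)"
    then have "P j" for j using P0 by (induction j) auto
    with Pd show False by blast
  qed
  then obtain j where j: "P j" "\<not> P (Suc j)" by blast
  obtain g where g: "g \<in> Gam \<mu>" "ordge j (transl v g)" "\<phi> (transl v g) \<noteq> 0" using j(1) unfolding P_def by blast
  have eq: "chi (\<lambda>f. \<phi> (transl v g * f)) v = cscale (\<phi> (transl v g)) (chi const_coeff v)"
  proof (rule ext)
    fix \<gamma>
    show "chi (\<lambda>f. \<phi> (transl v g * f)) v \<gamma> = cscale (\<phi> (transl v g)) (chi const_coeff v) \<gamma>"
    proof (cases "\<gamma> \<in> Gam \<mu>")
      case True
      define c where "c = const_coeff (transl v \<gamma>)"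
      \<comment> \<open>Subtracting from \<gamma> its value at \<open>v\<close> raises the order of
        the product by one, and by the choice of \<open>j\<close> the functional kills it.\<close>
      have "g * (\<gamma> - cst c) \<in> Gam \<mu>" by (intro Gam_mult Gam_diff Gam_cst g(1) True)
      moreover have "ordge (j + 1) (transl v (g * (\<gamma> - cst c)))"
      proof -
        have "ordge 1 (transl v \<gamma> - cst c)"
          unfolding ordge_1_iff const_coeff_def[symmetric] by (simp add: c_def)
        from ordge_mult[OF g(2) this] show ?thesis by simp
      qed
      ultimately have "\<phi> (transl v (g * (\<gamma> - cst c))) = 0" using j(2) unfolding P_def Suc_eq_plus1 by blast
      moreover have "transl v (g * (\<gamma> - cst c)) = transl v g * transl v \<gamma> - cst c * transl v g"
        by (simp add: algebra_simps)
      ultimately have "\<phi> (transl v g * transl v \<gamma>) = c * \<phi> (transl v g)"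
        by (simp add: Ann_diff[OF \<phi>] Ann_cst[OF \<phi>])
      then show ?thesis by (simp add: chi_Gam[OF True] cscale_def c_def)
    qed (simp add: chi_not_Gam cscale_def)
  qed
  have "cscale (\<phi> (transl v g)) (chi const_coeff v) \<in> N"
    using embN[OF g(1) N] unfolding dual_act_emb[OF g(1)] eq .
  from functional.subspace_scale[OF subN this, of "1 / \<phi> (transl v g)"] show ?thesis
    using g(3) by (simp add: cscale_def)
qed

section \<open>One step of a generator inside a submodule\<close>

lemma sum_squares_perm:
  assumes \<sigma>: "\<sigma> \<in> Smu \<mu>"
  shows "(\<Sum>q\<in>block \<mu> k. (perm_vec \<sigma> w q)\<^sup>2) = (\<Sum>q\<in>block \<mu> k. (w q)\<^sup>2)"
  unfolding perm_vec_def
  by (rule sum.reindex_bij_witness[of _ \<sigma> "invf \<sigma>"])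
    (simp_all add: Smu_inv_simps[OF \<sigma>] Smu_block[OF \<sigma>] Smu_block[OF Smu_inv[OF \<sigma>]])

text \<open>The sum of the squares over a block is invariant under permutations, and shifting the
  coordinate \<open>p\<close> by \<open>e\<close> adds \<open>2 * e * v p + e\<^sup>2\<close>. Equal
  orbits therefore force equal levels.\<close>

lemma shift_orbit:
  assumes \<sigma>: "\<sigma> \<in> Smu \<mu>" and p: "p \<in> block \<mu> k" and q: "q \<in> block \<mu> k" and e: "e \<noteq> 0"
    and eq: "perm_vec \<sigma> (v + svec e p) = v + svec e q"
  shows "v p = v q"
proof -
  have sq: "(\<Sum>r\<in>block \<mu> k. ((v + svec e p) r)\<^sup>2) = (\<Sum>r\<in>block \<mu> k. (v r)\<^sup>2) + 2 * e * v p + e\<^sup>2"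
    if "p \<in> block \<mu> k" for p
  proof -
    have "(\<Sum>r\<in>block \<mu> k. ((v + svec e p) r)\<^sup>2) = (\<Sum>r\<in>block \<mu> k. (v r)\<^sup>2 + (if r = p then 2 * e * v p + e\<^sup>2 else 0))"
      by (rule sum.cong) (simp_all add: svec_def power2_sum)
    also have "\<dots> = (\<Sum>r\<in>block \<mu> k. (v r)\<^sup>2) + (2 * e * v p + e\<^sup>2)"
      using that finite_block by (simp add: sum.distrib)
    finally show ?thesis by simp
  qed
  have "2 * e * v p = 2 * e * v q"
    using sum_squares_perm[OF \<sigma>, of "v + svec e p" k] unfolding eq sq[OF p] sq[OF q] by force
  then have "e * v p = e * v q" by (simp only: mult.assoc mult_cancel_left) simp
  then show ?thesis using e by (simp only: mult_cancel_left) simp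
qed

text \<open>By \<open>shift_orbit\<close> the summands of the generator sit on different orbits, so
  the one at the shift of \<open>q\<close> can be isolated, together with any extra factor
  \<open>h\<close> that is invariant under the stabiliser of the new point.\<close>

lemma move:
  assumes X: "gen_op \<mu> X k e F" and XN: "\<And>\<chi>. \<chi> \<in> N \<Longrightarrow> dual_act \<mu> X \<chi> \<in> N"
    and k: "k \<le> r'" and z: "z \<in> Z" and e: "e \<noteq> 0" "e \<in> \<int>" and q: "q \<in> block \<mu> k"
  defines "v \<equiv> vbar + z"
  obtains d' bs where "d' \<in> Lam \<mu>" "const_coeff d' \<noteq> 0" "ordge depth (d' * vden \<mu> k v - 1)"
    "distinct (q # bs)" "set bs = {p \<in> block \<mu> k. v p = v q} - {q}"
    "\<And>\<phi> h. \<phi> \<in> Ann \<Longrightarrow> chi \<phi> v \<in> N \<Longrightarrow> h \<in> Lam \<mu> \<Longrightarrow>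
      (\<And>\<sigma>. \<sigma> \<in> Smu \<mu> \<Longrightarrow> perm_vec \<sigma> (v + svec e q) = v + svec e q \<Longrightarrow> perm_pol \<sigma> h = h) \<Longrightarrow>
      chi (\<lambda>f. \<phi> (d' * ddiff q bs (vden_at \<mu> k v q * transl v (F q) * (h * f)))) (v + svec e q) \<in> N \<and>
      (\<lambda>f. \<phi> (d' * ddiff q bs (vden_at \<mu> k v q * transl v (F q) * (h * f)))) \<in> Ann"
proof -
  let ?B = "block \<mu> k"
  have u0: "v q \<in> v ` ?B" by (rule imageI[OF q])
  have v_eq: "v = vbar + z" by (simp only: v_def)
  obtain rep lst where rl: "\<forall>u\<in>v ` ?B. rep u \<in> ?B \<and> v (rep u) = u" and repq: "rep (v q) = q"
    and rl3: "\<forall>u. distinct (lst u) \<and> set (lst u) = {p \<in> ?B. v p = u} - {rep u}"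
    by (rule level_representatives[OF finite_block q, where v = v])
  note rep = bspec[OF rl] and lst = spec[OF rl3]
  obtain d' where d': "d' \<in> Lam \<mu>" "ordge depth (d' * vden \<mu> k v - 1)" "const_coeff d' \<noteq> 0"
    using unit_inverse[OF Lam_vden const_coeff_vden] by blast
  let ?bs = "lst (v q)"
  have bs: "set ?bs = {p \<in> ?B. v p = v q} - {q}" using lst[of "v q"] unfolding repq by blast
  have dist: "distinct (q # ?bs)" unfolding distinct.simps bs using lst[of "v q"] by blast
  show thesis
  proof (rule that[OF d'(1) d'(3) d'(2) dist bs])
    fix \<phi> h assume \<phi>: "\<phi> \<in> Ann" and N: "chi \<phi> v \<in> N" and h: "h \<in> Lam \<mu>"
      and stab: "\<And>\<sigma>. \<sigma> \<in> Smu \<mu> \<Longrightarrow> perm_vec \<sigma> (v + svec e q) = v + svec e q \<Longrightarrow> perm_pol \<sigma> h = h"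
    note act = dual_act_chi[OF X k z v_eq q \<phi> rl rl3 d'(1,2)]
    let ?\<Phi> = "\<lambda>u f. \<phi> (d' * ddiff (rep u) (lst u) (vden_at \<mu> k v (rep u) * transl v (F (rep u)) * f))"
    have \<Phi>: "?\<Phi> (v q) = (\<lambda>f. \<phi> (d' * ddiff q ?bs (vden_at \<mu> k v q * transl v (F q) * f)))" unfolding repq ..
    have "chi (\<lambda>f. ?\<Phi> (v q) (h * f)) (v + svec e (rep (v q))) \<in> N"
    proof (rule separate[where J = "v ` ?B" and \<phi> = ?\<Phi> and v = "\<lambda>u. v + svec e (rep u)"])
      show "finite (v ` ?B)" using finite_block by (rule finite_imageI)
      show "v q \<in> v ` ?B" by (rule u0)
      show "?\<Phi> u \<in> Ann" if "u \<in> v ` ?B" for u by (rule act(2)[OF that])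
      show "v + svec e (rep u) \<in> Cvec \<mu>" if "u \<in> v ` ?B" for u
      proof -
        have "rep u \<in> ?B" using rep[OF that] by blast
        then have "z + svec e (rep u) \<in> Z" using k by (intro Z_add_svec[OF z e(2)]) (simp_all add: block_def)
        from vbar_add_Cvec[OF this] show ?thesis unfolding v_def by (simp only: add.assoc)
      qed
      show "(\<Sum>u\<in>v ` ?B. chi (?\<Phi> u) (v + svec e (rep u))) \<in> N"
        using XN[OF N] unfolding act(1) .
      show "h \<in> Lam \<mu>" by (rule h)
      show "perm_pol \<sigma> h = h" if "\<sigma> \<in> Smu \<mu>" "perm_vec \<sigma> (v + svec e (rep (v q))) = v + svec e (rep (v q))" for \<sigma>
        using stab that unfolding repq by blast
      show "perm_vec \<sigma> (v + svec e (rep u)) \<noteq> v + svec e (rep (v q))"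
        if "u \<in> v ` ?B" "u \<noteq> v q" "\<sigma> \<in> Smu \<mu>" for u \<sigma>
        using shift_orbit[OF that(3) _ q e(1), of "rep u" v] rep[OF that(1)] that(2) unfolding repq by metis
    qed
    moreover have "(\<lambda>f. ?\<Phi> (v q) (h * f)) \<in> Ann" by (rule Ann_comp_mult[OF act(2)[OF u0] h])
    ultimately show "chi (\<lambda>f. \<phi> (d' * ddiff q ?bs (vden_at \<mu> k v q * transl v (F q) * (h * f)))) (v + svec e q) \<in> N \<and>
      (\<lambda>f. \<phi> (d' * ddiff q ?bs (vden_at \<mu> k v q * transl v (F q) * (h * f)))) \<in> Ann"
      unfolding repq by blast
  qed
qed

text \<open>After the shift \<open>q\<close> has left its level, so the other members of the level
  set are exactly the indices of the block with the old value; the stabiliser of the new point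
  permutes them.\<close>

lemma esym_stab:
  assumes bs: "set bs = {p \<in> block \<mu> k. v p = v q} - {q}" and q: "q \<in> block \<mu> k" and e: "e \<noteq> 0"
    and \<sigma>: "\<sigma> \<in> Smu \<mu>" and st: "perm_vec \<sigma> (v + svec e q) = v + svec e q"
  shows "perm_pol \<sigma> (esym (set bs) m) = esym (set bs) m"
proof (rule perm_esym)
  show "inj \<sigma>" by (rule bij_is_inj[OF Smu_bij[OF \<sigma>]])
  let ?w = "v + svec e q"
  have bs': "set bs = {p \<in> block \<mu> k. ?w p = v q}"
    unfolding bs using e by (intro equalityI subsetI) (simp_all add: svec_def split: if_splits)
  have w: "?w (\<sigma> p) = ?w p" for p
    using fun_cong[OF st, of "\<sigma> p"] Smu_inv_simps(2)[OF \<sigma>, of p] by (simp add: perm_vec_def)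
  have sub: "\<sigma> ` set bs \<subseteq> set bs"
    unfolding bs' using w Smu_block[OF \<sigma>] by (intro image_subsetI) simp
  then show "\<sigma> ` set bs = set bs"
    using endo_inj_surj[OF finite_set sub inj_on_subset[OF \<open>inj \<sigma>\<close> subset_UNIV]] by blast
qed

text \<open>Both parts come from Newton's expansion over the level set of \<open>q\<close>. For
  evaluations it shows that the functional obtained is nonzero, after which \<open>socle\<close>
  applies. For full local spaces it writes a given functional at the new point as a sum of images of
  functionals at the old one, with all prefactors absorbed before the step.\<close>

lemma move_results:
  assumes X: "gen_op \<mu> X k e F" and XN: "\<And>\<chi>. \<chi> \<in> N \<Longrightarrow> dual_act \<mu> X \<chi> \<in> N"
    and k: "k \<le> r'" and z: "z \<in> Z" and e: "e \<noteq> 0" "e \<in> \<int>" and q: "q \<in> block \<mu> k"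
    and nz: "mpol_eval (F q) (vbar + z) \<noteq> 0"
  shows "chi const_coeff (vbar + z) \<in> N \<Longrightarrow> chi const_coeff (vbar + (z + svec e q)) \<in> N"
    and "\<And>\<psi>. (\<And>\<phi>. \<phi> \<in> Ann \<Longrightarrow> chi \<phi> (vbar + z) \<in> N) \<Longrightarrow> \<psi> \<in> Ann \<Longrightarrow> chi \<psi> (vbar + (z + svec e q)) \<in> N"
proof -
  define v where "v = vbar + z"
  define v' where "v' = v + svec e q"
  have v'_eq: "vbar + (z + svec e q) = v'" unfolding v'_def v_def by (simp only: add.assoc)
  obtain d' bs where d': "d' \<in> Lam \<mu>" "const_coeff d' \<noteq> 0" "ordge depth (d' * vden \<mu> k v - 1)"
    and dist: "distinct (q # bs)" and bs: "set bs = {p \<in> block \<mu> k. v p = v q} - {q}"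
    and mv: "\<And>\<phi> h. \<phi> \<in> Ann \<Longrightarrow> chi \<phi> v \<in> N \<Longrightarrow> h \<in> Lam \<mu> \<Longrightarrow>
      (\<And>\<sigma>. \<sigma> \<in> Smu \<mu> \<Longrightarrow> perm_vec \<sigma> (v + svec e q) = v + svec e q \<Longrightarrow> perm_pol \<sigma> h = h) \<Longrightarrow>
      chi (\<lambda>f. \<phi> (d' * ddiff q bs (vden_at \<mu> k v q * transl v (F q) * (h * f)))) (v + svec e q) \<in> N \<and>
      (\<lambda>f. \<phi> (d' * ddiff q bs (vden_at \<mu> k v q * transl v (F q) * (h * f)))) \<in> Ann"
    using move[OF X XN k z e q] unfolding v_def by blast
  define P where "P = vden_at \<mu> k v q * transl v (F q)"
  let ?n = "length bs" and ?E = "esym (set bs)"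
  have bs_idx: "set bs \<subseteq> idx \<mu>" unfolding bs using block_idx by blast
  have E: "?E m \<in> Lam \<mu>" for m by (rule Lam_esym[OF bs_idx])
  have PL: "P \<in> Lam \<mu>" unfolding P_def by (intro Lam_mult Lam_vden_at Lam_transl gen_op_Lam[OF X q])
  have P0: "const_coeff P \<noteq> 0"
    unfolding P_def using const_coeff_vden_at nz by (simp add: const_coeff_transl v_def)
  have mvE: "chi (\<lambda>f. \<phi> (d' * ddiff q bs (P * (?E m * f)))) v' \<in> N \<and> (\<lambda>f. \<phi> (d' * ddiff q bs (P * (?E m * f)))) \<in> Ann"
    if "\<phi> \<in> Ann" "chi \<phi> v \<in> N" for \<phi> m
    using mv[OF that E esym_stab[OF bs q e(1)]] unfolding P_def v'_def .
  have q_bs: "q \<notin> set bs" using dist by simp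
  have dL: "ddiff q bs f \<in> Lam \<mu>" if "f \<in> Lam \<mu>" for f
    by (rule Lam_ddiff[OF q_bs block_idx[OF q] bs_idx that])
  show "chi const_coeff (vbar + (z + svec e q)) \<in> N" if N: "chi const_coeff (vbar + z) \<in> N"
  proof -
    let ?\<omega> = "\<lambda>f. const_coeff (d' * ddiff q bs (P * (?E ?n * f)))"
    have \<omega>: "chi ?\<omega> v' \<in> N \<and> ?\<omega> \<in> Ann"
      by (rule mvE[OF Ann_const_coeff]) (use N in \<open>simp add: v_def\<close>)
    have "const_coeff P = const_coeff (\<Sum>m\<le>?n. var q ^ (?n - m) * ddiff q bs (?E m * P))"
      using ddiff_esym_expansion[OF dist, of P] by simp
    \<comment> \<open>A variable has constant term 0, so the power \<open>0 ^ (?n - m)\<close>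
      selects the summand \<open>m = ?n\<close>; the choice of the top elementary symmetric
      polynomial in \<open>?\<omega>\<close> is made for this.\<close>
    also have "\<dots> = (\<Sum>m\<le>?n. 0 ^ (?n - m) * const_coeff (ddiff q bs (?E m * P)))" by simp
    also have "\<dots> = (\<Sum>m\<le>?n. if m = ?n then const_coeff (ddiff q bs (?E ?n * P)) else 0)"
      by (rule sum.cong) auto
    also have "\<dots> = const_coeff (ddiff q bs (?E ?n * P))" by simp
    \<comment> \<open>The functional is tested on the constant 1.\<close>
    finally have "chi ?\<omega> v' 1 \<noteq> 0"
      using P0 d'(2) unfolding chi_Gam[OF Gam_1] by (simp add: mult.commute)
    then have "chi ?\<omega> v' \<noteq> 0" by (metis zero_fun_apply)
    with socle[of ?\<omega> v'] \<omega> show ?thesis unfolding v'_eq by blast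
  qed
  show "chi \<psi> (vbar + (z + svec e q)) \<in> N"
    if all: "\<And>\<phi>. \<phi> \<in> Ann \<Longrightarrow> chi \<phi> (vbar + z) \<in> N" and \<psi>: "\<psi> \<in> Ann" for \<psi>
  proof -
    obtain P' where P': "P' \<in> Lam \<mu>" "ordge depth (P' * P - 1)" using unit_inverse[OF PL P0] by blast
    define a where "a m = P' * var q ^ (?n - m)" for m
    have aL: "a m \<in> Lam \<mu>" for m unfolding a_def by (intro Lam_mult Lam_power Lam_var P'(1) block_idx[OF q])
    \<comment> \<open>The functional at the old point carries in advance what the step will remove:
      \<open>vden\<close> cancels against \<open>d'\<close>, while \<open>P'\<close> and the power
      of the variable belong to the expansion.\<close>
    let ?\<phi> = "\<lambda>m x. \<psi> (a m * vden \<mu> k v * x)"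
    have \<phi>: "?\<phi> m \<in> Ann" for m by (rule Ann_comp_mult[OF \<psi> Lam_mult[OF aL Lam_vden]])
    have in_N: "chi (\<lambda>f. ?\<phi> m (d' * ddiff q bs (P * (?E m * f)))) v' \<in> N" for m
      using mvE[OF \<phi>] all[OF \<phi>] unfolding v_def by blast
    have "chi \<psi> v' = (\<Sum>m\<le>?n. chi (\<lambda>f. ?\<phi> m (d' * ddiff q bs (P * (?E m * f)))) v')"
    proof (rule ext)
      fix \<gamma>
      show "chi \<psi> v' \<gamma> = (\<Sum>m\<le>?n. chi (\<lambda>f. ?\<phi> m (d' * ddiff q bs (P * (?E m * f)))) v') \<gamma>"
      proof (cases "\<gamma> \<in> Gam \<mu>")
        case True
        define f where "f = transl v' \<gamma>"
        have f: "f \<in> Lam \<mu>" unfolding f_def by (rule Lam_transl[OF Gam_Lam[OF True]])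
        let ?Y = "\<lambda>m. ddiff q bs (?E m * (P * f))"
        have "\<psi> f = \<psi> (P' * (P * f))" by (rule Ann_unit[OF \<psi> f P'(1) PL P'(2), symmetric])
        also have "P * f = (\<Sum>m\<le>?n. var q ^ (?n - m) * ?Y m)" by (rule ddiff_esym_expansion[OF dist])
        also have "\<psi> (P' * (\<Sum>m\<le>?n. var q ^ (?n - m) * ?Y m)) = (\<Sum>m\<le>?n. \<psi> (a m * ?Y m))"
          unfolding sum_distrib_left Ann_sum[OF \<psi>] a_def by (simp only: mult.assoc)
        also have "\<dots> = (\<Sum>m\<le>?n. ?\<phi> m (d' * ddiff q bs (P * (?E m * f))))"
        proof (rule sum.cong[OF refl])
          fix m
          have YL: "?Y m \<in> Lam \<mu>" by (intro dL Lam_mult E PL f)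
          have "P * (?E m * f) = ?E m * (P * f)" by (rule mult.left_commute)
          then have "?\<phi> m (d' * ddiff q bs (P * (?E m * f))) = \<psi> (d' * (vden \<mu> k v * (a m * ?Y m)))"
            by (simp add: mult_ac)
          also have "\<dots> = \<psi> (a m * ?Y m)" by (rule Ann_unit[OF \<psi> Lam_mult[OF aL YL] d'(1) Lam_vden d'(3)])
          finally show "\<psi> (a m * ?Y m) = ?\<phi> m (d' * ddiff q bs (P * (?E m * f)))" ..
        qed
        finally show ?thesis unfolding sum_fun_apply chi_Gam[OF True] f_def .
      qed (simp add: sum_fun_apply chi_not_Gam)
    qed
    also have "\<dots> \<in> N" using in_N by (intro functional.subspace_sum[OF subN])
    finally show ?thesis unfolding v'_eq .
  qed
qed

end

end

lemma of_int_Nats_iff: "(of_int n :: complex) \<in> \<nat> \<longleftrightarrow> 0 \<le> n"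
proof
  assume "(of_int n :: complex) \<in> \<nat>"
  then obtain m where "(of_int n :: complex) = of_nat m" by (rule Nats_cases)
  then have "(of_int n :: complex) = of_int (int m)" by simp
  then have "n = int m" by (simp only: of_int_eq_iff)
  then show "0 \<le> n" by simp
next
  assume "0 \<le> n"
  then have "(of_int n :: complex) = of_nat (nat n)" by simp
  then show "(of_int n :: complex) \<in> \<nat>" by (simp only: of_nat_in_Nats)
qed

lemma perm_vec_add: "perm_vec \<sigma> (v + w) = perm_vec \<sigma> v + perm_vec \<sigma> w"
  by (rule ext) (simp add: perm_vec_def)

context seed_setup
begin

section \<open>Orbits and dominant vectors\<close>

lemma W_Smu:
  assumes "\<sigma> \<in> W"
  shows "\<sigma> \<in> Smu \<mu>"
proof -
  have "{p. \<exists>q. q \<noteq> p \<and> rel p q} \<subseteq> idx \<mu>"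
  proof
    fix p assume "p \<in> {p. \<exists>q. q \<noteq> p \<and> rel p q}"
    then obtain q where "q \<noteq> p" "rel p q" by blast
    then show "p \<in> idx \<mu>" unfolding rel_def by blast
  qed
  with W_permutes[OF assms] have "\<sigma> permutes idx \<mu>" by (rule permutes_subset)
  moreover have "fst (\<sigma> p) = fst p" for p using rel_fst[OF W_rel[OF assms]] by (rule sym)
  ultimately show ?thesis unfolding Smu_def by blast
qed

lemma perm_vbar: "\<sigma> \<in> W \<Longrightarrow> perm_vec \<sigma> vbar = vbar"
proof (rule ext)
  fix p assume "\<sigma> \<in> W"
  then have "rel p (invf \<sigma> p)" by (intro W_rel W_inv)
  then have "vbar p = vbar (invf \<sigma> p)" by (rule rel_vbar)
  then show "perm_vec \<sigma> vbar p = vbar p" by (simp only: perm_vec_apply)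
qed

lemma Z_perm:
  assumes \<sigma>: "\<sigma> \<in> W" and z: "z \<in> Z"
  shows "perm_vec \<sigma> z \<in> Z"
proof (rule ZI)
  show "perm_vec \<sigma> z p \<in> \<int>" for p unfolding perm_vec_apply by (rule Z_Ints[OF z])
  show "perm_vec \<sigma> z p = 0" if p: "p \<notin> idx \<mu> \<or> fst p > r'" for p
  proof -
    have "rel p (invf \<sigma> p)" by (rule W_rel[OF W_inv[OF \<sigma>]])
    then have "invf \<sigma> p = p" unfolding rel_def using p by auto
    then show ?thesis unfolding perm_vec_apply using p Z_idx[OF z, of p] Z_block[OF z, of p] by auto
  qed
qed

text \<open>A permutation whose inverse respects the classes conjugates \<open>W\<close> into
  itself, so it carries invariants to invariants and preserves the coinvariant ideal.\<close>

lemma Ann_comp_perm: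
  assumes \<phi>: "\<phi> \<in> Ann" and \<sigma>: "\<sigma> \<in> Smu \<mu>" and R: "\<And>p q. rel p q \<Longrightarrow> rel (invf \<sigma> p) (invf \<sigma> q)"
  shows "(\<lambda>f. \<phi> (perm_pol \<sigma> f)) \<in> Ann"
  unfolding Ann_def
proof (rule CollectI, intro conjI allI ballI)
  show "\<phi> (perm_pol \<sigma> (f + g)) = \<phi> (perm_pol \<sigma> f) + \<phi> (perm_pol \<sigma> g)" for f g
    unfolding perm_simps by (rule Ann_add[OF \<phi>])
  show "\<phi> (perm_pol \<sigma> (cst c * f)) = c * \<phi> (perm_pol \<sigma> f)" for c f
    unfolding perm_simps perm_cst by (rule Ann_cst[OF \<phi>])
  have Lam: "perm_pol \<sigma> g \<in> Lam \<mu>" if "g \<in> Lam \<mu>" for g by (rule Lam_perm[OF that Smu_idx[OF \<sigma>]])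
  have invs: "perm_pol \<sigma> g \<in> invs" if g: "g \<in> invs" for g
  proof -
    have "perm_pol \<tau> (perm_pol \<sigma> g) = perm_pol \<sigma> g" if \<tau>: "\<tau> \<in> W" for \<tau>
    proof -
      let ?\<rho> = "invf \<sigma> \<circ> (\<tau> \<circ> \<sigma>)"
      have "rel p (?\<rho> p)" for p
        using R[OF W_rel[OF \<tau>, of "\<sigma> p"]] by (simp add: Smu_inv_simps[OF \<sigma>])
      moreover have "bij ?\<rho>" by (intro bij_comp W_bij[OF \<tau>] Smu_bij[OF \<sigma>] bij_imp_bij_inv)
      ultimately have "?\<rho> \<in> W" unfolding W_def by blast
      then have "perm_pol ?\<rho> g = g" using g unfolding invs_def by blast
      moreover have "\<tau> \<circ> \<sigma> = \<sigma> \<circ> ?\<rho>" by (rule ext) (simp add: Smu_inv_simps[OF \<sigma>])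
      ultimately show ?thesis unfolding perm_perm by (metis perm_perm)
    qed
    then show ?thesis using g Lam unfolding invs_def by (simp add: const_coeff_perm[OF Smu_bij[OF \<sigma>]])
  qed
  show "\<phi> (perm_pol \<sigma> f) = 0" if "f \<in> I" for f
    using that
  proof (induction rule: I_induct)
    case zero
    show ?case by (simp add: Ann_0[OF \<phi>])
  next
    case (add x y)
    then show ?case by (simp add: Ann_add[OF \<phi>])
  next
    case (gen a g)
    have "perm_pol \<sigma> a * perm_pol \<sigma> g \<in> I" by (rule I_gen[OF Lam[OF gen(1)] invs[OF gen(2)]])
    then show ?case unfolding perm_simps by (rule Ann_I[OF \<phi>])
  qed
qed

lemma chi_perm:
  assumes \<sigma>: "\<sigma> \<in> Smu \<mu>"
  shows "chi \<phi> (perm_vec \<sigma> v) = chi (\<lambda>f. \<phi> (perm_pol \<sigma> f)) v"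
proof (rule ext)
  fix \<gamma>
  show "chi \<phi> (perm_vec \<sigma> v) \<gamma> = chi (\<lambda>f. \<phi> (perm_pol \<sigma> f)) v \<gamma>"
  proof (cases "\<gamma> \<in> Gam \<mu>")
    case True
    have "perm_pol \<sigma> (transl v \<gamma>) = transl (perm_vec \<sigma> v) \<gamma>"
      unfolding perm_transl[OF Smu_bij[OF \<sigma>]] Gam_perm[OF True \<sigma>] ..
    then show ?thesis by (simp only: chi_Gam[OF True])
  qed (simp add: chi_not_Gam)
qed

text \<open>A permutation relating two points of \<open>vbar + Z\<close> need not lie in \<open>W\<close>, but it normalises
  \<open>W\<close>.\<close>

lemma orbit_transfer:
  assumes \<phi>: "\<phi> \<in> Ann" and z: "z \<in> Z" "z' \<in> Z" and \<sigma>: "\<sigma> \<in> Smu \<mu>"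
    and eq: "perm_vec \<sigma> (vbar + z') = vbar + z"
  obtains \<psi> where "\<psi> \<in> Ann" "chi \<phi> (vbar + z) = chi \<psi> (vbar + z')"
proof (rule that)
  note \<rho> = Smu_inv[OF \<sigma>]
  \<comment> \<open>In the first \<open>r'\<close> blocks the values of \<open>vbar\<close> at an
    index and at its preimage differ by an integer. In the other blocks the classes are single
    indices, so nothing has to be shown there.\<close>
  have r: "rel p (invf \<sigma> p)" if "p \<in> idx \<mu>" "fst p \<le> r'" for p
  proof -
    have "vbar (invf \<sigma> p) + z' (invf \<sigma> p) = vbar p + z p" using fun_cong[OF eq, of p] by (simp add: perm_vec_apply)
    then have "vbar p - vbar (invf \<sigma> p) = z' (invf \<sigma> p) - z p" by (simp add: algebra_simps)
    then have "vbar p - vbar (invf \<sigma> p) \<in> \<int>" using Ints_diff[OF Z_Ints[OF z(2)] Z_Ints[OF z(1)]] by metis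
    then show ?thesis unfolding rel_def using that Smu_idx[OF \<rho> that(1)] Smu_fst[OF \<rho>, of p] by simp
  qed
  show "(\<lambda>f. \<phi> (perm_pol \<sigma> f)) \<in> Ann"
  proof (rule Ann_comp_perm[OF \<phi> \<sigma>])
    fix p q assume pq: "rel p q"
    show "rel (invf \<sigma> p) (invf \<sigma> q)"
    proof (cases "p = q")
      case True
      then show ?thesis by (simp only: rel_refl)
    next
      case False
      then have i: "p \<in> idx \<mu>" "fst p \<le> r'" "q \<in> idx \<mu>" "fst q \<le> r'" using pq unfolding rel_def by auto
      show ?thesis by (rule rel_trans[OF rel_sym[OF r[OF i(1,2)]] rel_trans[OF pq r[OF i(3,4)]]])
    qed
  qed
  show "chi \<phi> (vbar + z) = chi (\<lambda>f. \<phi> (perm_pol \<sigma> f)) (vbar + z')"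
    unfolding eq[symmetric] by (rule chi_perm[OF \<sigma>])
qed

lemma Zdom_iff: "z \<in> Zdom \<mu> r' simple_roots \<longleftrightarrow> z \<in> Z \<and> (\<forall>p q. adj p q \<longrightarrow> z p - z q \<in> \<nat>)"
proof
  assume a: "z \<in> Zdom \<mu> r' simple_roots"
  have "z p - z q \<in> \<nat>" if "adj p q" for p q
  proof -
    have "mpol_eval (var p - var q) z \<in> \<nat>" using a that unfolding Zdom_def simple_root_iff[symmetric] by blast
    then show ?thesis by simp
  qed
  then show "z \<in> Z \<and> (\<forall>p q. adj p q \<longrightarrow> z p - z q \<in> \<nat>)" using a unfolding Zdom_def by blast
next
  assume a: "z \<in> Z \<and> (\<forall>p q. adj p q \<longrightarrow> z p - z q \<in> \<nat>)"
  have "mpol_eval \<alpha> z \<in> \<nat>" if "\<alpha> \<in> simple_roots" for \<alpha>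
  proof -
    obtain k i where ki: "\<alpha> = var (k, i) - var (k, Suc i)" "rel (k, i) (k, Suc i)" using \<open>\<alpha> \<in> simple_roots\<close> by (rule simple_rootE)
    have "adj (k, i) (k, Suc i)" unfolding adj_def using ki(2) by simp
    then have "z (k, i) - z (k, Suc i) \<in> \<nat>" using a by blast
    then show ?thesis unfolding ki(1) by simp
  qed
  with a show "z \<in> Zdom \<mu> r' simple_roots" unfolding Zdom_def by blast
qed

lemma Zdom_Z: "z \<in> Zdom \<mu> r' simple_roots \<Longrightarrow> z \<in> Z"
  unfolding Zdom_def by blast

lemma Z_integral:
  assumes "z \<in> Z"
  obtains c where "z = (\<lambda>p. complex_of_int (c p))"
proof
  show "z = (\<lambda>p. complex_of_int \<lfloor>Re (z p)\<rfloor>)"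
  proof (rule ext)
    fix p
    obtain n where "z p = of_int n" using Z_Ints[OF assms, of p] by (rule Ints_cases)
    then show "z p = complex_of_int \<lfloor>Re (z p)\<rfloor>" by simp
  qed
qed

text \<open>Choose the permutation that minimises the sum of the entries weighted by position.
  Positions of adjacent indices differ by one, so exchanging them changes the weighted sum by the
  difference of the two entries, which is thus nonnegative.\<close>

lemma sort_W:
  assumes z: "z \<in> Z"
  obtains \<sigma> where "\<sigma> \<in> W" "perm_vec \<sigma> z \<in> Zdom \<mu> r' simple_roots"
proof -
  define S where "S y = (\<Sum>r\<in>idx \<mu>. real (snd r) * Re (y r))" for y :: vec
  have ne: "finite ((\<lambda>\<sigma>. S (perm_vec \<sigma> z)) ` W)" "(\<lambda>\<sigma>. S (perm_vec \<sigma> z)) ` W \<noteq> {}"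
    using finite_W W_id by blast+
  from Min_in[OF ne] obtain \<sigma> where \<sigma>: "\<sigma> \<in> W" "Min ((\<lambda>\<sigma>. S (perm_vec \<sigma> z)) ` W) = S (perm_vec \<sigma> z)"
    by (rule imageE)
  have min: "S (perm_vec \<sigma> z) \<le> S (perm_vec \<tau> z)" if "\<tau> \<in> W" for \<tau>
    unfolding \<sigma>(2)[symmetric] by (rule Min_le[OF ne(1) imageI[OF that]])
  define y where "y = perm_vec \<sigma> z"
  have yZ: "y \<in> Z" unfolding y_def by (rule Z_perm[OF \<sigma>(1) z])
  obtain c where c: "y = (\<lambda>p. complex_of_int (c p))" by (rule Z_integral[OF yZ])
  have "y p - y q \<in> \<nat>" if adj: "adj p q" for p q
  proof -
    have ne: "p \<noteq> q" by (rule adj_neq[OF adj])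
    have idx: "p \<in> idx \<mu>" "q \<in> idx \<mu>" using adj_rel[OF adj] ne unfolding rel_def by blast+
    have sn: "snd q = Suc (snd p)" using adj unfolding adj_def by simp
    have "swap p q \<circ> \<sigma> \<in> W" by (rule W_comp[OF W_swap[OF adj_rel[OF adj]] \<sigma>(1)])
    from min[OF this] have "S y \<le> S (perm_vec (swap p q) y)"
      unfolding y_def perm_vec_comp[OF W_Smu[OF W_swap[OF adj_rel[OF adj]]] W_Smu[OF \<sigma>(1)]] .
    also have "perm_vec (swap p q) y = (\<lambda>r. y (swap p q r))" by (rule ext) (simp add: perm_vec_apply)
    finally have le: "0 \<le> S (\<lambda>r. y (swap p q r)) - S y" by simp
    have "S (\<lambda>r. y (swap p q r)) - S y = (\<Sum>r\<in>idx \<mu>. real (snd r) * (Re (y (swap p q r)) - Re (y r)))"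
      unfolding S_def sum_subtractf[symmetric] by (simp add: algebra_simps)
    also have "\<dots> = (\<Sum>r\<in>{p, q}. real (snd r) * (Re (y (swap p q r)) - Re (y r)))"
    proof (rule sum.mono_neutral_right[OF finite_idx])
      show "{p, q} \<subseteq> idx \<mu>" using idx by simp
      show "\<forall>r\<in>idx \<mu> - {p, q}. real (snd r) * (Re (y (swap p q r)) - Re (y r)) = 0"
        by (simp add: Transposition.transpose_def)
    qed
    also have "\<dots> = real (snd p) * (real_of_int (c q) - c p) + real (snd q) * (real_of_int (c p) - c q)"
      using ne by (simp add: c)
    also have "\<dots> = real_of_int (c p - c q)" by (simp add: sn algebra_simps)
    finally have "0 \<le> c p - c q" using le by simp
    then show ?thesis using of_int_Nats_iff[of "c p - c q"] by (simp add: c)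
  qed
  with yZ have "y \<in> Zdom \<mu> r' simple_roots" unfolding Zdom_iff by blast
  with \<sigma>(1) show thesis unfolding y_def by (rule that)
qed

text \<open>On integral vectors this is the sum of the absolute values of the coordinates; the floor
  only converts it to a natural number.\<close>

definition height :: "vec \<Rightarrow> nat" where
  "height z = (\<Sum>p\<in>idx \<mu>. nat \<lfloor>cmod (z p)\<rfloor>)"

text \<open>Lower the last positive coordinate, or raise the first negative one.\<close>

lemma dominant_step:
  assumes z: "z \<in> Zdom \<mu> r' simple_roots" and nz: "z \<noteq> 0"
  obtains q e where "q \<in> idx \<mu>" "fst q \<le> r'" "e = 1 \<or> e = - 1"
    "z + svec e q \<in> Zdom \<mu> r' simple_roots" "height (z + svec e q) < height z"
proof -
  have zZ: "z \<in> Z" by (rule Zdom_Z[OF z])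
  obtain c where c: "z = (\<lambda>p. complex_of_int (c p))" by (rule Z_integral[OF zZ])
  have dom: "c q \<le> c p" if "adj p q" for p q
  proof -
    have "z p - z q \<in> \<nat>" using z that unfolding Zdom_iff by blast
    then show ?thesis using of_int_Nats_iff[of "c p - c q"] by (simp add: c)
  qed
  have supp: "p \<in> idx \<mu>" "fst p \<le> r'" if "c p \<noteq> 0" for p
  proof -
    have "z p \<noteq> 0" using that by (simp add: c)
    then show "p \<in> idx \<mu>" "fst p \<le> r'" using Z_idx[OF zZ, of p] Z_block[OF zZ, of p] not_less by blast+
  qed
  have "\<exists>q n. c q \<noteq> 0 \<and> (n = 1 \<or> n = - 1) \<and> \<bar>c q + n\<bar> < \<bar>c q\<bar> \<and>
      (\<forall>r s. adj r s \<longrightarrow> (c s + (if s = q then n else 0)) \<le> c r + (if r = q then n else 0))"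
  proof (cases "\<exists>p. 0 < c p")
    case True
    have fin: "finite (snd ` {p. 0 < c p})"
      by (intro finite_imageI finite_subset[OF _ finite_idx[of \<mu>]] subsetI supp(1)) simp
    have "snd ` {p. 0 < c p} \<noteq> {}" using True by blast
    from Max_in[OF fin this] obtain q where q: "Max (snd ` {p. 0 < c p}) = snd q" "q \<in> {p. 0 < c p}" by (rule imageE)
    \<comment> \<open>The maximum runs over all blocks at once. It makes the successor of
      \<open>q\<close> within its class nonpositive, so lowering \<open>q\<close> keeps the vector
      dominant.\<close>
    have max: "snd p \<le> snd q" if "0 < c p" for p
      unfolding q(1)[symmetric] by (rule Max_ge[OF fin]) (use that in blast)
    have cq: "0 < c q" using q(2) by simp
    have "(c s + (if s = q then - 1 else 0)) \<le> c r + (if r = q then - 1 else 0)" if "adj r s" for r s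
    proof (cases "r = q")
      case True
      have "s \<noteq> q" using adj_neq[OF that] True by simp
      moreover have "\<not> 0 < c s" using max[of s] that True unfolding adj_def by auto
      ultimately show ?thesis using True cq by simp
    next
      case False
      then show ?thesis using dom[OF that] by auto
    qed
    then show ?thesis using cq by (intro exI[of _ q] exI[of _ "- 1"]) simp
  next
    case False
    then have nonpos: "c p \<le> 0" for p by (simp add: not_less)
    have ex: "\<exists>p. c p < 0"
    proof (rule ccontr)
      assume "\<nexists>p. c p < 0"
      then have "c p = 0" for p using nonpos[of p] by (metis less_le)
      then have "z = 0" by (intro ext) (simp add: c)
      with nz show False by simp
    qed
    have fin: "finite (snd ` {p. c p < 0})"
      by (intro finite_imageI finite_subset[OF _ finite_idx[of \<mu>]] subsetI supp(1)) simp
    have "snd ` {p. c p < 0} \<noteq> {}" using ex by blast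
    from Min_in[OF fin this] obtain q where q: "Min (snd ` {p. c p < 0}) = snd q" "q \<in> {p. c p < 0}" by (rule imageE)
    have min: "snd q \<le> snd p" if "c p < 0" for p
      unfolding q(1)[symmetric] by (rule Min_le[OF fin]) (use that in blast)
    have cq: "c q < 0" using q(2) by simp
    have "(c s + (if s = q then 1 else 0)) \<le> c r + (if r = q then 1 else 0)" if "adj r s" for r s
    proof (cases "s = q")
      case True
      have "r \<noteq> q" using adj_neq[OF that] True by simp
      moreover have "\<not> c r < 0" using min[of r] that True unfolding adj_def by auto
      ultimately show ?thesis using True cq by simp
    next
      case False
      then show ?thesis using dom[OF that] by auto
    qed
    then show ?thesis using cq by (intro exI[of _ q] exI[of _ 1]) simp
  qed
  then obtain q n where q: "c q \<noteq> 0" "n = 1 \<or> n = - 1" "\<bar>c q + n\<bar> < \<bar>c q\<bar>"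
    "\<forall>r s. adj r s \<longrightarrow> (c s + (if s = q then n else 0)) \<le> c r + (if r = q then n else 0)" by blast
  let ?e = "complex_of_int n"
  have y: "(z + svec ?e q) r = complex_of_int (c r + (if r = q then n else 0))" for r
    by (simp add: c svec_def)
  have yZ: "z + svec ?e q \<in> Z" by (rule Z_add_svec[OF zZ Ints_of_int supp[OF q(1)]])
  show thesis
  proof (rule that[OF supp[OF q(1)]])
    show "?e = 1 \<or> ?e = - 1" using q(2) by auto
    have "(z + svec ?e q) r - (z + svec ?e q) s \<in> \<nat>" if "adj r s" for r s
    proof -
      have "0 \<le> (c r + (if r = q then n else 0)) - (c s + (if s = q then n else 0))" using q(4) that by simp
      then show ?thesis unfolding y of_int_diff[symmetric] of_int_Nats_iff .
    qed
    with yZ show "z + svec ?e q \<in> Zdom \<mu> r' simple_roots" unfolding Zdom_iff by blast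
    have "(\<Sum>p\<in>idx \<mu> - {q}. nat \<lfloor>cmod ((z + svec ?e q) p)\<rfloor>) = (\<Sum>p\<in>idx \<mu> - {q}. nat \<lfloor>cmod (z p)\<rfloor>)"
      by (rule sum.cong) (simp_all add: svec_def)
    moreover have "nat \<lfloor>cmod ((z + svec ?e q) q)\<rfloor> < nat \<lfloor>cmod (z q)\<rfloor>"
    proof -
      have "cmod ((z + svec ?e q) q) = real_of_int \<bar>c q + n\<bar>" "cmod (z q) = real_of_int \<bar>c q\<bar>"
        unfolding y by (simp_all only: c norm_of_int if_True refl of_int_abs)
      then show ?thesis using q(3) by linarith
    qed
    ultimately show "height (z + svec ?e q) < height z"
      unfolding height_def sum.remove[OF finite_idx supp(1)[OF q(1)]] by linarith
  qed
qed

text \<open>The Taylor expansion of a symmetric polynomial at \<open>vbar\<close> is invariant under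
  \<open>W\<close>, so it differs from its constant term by an element of the coinvariant
  ideal.\<close>

lemma chi_vbar:
  assumes \<phi>: "\<phi> \<in> Ann"
  shows "chi \<phi> vbar = cscale (\<phi> 1) (chi const_coeff vbar)"
proof (rule ext)
  fix \<gamma>
  show "chi \<phi> vbar \<gamma> = cscale (\<phi> 1) (chi const_coeff vbar) \<gamma>"
  proof (cases "\<gamma> \<in> Gam \<mu>")
    case True
    define g where "g = transl vbar \<gamma>"
    have inv: "perm_pol \<sigma> g = g" if "\<sigma> \<in> W" for \<sigma>
      unfolding g_def perm_transl[OF W_bij[OF that]] perm_vbar[OF that] Gam_perm[OF True W_Smu[OF that]] ..
    have gL: "g \<in> Lam \<mu>" unfolding g_def by (rule Lam_transl[OF Gam_Lam[OF True]])
    have "g - cst (const_coeff g) \<in> invs"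
      unfolding invs_def using gL inv by (simp add: Lam_diff)
    then have "\<phi> g = \<phi> (cst (const_coeff g))" by (rule Ann_cong[OF \<phi> invs_I])
    also have "\<dots> = const_coeff g * \<phi> 1" using Ann_cst[OF \<phi>, of "const_coeff g" 1] by simp
    finally show ?thesis by (simp add: chi_Gam[OF True] cscale_def g_def)
  qed (simp add: chi_not_Gam cscale_def)
qed

section \<open>Irreducibility\<close>

definition represents :: "nat set \<Rightarrow> (nat \<Rightarrow> mpol \<Rightarrow> complex) \<Rightarrow> (nat \<Rightarrow> vec) \<Rightarrow> (mpol \<Rightarrow> complex) \<Rightarrow> bool" where
  "represents J \<phi> z \<chi> \<longleftrightarrow> finite J \<and> (\<forall>i\<in>J. \<phi> i \<in> Ann \<and> z i \<in> Z) \<and> \<chi> = (\<Sum>i\<in>J. chi (\<phi> i) (vbar + z i))"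

lemma V_represents: "\<chi> \<in> V \<Longrightarrow> \<exists>J \<phi> z. represents J \<phi> z \<chi>"
  unfolding V_eq
proof (induction rule: functional.span_induct_alt)
  case base
  have "represents {} (\<lambda>i. const_coeff) (\<lambda>i. 0) 0" unfolding represents_def by simp
  then show ?case by blast
next
  case (step c x y)
  then obtain J \<phi> z where r: "represents J \<phi> z y" by blast
  obtain \<psi> w where x: "x = chi \<psi> (vbar + w)" "\<psi> \<in> Ann" "w \<in> Z" using step by blast
  have fin: "finite J" using r unfolding represents_def by blast
  then obtain j where j: "j \<notin> J" using ex_new_if_finite[OF infinite_UNIV_nat] by blast
  let ?\<psi> = "\<lambda>f. \<psi> (cst c * f)"
  have \<psi>: "?\<psi> \<in> Ann" by (rule Ann_comp_mult[OF x(2) Lam_cst])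
  have cx: "cscale c x = chi ?\<psi> (vbar + w)"
    unfolding x(1) by (rule ext) (simp add: cscale_def chi_def Ann_cst[OF x(2)])
  have sum: "(\<Sum>i\<in>J. chi ((\<phi>(j := ?\<psi>)) i) (vbar + (z(j := w)) i)) = y"
  proof -
    have "(\<Sum>i\<in>J. chi ((\<phi>(j := ?\<psi>)) i) (vbar + (z(j := w)) i)) = (\<Sum>i\<in>J. chi (\<phi> i) (vbar + z i))"
      by (rule sum.cong[OF refl]) (metis fun_upd_other j)
    then show ?thesis using r unfolding represents_def by simp
  qed
  have "represents (insert j J) (\<phi>(j := ?\<psi>)) (z(j := w)) (cscale c x + y)"
    unfolding represents_def
  proof (intro conjI ballI)
    show "finite (insert j J)" using fin by simp
    show "(\<phi>(j := ?\<psi>)) i \<in> Ann" "(z(j := w)) i \<in> Z" if "i \<in> insert j J" for i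
      using that r \<psi> x(3) unfolding represents_def by auto
    show "cscale c x + y = (\<Sum>i\<in>insert j J. chi ((\<phi>(j := ?\<psi>)) i) (vbar + (z(j := w)) i))"
      unfolding sum.insert[OF fin j] sum by (simp only: cx fun_upd_same)
  qed
  then show ?case by blast
qed

text \<open>In a representation with the fewest summands no summand vanishes and the points lie in
  distinct orbits.\<close>

lemma evaluation_in_submodule:
  assumes subN: "functional.subspace N"
    and embN: "\<And>g \<chi>. g \<in> Gam \<mu> \<Longrightarrow> \<chi> \<in> N \<Longrightarrow> dual_act \<mu> (emb (to_fract g)) \<chi> \<in> N"
    and \<chi>: "\<chi> \<in> N" "\<chi> \<in> V" "\<chi> \<noteq> 0"
  obtains z where "z \<in> Zdom \<mu> r' simple_roots" "chi const_coeff (vbar + z) \<in> N"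
proof -
  define P where "P n \<longleftrightarrow> (\<exists>J \<phi> z. represents J \<phi> z \<chi> \<and> card J = n)" for n
  have "P (LEAST n. P n)"
    by (rule LeastI_ex) (use V_represents[OF \<chi>(2)] in \<open>unfold P_def, blast\<close>)
  then obtain J \<phi> z where r: "represents J \<phi> z \<chi>" "card J = (LEAST n. P n)" unfolding P_def by blast
  have least: "card J \<le> card J'" if "represents J' \<phi>' z' \<chi>" for J' \<phi>' z'
    unfolding r(2) by (rule Least_le) (use that in \<open>unfold P_def, blast\<close>)
  have fin: "finite J" and \<phi>: "\<And>i. i \<in> J \<Longrightarrow> \<phi> i \<in> Ann" and z: "\<And>i. i \<in> J \<Longrightarrow> z i \<in> Z"
    and sum: "\<chi> = (\<Sum>i\<in>J. chi (\<phi> i) (vbar + z i))" using r(1) unfolding represents_def by blast+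
  have "J \<noteq> {}" using sum \<chi>(3) by auto
  then obtain i0 where i0: "i0 \<in> J" by blast
  have nz: "chi (\<phi> i0) (vbar + z i0) \<noteq> 0"
  proof
    assume 0: "chi (\<phi> i0) (vbar + z i0) = 0"
    have "\<chi> = (\<Sum>i\<in>J - {i0}. chi (\<phi> i) (vbar + z i))" unfolding sum sum.remove[OF fin i0] 0 by simp
    then have "represents (J - {i0}) \<phi> z \<chi>" using fin \<phi> z unfolding represents_def by blast
    from least[OF this] show False using card_Diff1_less[OF fin i0] by simp
  qed
  have orb: "perm_vec \<sigma> (vbar + z i) \<noteq> vbar + z i0" if i: "i \<in> J" "i \<noteq> i0" and \<sigma>: "\<sigma> \<in> Smu \<mu>" for i \<sigma>
  proof
    assume eq: "perm_vec \<sigma> (vbar + z i) = vbar + z i0"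
    obtain \<psi> where \<psi>: "\<psi> \<in> Ann" "chi (\<phi> i0) (vbar + z i0) = chi \<psi> (vbar + z i)"
      by (rule orbit_transfer[OF \<phi>[OF i0] z[OF i0] z[OF i(1)] \<sigma> eq])
    \<comment> \<open>The summand of \<open>i0\<close> is transported to the point of
      \<open>i\<close> in the same orbit and merged there, which would shorten the
      representation.\<close>
    let ?J = "J - {i0}" and ?\<phi> = "\<phi>(i := (\<lambda>f. \<psi> f + \<phi> i f))"
    have iJ: "i \<in> ?J" using i by simp
    have fJ: "finite ?J" using fin by simp
    have A: "(\<lambda>f. \<psi> f + \<phi> i f) \<in> Ann"
      using \<psi>(1) \<phi>[OF i(1)] unfolding Ann_def by (simp add: algebra_simps)
    have "chi (\<lambda>f. \<psi> f + \<phi> i f) (vbar + z i) = chi \<psi> (vbar + z i) + chi (\<phi> i) (vbar + z i)"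
      by (rule ext) (simp add: chi_def)
    moreover have "(\<Sum>l\<in>?J - {i}. chi (?\<phi> l) (vbar + z l)) = (\<Sum>l\<in>?J - {i}. chi (\<phi> l) (vbar + z l))"
      by (rule sum.cong) simp_all
    ultimately have "\<chi> = (\<Sum>l\<in>?J. chi (?\<phi> l) (vbar + z l))"
      unfolding sum sum.remove[OF fin i0] sum.remove[OF fJ iJ] \<psi>(2) fun_upd_same by (simp only: add.assoc)
    moreover have "?\<phi> l \<in> Ann" if "l \<in> ?J" for l using A \<phi> that by simp
    ultimately have "represents ?J ?\<phi> z \<chi>" using fJ z unfolding represents_def by blast
    from least[OF this] show False using card_Diff1_less[OF fin i0] by simp
  qed
  have "chi (\<lambda>f. \<phi> i0 (1 * f)) (vbar + z i0) \<in> N"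
  proof (rule separate[OF subN embN fin i0, where v = "\<lambda>i. vbar + z i"])
    show "vbar + z i \<in> Cvec \<mu>" if "i \<in> J" for i by (rule vbar_add_Cvec[OF z[OF that]])
    show "(\<Sum>i\<in>J. chi (\<phi> i) (vbar + z i)) \<in> N" using \<chi>(1) unfolding sum .
  qed (use \<phi> orb in simp_all)
  then have "chi (\<phi> i0) (vbar + z i0) \<in> N" by simp
  from socle[OF subN embN \<phi>[OF i0] this nz] have ev: "chi const_coeff (vbar + z i0) \<in> N" .
  obtain \<sigma> where \<sigma>: "\<sigma> \<in> W" "perm_vec \<sigma> (z i0) \<in> Zdom \<mu> r' simple_roots" by (rule sort_W[OF z[OF i0]])
  \<comment> \<open>The group fixes \<open>vbar\<close>, so sorting \<open>z\<close> moves the point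
    within its orbit, and evaluation of symmetric polynomials does not notice.\<close>
  have "vbar + perm_vec \<sigma> (z i0) = perm_vec \<sigma> (vbar + z i0)" unfolding perm_vec_add perm_vbar[OF \<sigma>(1)] ..
  then have "chi const_coeff (vbar + perm_vec \<sigma> (z i0)) = chi const_coeff (vbar + z i0)"
    by (simp only: chi_perm[OF W_Smu[OF \<sigma>(1)]] const_coeff_perm[OF W_bij[OF \<sigma>(1)]])
  with ev have "chi const_coeff (vbar + perm_vec \<sigma> (z i0)) \<in> N" by simp
  with \<sigma>(2) show thesis by (rule that)
qed

lemma V_subset:
  assumes subN: "functional.subspace N"
    and embN: "\<And>g \<chi>. g \<in> Gam \<mu> \<Longrightarrow> \<chi> \<in> N \<Longrightarrow> dual_act \<mu> (emb (to_fract g)) \<chi> \<in> N"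
    and NV: "N \<subseteq> V" and N0: "N \<noteq> {0}"
    and gens: "\<And>z q e. z \<in> Zdom \<mu> r' simple_roots \<Longrightarrow> q \<in> idx \<mu> \<Longrightarrow> fst q \<le> r' \<Longrightarrow> e = 1 \<or> e = - 1 \<Longrightarrow>
      \<exists>X F. gen_op \<mu> X (fst q) e F \<and> (\<forall>\<chi>\<in>N. dual_act \<mu> X \<chi> \<in> N) \<and> mpol_eval (F q) (vbar + z) \<noteq> 0"
  shows "V \<subseteq> N"
proof -
  let ?D = "Zdom \<mu> r' simple_roots"
  have block: "q \<in> block \<mu> (fst q)" if "q \<in> idx \<mu>" for q using that unfolding block_def by simp
  have e01: "e \<noteq> 0 \<and> e \<in> \<int>" if "e = 1 \<or> e = - 1" for e :: complex using that by auto
  have ev_step: "chi const_coeff (vbar + (z + svec e q)) \<in> N"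
    if prem: "chi const_coeff (vbar + z) \<in> N" "z \<in> ?D" "q \<in> idx \<mu>" "fst q \<le> r'" "e = 1 \<or> e = - 1" for z q e
  proof -
    obtain X F where X: "gen_op \<mu> X (fst q) e F" "\<forall>\<chi>\<in>N. dual_act \<mu> X \<chi> \<in> N" "mpol_eval (F q) (vbar + z) \<noteq> 0"
      using gens[OF prem(2-5)] by blast
    show ?thesis
      by (rule move_results(1)[OF subN embN X(1) bspec[OF X(2)] prem(4) Zdom_Z[OF prem(2)]
        conjunct1[OF e01[OF prem(5)]] conjunct2[OF e01[OF prem(5)]] block[OF prem(3)] X(3) prem(1)])
  qed
  have D_step: "\<forall>\<psi>\<in>Ann. chi \<psi> (vbar + (z + svec e q)) \<in> N"
    if prem: "\<forall>\<phi>\<in>Ann. chi \<phi> (vbar + z) \<in> N" "z \<in> ?D" "q \<in> idx \<mu>" "fst q \<le> r'" "e = 1 \<or> e = - 1" for z q e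
  proof
    fix \<psi> assume \<psi>: "\<psi> \<in> Ann"
    obtain X F where X: "gen_op \<mu> X (fst q) e F" "\<forall>\<chi>\<in>N. dual_act \<mu> X \<chi> \<in> N" "mpol_eval (F q) (vbar + z) \<noteq> 0"
      using gens[OF prem(2-5)] by blast
    show "chi \<psi> (vbar + (z + svec e q)) \<in> N"
      by (rule move_results(2)[OF subN embN X(1) bspec[OF X(2)] prem(4) Zdom_Z[OF prem(2)]
        conjunct1[OF e01[OF prem(5)]] conjunct2[OF e01[OF prem(5)]] block[OF prem(3)] X(3) bspec[OF prem(1)] \<psi>])
  qed
  have down: "chi const_coeff (vbar + 0) \<in> N" if "chi const_coeff (vbar + z) \<in> N" "z \<in> ?D" for z
    using that
  proof (induction "height z" arbitrary: z rule: less_induct)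
    case less
    show ?case
    proof (cases "z = 0")
      case True
      then show ?thesis using less.prems(1) by simp
    next
      case False
      obtain q e where q: "q \<in> idx \<mu>" "fst q \<le> r'" "e = 1 \<or> e = - 1" "z + svec e q \<in> ?D" "height (z + svec e q) < height z"
        by (rule dominant_step[OF less.prems(2) False])
      show ?thesis by (rule less.hyps[OF q(5) ev_step[OF less.prems q(1-3)] q(4)])
    qed
  qed
  have up: "\<forall>\<psi>\<in>Ann. chi \<psi> (vbar + z) \<in> N" if "\<forall>\<psi>\<in>Ann. chi \<psi> (vbar + 0) \<in> N" "z \<in> ?D" for z
    using that(2)
  proof (induction "height z" arbitrary: z rule: less_induct)
    case less
    show ?case
    proof (cases "z = 0")
      case True
      then show ?thesis using that(1) by simp
    next
      case False
      obtain q e where q: "q \<in> idx \<mu>" "fst q \<le> r'" "e = 1 \<or> e = - 1" "z + svec e q \<in> ?D" "height (z + svec e q) < height z"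
        by (rule dominant_step[OF less.prems False])
      \<comment> \<open>The way back uses the opposite shift. It starts at the dominant vector
        \<open>z + svec e q\<close>, so the coefficients are known not to vanish there.\<close>
      have e: "- e = 1 \<or> - e = - 1" using q(3) by auto
      have z: "z + svec e q + svec (- e) q = z" by (rule ext) (simp add: svec_def)
      show ?thesis using D_step[OF less.hyps[OF q(5,4)] q(4) q(1,2) e] unfolding z .
    qed
  qed
  have "0 \<in> N" by (rule functional.subspace_0[OF subN])
  with N0 obtain \<chi> where \<chi>: "\<chi> \<in> N" "\<chi> \<noteq> 0" by blast
  obtain z where z: "z \<in> ?D" "chi const_coeff (vbar + z) \<in> N"
    by (rule evaluation_in_submodule[OF subN embN \<chi>(1) subsetD[OF NV \<chi>(1)] \<chi>(2)])
  have "chi const_coeff vbar \<in> N" using down[OF z(2,1)] by simp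
  then have "\<forall>\<psi>\<in>Ann. chi \<psi> (vbar + 0) \<in> N"
    using functional.subspace_scale[OF subN] by (simp add: chi_vbar)
  then have dom: "chi \<psi> (vbar + z) \<in> N" if "\<psi> \<in> Ann" "z \<in> ?D" for \<psi> z using up that by blast
  \<comment> \<open>For a vector that is not dominant no generator is applied: every functional
    there is also a functional at the sorted vector.\<close>
  have "chi \<phi> (vbar + z) \<in> N" if \<phi>: "\<phi> \<in> Ann" and z: "z \<in> Z" for \<phi> z
  proof -
    obtain \<sigma> where \<sigma>: "\<sigma> \<in> W" "perm_vec \<sigma> z \<in> ?D" by (rule sort_W[OF z])
    have "perm_vec \<sigma> (vbar + z) = vbar + perm_vec \<sigma> z" unfolding perm_vec_add perm_vbar[OF \<sigma>(1)] ..
    then have eq: "perm_vec (invf \<sigma>) (vbar + perm_vec \<sigma> z) = vbar + z"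
      using perm_vec_inv(1)[OF W_Smu[OF \<sigma>(1)], of "vbar + z"] by simp
    obtain \<psi> where \<psi>: "\<psi> \<in> Ann" "chi \<phi> (vbar + z) = chi \<psi> (vbar + perm_vec \<sigma> z)"
      by (rule orbit_transfer[OF \<phi> z Zdom_Z[OF \<sigma>(2)] Smu_inv[OF W_Smu[OF \<sigma>(1)]] eq])
    show ?thesis unfolding \<psi>(2) by (rule dom[OF \<psi>(1) \<sigma>(2)])
  qed
  then show ?thesis unfolding V_eq by (intro functional.span_minimal[OF _ subN]) blast
qed

lemma V_nonzero: "V \<noteq> {0}"
proof
  assume V: "V = {0}"
  have "(0 :: vec) \<in> Z" by (rule ZI) simp_all
  from chi_V[OF Ann_const_coeff this] have "chi const_coeff (vbar + 0) = 0" unfolding V by blast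
  then have "chi const_coeff (vbar + 0) 1 = 0" by simp
  then show False unfolding chi_Gam[OF Gam_1] by simp
qed

lemma preserving_generated:
  assumes sub: "generate_ring (smash_inv \<mu> M) H \<subseteq> carrier (smash_inv \<mu> M)"
    and gen: "\<And>X. X \<in> H \<Longrightarrow> preserving X" and X: "X \<in> generate_ring (smash_inv \<mu> M) H"
  shows "preserving X"
  using X
proof (induction rule: generate_ring.induct)
  case one
  have "\<one>\<^bsub>smash_inv \<mu> M\<^esub> = emb (to_fract 1)" by (simp add: smash_inv_def)
  then show ?case using preserving_emb[OF Gam_1] by simp
next
  case (incl h)
  then show ?case by (rule gen)
next
  case (a_inv h)
  have "h \<in> carrier (smash_inv \<mu> M)" using a_inv(1) sub by blast
  from preserving_uminus[OF a_inv(2)] show ?case unfolding a_inv_smash[OF \<open>h \<in> carrier (smash_inv \<mu> M)\<close>] .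
next
  case (eng_add h1 h2)
  have "h1 \<oplus>\<^bsub>smash_inv \<mu> M\<^esub> h2 = h1 + h2" by (simp add: smash_inv_def)
  then show ?case using preserving_add[OF eng_add(3,4)] by simp
next
  case (eng_mult h1 h2)
  have "h1 \<otimes>\<^bsub>smash_inv \<mu> M\<^esub> h2 = smul h1 h2" by (simp add: smash_inv_def)
  then show ?case using preserving_smul[OF eng_mult(3,4)] by simp
qed

end

text \<open>The numerators of the generators and the polynomials in the hypothesis differ by nonzero
  scalars only, one from averaging over the block group and one from the block size.\<close>

lemma fcoef_nonzero:
  assumes "mpol_eval (fcoef \<mu> f k i) v \<noteq> 0" "c \<noteq> 0"
  shows "mpol_eval (cst c * perm_pol (swap (k, 1) (k, i)) (f k)) v \<noteq> 0"
  using assms by (simp add: fcoef_def)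

theorem theorem8p5:
  fixes \<mu> :: "nat list" and r' :: nat
    and fp fm :: "nat \<Rightarrow> mpol" and U :: "smash set"
    and vbar :: vec and \<Psi> \<Omega> :: "mpol set"
  assumes "\<forall>m \<in> set \<mu>. 0 < m"
    and "r' \<le> length \<mu>"
    and "standard_galois_order \<mu> r' fp fm U"
    and "seed \<mu> r' vbar"
    and "\<Psi> = Psi \<mu> r' vbar"
    and "\<Omega> = \<Psi> \<inter> Sigbar \<mu> r'"
    and "\<And>z k i. z \<in> Zdom \<mu> r' \<Omega> \<Longrightarrow> 1 \<le> k \<Longrightarrow> k \<le> r' \<Longrightarrow> 1 \<le> i \<Longrightarrow> i \<le> msize \<mu> k \<Longrightarrow>
           mpol_eval (fcoef \<mu> fp k i) (vbar + z) \<noteq> 0 \<and>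
           mpol_eval (fcoef \<mu> fm k i) (vbar + z) \<noteq> 0"
  shows "irreducible_dual \<mu> U (Vmod \<mu> r' \<Psi> \<Omega> vbar)"
proof -
  interpret seed_setup \<mu> r' vbar by unfold_locales (rule assms(4))
  have \<Psi>: "\<Psi> = roots" unfolding roots_eq by (rule assms(5))
  have \<Omega>: "\<Omega> = simple_roots" unfolding simple_roots_eq assms(6) assms(5) ..
  let ?R = "smash_inv \<mu> (Zbar \<mu> r')"
  let ?H = "emb ` to_fract ` Gam \<mu> \<union> Xplus \<mu> fp ` {1..r'} \<union> Xminus \<mu> fm ` {1..r'}"
  have U: "U = generate_ring ?R ?H" using assms(3) unfolding standard_galois_order_def by blast
  have "subring U ?R" using assms(3) unfolding standard_galois_order_def galois_order_def Let_def by blast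
  then have sub: "generate_ring ?R ?H \<subseteq> carrier ?R" unfolding U by (rule submonoid.subset[OF subring.axioms(2)])
  have f: "fp k \<in> Lam \<mu> \<and> fm k \<in> Lam \<mu> \<and> (\<forall>\<sigma> \<in> Smu \<mu>. perm_vec \<sigma> (unit_vec (k, 1)) = unit_vec (k, 1) \<longrightarrow>
      perm_pol \<sigma> (fp k) = fp k \<and> perm_pol \<sigma> (fm k) = fm k)" if "k \<in> {1..r'}" for k
    using assms(3) that unfolding standard_galois_order_def by blast
  have k1: "(k, 1) \<in> idx \<mu>" if "k \<in> {1..r'}" for k
  proof -
    have "k - 1 < length \<mu>" using that assms(2) by auto
    then have "0 < msize \<mu> k" unfolding msize_def using assms(1) nth_mem by blast
    then show ?thesis using that assms(2) unfolding idx_def by auto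
  qed
  have plus: "\<exists>c. c \<noteq> 0 \<and> gen_op \<mu> (Xplus \<mu> fp k) k (- 1) (\<lambda>p. cst c * perm_pol (swap (k, 1) p) (fp k))"
    if k: "k \<in> {1..r'}" for k
  proof -
    have inv: "perm_pol \<sigma> (fp k) = fp k" if "\<sigma> \<in> Smu \<mu>" "perm_vec \<sigma> (unit_vec (k, 1)) = unit_vec (k, 1)" for \<sigma>
      using f[OF k] that by blast
    obtain c where c: "c \<noteq> 0" "\<And>e. gen_op \<mu> (Xgen \<mu> k (svec e (k, 1)) (fp k)) k (- e) (\<lambda>p. cst c * perm_pol (swap (k, 1) p) (fp k))"
      using gen_op_Xgen[OF k1[OF k] conjunct1[OF f[OF k]] inv] by blast
    then show ?thesis using c(2)[of 1] unfolding Xplus_def svec_1 by blast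
  qed
  have minus: "\<exists>c. c \<noteq> 0 \<and> gen_op \<mu> (Xminus \<mu> fm k) k 1 (\<lambda>p. cst c * perm_pol (swap (k, 1) p) (fm k))"
    if k: "k \<in> {1..r'}" for k
  proof -
    have inv: "perm_pol \<sigma> (fm k) = fm k" if "\<sigma> \<in> Smu \<mu>" "perm_vec \<sigma> (unit_vec (k, 1)) = unit_vec (k, 1)" for \<sigma>
      using f[OF k] that by blast
    obtain c where c: "c \<noteq> 0" "\<And>e. gen_op \<mu> (Xgen \<mu> k (svec e (k, 1)) (fm k)) k (- e) (\<lambda>p. cst c * perm_pol (swap (k, 1) p) (fm k))"
      using gen_op_Xgen[OF k1[OF k] conjunct1[OF conjunct2[OF f[OF k]]] inv] by blast
    then show ?thesis using c(2)[of "- 1"] unfolding Xminus_def svec_m1 minus_minus by blast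
  qed
  have block1: "(k, 1) \<in> block \<mu> k" if "k \<in> {1..r'}" for k using k1[OF that] unfolding block_def by simp
  have gen: "preserving X" if X: "X \<in> ?H" for X
  proof -
    consider g where "g \<in> Gam \<mu>" "X = emb (to_fract g)" | k where "k \<in> {1..r'}" "X = Xplus \<mu> fp k"
      | k where "k \<in> {1..r'}" "X = Xminus \<mu> fm k" using X by blast
    then show ?thesis
    proof cases
      case 1
      then show ?thesis using preserving_emb by blast
    next
      case (2 k)
      obtain c where "gen_op \<mu> (Xplus \<mu> fp k) k (- 1) (\<lambda>p. cst c * perm_pol (swap (k, 1) p) (fp k))" using plus[OF 2(1)] by blast
      from preserving_gen_op[OF this _ block1[OF 2(1)]] show ?thesis using 2 by simp
    next
      case (3 k)
      obtain c where "gen_op \<mu> (Xminus \<mu> fm k) k 1 (\<lambda>p. cst c * perm_pol (swap (k, 1) p) (fm k))" using minus[OF 3(1)] by blast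
      from preserving_gen_op[OF this _ block1[OF 3(1)]] show ?thesis using 3 by simp
    qed
  qed
  have pres: "preserving X" if "X \<in> U" for X by (rule preserving_generated[OF sub gen]) (use that U in blast)+
  have HU: "X \<in> U" if "X \<in> ?H" for X unfolding U by (rule generate_ring.incl[OF that])
  have module: "submodule_dual \<mu> U V"
    unfolding submodule_dual_def using V_Gdual subspace_V pres unfolding preserving_def by blast
  have "N = V" if N: "submodule_dual \<mu> U N" "N \<subseteq> V" "N \<noteq> {0}" for N
  proof -
    have act: "dual_act \<mu> X \<chi> \<in> N" if "X \<in> ?H" "\<chi> \<in> N" for X \<chi>
      using N(1) HU[OF that(1)] that(2) unfolding submodule_dual_def by blast
    have "V \<subseteq> N"
    proof (rule V_subset[OF _ _ N(2,3)])
      show "functional.subspace N" using N(1) unfolding submodule_dual_def by blast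
      show "dual_act \<mu> (emb (to_fract g)) \<chi> \<in> N" if "g \<in> Gam \<mu>" "\<chi> \<in> N" for g \<chi>
        by (rule act[OF _ that(2)]) (use that(1) in blast)
      fix z q and e :: complex
      assume z: "z \<in> Zdom \<mu> r' simple_roots" and q: "q \<in> idx \<mu>" "fst q \<le> r'" and e: "e = 1 \<or> e = - 1"
      obtain k i where ki: "q = (k, i)" by (cases q)
      have k: "k \<in> {1..r'}" "1 \<le> i" "i \<le> msize \<mu> k" using q unfolding ki idx_def by auto
      have nz: "mpol_eval (fcoef \<mu> fp k i) (vbar + z) \<noteq> 0 \<and> mpol_eval (fcoef \<mu> fm k i) (vbar + z) \<noteq> 0"
        by (rule assms(7)) (use z \<Omega> k in simp_all)
      show "\<exists>X F. gen_op \<mu> X (fst q) e F \<and> (\<forall>\<chi>\<in>N. dual_act \<mu> X \<chi> \<in> N) \<and> mpol_eval (F q) (vbar + z) \<noteq> 0"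
        using e
      proof
        \<comment> \<open>The dagger inverts translations, so a step that raises a coordinate comes
          from the generator with the negative shift.\<close>
        assume e: "e = 1"
        obtain c where c: "c \<noteq> 0" "gen_op \<mu> (Xminus \<mu> fm k) k 1 (\<lambda>p. cst c * perm_pol (swap (k, 1) p) (fm k))"
          using minus[OF k(1)] by blast
        have "Xminus \<mu> fm k \<in> ?H" using k(1) by blast
        then show ?thesis unfolding e ki fst_conv using c(2) act fcoef_nonzero[OF conjunct2[OF nz] c(1)] by blast
      next
        assume e: "e = - 1"
        obtain c where c: "c \<noteq> 0" "gen_op \<mu> (Xplus \<mu> fp k) k (- 1) (\<lambda>p. cst c * perm_pol (swap (k, 1) p) (fp k))"
          using plus[OF k(1)] by blast
        have "Xplus \<mu> fp k \<in> ?H" using k(1) by blast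
        then show ?thesis unfolding e ki fst_conv using c(2) act fcoef_nonzero[OF conjunct1[OF nz] c(1)] by blast
      qed
    qed
    with N(2) show ?thesis by blast
  qed
  with module V_nonzero show ?thesis unfolding irreducible_dual_def \<Psi> \<Omega> by blast
qed

end
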